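(* Let $\mathbf u_0,\mathbf v_0\in\mathbb H^1_\Delta$ and let $\mathbf u$ and $\mathbf v$ be strong solutions of the LLBE on $[0,T^\ast]$ associated with the initial data $\mathbf u_0$ and $\mathbf v_0$, respectively, having the regularity $$\mathbf u,\mathbf v\in L^\infty_{T^\ast}(\mathbb H^{1+\alpha})\cap L^\infty_{T^\ast}(\mathbb H^1_\Delta),\quad \Delta\mathbf u,\Delta\mathbf v\in L^2_{T^\ast}(\mathbb H^1),\quad \partial_t\mathbf u,\partial_t\mathbf v\in L^\infty_{T^\ast}(\mathbb L^2)\cap L^2_{T^\ast}(\mathbb H^1)$$ for all admissible $\alpha$. Then $$\|\mathbf u-\mathbf v\|_{L^\infty_{T^\ast}(\mathbb L^2)}\le C\,\|\mathbf u_0-\mathbf v_0\|_{\mathbb L^2},$$ where the constant $C$ may depend on $T^\ast$ (and on the coefficients, the domain and bounds for $\mathbf u,\mathbf v$ in $L^\infty_{T^\ast}(\mathbb H^{1+\alpha})$ and $L^\infty_{T^\ast}(\mathbb H^1_\Delta)$, for $\Delta\mathbf u,\Delta\mathbf v$ in $L^2_{T^\ast}(\mathbb H^1)$, and for $\partial_t\mathbf u,\partial_t\mathbf v$ in $L^\infty_{T^\ast}(\mathbb L^2)$ and $L^2_{T^\ast}(\mathbb H^1)$). In particular, the strong solution with a given initial datum is unique.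
   Context: Domain: $d\in\{1,2,3\}$ and $\mathscr D\subset\mathbb R^d$ is a bounded polytopal domain (a bounded interval if $d=1$, a polygon, possibly non-convex, if $d=2$, a convex polyhedron if $d=3$). If $\mathscr D$ is non-convex ($d=2$), it has exactly one re-entrant corner, of angle $\omega\in(\pi,2\pi)$, and $\alpha_0:=\pi/\omega\in(\tfrac12,1)$. An exponent $\alpha$ is admissible if $\tfrac12<\alpha<\alpha_0$ when $\mathscr D$ is non-convex, and $\alpha=1$ when $\mathscr D$ is convex. Spaces: $\mathbb L^p,\mathbb H^s$ are the Lebesgue and (fractional) Sobolev spaces of $\mathbb R^3$-valued functions on $\mathscr D$. $\mathbb H^1_\Delta:=\{\mathbf v\in\mathbb H^1:\Delta\mathbf v\in\mathbb L^2\}$ with norm $\|\mathbf v\|_{\mathbb H^1}+\|\Delta\mathbf v\|_{\mathbb L^2}$. $L^q_T(X)=L^q(0,T;X)$, $W^{1,q}_T(X)=W^{1,q}(0,T;X)$. $\langle\mathbf u\times\nabla\mathbf v,\nabla\mathbf w\rangle_{\mathbb L^2}=\sum_{j=1}^d\int_{\mathscr D}(\mathbf u\times\partial_j\mathbf v)\cdot\partial_j\mathbf w\,dx$. LLBE: with constants $\kappa_1,\kappa_2,\mu>0$, $\gamma\in\mathbb R$: $\partial_t\mathbf u=\kappa_1\Delta\mathbf u+\gamma\,\mathbf u\times\Delta\mathbf u-\kappa_2(1+\mu|\mathbf u|^2)\mathbf u$ in $(0,T)\times\mathscr D$, $\mathbf u(0)=\mathbf u_0$, $\partial\mathbf u/\partial\boldsymbol\nu=0$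 on $\partial\mathscr D$. Weak solution on $[0,T]$: for admissible $\alpha$, $\mathbf u\in W^{1,4/3}_T(\mathbb L^2)\cap L^\infty_T(\mathbb H^1)\cap L^2_T(\mathbb H^{1+\alpha})$ with $\mathbf u(0)=\mathbf u_0$ and, for all $t\in(0,T)$ and $\mathbf v\in\mathbb H^1$, $$\langle\mathbf u(t),\mathbf v\rangle_{\mathbb L^2}+\kappa_1\!\int_0^t\!\langle\nabla\mathbf u,\nabla\mathbf v\rangle_{\mathbb L^2}ds+\gamma\!\int_0^t\!\langle\mathbf u\times\nabla\mathbf u,\nabla\mathbf v\rangle_{\mathbb L^2}ds+\kappa_2\!\int_0^t\!\langle(1+\mu|\mathbf u|^2)\mathbf u,\mathbf v\rangle_{\mathbb L^2}ds=\langle\mathbf u_0,\mathbf v\rangle_{\mathbb L^2}.$$ Strong solution: a weak solution with in addition $\mathbf u\in W^{1,\infty}_T(\mathbb L^2)\cap L^\infty_T(\mathbb H^1_\Delta)$. $T^\ast$ is the existence time of the strong solutions: for a given $T>0$, $T^\ast=T$ if $d\in\{1,2\}$ and $T^\ast\in(0,T]$ if $d=3$. *)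

theory Defs
  imports "HOL-Analysis.Analysis" "HOL-Probability.Essential_Supremum"
begin

section \<open>Polytopal domains\<close>

text \<open>Near \<open>x\<close> the set \<open>D\<close> is an open plane sector with apex \<open>x\<close> and opening \<open>\<omega>\<close>. The value
  \<open>\<omega> = pi\<close> occurs at the points interior to an edge, \<open>\<omega> > pi\<close> exactly at re-entrant corners.\<close>

definition interior_angle :: "'a::euclidean_space set \<Rightarrow> 'a \<Rightarrow> real \<Rightarrow> bool" where
  "interior_angle D x \<omega> \<longleftrightarrow> 0 < \<omega> \<and> \<omega> < 2 * pi \<and>
     (\<exists>r e1 e2. 0 < r \<and> norm e1 = 1 \<and> norm e2 = 1 \<and> e1 \<bullet> e2 = 0 \<and>
        D \<inter> ball x r =
          {x + \<rho> *\<^sub>R (cos \<theta> *\<^sub>R e1 + sin \<theta> *\<^sub>R e2) | \<rho> \<theta>. 0 < \<rho> \<and> \<rho> < r \<and> 0 < \<theta> \<and> \<theta> < \<omega>})"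

text \<open>By compactness of the frontier only finitely many boundary points have an angle
  other than \<open>pi\<close>. Slits and cusps are excluded by \<open>0 < \<omega> < 2 * pi\<close>.\<close>

definition polygon :: "'a::euclidean_space set \<Rightarrow> bool" where
  "polygon D \<longleftrightarrow> open D \<and> connected D \<and> bounded D \<and> D \<noteq> {} \<and>
     (\<forall>x\<in>frontier D. \<exists>\<omega>. interior_angle D x \<omega>)"

definition reentrant_corner :: "'a::euclidean_space set \<Rightarrow> 'a \<Rightarrow> real \<Rightarrow> bool" where
  "reentrant_corner D x \<omega> \<longleftrightarrow> x \<in> frontier D \<and> interior_angle D x \<omega> \<and> pi < \<omega>"

definition polytopal_domain :: "'a::euclidean_space set \<Rightarrow> bool" where
  "polytopal_domain D \<longleftrightarrow>
     DIM('a) = 1 \<and> D \<noteq> {} \<and> (\<exists>a b. D = box a b) \<or>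
     DIM('a) = 2 \<and> polygon D \<and> (\<not> convex D \<longrightarrow> (\<exists>!x. \<exists>\<omega>. reentrant_corner D x \<omega>)) \<or>
     DIM('a) = 3 \<and> D \<noteq> {} \<and> (\<exists>P. polytope P \<and> D = interior P)"

definition admissible :: "'a::euclidean_space set \<Rightarrow> real \<Rightarrow> bool" where
  "admissible D \<alpha> \<longleftrightarrow>
     (if convex D then \<alpha> = 1
      else 1/2 < \<alpha> \<and> (\<exists>x \<omega>. reentrant_corner D x \<omega> \<and> \<alpha> < pi / \<omega>))"


section \<open>Test functions and weak derivatives\<close>

definition partial :: "'a::euclidean_space \<Rightarrow> ('a \<Rightarrow> real) \<Rightarrow> 'a \<Rightarrow> real" where
  "partial b \<phi> x = frechet_derivative \<phi> (at x) b"

primrec Ck :: "nat \<Rightarrow> ('a::euclidean_space \<Rightarrow> real) \<Rightarrow> bool" where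
  "Ck 0 \<phi> \<longleftrightarrow> continuous_on UNIV \<phi>"
| "Ck (Suc k) \<phi> \<longleftrightarrow> (\<forall>x. \<phi> differentiable (at x)) \<and> (\<forall>b\<in>Basis. Ck k (partial b \<phi>))"

definition test_function :: "'a::euclidean_space set \<Rightarrow> ('a \<Rightarrow> real) \<Rightarrow> bool" where
  "test_function D \<phi> \<longleftrightarrow>
     (\<forall>k. Ck k \<phi>) \<and> (\<exists>K. compact K \<and> K \<subseteq> D \<and> (\<forall>x. x \<notin> K \<longrightarrow> \<phi> x = 0))"

definition locally_integrable :: "'a::euclidean_space set \<Rightarrow> ('a \<Rightarrow> 'b::euclidean_space) \<Rightarrow> bool" where
  "locally_integrable D f \<longleftrightarrow> (\<forall>K. compact K \<and> K \<subseteq> D \<longrightarrow> f absolutely_integrable_on K)"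

definition weak_partial ::
    "'a::euclidean_space set \<Rightarrow> 'a \<Rightarrow> ('a \<Rightarrow> 'b::euclidean_space) \<Rightarrow> ('a \<Rightarrow> 'b) \<Rightarrow> bool" where
  "weak_partial D b f g \<longleftrightarrow> locally_integrable D f \<and> locally_integrable D g \<and>
     (\<forall>\<phi>. test_function D \<phi> \<longrightarrow>
        (LINT x|lebesgue_on D. partial b \<phi> x *\<^sub>R f x) = - (LINT x|lebesgue_on D. \<phi> x *\<^sub>R g x))"

definition weak_laplacian ::
    "'a::euclidean_space set \<Rightarrow> ('a \<Rightarrow> 'b::euclidean_space) \<Rightarrow> ('a \<Rightarrow> 'b) \<Rightarrow> bool" where
  "weak_laplacian D f g \<longleftrightarrow> locally_integrable D f \<and> locally_integrable D g \<and>
     (\<forall>\<phi>. test_function D \<phi> \<longrightarrow>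
        (LINT x|lebesgue_on D. (\<Sum>b\<in>Basis. partial b (partial b \<phi>) x) *\<^sub>R f x) =
        (LINT x|lebesgue_on D. \<phi> x *\<^sub>R g x))"

text \<open>Weak derivatives are determined up to null sets; the following pick a representative.\<close>

definition wpartial ::
    "'a::euclidean_space set \<Rightarrow> 'a \<Rightarrow> ('a \<Rightarrow> 'b::euclidean_space) \<Rightarrow> 'a \<Rightarrow> 'b" where
  "wpartial D b f = (SOME g. weak_partial D b f g)"

definition wlaplacian ::
    "'a::euclidean_space set \<Rightarrow> ('a \<Rightarrow> 'b::euclidean_space) \<Rightarrow> 'a \<Rightarrow> 'b" where
  "wlaplacian D f = (SOME g. weak_laplacian D f g)"


section \<open>Function spaces on the domain\<close>

text \<open>A function space is given by its elements (representatives, not classes modulo null sets) and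
  its norm, which is only meaningful on the elements and is a seminorm on representatives.\<close>

type_synonym 'f fspace = "'f set \<times> ('f \<Rightarrow> real)"

abbreviation elems :: "'f fspace \<Rightarrow> 'f set" where "elems X \<equiv> fst X"
abbreviation nrm :: "'f fspace \<Rightarrow> 'f \<Rightarrow> real" where "nrm X \<equiv> snd X"

definition L2 :: "'a::euclidean_space set \<Rightarrow> ('a \<Rightarrow> 'b::euclidean_space) fspace" where
  "L2 D =
    ({f. f \<in> borel_measurable (lebesgue_on D) \<and> integrable (lebesgue_on D) (\<lambda>x. (norm (f x))\<^sup>2)},
     \<lambda>f. sqrt (LINT x|lebesgue_on D. (norm (f x))\<^sup>2))"

definition L2_inner ::
    "'a::euclidean_space set \<Rightarrow> ('a \<Rightarrow> 'b::euclidean_space) \<Rightarrow> ('a \<Rightarrow> 'b) \<Rightarrow> real" where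
  "L2_inner D f g = (LINT x|lebesgue_on D. f x \<bullet> g x)"

definition H1 :: "'a::euclidean_space set \<Rightarrow> ('a \<Rightarrow> 'b::euclidean_space) fspace" where
  "H1 D =
    ({f \<in> elems (L2 D). \<forall>b\<in>Basis. \<exists>g\<in>elems (L2 D). weak_partial D b f g},
     \<lambda>f. sqrt ((nrm (L2 D) f)\<^sup>2 + (\<Sum>b\<in>Basis. (nrm (L2 D) (wpartial D b f))\<^sup>2)))"

text \<open>Sobolev--Slobodeckij spaces, for \<open>0 < s \<le> 1\<close>.\<close>

definition gagliardo_integrand ::
    "real \<Rightarrow> ('a::euclidean_space \<Rightarrow> 'b::euclidean_space) \<Rightarrow> 'a \<times> 'a \<Rightarrow> real" where
  "gagliardo_integrand s f =
     (\<lambda>(x, y). (norm (f x - f y))\<^sup>2 / norm (x - y) powr (real DIM('a) + 2 * s))"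

definition Hs :: "'a::euclidean_space set \<Rightarrow> real \<Rightarrow> ('a \<Rightarrow> 'b::euclidean_space) fspace" where
  "Hs D s = (if s = 1 then H1 D else
    ({f \<in> elems (L2 D). integrable (lebesgue_on D \<Otimes>\<^sub>M lebesgue_on D) (gagliardo_integrand s f)},
     \<lambda>f. sqrt ((nrm (L2 D) f)\<^sup>2 +
               (LINT z|(lebesgue_on D \<Otimes>\<^sub>M lebesgue_on D). gagliardo_integrand s f z))))"

text \<open>The space of order \<open>1 + \<alpha>\<close>, for \<open>0 < \<alpha> \<le> 1\<close>.\<close>

definition H1plus :: "'a::euclidean_space set \<Rightarrow> real \<Rightarrow> ('a \<Rightarrow> 'b::euclidean_space) fspace" where
  "H1plus D \<alpha> =
    ({f \<in> elems (H1 D). \<forall>b\<in>Basis. wpartial D b f \<in> elems (Hs D \<alpha>)},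
     \<lambda>f. sqrt ((nrm (L2 D) f)\<^sup>2 + (\<Sum>b\<in>Basis. (nrm (Hs D \<alpha>) (wpartial D b f))\<^sup>2)))"

definition H1Delta :: "'a::euclidean_space set \<Rightarrow> ('a \<Rightarrow> 'b::euclidean_space) fspace" where
  "H1Delta D =
    ({f \<in> elems (H1 D). \<exists>g\<in>elems (L2 D). weak_laplacian D f g},
     \<lambda>f. nrm (H1 D) f + nrm (L2 D) (wlaplacian D f))"


section \<open>Bochner spaces on \<open>(0, T)\<close>\<close>

definition simple_in ::
    "real \<Rightarrow> ('a \<Rightarrow> 'b::real_normed_vector) fspace \<Rightarrow> (real \<Rightarrow> 'a \<Rightarrow> 'b) \<Rightarrow> bool" where
  "simple_in T X s \<longleftrightarrow>
     simple_function (lebesgue_on {0<..<T}) s \<and> (\<forall>t\<in>{0<..<T}. s t \<in> elems X)"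

definition simple_integral ::
    "real \<Rightarrow> (real \<Rightarrow> 'a \<Rightarrow> 'b::real_normed_vector) \<Rightarrow> 'a \<Rightarrow> 'b" where
  "simple_integral T s =
     (\<lambda>x. \<Sum>y\<in>s ` {0<..<T}. measure lebesgue {t \<in> {0<..<T}. s t = y} *\<^sub>R y x)"

definition strongly_measurable ::
    "real \<Rightarrow> ('a \<Rightarrow> 'b::real_normed_vector) fspace \<Rightarrow> (real \<Rightarrow> 'a \<Rightarrow> 'b) \<Rightarrow> bool" where
  "strongly_measurable T X u \<longleftrightarrow>
     (AE t in lebesgue_on {0<..<T}. u t \<in> elems X) \<and>
     (\<exists>s. (\<forall>n. simple_in T X (s n)) \<and>
          (AE t in lebesgue_on {0<..<T}. (\<lambda>n. nrm X (\<lambda>x. s n t x - u t x)) \<longlonglongrightarrow> 0))"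

definition has_X_integral ::
    "real \<Rightarrow> ('a \<Rightarrow> 'b::real_normed_vector) fspace \<Rightarrow> (real \<Rightarrow> 'a \<Rightarrow> 'b) \<Rightarrow> ('a \<Rightarrow> 'b) \<Rightarrow> bool" where
  "has_X_integral T X u I \<longleftrightarrow> strongly_measurable T X u \<and> I \<in> elems X \<and>
     (\<exists>s. (\<forall>n. simple_in T X (s n)) \<and>
          (\<lambda>n. \<integral>\<^sup>+t. ennreal (nrm X (\<lambda>x. u t x - s n t x)) \<partial>lebesgue_on {0<..<T}) \<longlonglongrightarrow> 0 \<and>
          (\<lambda>n. nrm X (\<lambda>x. simple_integral T (s n) x - I x)) \<longlonglongrightarrow> 0)"

definition Lq_norm ::
    "ereal \<Rightarrow> real \<Rightarrow> ('a \<Rightarrow> 'b::real_normed_vector) fspace \<Rightarrow> (real \<Rightarrow> 'a \<Rightarrow> 'b) \<Rightarrow> ereal" where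
  "Lq_norm q T X u =
     (if q = \<infinity> then esssup (lebesgue_on {0<..<T}) (\<lambda>t. ereal (nrm X (u t)))
      else ereal ((LINT t|lebesgue_on {0<..<T}. nrm X (u t) powr real_of_ereal q)
                    powr (1 / real_of_ereal q)))"

definition Lq ::
    "ereal \<Rightarrow> real \<Rightarrow> ('a \<Rightarrow> 'b::real_normed_vector) fspace \<Rightarrow> (real \<Rightarrow> 'a \<Rightarrow> 'b) set" where
  "Lq q T X = {u. strongly_measurable T X u \<and>
     (if q = \<infinity> then Lq_norm \<infinity> T X u < \<infinity>
      else integrable (lebesgue_on {0<..<T}) (\<lambda>t. nrm X (u t) powr real_of_ereal q))}"

definition weak_time_deriv ::
    "real \<Rightarrow> ('a \<Rightarrow> 'b::real_normed_vector) fspace \<Rightarrow>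
     (real \<Rightarrow> 'a \<Rightarrow> 'b) \<Rightarrow> (real \<Rightarrow> 'a \<Rightarrow> 'b) \<Rightarrow> bool" where
  "weak_time_deriv T X u g \<longleftrightarrow> u \<in> Lq 1 T X \<and> g \<in> Lq 1 T X \<and>
     (\<forall>\<phi>. test_function {0<..<T} \<phi> \<longrightarrow>
        (\<exists>I. has_X_integral T X (\<lambda>t x. deriv \<phi> t *\<^sub>R u t x) I \<and>
             has_X_integral T X (\<lambda>t x. \<phi> t *\<^sub>R g t x) (\<lambda>x. - I x)))"

definition time_deriv ::
    "real \<Rightarrow> ('a \<Rightarrow> 'b::real_normed_vector) fspace \<Rightarrow> (real \<Rightarrow> 'a \<Rightarrow> 'b) \<Rightarrow> real \<Rightarrow> 'a \<Rightarrow> 'b" where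
  "time_deriv T X u = (SOME g. weak_time_deriv T X u g)"

definition W1q ::
    "ereal \<Rightarrow> real \<Rightarrow> ('a \<Rightarrow> 'b::real_normed_vector) fspace \<Rightarrow> (real \<Rightarrow> 'a \<Rightarrow> 'b) set" where
  "W1q q T X = {u \<in> Lq q T X. \<exists>g\<in>Lq q T X. weak_time_deriv T X u g}"

definition continuous_in_time ::
    "real \<Rightarrow> ('a \<Rightarrow> 'b::real_normed_vector) fspace \<Rightarrow> (real \<Rightarrow> 'a \<Rightarrow> 'b) \<Rightarrow> bool" where
  "continuous_in_time T X u \<longleftrightarrow> (\<forall>t\<in>{0..T}. u t \<in> elems X \<and>
     ((\<lambda>s. nrm X (\<lambda>x. u s x - u t x)) \<longlongrightarrow> 0) (at t within {0..T}))"


section \<open>Solutions of the LLBE\<close>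

definition grad_inner ::
    "'a::euclidean_space set \<Rightarrow> ('a \<Rightarrow> real^3) \<Rightarrow> ('a \<Rightarrow> real^3) \<Rightarrow> real" where
  "grad_inner D v w = (\<Sum>b\<in>Basis. L2_inner D (wpartial D b v) (wpartial D b w))"

definition cross_grad_inner ::
    "'a::euclidean_space set \<Rightarrow> ('a \<Rightarrow> real^3) \<Rightarrow> ('a \<Rightarrow> real^3) \<Rightarrow> ('a \<Rightarrow> real^3) \<Rightarrow> real" where
  "cross_grad_inner D u v w =
     (\<Sum>b\<in>Basis. L2_inner D (\<lambda>x. cross3 (u x) (wpartial D b v x)) (wpartial D b w))"

text \<open>Elements of \<open>W1q (ereal (4/3)) T (L2 D)\<close> have a representative that is continuous in time
  with values in \<open>L2 D\<close>; a solution is this representative, so that \<open>u 0\<close> and \<open>u t\<close> for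
  every \<open>t\<close> make sense.\<close>

definition weak_solution ::
    "'a::euclidean_space set \<Rightarrow> real \<Rightarrow> real \<Rightarrow> real \<Rightarrow> real \<Rightarrow> real \<Rightarrow>
     ('a \<Rightarrow> real^3) \<Rightarrow> (real \<Rightarrow> 'a \<Rightarrow> real^3) \<Rightarrow> bool" where
  "weak_solution D \<kappa>1 \<kappa>2 \<mu> \<gamma> T u0 u \<longleftrightarrow>
     u \<in> W1q (ereal (4/3)) T (L2 D) \<and>
     u \<in> Lq \<infinity> T (H1 D) \<and>
     (\<forall>\<alpha>. admissible D \<alpha> \<longrightarrow> u \<in> Lq 2 T (H1plus D \<alpha>)) \<and>
     continuous_in_time T (L2 D) u \<and>
     (AE x in lebesgue_on D. u 0 x = u0 x) \<and>
     (\<forall>t\<in>{0<..<T}. \<forall>v\<in>elems (H1 D).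
        L2_inner D (u t) v
        + \<kappa>1 * (LINT s|lebesgue_on {0<..<t}. grad_inner D (u s) v)
        + \<gamma> * (LINT s|lebesgue_on {0<..<t}. cross_grad_inner D (u s) (u s) v)
        + \<kappa>2 * (LINT s|lebesgue_on {0<..<t}.
                   L2_inner D (\<lambda>x. (1 + \<mu> * (norm (u s x))\<^sup>2) *\<^sub>R u s x) v)
        = L2_inner D u0 v)"

definition strong_solution ::
    "'a::euclidean_space set \<Rightarrow> real \<Rightarrow> real \<Rightarrow> real \<Rightarrow> real \<Rightarrow> real \<Rightarrow>
     ('a \<Rightarrow> real^3) \<Rightarrow> (real \<Rightarrow> 'a \<Rightarrow> real^3) \<Rightarrow> bool" where
  "strong_solution D \<kappa>1 \<kappa>2 \<mu> \<gamma> T u0 u \<longleftrightarrow>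
     weak_solution D \<kappa>1 \<kappa>2 \<mu> \<gamma> T u0 u \<and> u \<in> W1q \<infinity> T (L2 D) \<and> u \<in> Lq \<infinity> T (H1Delta D)"

definition has_regularity ::
    "'a::euclidean_space set \<Rightarrow> real \<Rightarrow> (real \<Rightarrow> 'a \<Rightarrow> real^3) \<Rightarrow> bool" where
  "has_regularity D T u \<longleftrightarrow>
     (\<forall>\<alpha>. admissible D \<alpha> \<longrightarrow> u \<in> Lq \<infinity> T (H1plus D \<alpha>)) \<and>
     u \<in> Lq \<infinity> T (H1Delta D) \<and>
     (\<lambda>t. wlaplacian D (u t)) \<in> Lq 2 T (H1 D) \<and>
     time_deriv T (L2 D) u \<in> Lq \<infinity> T (L2 D) \<and>
     time_deriv T (L2 D) u \<in> Lq 2 T (H1 D)"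

definition regularity_bound ::
    "'a::euclidean_space set \<Rightarrow> real \<Rightarrow> real \<Rightarrow> real \<Rightarrow> (real \<Rightarrow> 'a \<Rightarrow> real^3) \<Rightarrow> bool" where
  "regularity_bound D T \<alpha> M u \<longleftrightarrow>
     Lq_norm \<infinity> T (H1plus D \<alpha>) u \<le> ereal M \<and>
     Lq_norm \<infinity> T (H1Delta D) u \<le> ereal M \<and>
     Lq_norm 2 T (H1 D) (\<lambda>t. wlaplacian D (u t)) \<le> ereal M \<and>
     Lq_norm \<infinity> T (L2 D) (time_deriv T (L2 D) u) \<le> ereal M \<and>
     Lq_norm 2 T (H1 D) (time_deriv T (L2 D) u) \<le> ereal M"

end

theory Submission imports Defs
begin

text \<open>The difference \<open>w = u - v\<close> is treated by the energy method. By the identity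
  \<open>u \<times> \<nabla>u - v \<times> \<nabla>v = w \<times> \<nabla>u + v \<times> \<nabla>w\<close> the only term that has to be absorbed is
  \<open>\<integral> |w|\<^sup>2 |\<nabla>u|\<^sup>2\<close>. The domain is a finite union of bounded convex open sets. On these, \<open>w\<close> and
  \<open>\<nabla>u\<close> satisfy Nikolskii bounds of order \<open>s = \<alpha>\<close> (\<open>s = 1/2\<close> if \<open>d = 1\<close>), where
  \<open>4 * s > d\<close>, and a recursion over the superlevel sets turns such bounds into bounds
  in \<open>L4\<close> with uniformly small tails. Hence the term is at most
  \<open>\<delta> * \<parallel>w\<parallel>\<^sup>2\<close> in \<open>H1\<close> plus a multiple of \<open>\<parallel>w\<parallel>\<^sup>2\<close> in \<open>L2\<close>.
  Since the time derivatives are bounded in \<open>L2\<close>, the energy inequality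
  holds for almost all times, and the increments of \<open>exp (- 2 * B * t) * \<parallel>w t\<parallel>\<^sup>2\<close> over \<open>[s, t]\<close>
  are at most of order \<open>(t - s)\<^sup>2\<close>; summing them over fine partitions shows that this function
  does not increase.\<close>

section \<open>Smooth functions of compact support\<close>

text \<open>Neither factor of |w|^2 |grad u|^2 is bounded, and plain L4 bounds would give a multiple
  of the full \<open>H1\<close> norm of w that the coercive term cannot absorb. Uniformly small
  tails cure this: above a height that depends only on the norm bound for u, grad u has L4 norm as
  small as desired; below it, only the \<open>L2\<close> norm of w is charged. The strict inequality
  4 * s > d is the price. Convexity of the pieces is used twice: a ball of radius r <= 1 about a
  point of a piece meets it in measure at least of order r^d, and segments between its points stay
  inside, so that differences can be integrated along them. In time, the weak formulation admits
  only fixed test functions, while the energy method tests with w itself; the equation is therefore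
  first turned, for almost every time, into an identity between the form and the \<open>L2\<close>
  pairing with the weak time derivative. Weak derivatives are picked by \<open>SOME\<close>, so they
  are linear and square integrable only through almost everywhere uniqueness; this is why the
  fundamental lemma of the calculus of variations stands at the start.\<close>

lemma frechet_derivative_eqI: "(f has_derivative D) (at x) \<Longrightarrow> frechet_derivative f (at x) = D"
  using frechet_derivative_at by metis

text \<open>\<open>partial\<close> is read off from \<open>frechet_derivative\<close>, so smoothness
  is proved by exhibiting a total derivative and identifying the partials by its uniqueness.\<close>

lemma Ck_SucI:
  assumes "\<And>x. (\<phi> has_derivative D x) (at x)" and "\<And>b. b \<in> Basis \<Longrightarrow> Ck k (\<lambda>x. D x b)"
  shows "Ck (Suc k) \<phi>"
proof -
  have "partial b \<phi> = (\<lambda>x. D x b)" for b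
    by (rule ext) (simp add: partial_def frechet_derivative_eqI[OF assms(1)])
  then show ?thesis
    using assms by (auto simp: differentiable_def)
qed

lemma Ck_Suc_has_derivative:
  assumes "Ck (Suc k) \<phi>"
  shows "(\<phi> has_derivative (\<lambda>h. partial h \<phi> x)) (at x)"
  using assms by (auto simp: partial_def frechet_derivative_works[symmetric])

lemma Ck_Suc_imp: "Ck (Suc k) \<phi> \<Longrightarrow> Ck k \<phi>"
proof (induction k arbitrary: \<phi>)
  case 0
  then show ?case
    by (auto intro!: continuous_at_imp_continuous_on differentiable_imp_continuous_within)
next
  case (Suc k)
  have "Ck k (partial b \<phi>)" if "b \<in> Basis" for b
    using Suc.IH[of "partial b \<phi>"] Suc.prems that unfolding Ck.simps(2)[of _ \<phi>] by blast
  then show ?case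
    using Suc.prems by simp
qed

lemma Ck_partial: "Ck (Suc k) f \<Longrightarrow> b \<in> Basis \<Longrightarrow> Ck k (partial b f)"
  by simp

lemma Ck_imp_continuous: "Ck k \<phi> \<Longrightarrow> continuous_on UNIV \<phi>"
  by (induction k) (use Ck_Suc_imp in auto)

lemma Ck_const: "Ck k (\<lambda>x. c)"
proof (induction k arbitrary: c)
  case (Suc k)
  show ?case
    by (rule Ck_SucI[where D = "\<lambda>x h. 0"]) (auto simp: Suc)
qed auto

lemma Ck_add: "Ck k f \<Longrightarrow> Ck k g \<Longrightarrow> Ck k (\<lambda>x. f x + g x)"
proof (induction k arbitrary: f g)
  case (Suc k)
  show ?case
    by (rule Ck_SucI[where D = "\<lambda>x h. partial h f x + partial h g x"])
       (use Suc in \<open>auto intro!: has_derivative_add Ck_Suc_has_derivative[where k = k]\<close>)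
qed (auto intro: continuous_on_add)

lemma Ck_mult: "Ck k f \<Longrightarrow> Ck k g \<Longrightarrow> Ck k (\<lambda>x. f x * g x)"
proof (induction k arbitrary: f g)
  case (Suc k)
  show ?case
  proof (rule Ck_SucI[where D = "\<lambda>x h. f x * partial h g x + partial h f x * g x"])
    show "((\<lambda>x. f x * g x) has_derivative (\<lambda>h. f x * partial h g x + partial h f x * g x)) (at x)" for x
      by (intro has_derivative_mult Ck_Suc_has_derivative[OF Suc.prems(1)] Ck_Suc_has_derivative[OF Suc.prems(2)])
    show "Ck k (\<lambda>x. f x * partial b g x + partial b f x * g x)" if "b \<in> Basis" for b
      by (rule Ck_add; rule Suc.IH)
         (use Suc.prems that in \<open>blast intro: Ck_partial Ck_Suc_imp\<close>)+
  qed
qed (auto intro: continuous_on_mult)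

lemma Ck_prod: "(\<And>i. i \<in> I \<Longrightarrow> Ck k (f i)) \<Longrightarrow> Ck k (\<lambda>x. \<Prod>i\<in>I. f i x)"
  by (induction I rule: infinite_finite_induct) (auto simp: Ck_const Ck_mult)

lemma Ck_translate: "Ck k f \<Longrightarrow> Ck k (\<lambda>x. f (x - a))"
proof (induction k arbitrary: f)
  case 0
  then show ?case
    by (auto intro!: continuous_on_compose2[of UNIV f] continuous_intros)
next
  case (Suc k)
  have *: "(f has_derivative (\<lambda>h. partial h f y)) (at y)" for y
    by (rule Ck_Suc_has_derivative[OF Suc.prems])
  have "((\<lambda>x. f (x - a)) has_derivative (\<lambda>h. partial h f (x - a))) (at x)" for x
    by (rule has_derivative_compose[of "\<lambda>x. x - a" "\<lambda>h. h" x UNIV f, OF _ *])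
       (auto intro!: derivative_eq_intros)
  then show ?case
    by (rule Ck_SucI) (use Suc in auto)
qed

lemma test_function_imp_continuous: "test_function D \<phi> \<Longrightarrow> continuous_on UNIV \<phi>"
  unfolding test_function_def using Ck_imp_continuous by blast

lemma test_function_has_derivative:
  "test_function D \<phi> \<Longrightarrow> (\<phi> has_derivative (\<lambda>h. partial h \<phi> x)) (at x)"
  unfolding test_function_def using Ck_Suc_has_derivative by blast

lemma test_function_mono: "test_function C \<phi> \<Longrightarrow> C \<subseteq> D \<Longrightarrow> test_function D \<phi>"
  unfolding test_function_def by (meson subset_trans)

lemma test_function_partial:
  assumes "test_function D \<phi>" and b: "b \<in> Basis"
  shows "test_function D (partial b \<phi>)"
proof -
  obtain K where K: "compact K" "K \<subseteq> D" "\<And>x. x \<notin> K \<Longrightarrow> \<phi> x = 0" and \<phi>: "\<And>k. Ck k \<phi>"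
    using assms(1) unfolding test_function_def by auto
  have "partial b \<phi> x = 0" if "x \<notin> K" for x
  proof -
    \<comment> \<open>The complement of \<open>K\<close> is open, so \<phi> vanishes in a
      neighbourhood of \<open>x\<close> and not just at \<open>x\<close>; the partial derivative
      inherits the same compact set.\<close>
    have "open (- K)"
      using K(1) by (simp add: compact_imp_closed open_Compl)
    then have "(\<phi> has_derivative (\<lambda>h. 0)) (at x)"
      by (rule has_derivative_transform_within_open[OF has_derivative_const]) (use that K(3) in auto)
    then show ?thesis
      by (simp add: partial_def frechet_derivative_eqI)
  qed
  moreover have "Ck k (partial b \<phi>)" for k
    using \<phi>[of "Suc k"] b by simp
  ultimately show ?thesis
    unfolding test_function_def using K by blast
qed

lemma test_function_bounded:
  assumes "test_function D \<phi>"
  obtains B where "\<And>x. \<bar>\<phi> x\<bar> \<le> B" "0 \<le> B"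
proof -
  obtain K where K: "compact K" "K \<subseteq> D" "\<And>x. x \<notin> K \<Longrightarrow> \<phi> x = 0"
    using assms(1) unfolding test_function_def by auto
  have "compact (\<phi> ` K)"
    using K(1) test_function_imp_continuous[OF assms] by (meson compact_continuous_image continuous_on_subset top_greatest)
  then obtain B where B: "\<And>x. x \<in> K \<Longrightarrow> \<bar>\<phi> x\<bar> \<le> B"
    using compact_imp_bounded bounded_real by (metis image_eqI)
  have "\<bar>\<phi> x\<bar> \<le> max B 0" for x
    using B[of x] K(3)[of x] by (cases "x \<in> K") auto
  then show thesis
    by (rule that) simp
qed

lemma test_function_zero_outside: "test_function D \<phi> \<Longrightarrow> x \<notin> D \<Longrightarrow> \<phi> x = 0"
  unfolding test_function_def by blast

section \<open>Flat exponentials and box-shaped bump functions\<close>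

definition flat_exp :: "nat \<Rightarrow> real \<Rightarrow> real" where
  "flat_exp m t = (if 0 < t then exp (- 1 / t) / t ^ m else 0)"

text \<open>A single term of the series of \<open>exp (1 / t)\<close>, the one of index
  \<open>m + 2\<close>, beats \<open>t ^ m\<close> with two powers to spare. The square is what
  makes the difference quotient at 0 tend to 0.\<close>

lemma flat_exp_le_square: "\<bar>flat_exp m t\<bar> \<le> fact (m + 2) * t\<^sup>2"
proof (cases "0 < t")
  case True
  have "(1 / t) ^ (m + 2) / fact (m + 2) \<le> exp (1 / t)"
    using exp_lower_Taylor_quadratic[of "1/t"] exp_first_terms[of "1/t" "m + 3"]
  proof -
    have s: "summable (\<lambda>n. inverse (fact n) * (1 / t) ^ n)"
      using summable_exp[of "1/t"] by simp
    have "(\<Sum>n\<in>{m + 2}. inverse (fact n) * (1 / t) ^ n) \<le> (\<Sum>n. inverse (fact n) * (1 / t) ^ n)"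
      using True by (intro sum_le_suminf s) auto
    then show ?thesis
      by (simp add: exp_def divide_inverse scaleR_conv_of_real mult.commute)
  qed
  then have "exp (- 1 / t) \<le> fact (m + 2) * t ^ (m + 2)"
  proof -
    assume "(1 / t) ^ (m + 2) / fact (m + 2) \<le> exp (1 / t)"
    then have "1 \<le> exp (1 / t) * (fact (m + 2) * t ^ (m + 2))"
      using True by (simp only: power_divide power_one divide_divide_eq_left) (simp add: divide_le_eq mult.commute)
    then have "exp (- (1 / t)) * 1 \<le> exp (- (1 / t)) * (exp (1 / t) * (fact (m + 2) * t ^ (m + 2)))"
      by (intro mult_left_mono) auto
    then show ?thesis
      by (simp only: mult.assoc[symmetric] exp_minus_inverse mult_1_left mult_1_right minus_divide_left
            exp_add[symmetric]) (simp add: exp_minus)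
  qed
  then have "exp (- 1 / t) / t ^ m \<le> fact (m + 2) * t\<^sup>2"
    using True by (subst divide_le_eq) (simp add: power_add mult_ac power2_eq_square)
  then show ?thesis
    using True by (simp add: flat_exp_def)
qed (simp add: flat_exp_def)

text \<open>The index \<open>m\<close> exists because of this formula: the family is closed under
  differentiation up to linear combinations, so all members are smooth by one induction over the
  order, for all \<open>m\<close> at once.\<close>

lemma flat_exp_has_derivative:
  "(flat_exp m has_real_derivative (flat_exp (m + 2) t - real m * flat_exp (m + 1) t)) (at t)"
proof -
  consider "t < 0" | "t = 0" | "t > 0" by linarith
  then show ?thesis
  proof cases
    case 1
    have "((\<lambda>t. 0) has_real_derivative 0) (at t)" by simp
    then have "(flat_exp m has_real_derivative 0) (at t)"
      by (rule has_field_derivative_transform_within_open[of _ _ _ "{..<0}"])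
         (use 1 in \<open>auto simp: flat_exp_def\<close>)
    then show ?thesis using 1 by (simp add: flat_exp_def)
  next
    case 2
    have "((\<lambda>h. flat_exp m h / h) \<longlongrightarrow> 0) (at 0)"
    proof (rule Lim_null_comparison)
      show "\<forall>\<^sub>F h in at 0. norm (flat_exp m h / h) \<le> fact (m + 2) * \<bar>h\<bar>"
        using flat_exp_le_square[of m]
        by (auto simp: eventually_at divide_simps power2_eq_square mult.assoc abs_mult[symmetric] intro!: exI[of _ 1])
      show "((\<lambda>h. fact (m + 2) * \<bar>h\<bar>) \<longlongrightarrow> (0::real)) (at 0)"
        by (auto intro!: tendsto_eq_intros)
    qed
    then show ?thesis
      using 2 by (simp add: has_field_derivative_iff flat_exp_def)
  next
    case 3
    have "((\<lambda>t. exp (- 1 / t) / t ^ m) has_real_derivative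
            (exp (- 1 / t) / t ^ (m + 2) - real m * (exp (- 1 / t) / t ^ (m + 1)))) (at t)"
    proof (cases m)
      case 0
      show ?thesis unfolding 0 by (rule derivative_eq_intros refl | use 3 in \<open>simp add: field_simps power2_eq_square\<close>)+
    next
      case (Suc n)
      show ?thesis unfolding Suc by (rule derivative_eq_intros refl | use 3 in \<open>simp add: field_simps power2_eq_square\<close>)+
    qed
    then have "(flat_exp m has_real_derivative
            (exp (- 1 / t) / t ^ (m + 2) - real m * (exp (- 1 / t) / t ^ (m + 1)))) (at t)"
      by (rule has_field_derivative_transform_within_open[of _ _ _ "{0<..}"])
         (use 3 in \<open>auto simp: flat_exp_def\<close>)
    then show ?thesis using 3 by (simp add: flat_exp_def)
  qed
qed

lemma Ck_flat_exp: "Ck k (\<lambda>x. flat_exp m (c * (x \<bullet> i) + d))"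
proof (induction k arbitrary: m)
  case 0
  have "continuous_on UNIV (flat_exp m)"
    using flat_exp_has_derivative DERIV_isCont continuous_at_imp_continuous_on by blast
  then show ?case
    by (auto intro!: continuous_on_compose2[of UNIV "flat_exp m"] continuous_intros)
next
  case (Suc k)
  let ?g = "\<lambda>x. c * (x \<bullet> i) + d"
  have *: "(flat_exp m has_derivative (\<lambda>h. (flat_exp (m + 2) y + (- real m) * flat_exp (m + 1) y) * h)) (at y)" for y
    using flat_exp_has_derivative[of m y] by (simp add: has_field_derivative_def)
  have g: "(?g has_derivative (\<lambda>h. c * (h \<bullet> i))) (at x)" for x
    by (auto intro!: derivative_eq_intros)
  show ?case
  proof (rule Ck_SucI)
    show "((\<lambda>x. flat_exp m (?g x)) has_derivative
      (\<lambda>h. (flat_exp (m + 2) (?g x) + (- real m) * flat_exp (m + 1) (?g x)) * (c * (h \<bullet> i)))) (at x)" for x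
      by (rule has_derivative_compose[OF g *])
    show "Ck k (\<lambda>x. (flat_exp (m + 2) (?g x) + (- real m) * flat_exp (m + 1) (?g x)) * (c * (b \<bullet> i)))" for b
      by (rule Ck_mult[OF Ck_add[OF Suc.IH Ck_mult[OF Ck_const Suc.IH]] Ck_const])
  qed
qed

text \<open>Each factor is flat in the scaled signed distance to one face of the box, written as an
  affine function of \<open>x \<bullet> i\<close> to fit \<open>Ck_flat_exp\<close>. As
  \<open>c\<close> grows, the factors tend to 1 inside the box, so the limit is the indicator of the
  open box.\<close>

definition bump :: "real \<Rightarrow> 'a::euclidean_space \<Rightarrow> 'a \<Rightarrow> 'a \<Rightarrow> real" where
  "bump c p q x = (\<Prod>i\<in>Basis. flat_exp 0 (c * (x \<bullet> i) + - c * (p \<bullet> i)) * flat_exp 0 (- c * (x \<bullet> i) + c * (q \<bullet> i)))"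

lemma bump_bounds: "0 \<le> bump c p q x" "bump c p q x \<le> 1"
proof -
  have "0 \<le> flat_exp 0 t" "flat_exp 0 t \<le> 1" for t
    by (auto simp: flat_exp_def)
  then show "0 \<le> bump c p q x" "bump c p q x \<le> 1"
    unfolding bump_def by (auto intro!: prod_nonneg prod_le_1 mult_le_one)
qed

lemma bump_eq_0: "0 < c \<Longrightarrow> x \<notin> box p q \<Longrightarrow> bump c p q x = 0"
proof -
  assume c: "0 < c" and "x \<notin> box p q"
  then obtain i where i: "i \<in> Basis" "x \<bullet> i \<le> p \<bullet> i \<or> q \<bullet> i \<le> x \<bullet> i"
    by (auto simp: mem_box not_less)
  then have "c * (x \<bullet> i) \<le> c * (p \<bullet> i) \<or> c * (q \<bullet> i) \<le> c * (x \<bullet> i)"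
    using c by (auto intro: mult_left_mono)
  then have "flat_exp 0 (c * (x \<bullet> i) + - c * (p \<bullet> i)) * flat_exp 0 (- c * (x \<bullet> i) + c * (q \<bullet> i)) = 0"
    by (auto simp: flat_exp_def)
  then show "bump c p q x = 0"
    unfolding bump_def using i(1) by (intro prod_zero) auto
qed

lemma test_function_bump:
  assumes "0 < c" "cbox p q \<subseteq> D"
  shows "test_function D (bump c p q)"
proof -
  have "Ck k (bump c p q)" for k
    unfolding bump_def by (intro Ck_prod Ck_mult Ck_flat_exp)
  moreover have "bump c p q x = 0" if "x \<notin> cbox p q" for x
    using bump_eq_0[of c x p q] that assms(1) box_subset_cbox by blast
  ultimately show ?thesis
    unfolding test_function_def using assms(2) by (intro conjI allI exI[of _ "cbox p q"]) auto
qed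

lemma bump_tendsto: "(\<lambda>n. bump (real (Suc n)) p q x) \<longlonglongrightarrow> indicator (box p q) x"
proof (cases "x \<in> box p q")
  case True
  have *: "(\<lambda>n. flat_exp 0 (real (Suc n) * s)) \<longlonglongrightarrow> 1" if "s > 0" for s
  proof -
    have "(\<lambda>n. exp (- (1 / s) / real (Suc n))) \<longlonglongrightarrow> exp 0"
      by (intro tendsto_exp LIMSEQ_Suc[OF lim_const_over_n])
    moreover have "flat_exp 0 (real (Suc n) * s) = exp (- (1 / s) / real (Suc n))" for n
      using that by (simp add: flat_exp_def mult.commute del: of_nat_Suc)
    ultimately show ?thesis
      by simp
  qed
  have "(\<lambda>n. bump (real (Suc n)) p q x) \<longlonglongrightarrow> (\<Prod>i\<in>(Basis::'a set). 1 * 1)"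
    unfolding bump_def
  proof (intro tendsto_prod tendsto_mult)
    fix i :: 'a assume "i \<in> Basis"
    then have i: "x \<bullet> i - p \<bullet> i > 0" "q \<bullet> i - x \<bullet> i > 0"
      using True by (auto simp: mem_box)
    show "(\<lambda>n. flat_exp 0 (real (Suc n) * (x \<bullet> i) + - real (Suc n) * (p \<bullet> i))) \<longlonglongrightarrow> 1"
      using *[OF i(1)] by (simp add: algebra_simps)
    show "(\<lambda>n. flat_exp 0 (- real (Suc n) * (x \<bullet> i) + real (Suc n) * (q \<bullet> i))) \<longlonglongrightarrow> 1"
      using *[OF i(2)] by (simp add: algebra_simps)
  qed
  then show ?thesis using True by simp
next
  case False
  then show ?thesis by (simp add: bump_eq_0)
qed

section \<open>The fundamental lemma of the calculus of variations\<close>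

lemma sigma_finite_lebesgue: "sigma_finite_measure (lebesgue :: 'a::euclidean_space measure)"
proof -
  obtain A :: "'a set set" where "countable A" "A \<subseteq> sets lborel" "\<Union>A = UNIV" "\<forall>a\<in>A. emeasure lborel a \<noteq> \<infinity>"
    using sigma_finite_lborel unfolding sigma_finite_measure_def by auto
  then show ?thesis
    unfolding sigma_finite_measure_def
    by (intro exI[where x = A] conjI) (auto simp: subset_eq emeasure_completion)
qed

text \<open>Open boxes form an intersection-stable generator of the Borel sets, and the Borel sets
  with vanishing integral form a Dynkin system, closed under complements because the integral over
  the whole space vanishes too. Lebesgue sets differ from Borel sets by null sets only.\<close>

lemma AE_zero_if_box_integrals_zero:
  fixes f :: "'a::euclidean_space \<Rightarrow> 'b::euclidean_space"
  assumes f: "integrable lebesgue f" and z: "\<And>a b. (LINT x|lebesgue. indicator (box a b) x *\<^sub>R f x) = 0"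
  shows "AE x in lebesgue. f x = 0"
proof -
  let ?I = "\<lambda>A. LINT x|lebesgue. indicator A x *\<^sub>R f x"
  have int: "integrable lebesgue (\<lambda>x. indicator A x *\<^sub>R f x)" if "A \<in> sets lebesgue" for A
    using f that by (rule integrable_mult_indicator[rotated])
  have meas: "(\<lambda>x. indicator A x *\<^sub>R f x) \<in> borel_measurable lebesgue" if "A \<in> sets borel" for A
    using int[of A] that by (intro borel_measurable_integrable) auto
  have lim: "(\<lambda>n. ?I (A n)) \<longlonglongrightarrow> ?I B"
    if "\<And>n. A n \<in> sets borel" "B \<in> sets borel" "\<And>x. (\<lambda>n. indicator (A n) x :: real) \<longlonglongrightarrow> indicator B x" for A B
    using that f
    by (intro integral_dominated_convergence[where w = "\<lambda>x. norm (f x)"])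
       (auto intro!: meas AE_I2 integrable_norm tendsto_scaleR mult_left_le_one_le simp: indicator_le_1)
  \<comment> \<open>The boxes with corners \<open>- n\<close> and \<open>n\<close> in every
    coordinate exhaust the space, and dominated convergence carries the zero over.\<close>
  have univ: "(LINT x|lebesgue. f x) = 0"
  proof -
    have "(\<lambda>n. ?I (box (- real n *\<^sub>R One) (real n *\<^sub>R One))) \<longlonglongrightarrow> ?I UNIV"
    proof (rule lim)
      fix x :: 'a
      obtain N :: nat where N: "norm x < N" using reals_Archimedean2 by blast
      have "x \<in> box (- real n *\<^sub>R One) (real n *\<^sub>R One)" if "N \<le> n" for n
        unfolding mem_box
      proof (intro ballI)
        fix i :: 'a assume i: "i \<in> Basis"
        have "\<bar>x \<bullet> i\<bar> < real n"
          using Basis_le_norm[OF i, of x] N that by linarith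
        then show "(- real n *\<^sub>R One) \<bullet> i < x \<bullet> i \<and> x \<bullet> i < (real n *\<^sub>R One) \<bullet> i"
          using i by auto
      qed
      then have "\<forall>\<^sub>F n in sequentially. indicator (box (- real n *\<^sub>R One) (real n *\<^sub>R One)) x = (1::real)"
        by (auto simp: eventually_sequentially intro!: exI[of _ N])
      then show "(\<lambda>n. indicator (box (- real n *\<^sub>R One) (real n *\<^sub>R One)) x :: real) \<longlonglongrightarrow> indicator UNIV x"
        by (simp add: tendsto_eventually)
    qed auto
    then show ?thesis
      by (simp add: z LIMSEQ_const_iff)
  qed
  have bor: "?I A = 0" if "A \<in> sets borel" for A
  proof -
    have "Int_stable (range (\<lambda>(a, b). box a b :: 'a set))"
      by (auto simp: Int_stable_def box_Int_box)
    moreover have "range (\<lambda>(a, b). box a b :: 'a set) \<subseteq> Pow UNIV" by simp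
    moreover have "A \<in> sigma_sets UNIV (range (\<lambda>(a, b). box a b))"
      using that unfolding borel_eq_box by (simp add: sets_measure_of)
    ultimately show ?thesis
    proof (induction rule: sigma_sets_induct_disjoint)
      case (compl A)
      then have A: "A \<in> sets borel"
        unfolding borel_eq_box by (simp add: sets_measure_of)
      have "?I (UNIV - A) = (LINT x|lebesgue. f x - indicator A x *\<^sub>R f x)"
        by (intro Bochner_Integration.integral_cong) (auto split: split_indicator)
      also have "\<dots> = 0"
        using int[of A] A f univ compl by simp
      finally show ?case .
    next
      case (union A)
      then have A: "A i \<in> sets borel" for i
        unfolding borel_eq_box by (simp add: sets_measure_of subset_eq image_subset_iff)
      have B: "?I (\<Union>i<n. A i) = 0" for n
      proof (induction n)
        case (Suc n)
        have d: "A n \<inter> (\<Union>i<n. A i) = {}"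
        proof -
          have "A n \<inter> A i = {}" if "i < n" for i
            using disjoint_family_onD[OF union(1), of n i] that by simp
          then show ?thesis by auto
        qed
        have e: "indicator (\<Union>i<Suc n. A i) x = (indicator (\<Union>i<n. A i) x + indicator (A n) x :: real)" for x
          using d unfolding lessThan_Suc UN_insert by (cases "x \<in> A n"; cases "x \<in> (\<Union>i<n. A i)") (auto simp: indicator_def)
        have "?I (\<Union>i<Suc n. A i) = (LINT x|lebesgue. indicator (\<Union>i<n. A i) x *\<^sub>R f x + indicator (A n) x *\<^sub>R f x)"
          unfolding e scaleR_left_distrib ..
        also have "\<dots> = 0"
          using Suc union(3)[of n] by (subst Bochner_Integration.integral_add) (simp_all add: int A sets.finite_UN)
        finally show ?case .
      qed simp
      have "(\<lambda>n. ?I (\<Union>i<n. A i)) \<longlonglongrightarrow> ?I (\<Union>i. A i)"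
        by (rule lim) (use A LIMSEQ_indicator_UN in auto)
      then show ?case
        by (simp add: B LIMSEQ_const_iff)
    qed (auto simp: z)
  qed
  show ?thesis
  proof (rule sigma_finite_measure.density_zero[OF sigma_finite_lebesgue f])
    fix A :: "'a set" assume "A \<in> sets lebesgue"
    then obtain S N N' where S: "A = S \<union> N" "N \<subseteq> N'" "N' \<in> null_sets lborel" "S \<in> sets lborel"
      by (auto elim: sets_completionE)
    have "AE x in lebesgue. x \<notin> N'"
      using S(3) AE_not_in null_sets_completionI by blast
    then have "?I A = ?I S"
      using S \<open>A \<in> sets lebesgue\<close> f
      by (intro integral_cong_AE borel_measurable_integrable int meas)
         (auto elim!: eventually_mono split: split_indicator)
    then show "set_lebesgue_integral lebesgue A f = 0"
      using bor S(4) by (simp add: set_lebesgue_integral_def)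
  qed
qed

lemma test_function_measurable: "test_function D \<phi> \<Longrightarrow> \<phi> \<in> borel_measurable borel"
  by (intro borel_measurable_continuous_onI test_function_imp_continuous)

lemma test_function_scaleR_integrable:
  fixes f :: "'a::euclidean_space \<Rightarrow> 'b::euclidean_space"
  assumes "test_function D \<phi>" and f: "locally_integrable D f" and D: "D \<in> sets lebesgue"
  shows "integrable (lebesgue_on D) (\<lambda>x. \<phi> x *\<^sub>R f x)"
proof -
  obtain K where K: "compact K" "K \<subseteq> D" "\<And>x. x \<notin> K \<Longrightarrow> \<phi> x = 0"
    using assms(1) unfolding test_function_def by auto
  have [measurable]: "\<phi> \<in> borel_measurable borel" using assms(1) by (rule test_function_measurable)
  obtain B where B: "\<And>x. \<bar>\<phi> x\<bar> \<le> B" and "0 \<le> B"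
    using test_function_bounded[OF assms(1)] by metis
  have "integrable lebesgue (\<lambda>x. indicator K x *\<^sub>R f x)"
    using f K unfolding locally_integrable_def set_integrable_def by auto
  then have fK: "integrable lebesgue (\<lambda>x. B * norm (indicator K x *\<^sub>R f x))"
    and [measurable]: "(\<lambda>x. indicator K x *\<^sub>R f x) \<in> borel_measurable lebesgue"
    by (simp_all add: borel_measurable_integrable del: norm_scaleR)
  have [measurable]: "\<phi> \<in> borel_measurable lebesgue"
    by (simp add: measurable_completion)
  have "integrable lebesgue (\<lambda>x. \<phi> x *\<^sub>R (indicator K x *\<^sub>R f x))"
    by (rule Bochner_Integration.integrable_bound[OF fK])
       (use B \<open>0 \<le> B\<close> in \<open>auto intro!: mult_right_mono AE_I2 simp: abs_mult simp del: scaleR_scaleR\<close>)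
  then have "integrable lebesgue (\<lambda>x. indicator D x *\<^sub>R (\<phi> x *\<^sub>R f x))"
    by (rule Bochner_Integration.integrable_cong[THEN iffD1, rotated -1])
       (use K in \<open>auto split: split_indicator\<close>)
  then show ?thesis
    using D by (simp add: integrable_restrict_space)
qed

lemma AE_lebesgue_on_iff:
  "D \<in> sets lebesgue \<Longrightarrow> (AE x in lebesgue_on D. P x) \<longleftrightarrow> (AE x in lebesgue. x \<in> D \<longrightarrow> P x)"
  by (simp add: AE_restrict_space_iff)

text \<open>An open set is a countable union of closed boxes contained in it, and on each of these
  \<open>f\<close> is integrable. Bumps on sub-boxes are test functions of \<open>D\<close>; in the
  limit they give the integrals over all sub-boxes, which determine \<open>f\<close>.\<close>

theorem fundamental_lemma_calculus_of_variations:
  fixes f :: "'a::euclidean_space \<Rightarrow> 'b::euclidean_space"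
  assumes D: "open D" and f: "locally_integrable D f"
    and z: "\<And>\<phi>. test_function D \<phi> \<Longrightarrow> (LINT x|lebesgue_on D. \<phi> x *\<^sub>R f x) = 0"
  shows "AE x in lebesgue_on D. f x = 0"
proof -
  have Dm: "D \<in> sets lebesgue" using D by (simp add: borel_open)
  obtain \<D> where \<D>: "countable \<D>" "\<D> \<subseteq> Pow D" "\<And>X. X \<in> \<D> \<Longrightarrow> \<exists>a b. X = cbox a b" "\<Union>\<D> = D"
    using open_countable_Union_open_cbox[OF D] by metis
  have "AE x in lebesgue. x \<in> X \<longrightarrow> f x = 0" if XD: "X \<in> \<D>" for X
  proof -
    obtain p q where X1: "X = cbox p q"
      using \<D>(3)[OF XD] by auto
    have "X \<subseteq> D"
      using \<D>(2) XD by auto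
    then have X2: "cbox p q \<subseteq> D"
      by (simp add: X1)
    note X = X1 X2
    let ?F = "\<lambda>x. indicator (box p q) x *\<^sub>R f x"
    have intc: "integrable lebesgue (\<lambda>x. indicator (cbox p q) x *\<^sub>R f x)"
      using f X(2) compact_cbox unfolding locally_integrable_def set_integrable_def by blast
    have "integrable lebesgue (\<lambda>x. indicator (box p q) x *\<^sub>R (indicator (cbox p q) x *\<^sub>R f x))"
      by (intro integrable_mult_indicator intc) auto
    moreover have "indicator (box p q) x *\<^sub>R (indicator (cbox p q) x *\<^sub>R f x) = ?F x" for x
      using box_subset_cbox[of p q] by (auto split: split_indicator)
    ultimately have intF: "integrable lebesgue ?F" by (simp only:)
    have "(LINT x|lebesgue. indicator (box a b) x *\<^sub>R ?F x) = 0" for a b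
    proof -
      \<comment> \<open>The intersection of an arbitrary box with \<open>box p q\<close> is again a
        box, and the corresponding closed box lies in \<open>cbox p q\<close> and hence in
        \<open>D\<close>, so its bumps may be used as test functions.\<close>
      define a' b' where "a' = (\<Sum>i\<in>Basis. max (a\<bullet>i) (p\<bullet>i) *\<^sub>R i)" and "b' = (\<Sum>i\<in>Basis. min (b\<bullet>i) (q\<bullet>i) *\<^sub>R i)"
      have box: "box a b \<inter> box p q = box a' b'" and "cbox a b \<inter> cbox p q = cbox a' b'"
        by (simp_all add: box_Int_box Int_interval a'_def b'_def)
      then have sub: "cbox a' b' \<subseteq> cbox p q" by blast
      let ?\<phi> = "\<lambda>n. bump (real (Suc n)) a' b'"
      have test: "test_function D (?\<phi> n)" for n
        using sub X by (intro test_function_bump) auto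
      have "(LINT x|lebesgue. ?\<phi> n x *\<^sub>R ?F x) = 0" for n
      proof -
        have "?\<phi> n x *\<^sub>R ?F x = (if x \<in> D then ?\<phi> n x *\<^sub>R f x else 0)" for x
        proof (cases "x \<in> box a' b'")
          case True
          then have "x \<in> box p q" using box by blast
          moreover have "x \<in> D" using calculation X2 box_subset_cbox by blast
          ultimately show ?thesis by simp
        next
          case False
          then show ?thesis
            by (subst (1 2) bump_eq_0) simp_all
        qed
        then have "(LINT x|lebesgue. ?\<phi> n x *\<^sub>R ?F x) = (LINT x|lebesgue. (if x \<in> D then ?\<phi> n x *\<^sub>R f x else 0))"
          by simp
        also have "\<dots> = 0"
          using z[OF test[of n]] Lebesgue_Measure.integral_restrict_UNIV[OF Dm, of "\<lambda>x. ?\<phi> n x *\<^sub>R f x"] by (simp only:)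
        finally show ?thesis .
      qed
      moreover have "(\<lambda>n. LINT x|lebesgue. ?\<phi> n x *\<^sub>R ?F x) \<longlonglongrightarrow> (LINT x|lebesgue. indicator (box a' b') x *\<^sub>R ?F x)"
      proof (rule integral_dominated_convergence[where w = "\<lambda>x. norm (?F x)"])
        have F: "?F \<in> borel_measurable lebesgue"
          by (rule borel_measurable_integrable[OF intF])
        have "?\<phi> n \<in> borel_measurable lebesgue" for n
          using test_function_measurable[OF test] by (simp add: measurable_completion)
        then show "(\<lambda>x. indicator (box a' b') x *\<^sub>R ?F x) \<in> borel_measurable lebesgue"
          "(\<lambda>x. ?\<phi> n x *\<^sub>R ?F x) \<in> borel_measurable lebesgue" for n
          using F by (auto intro!: borel_measurable_scaleR borel_measurable_indicator simp del: scaleR_scaleR)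
        show "AE x in lebesgue. (\<lambda>n. ?\<phi> n x *\<^sub>R ?F x) \<longlonglongrightarrow> indicator (box a' b') x *\<^sub>R ?F x"
          by (intro AE_I2 tendsto_scaleR bump_tendsto tendsto_const)
        show "AE x in lebesgue. norm (?\<phi> n x *\<^sub>R ?F x) \<le> norm (?F x)" for n
          using bump_bounds[of "real (Suc n)" a' b']
          by (intro AE_I2) (auto simp del: of_nat_Suc scaleR_scaleR intro!: mult_left_le_one_le)
      qed (rule integrable_norm[OF intF])
      ultimately have "(LINT x|lebesgue. indicator (box a' b') x *\<^sub>R ?F x) = 0"
        by (simp add: LIMSEQ_const_iff)
      moreover have "indicator (box a' b') x *\<^sub>R ?F x = indicator (box a b) x *\<^sub>R ?F x" for x
        using box by (auto simp: indicator_def)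
      ultimately show ?thesis by (simp only:)
    qed
    then have "AE x in lebesgue. ?F x = 0"
      by (rule AE_zero_if_box_integrals_zero[OF intF])
    \<comment> \<open>The faces of the closed box escape the argument, but they form a null
      set.\<close>
    moreover have "AE x in lebesgue. x \<notin> cbox p q - box p q"
      using null_sets_cbox_Diff_box AE_not_in null_sets_completionI by blast
    ultimately show ?thesis
      by eventually_elim (auto simp: X indicator_def split: if_splits)
  qed
  then have "AE x in lebesgue. \<forall>X\<in>\<D>. x \<in> X \<longrightarrow> f x = 0"
    by (subst AE_ball_countable[OF \<D>(1)]) blast
  then have "AE x in lebesgue. x \<in> D \<longrightarrow> f x = 0"
    by eventually_elim (use \<D>(4) in blast)
  then show ?thesis
    by (simp add: AE_lebesgue_on_iff Dm)
qed

section \<open>Square-integrable functions\<close>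

text \<open>This is completeness of Lebesgue measure. It is called for because weak derivatives are
  chosen representatives about which only almost everywhere statements are available.\<close>

lemma AE_lebesgue_on_measurable:
  fixes f :: "'a::euclidean_space \<Rightarrow> 'b::euclidean_space"
  assumes S: "S \<in> sets lebesgue" and f: "f \<in> borel_measurable (lebesgue_on S)"
    and ae: "AE x in lebesgue_on S. f x = g x"
  shows "g \<in> borel_measurable (lebesgue_on S)"
proof -
  have "(\<lambda>x. if x \<in> S then f x else 0) \<in> borel_measurable lebesgue"
    using f S by (simp add: borel_measurable_if)
  then have "(\<lambda>x. if x \<in> S then g x else 0) \<in> borel_measurable lebesgue"
    by (rule borel_measurable_AE) (use ae in \<open>auto simp: AE_lebesgue_on_iff S elim!: eventually_mono\<close>)
  then show ?thesis
    using S by (simp add: borel_measurable_if)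
qed

lemma L2_iff: "f \<in> elems (L2 D) \<longleftrightarrow>
    f \<in> borel_measurable (lebesgue_on D) \<and> integrable (lebesgue_on D) (\<lambda>x. (norm (f x))\<^sup>2)"
  by (simp add: L2_def)

lemma nrm_L2: "nrm (L2 D) f = sqrt (LINT x|lebesgue_on D. (norm (f x))\<^sup>2)"
  by (simp add: L2_def)

lemma nrm_L2_nonneg [simp]: "0 \<le> nrm (L2 D) f"
  by (simp add: nrm_L2 integral_nonneg_AE)

lemma nrm_L2_power2: "(nrm (L2 D) f)\<^sup>2 = (LINT x|lebesgue_on D. (norm (f x))\<^sup>2)"
  by (simp add: nrm_L2 integral_nonneg_AE)

lemma L2_integrable_norm_mult:
  assumes "f \<in> elems (L2 D)" "g \<in> elems (L2 D)"
  shows "integrable (lebesgue_on D) (\<lambda>x. norm (f x) * norm (g x))"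
proof (rule Bochner_Integration.integrable_bound)
  show "integrable (lebesgue_on D) (\<lambda>x. (norm (f x))\<^sup>2 + (norm (g x))\<^sup>2)"
    using assms by (auto simp: L2_iff)
  have [measurable]: "f \<in> borel_measurable (lebesgue_on D)" "g \<in> borel_measurable (lebesgue_on D)"
    using assms by (auto simp: L2_iff)
  show "(\<lambda>x. norm (f x) * norm (g x)) \<in> borel_measurable (lebesgue_on D)"
    by measurable
  have "a * b \<le> a\<^sup>2 + b\<^sup>2" for a b :: real
    using sum_squares_bound[of a b] sum_power2_ge_zero[of a b] by linarith
  then show "AE x in lebesgue_on D. norm (norm (f x) * norm (g x)) \<le> norm ((norm (f x))\<^sup>2 + (norm (g x))\<^sup>2)"
    by simp
qed

lemma L2_Cauchy_Schwarz:
  assumes "f \<in> elems (L2 D)" "g \<in> elems (L2 D)"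
  shows "(LINT x|lebesgue_on D. norm (f x) * norm (g x)) \<le> nrm (L2 D) f * nrm (L2 D) g"
proof -
  have [measurable]: "f \<in> borel_measurable (lebesgue_on D)" "g \<in> borel_measurable (lebesgue_on D)"
    using assms by (auto simp: L2_iff)
  let ?I = "\<lambda>h. LINT x|lebesgue_on D. h x :: real"
  have nn: "(\<integral>\<^sup>+x. ennreal (norm (f x)) * ennreal (norm (g x)) \<partial>lebesgue_on D) = ennreal (?I (\<lambda>x. norm (f x) * norm (g x)))"
    using nn_integral_eq_integral[OF L2_integrable_norm_mult[OF assms]] by (simp add: ennreal_mult)
  have n1: "(\<integral>\<^sup>+x. (ennreal (norm (f x)))\<^sup>2 \<partial>lebesgue_on D) = ennreal ((nrm (L2 D) f)\<^sup>2)"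
    using nn_integral_eq_integral[of "lebesgue_on D" "\<lambda>x. (norm (f x))\<^sup>2"] assms
    by (simp add: L2_iff nrm_L2_power2 ennreal_power)
  have n2: "(\<integral>\<^sup>+x. (ennreal (norm (g x)))\<^sup>2 \<partial>lebesgue_on D) = ennreal ((nrm (L2 D) g)\<^sup>2)"
    using nn_integral_eq_integral[of "lebesgue_on D" "\<lambda>x. (norm (g x))\<^sup>2"] assms
    by (simp add: L2_iff nrm_L2_power2 ennreal_power)
  have "ennreal ((?I (\<lambda>x. norm (f x) * norm (g x)))\<^sup>2) \<le> ennreal ((nrm (L2 D) f)\<^sup>2 * (nrm (L2 D) g)\<^sup>2)"
    using Cauchy_Schwarz_nn_integral[of "\<lambda>x. ennreal (norm (f x))" "lebesgue_on D" "\<lambda>x. ennreal (norm (g x))"]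
    unfolding nn n1 n2 by (simp add: ennreal_mult ennreal_power integral_nonneg_AE)
  then have "(?I (\<lambda>x. norm (f x) * norm (g x)))\<^sup>2 \<le> (nrm (L2 D) f * nrm (L2 D) g)\<^sup>2"
    by (simp add: power_mult_distrib)
  then show ?thesis
    by (rule power2_le_imp_le) simp
qed

lemma L2_integrable_inner:
  fixes f g :: "'a::euclidean_space \<Rightarrow> 'b::euclidean_space"
  assumes "f \<in> elems (L2 D)" "g \<in> elems (L2 D)"
  shows "integrable (lebesgue_on D) (\<lambda>x. f x \<bullet> g x)"
proof (rule Bochner_Integration.integrable_bound[OF L2_integrable_norm_mult[OF assms]])
  have [measurable]: "f \<in> borel_measurable (lebesgue_on D)" "g \<in> borel_measurable (lebesgue_on D)"
    using assms by (auto simp: L2_iff)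
  show "(\<lambda>x. f x \<bullet> g x) \<in> borel_measurable (lebesgue_on D)" by measurable
qed (simp add: Cauchy_Schwarz_ineq2)

lemma L2_inner_bound:
  fixes f g :: "'a::euclidean_space \<Rightarrow> 'b::euclidean_space"
  assumes "f \<in> elems (L2 D)" "g \<in> elems (L2 D)"
  shows "\<bar>L2_inner D f g\<bar> \<le> nrm (L2 D) f * nrm (L2 D) g"
proof -
  have "\<bar>L2_inner D f g\<bar> \<le> (LINT x|lebesgue_on D. norm (f x \<bullet> g x))"
    unfolding L2_inner_def using integral_norm_bound[of "lebesgue_on D" "\<lambda>x. f x \<bullet> g x"] by simp
  also have "\<dots> \<le> (LINT x|lebesgue_on D. norm (f x) * norm (g x))"
    using L2_integrable_inner[OF assms]
    by (intro integral_mono L2_integrable_norm_mult assms) (auto simp: Cauchy_Schwarz_ineq2)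
  finally show ?thesis
    using L2_Cauchy_Schwarz[OF assms] by linarith
qed

lemma L2_scaleR: "f \<in> elems (L2 D) \<Longrightarrow> (\<lambda>x. c *\<^sub>R f x) \<in> elems (L2 D)"
  by (auto simp: L2_iff power_mult_distrib)

lemma L2_add:
  fixes f g :: "'a::euclidean_space \<Rightarrow> 'b::euclidean_space"
  assumes "f \<in> elems (L2 D)" "g \<in> elems (L2 D)"
  shows "(\<lambda>x. f x + g x) \<in> elems (L2 D)"
proof -
  have "integrable (lebesgue_on D) (\<lambda>x. (norm (f x))\<^sup>2 + 2 * (f x \<bullet> g x) + (norm (g x))\<^sup>2)"
    using assms L2_integrable_inner[OF assms] by (auto simp: L2_iff)
  then show ?thesis
    using assms by (auto simp: L2_iff power2_norm_eq_inner inner_add inner_commute algebra_simps)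
qed

lemma L2_diff:
  fixes f g :: "'a::euclidean_space \<Rightarrow> 'b::euclidean_space"
  shows "f \<in> elems (L2 D) \<Longrightarrow> g \<in> elems (L2 D) \<Longrightarrow> (\<lambda>x. f x - g x) \<in> elems (L2 D)"
  using L2_add[OF _ L2_scaleR[of g D "-1"], of f] by simp

lemma L2_zero: "(\<lambda>x. 0) \<in> elems (L2 D)"
  by (simp add: L2_iff)

lemma L2_uminus: "f \<in> elems (L2 D) \<Longrightarrow> (\<lambda>x. - f x) \<in> elems (L2 D)"
  using L2_scaleR[of f D "-1"] by simp

lemma L2_inner_commute: "L2_inner D f g = L2_inner D g f"
  by (simp add: L2_inner_def inner_commute)

lemma L2_inner_self: "L2_inner D f f = (nrm (L2 D) f)\<^sup>2"
  by (simp add: L2_inner_def nrm_L2_power2 power2_norm_eq_inner)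

lemma L2_inner_add_left:
  fixes f g h :: "'a::euclidean_space \<Rightarrow> 'b::euclidean_space"
  assumes "f \<in> elems (L2 D)" "g \<in> elems (L2 D)" "h \<in> elems (L2 D)"
  shows "L2_inner D (\<lambda>x. f x + g x) h = L2_inner D f h + L2_inner D g h"
  by (simp add: L2_inner_def inner_add_left Bochner_Integration.integral_add L2_integrable_inner assms)

lemma L2_inner_diff_left:
  fixes f g h :: "'a::euclidean_space \<Rightarrow> 'b::euclidean_space"
  assumes "f \<in> elems (L2 D)" "g \<in> elems (L2 D)" "h \<in> elems (L2 D)"
  shows "L2_inner D (\<lambda>x. f x - g x) h = L2_inner D f h - L2_inner D g h"
  by (simp add: L2_inner_def inner_diff_left Bochner_Integration.integral_diff L2_integrable_inner assms)

lemma L2_inner_scaleR_left: "L2_inner D (\<lambda>x. c *\<^sub>R f x) h = c * L2_inner D f h"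
  by (simp add: L2_inner_def)

lemma L2_inner_uminus_left: "L2_inner D (\<lambda>x. - f x) h = - L2_inner D f h"
  by (simp add: L2_inner_def)

lemma nrm_L2_triangle:
  fixes f g :: "'a::euclidean_space \<Rightarrow> 'b::euclidean_space"
  assumes "f \<in> elems (L2 D)" "g \<in> elems (L2 D)"
  shows "nrm (L2 D) (\<lambda>x. f x + g x) \<le> nrm (L2 D) f + nrm (L2 D) g"
proof -
  note fg = L2_add[OF assms]
  have "(nrm (L2 D) (\<lambda>x. f x + g x))\<^sup>2 = L2_inner D f (\<lambda>x. f x + g x) + L2_inner D g (\<lambda>x. f x + g x)"
    by (simp add: L2_inner_self[symmetric] L2_inner_add_left[OF assms fg])
  also have "\<dots> = L2_inner D f f + 2 * L2_inner D f g + L2_inner D g g"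
    by (simp add: L2_inner_commute[of _ _ "\<lambda>x. f x + g x"] L2_inner_add_left assms L2_inner_commute[of D g f])
  also have "\<dots> \<le> (nrm (L2 D) f + nrm (L2 D) g)\<^sup>2"
    using L2_inner_bound[OF assms] by (simp add: L2_inner_self power2_sum)
  finally show ?thesis
    by (rule power2_le_imp_le) simp
qed

lemma nrm_L2_minus_commute: "nrm (L2 D) (\<lambda>x. f x - g x) = nrm (L2 D) (\<lambda>x. g x - f x)"
  by (simp add: nrm_L2 norm_minus_commute)

lemma nrm_L2_diff_triangle:
  fixes f g h :: "'a::euclidean_space \<Rightarrow> 'b::euclidean_space"
  assumes "f \<in> elems (L2 D)" "g \<in> elems (L2 D)" "h \<in> elems (L2 D)"
  shows "nrm (L2 D) (\<lambda>x. f x - g x) \<le> nrm (L2 D) (\<lambda>x. f x - h x) + nrm (L2 D) (\<lambda>x. h x - g x)"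
  using nrm_L2_triangle[OF L2_diff[OF assms(1,3)] L2_diff[OF assms(3,2)]] by simp

lemma nrm_L2_cong_AE:
  fixes f g :: "'a::euclidean_space \<Rightarrow> 'b::euclidean_space"
  assumes D: "D \<in> sets lebesgue" and f: "f \<in> borel_measurable (lebesgue_on D)"
    and ae: "AE x in lebesgue_on D. f x = g x"
  shows "nrm (L2 D) f = nrm (L2 D) g"
proof -
  have [measurable]: "f \<in> borel_measurable (lebesgue_on D)" "g \<in> borel_measurable (lebesgue_on D)"
    using AE_lebesgue_on_measurable[OF D f ae] f by auto
  have "(LINT x|lebesgue_on D. (norm (f x))\<^sup>2) = (LINT x|lebesgue_on D. (norm (g x))\<^sup>2)"
    by (rule integral_cong_AE) (use ae in \<open>auto elim!: eventually_mono\<close>)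
  then show ?thesis
    by (simp add: nrm_L2)
qed

lemma L2_cong_AE:
  fixes f g :: "'a::euclidean_space \<Rightarrow> 'b::euclidean_space"
  assumes D: "D \<in> sets lebesgue" and f: "f \<in> elems (L2 D)" and ae: "AE x in lebesgue_on D. f x = g x"
  shows "g \<in> elems (L2 D)"
proof -
  have [measurable]: "f \<in> borel_measurable (lebesgue_on D)" "g \<in> borel_measurable (lebesgue_on D)"
    using AE_lebesgue_on_measurable[OF D _ ae] f by (auto simp: L2_iff)
  have "integrable (lebesgue_on D) (\<lambda>x. (norm (f x))\<^sup>2) \<longleftrightarrow> integrable (lebesgue_on D) (\<lambda>x. (norm (g x))\<^sup>2)"
    by (rule integrable_cong_AE) (use ae in \<open>auto elim!: eventually_mono\<close>)
  then show ?thesis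
    using f by (simp add: L2_iff)
qed

lemma nrm_L2_eq_0D:
  assumes "f \<in> elems (L2 D)" "nrm (L2 D) f = 0"
  shows "AE x in lebesgue_on D. f x = 0"
proof -
  have "(LINT x|lebesgue_on D. (norm (f x))\<^sup>2) = 0"
    using nrm_L2_power2[of D f] assms(2) by simp
  then have "AE x in lebesgue_on D. (norm (f x))\<^sup>2 = 0"
    using assms(1) by (subst (asm) integral_nonneg_eq_0_iff_AE) (auto simp: L2_iff)
  then show ?thesis by simp
qed

section \<open>Weak derivatives\<close>

lemma locally_integrable_lincomb:
  fixes f g :: "'a::euclidean_space \<Rightarrow> 'b::euclidean_space"
  assumes "locally_integrable D f" "locally_integrable D g"
  shows "locally_integrable D (\<lambda>x. a *\<^sub>R f x + c *\<^sub>R g x)"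
  using assms unfolding locally_integrable_def by (auto intro!: set_integral_add set_integrable_scaleR_right)

lemma weak_partial_lincomb:
  fixes f g :: "'a::euclidean_space \<Rightarrow> 'b::euclidean_space"
  assumes D: "D \<in> sets lebesgue" and b: "b \<in> Basis"
    and f: "weak_partial D b f f'" and g: "weak_partial D b g g'"
  shows "weak_partial D b (\<lambda>x. a *\<^sub>R f x + c *\<^sub>R g x) (\<lambda>x. a *\<^sub>R f' x + c *\<^sub>R g' x)"
proof -
  have lint: "locally_integrable D f" "locally_integrable D g" "locally_integrable D f'" "locally_integrable D g'"
    using f g by (auto simp: weak_partial_def)
  have split: "(LINT x|lebesgue_on D. \<psi> x *\<^sub>R (a *\<^sub>R u x + c *\<^sub>R v x)) =
      a *\<^sub>R (LINT x|lebesgue_on D. \<psi> x *\<^sub>R u x) + c *\<^sub>R (LINT x|lebesgue_on D. \<psi> x *\<^sub>R v x)"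
    if "test_function D \<psi>" "locally_integrable D u" "locally_integrable D v" for \<psi> and u v :: "'a \<Rightarrow> 'b"
  proof -
    have "\<psi> x *\<^sub>R (a *\<^sub>R u x + c *\<^sub>R v x) = a *\<^sub>R (\<psi> x *\<^sub>R u x) + c *\<^sub>R (\<psi> x *\<^sub>R v x)" for x
      by (simp add: scaleR_add_right mult.commute)
    then show ?thesis
      using test_function_scaleR_integrable[OF that(1,2) D] test_function_scaleR_integrable[OF that(1,3) D]
      by (simp only: Bochner_Integration.integral_add integrable_scaleR_right integral_scaleR_right)
  qed
  show ?thesis
    unfolding weak_partial_def
  proof (intro conjI allI impI)
    fix \<phi> assume t: "test_function D \<phi>"
    then show "(LINT x|lebesgue_on D. partial b \<phi> x *\<^sub>R (a *\<^sub>R f x + c *\<^sub>R g x)) =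
       - (LINT x|lebesgue_on D. \<phi> x *\<^sub>R (a *\<^sub>R f' x + c *\<^sub>R g' x))"
      using f g test_function_partial[OF t b]
      by (simp add: split lint weak_partial_def)
  qed (intro locally_integrable_lincomb lint)+
qed

text \<open>By linearity the difference of two candidates is a weak derivative of zero and therefore
  orthogonal to all test functions.\<close>

lemma weak_partial_unique:
  fixes f g :: "'a::euclidean_space \<Rightarrow> 'b::euclidean_space"
  assumes D: "open D" and b: "b \<in> Basis"
    and f: "weak_partial D b f f'" and g: "weak_partial D b f g'"
  shows "AE x in lebesgue_on D. f' x = g' x"
proof -
  have "D \<in> sets lebesgue" using D by (simp add: borel_open)
  from weak_partial_lincomb[OF this b f g, of 1 "-1"]
  have w: "weak_partial D b (\<lambda>x. 0) (\<lambda>x. f' x - g' x)" by simp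
  have "AE x in lebesgue_on D. f' x - g' x = 0"
  proof (rule fundamental_lemma_calculus_of_variations[OF D])
    show "locally_integrable D (\<lambda>x. f' x - g' x)"
      using w by (simp add: weak_partial_def)
    show "(LINT x|lebesgue_on D. \<phi> x *\<^sub>R (f' x - g' x)) = 0" if "test_function D \<phi>" for \<phi>
      using w that by (simp add: weak_partial_def)
  qed
  then show ?thesis by simp
qed

lemma H1_imp_L2: "f \<in> elems (H1 D) \<Longrightarrow> f \<in> elems (L2 D)"
  by (simp add: H1_def)

lemma H1_weak_partial:
  assumes "f \<in> elems (H1 D)" "b \<in> Basis"
  shows "weak_partial D b f (wpartial D b f)"
  unfolding wpartial_def using assms by (intro someI_ex[of "weak_partial D b f"]) (auto simp: H1_def)

text \<open>\<open>wpartial\<close> may choose a weak derivative other than the square integrable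
  one whose existence defines the space; the two agree almost everywhere, so square integrability
  carries over.\<close>

lemma H1_wpartial_L2:
  assumes D: "open D" and f: "f \<in> elems (H1 D)" and b: "b \<in> Basis"
  shows "wpartial D b f \<in> elems (L2 D)"
proof -
  obtain g where g: "g \<in> elems (L2 D)" "weak_partial D b f g"
    using f b by (auto simp: H1_def)
  have "AE x in lebesgue_on D. g x = wpartial D b f x"
    by (rule weak_partial_unique[OF D b g(2) H1_weak_partial[OF f b]])
  then show ?thesis
    using L2_cong_AE[OF _ g(1)] D by (simp add: borel_open)
qed

lemma wpartial_eq_AE:
  assumes "open D" "b \<in> Basis" "f \<in> elems (H1 D)" "weak_partial D b f g"
  shows "AE x in lebesgue_on D. wpartial D b f x = g x"
  using assms by (intro weak_partial_unique[OF _ _ H1_weak_partial]) auto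

lemma H1_lincomb:
  assumes D: "open D" and f: "f \<in> elems (H1 D)" and g: "g \<in> elems (H1 D)"
  shows "(\<lambda>x. a *\<^sub>R f x + c *\<^sub>R g x) \<in> elems (H1 D)"
proof -
  have Dm: "D \<in> sets lebesgue" using D by (simp add: borel_open)
  have "\<exists>h\<in>elems (L2 D). weak_partial D b (\<lambda>x. a *\<^sub>R f x + c *\<^sub>R g x) h" if b: "b \<in> Basis" for b
    using weak_partial_lincomb[OF Dm b H1_weak_partial[OF f b] H1_weak_partial[OF g b], of a c]
      L2_add[OF L2_scaleR L2_scaleR, OF H1_wpartial_L2[OF D f b] H1_wpartial_L2[OF D g b], of a c]
    by (rule bexI)
  moreover have "(\<lambda>x. a *\<^sub>R f x + c *\<^sub>R g x) \<in> elems (L2 D)"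
    by (intro L2_add L2_scaleR H1_imp_L2 f g)
  ultimately show ?thesis
    by (simp add: H1_def)
qed

lemma wpartial_lincomb_AE:
  assumes D: "open D" and f: "f \<in> elems (H1 D)" and g: "g \<in> elems (H1 D)" and b: "b \<in> Basis"
  shows "AE x in lebesgue_on D. wpartial D b (\<lambda>x. a *\<^sub>R f x + c *\<^sub>R g x) x
    = a *\<^sub>R wpartial D b f x + c *\<^sub>R wpartial D b g x"
  using D b H1_lincomb[OF D f g] weak_partial_lincomb[OF _ b H1_weak_partial[OF f b] H1_weak_partial[OF g b]]
  by (intro wpartial_eq_AE) (auto simp: borel_open)

lemma H1_diff:
  assumes "open D" "f \<in> elems (H1 D)" "g \<in> elems (H1 D)"
  shows "(\<lambda>x. f x - g x) \<in> elems (H1 D)"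
  using H1_lincomb[OF assms, of 1 "-1"] by simp

lemma wpartial_diff_AE:
  assumes "open D" "f \<in> elems (H1 D)" "g \<in> elems (H1 D)" "b \<in> Basis"
  shows "AE x in lebesgue_on D. wpartial D b (\<lambda>x. f x - g x) x = wpartial D b f x - wpartial D b g x"
  using wpartial_lincomb_AE[OF assms, of 1 "-1"] by simp

lemma nrm_H1_nonneg [simp]: "0 \<le> nrm (H1 D) f"
  by (simp add: H1_def sum_nonneg)

lemma nrm_H1_power2: "(nrm (H1 D) f)\<^sup>2 = (nrm (L2 D) f)\<^sup>2 + (\<Sum>b\<in>Basis. (nrm (L2 D) (wpartial D b f))\<^sup>2)"
  by (simp add: H1_def sum_nonneg)

lemma nrm_L2_le_H1: "nrm (L2 D) f \<le> nrm (H1 D) f"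
  by (rule power2_le_imp_le) (simp_all add: nrm_H1_power2 sum_nonneg)

lemma nrm_L2_wpartial_le_H1: "b \<in> Basis \<Longrightarrow> nrm (L2 D) (wpartial D b f) \<le> nrm (H1 D) f"
  by (rule power2_le_imp_le) (auto simp: nrm_H1_power2 intro!: add_increasing member_le_sum)

section \<open>Higher integrability from a bound on the mean oscillation\<close>

text \<open>Shrinking the convex set towards \<open>x\<close> by the factor \<open>r / R\<close>,
  with \<open>R\<close> above its diameter, moves a fixed ball inside \<open>C\<close> to a ball of
  radius proportional to \<open>r\<close> that lies in both \<open>C\<close> and
  \<open>ball x r\<close>. The constant is the volume of a ball of radius
  \<open>\<rho> / R\<close>.\<close>

lemma convex_measure_ball_ge:
  fixes C :: "'a::euclidean_space set"
  assumes C: "open C" "convex C" "bounded C" "C \<noteq> {}"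
  obtains c where "0 < c" "\<And>x r. x \<in> C \<Longrightarrow> 0 < r \<Longrightarrow> r \<le> 1 \<Longrightarrow> c * r ^ DIM('a) \<le> measure lebesgue (C \<inter> ball x r)"
proof -
  obtain y0 where "y0 \<in> C" using C by blast
  then obtain \<rho> where \<rho>: "0 < \<rho>" "ball y0 \<rho> \<subseteq> C"
    using C(1) open_contains_ball by blast
  obtain R0 where R0: "\<forall>x\<in>C. \<forall>y\<in>C. dist x y \<le> R0"
    using C(3) unfolding bounded_two_points by blast
  \<comment> \<open>\<open>R\<close> strictly exceeds all distances in \<open>C\<close>, so that the
    shrunken points fall into the open ball, and it is at least 1, so that \<open>r \<le> 1\<close>
    makes the factor \<open>r / R\<close> at most 1.\<close>
  define R where "R = max 1 (R0 + 1)"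
  have R: "1 \<le> R" "\<And>x y. x \<in> C \<Longrightarrow> y \<in> C \<Longrightarrow> dist x y < R"
    using R0 unfolding R_def by (simp, smt (verit))
  define c where "c = unit_ball_vol DIM('a) * (\<rho> / R) ^ DIM('a)"
  have "c * r ^ DIM('a) \<le> measure lebesgue (C \<inter> ball x r)" if x: "x \<in> C" and r: "0 < r" "r \<le> 1" for x r
  proof -
    define t where "t = r / R"
    have t: "0 < t" "t \<le> 1" "t * R = r"
      using r R(1) unfolding t_def by auto
    have sub: "ball (x + t *\<^sub>R (y0 - x)) (t * \<rho>) \<subseteq> C \<inter> ball x r"
    proof
      fix z assume z: "z \<in> ball (x + t *\<^sub>R (y0 - x)) (t * \<rho>)"
      define y where "y = x + (1 / t) *\<^sub>R (z - x)"
      have zy: "z = (1 - t) *\<^sub>R x + t *\<^sub>R y"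
        using t unfolding y_def by (simp add: algebra_simps)
      have "x + t *\<^sub>R (y0 - x) - z = t *\<^sub>R (y0 - y)"
        unfolding zy by (simp add: algebra_simps)
      then have "t * norm (y0 - y) < t * \<rho>"
        using z t by (simp add: dist_norm)
      then have y: "y \<in> C"
        using \<rho>(2) t by (auto simp: dist_norm)
      have "z \<in> C"
        unfolding zy using convexD[OF C(2) x y, of "1 - t" t] t by simp
      moreover have "x - z = t *\<^sub>R (x - y)"
        unfolding zy by (simp add: algebra_simps)
      then have "dist x z = t * dist x y"
        using t by (simp add: dist_norm)
      then have "dist x z < r"
        using R(2)[OF x y] t mult_strict_left_mono[of "dist x y" R t] by simp
      ultimately show "z \<in> C \<inter> ball x r" by simp
    qed
    have "c * r ^ DIM('a) = measure lebesgue (ball (x + t *\<^sub>R (y0 - x)) (t * \<rho>))"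
    proof -
      have "measure lebesgue (ball (x + t *\<^sub>R (y0 - x)) (t * \<rho>)) = unit_ball_vol DIM('a) * (t * \<rho>) ^ DIM('a)"
        using t(1) \<rho>(1) content_ball[of "t * \<rho>" "x + t *\<^sub>R (y0 - x)"] by simp
      then show ?thesis
        by (simp add: c_def t_def power_mult_distrib power_divide)
    qed
    also have "\<dots> \<le> measure lebesgue (C \<inter> ball x r)"
      using C by (intro measure_mono_fmeasurable[OF sub]) (auto intro: lmeasurable_open)
    finally show ?thesis .
  qed
  moreover have "0 < c"
    using \<rho>(1) R(1) unfolding c_def by simp
  ultimately show ?thesis using that by blast
qed

text \<open>For \<open>0 < s < 1\<close> this is the condition defining the Nikolskii space of order \<open>s\<close>; it is implied
  both by membership in the Slobodeckij space of order \<open>s\<close> and by membership in \<open>H1\<close>.\<close>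

definition nikolskii :: "'a::euclidean_space set \<Rightarrow> real \<Rightarrow> real \<Rightarrow> ('a \<Rightarrow> 'b::euclidean_space) \<Rightarrow> bool" where
  "nikolskii C s N f \<longleftrightarrow> f \<in> elems (L2 C) \<and> nrm (L2 C) f \<le> N \<and>
     (\<forall>r. 0 < r \<and> r \<le> 1 \<longrightarrow>
       (\<integral>\<^sup>+x. \<integral>\<^sup>+y. ennreal ((norm (f x - f y))\<^sup>2) * indicator (ball x r) y \<partial>lebesgue_on C \<partial>lebesgue_on C)
         \<le> ennreal (N\<^sup>2 * r powr (real DIM('a) + 2 * s)))"

text \<open>Once the coefficient \<open>K * \<theta> ^ k\<close> is below 1/2 the sequence stays
  bounded, and one further application of the recursion makes it decay geometrically. The crude
  growth bound \<open>4 ^ k\<close> supplies a starting value independent of the sequence, which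
  makes \<open>n\<close> uniform in \<open>b\<close>.\<close>

lemma geometric_recursion_tail:
  fixes K \<theta> \<epsilon> :: real
  assumes K: "0 < K" and \<theta>: "0 < \<theta>" "\<theta> < 1" and \<epsilon>: "0 < \<epsilon>"
  obtains n where "\<And>b. (\<And>k. 0 \<le> b k) \<Longrightarrow> (\<And>k. b k \<le> 4 ^ k) \<Longrightarrow>
      (\<And>k. k1 \<le> k \<Longrightarrow> b (Suc k) \<le> K * \<theta> ^ k * (1 + b k)) \<Longrightarrow>
      (\<Sum>k. ennreal (b (n + k))) \<le> ennreal \<epsilon>"
proof -
  have lim: "(\<lambda>k. c * \<theta> ^ k) \<longlonglongrightarrow> 0" for c
    using LIMSEQ_power_zero[of \<theta>] \<theta> by (intro tendsto_mult_right_zero) auto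
  have "\<forall>\<^sub>F k in sequentially. K * \<theta> ^ k < 1/2"
    using lim by (rule order_tendstoD) simp
  then obtain k2' where k2': "\<And>k. k2' \<le> k \<Longrightarrow> K * \<theta> ^ k < 1/2"
    by (auto simp: eventually_sequentially)
  define k2 where "k2 = max k1 k2'"
  \<comment> \<open>The added 1 gives \<open>(1 + B) / 2 \<le> B\<close>, which is what the
    induction step consumes.\<close>
  define B :: real where "B = 4 ^ k2 + 1"
  have B: "1 \<le> B" by (simp add: B_def)
  have "\<forall>\<^sub>F k in sequentially. (K * (1 + B) / (1 - \<theta>)) * \<theta> ^ k < \<epsilon>"
    using lim by (rule order_tendstoD) (rule \<epsilon>)
  then obtain m' where m': "\<And>k. m' \<le> k \<Longrightarrow> (K * (1 + B) / (1 - \<theta>)) * \<theta> ^ k < \<epsilon>"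
    by (auto simp: eventually_sequentially)
  define m where "m = max m' k2"
  show thesis
  proof (rule that[of "Suc m"])
    fix b :: "nat \<Rightarrow> real"
    assume b0: "\<And>k. 0 \<le> b k" and b4: "\<And>k. b k \<le> 4 ^ k"
      and rec: "\<And>k. k1 \<le> k \<Longrightarrow> b (Suc k) \<le> K * \<theta> ^ k * (1 + b k)"
    have bB: "b k \<le> B" if "k2 \<le> k" for k
      using that
    proof (induction k rule: dec_induct)
      case base
      then show ?case using b4[of k2] by (simp add: B_def)
    next
      case (step k)
      have "b (Suc k) \<le> K * \<theta> ^ k * (1 + b k)"
        using step by (intro rec) (simp add: k2_def)
      also have "\<dots> \<le> (1/2) * (1 + B)"
        using step k2'[of k] b0[of k] B by (intro mult_mono) (auto simp: k2_def)
      also have "\<dots> \<le> B" using B by simp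
      finally show ?case .
    qed
    have bs: "b (Suc m + k) \<le> K * (1 + B) * \<theta> ^ m * \<theta> ^ k" for k
    proof -
      have "b (Suc (m + k)) \<le> K * \<theta> ^ (m + k) * (1 + b (m + k))"
        by (intro rec) (simp add: m_def k2_def)
      also have "\<dots> \<le> K * \<theta> ^ (m + k) * (1 + B)"
        using bB[of "m + k"] K \<theta> by (intro mult_left_mono) (auto simp: m_def)
      finally show ?thesis by (simp add: power_add mult_ac)
    qed
    have sums: "(\<lambda>k. K * (1 + B) * \<theta> ^ m * \<theta> ^ k) sums (K * (1 + B) * \<theta> ^ m * (1 / (1 - \<theta>)))"
      using \<theta> by (intro sums_mult geometric_sums) auto
    have "(\<Sum>k. ennreal (b (Suc m + k))) \<le> (\<Sum>k. ennreal (K * (1 + B) * \<theta> ^ m * \<theta> ^ k))"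
      using bs by (intro suminf_le summableI ennreal_leI)
    also have "\<dots> = ennreal (K * (1 + B) * \<theta> ^ m * (1 / (1 - \<theta>)))"
      using K B \<theta> sums by (intro suminf_ennreal_eq) auto
    also have "\<dots> \<le> ennreal \<epsilon>"
      using m'[of m] by (intro ennreal_leI) (simp add: m_def mult_ac)
    finally show "(\<Sum>k. ennreal (b (Suc m + k))) \<le> ennreal \<epsilon>" .
  qed
qed

section \<open>Decay of the measure of superlevel sets\<close>

lemma nikolskii_chebyshev:
  fixes f :: "'a::euclidean_space \<Rightarrow> real"
  assumes C: "C \<in> lmeasurable" and f: "nikolskii C s 1 f" and l: "0 < l"
  shows "measure lebesgue {x \<in> C. l < f x} \<le> 1 / l\<^sup>2"
proof -
  let ?M = "lebesgue_on C" and ?A = "{x \<in> C. l < f x}"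
  have Cs: "C \<in> sets lebesgue" using C by (rule fmeasurableD)
  have int: "integrable ?M (\<lambda>x. (f x)\<^sup>2)" and fm: "f \<in> borel_measurable ?M"
    using f by (simp_all add: nikolskii_def L2_iff)
  have meas: "?A \<in> sets ?M"
    using measurable_sets[OF fm, of "{l<..}"] by (simp add: vimage_def Int_def conj_commute)
  then have lm: "?A \<in> lmeasurable"
    using C Cs by (intro fmeasurableI2[OF C]) (auto simp: sets_restrict_space_iff)
  have em: "emeasure ?M ?A = ennreal (measure lebesgue ?A)"
    using lm Cs by (simp add: emeasure_restrict_space emeasure_eq_measure2)
  have "ennreal (l\<^sup>2 * measure lebesgue ?A) = (\<integral>\<^sup>+x. ennreal (l\<^sup>2) * indicator ?A x \<partial>?M)"
    using meas by (simp add: nn_integral_cmult_indicator em ennreal_mult)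
  also have "\<dots> \<le> (\<integral>\<^sup>+x. ennreal ((f x)\<^sup>2) \<partial>?M)"
    using l by (intro nn_integral_mono) (auto split: split_indicator intro!: ennreal_leI power_mono)
  also have "\<dots> = ennreal ((nrm (L2 C) f)\<^sup>2)"
    using nn_integral_eq_integral[OF int] by (simp add: nrm_L2_power2)
  also have "\<dots> \<le> ennreal 1"
    using f by (intro ennreal_leI) (simp add: nikolskii_def power_le_one)
  finally show ?thesis
    using l by (simp add: field_simps ennreal_le_iff del: ennreal_1)
qed

text \<open>The radius \<open>r\<close> is chosen such that \<open>c * r ^ DIM('a)\<close> is twice
  the measure of the set where \<open>f > l\<close>. Then the points of
  \<open>C \<inter> ball x r\<close> with \<open>f \<le> l\<close> still have at least that measure.
  If \<open>f x > 2 * l\<close>, all of them differ from \<open>x\<close> in value by at least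
  \<open>l\<close>, and the oscillation bound limits the measure of the set of such
  \<open>x\<close>.\<close>

lemma nikolskii_superlevel:
  fixes f :: "'a::euclidean_space \<Rightarrow> real"
  assumes C: "C \<in> lmeasurable" and f: "nikolskii C s 1 f"
    and c: "0 < c" "\<And>x r. x \<in> C \<Longrightarrow> 0 < r \<Longrightarrow> r \<le> 1 \<Longrightarrow> c * r ^ DIM('a) \<le> measure lebesgue (C \<inter> ball x r)"
    and l: "0 < l" "2 / c \<le> l\<^sup>2"
  shows "measure lebesgue {x \<in> C. 2 * l < f x}
    \<le> (2 / c) * (2 / c) powr (2 * s / DIM('a)) / l\<^sup>2 * measure lebesgue {x \<in> C. l < f x} powr (2 * s / DIM('a))"
proof -
  let ?d = "real DIM('a)" and ?M = "lebesgue_on C"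
  define m where "m = (\<lambda>l. measure lebesgue {x \<in> C. l < f x})"
  have Cs: "C \<in> sets lebesgue" using C by (rule fmeasurableD)
  have [measurable]: "f \<in> borel_measurable ?M" using f by (simp add: nikolskii_def L2_iff)
  have meas: "{x \<in> C. k < f x} \<in> sets ?M" for k
    using measurable_sets[of f ?M borel "{k<..}"] by (simp add: vimage_def Int_def conj_commute)
  have lm: "{x \<in> C. k < f x} \<in> lmeasurable" for k
    using meas[of k] C Cs by (intro fmeasurableI2[OF C]) (auto simp: sets_restrict_space_iff)
  have em: "emeasure ?M A = ennreal (measure lebesgue A)" if "A \<subseteq> C" "A \<in> lmeasurable" for A
    using that Cs by (simp add: emeasure_restrict_space emeasure_eq_measure2)
  have sm: "A \<in> sets ?M" if "A \<subseteq> C" "A \<in> lmeasurable" for A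
    using that Cs by (auto simp: sets_restrict_space_iff fmeasurableD)
  note cheb = nikolskii_chebyshev[OF C f l(1)]
  let ?a = "2 * s / ?d"
  have m0: "0 \<le> m k" for k by (simp add: m_def)
  show "measure lebesgue {x \<in> C. 2 * l < f x}
    \<le> (2 / c) * (2 / c) powr (2 * s / DIM('a)) / l\<^sup>2 * measure lebesgue {x \<in> C. l < f x} powr (2 * s / DIM('a))"
  proof (cases "m l = 0")
    case True
    have "m (2 * l) \<le> m l"
      unfolding m_def using l by (intro measure_mono_fmeasurable lm fmeasurableD) auto
    then have "m (2 * l) = 0" using True m0[of "2 * l"] by simp
    then show ?thesis using c by (simp add: m_def)
  next
    case False
    then have ml: "0 < m l" using m0[of l] by simp
    define r where "r = (2 * m l / c) powr (1 / ?d)"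
    have r0: "0 < r" using ml c by (simp add: r_def)
    have rd: "r ^ DIM('a) = 2 * m l / c"
      using ml c r0 by (simp add: r_def powr_realpow[symmetric] powr_powr)
    \<comment> \<open>The oscillation bound is available for radii up to 1 only; Chebyshev's
      inequality together with \<open>2 / c \<le> l\<^sup>2\<close> secures this.\<close>
    have "2 * m l / c \<le> 1"
    proof -
      have "2 * m l \<le> 2 * (1 / l\<^sup>2)" using cheb by (simp add: m_def)
      also have "\<dots> \<le> c" using l c by (simp add: field_simps)
      finally show ?thesis using c by simp
    qed
    then have r1: "r \<le> 1"
      using ml c unfolding r_def by (intro powr_le1) auto
    have inner: "ennreal (l\<^sup>2 * m l) \<le> (\<integral>\<^sup>+y. ennreal ((norm (f x - f y))\<^sup>2) * indicator (ball x r) y \<partial>?M)"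
      if x: "x \<in> C" "2 * l < f x" for x
    proof -
      let ?A = "C \<inter> ball x r - {x \<in> C. l < f x}"
      have b: "C \<inter> ball x r \<in> lmeasurable"
        using C by (intro fmeasurable.Int) auto
      have A: "?A \<in> lmeasurable" "?A \<subseteq> C"
        using b lm by (auto intro: fmeasurable.Diff)
      have "c * r ^ DIM('a) \<le> measure lebesgue (C \<inter> ball x r)"
        by (rule c(2)[OF x(1) r0 r1])
      also have "\<dots> \<le> measure lebesgue (?A \<union> {x \<in> C. l < f x})"
        using A lm b by (intro measure_mono_fmeasurable fmeasurable.Un fmeasurableD) auto
      also have "\<dots> \<le> measure lebesgue ?A + m l"
        unfolding m_def using A lm by (intro measure_Un_le fmeasurableD) auto
      finally have "m l \<le> measure lebesgue ?A"
        using rd c by simp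
      then have "ennreal (l\<^sup>2 * m l) \<le> ennreal (l\<^sup>2 * measure lebesgue ?A)"
        by (intro ennreal_leI mult_left_mono) auto
      also have "\<dots> = (\<integral>\<^sup>+y. ennreal (l\<^sup>2) * indicator ?A y \<partial>?M)"
        using sm[OF A(2,1)] by (simp add: nn_integral_cmult_indicator em A ennreal_mult)
      also have "\<dots> \<le> (\<integral>\<^sup>+y. ennreal ((norm (f x - f y))\<^sup>2) * indicator (ball x r) y \<partial>?M)"
        using l x by (intro nn_integral_mono) (auto split: split_indicator intro!: ennreal_leI power2_le_iff_abs_le[THEN iffD2])
      finally show ?thesis .
    qed
    have "ennreal (l\<^sup>2 * m l * m (2 * l)) = (\<integral>\<^sup>+x. ennreal (l\<^sup>2 * m l) * indicator {x \<in> C. 2 * l < f x} x \<partial>?M)"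
      using meas[of "2 * l"] lm[of "2 * l"] m0 by (simp add: nn_integral_cmult_indicator em m_def ennreal_mult)
    also have "\<dots> \<le> (\<integral>\<^sup>+x. \<integral>\<^sup>+y. ennreal ((norm (f x - f y))\<^sup>2) * indicator (ball x r) y \<partial>?M \<partial>?M)"
      using inner by (intro nn_integral_mono) (auto split: split_indicator)
    also have "\<dots> \<le> ennreal (r powr (?d + 2 * s))"
      using f r0 r1 unfolding nikolskii_def by simp
    finally have "l\<^sup>2 * m l * m (2 * l) \<le> r powr (?d + 2 * s)"
      by (simp add: ennreal_le_iff)
    also have "\<dots> = (2 * m l / c) * (2 * m l / c) powr ?a"
      using r0 ml c by (simp add: powr_add powr_realpow rd) (simp add: r_def powr_powr mult.commute)
    also have "(2 * m l / c) powr ?a = (2 / c) powr ?a * m l powr ?a"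
      using ml c powr_mult[of "2 / c" "m l" ?a] by (simp add: mult_ac)
    \<comment> \<open>One factor \<open>m l\<close> is common to both sides and cancels, which
      leaves the power \<open>2 * s / d\<close>.\<close>
    finally have "m l * (l\<^sup>2 * m (2 * l)) \<le> m l * ((2 / c) * (2 / c) powr ?a * m l powr ?a)"
      by (simp add: mult_ac)
    then have "l\<^sup>2 * m (2 * l) \<le> (2 / c) * (2 / c) powr ?a * m l powr ?a"
      using ml by (simp only: mult_le_cancel_left_pos)
    then have "m (2 * l) \<le> (2 / c) * (2 / c) powr ?a * m l powr ?a / l\<^sup>2"
      using l by (subst pos_le_divide_eq) (simp_all add: mult.commute)
    then show ?thesis
      by (simp add: m_def)
  qed
qed

text \<open>With \<open>m l\<close> the measure of the set where \<open>f > l\<close> and \<open>a = 2 * s / d\<close>, the bound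
  \<open>m (2 * l) \<le> K * m l powr a / l\<^sup>2\<close> turns into a recursion with geometrically decaying factors for
  \<open>16 ^ k * m (2 ^ k)\<close> exactly when \<open>a > 1/2\<close>.\<close>

lemma nikolskii_L4_tail_scalar:
  fixes C :: "'a::euclidean_space set"
  assumes C: "open C" "convex C" "bounded C" "C \<noteq> {}"
    and a: "1/2 < 2 * s / DIM('a)" "2 * s / DIM('a) \<le> 1" and \<epsilon>: "0 < \<epsilon>"
  shows "\<exists>L>0. \<forall>f::'a \<Rightarrow> real. (\<forall>x. 0 \<le> f x) \<longrightarrow> nikolskii C s 1 f \<longrightarrow>
     (\<integral>\<^sup>+x. ennreal (f x ^ 4) * indicator {L<..} (f x) \<partial>lebesgue_on C) \<le> ennreal \<epsilon>"
proof -
  let ?a = "2 * s / DIM('a)" and ?M = "lebesgue_on C"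
  obtain c where c: "0 < c" "\<And>x r. x \<in> C \<Longrightarrow> 0 < r \<Longrightarrow> r \<le> 1 \<Longrightarrow> c * r ^ DIM('a) \<le> measure lebesgue (C \<inter> ball x r)"
    using convex_measure_ball_ge[OF C] by blast
  have Clm: "C \<in> lmeasurable" using C by (simp add: lmeasurable_open)
  have Cs: "C \<in> sets lebesgue" using Clm by (rule fmeasurableD)
  define K0 where "K0 = (2 / c) * (2 / c) powr ?a"
  have K0: "0 < K0" using c by (simp add: K0_def)
  \<comment> \<open>In the step from level \<open>2 ^ k\<close> the weight contributes
    \<open>16 ^ k\<close>, the division by the squared level \<open>1 / 4 ^ k\<close>, and
    expressing the measure through \<open>b k\<close> the factor \<open>(1 / 16 ^ k) powr a\<close>;
    their product is \<open>\<theta> ^ k\<close>.\<close>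
  define \<theta> :: real where "\<theta> = 4 * (1/16) powr ?a"
  have \<theta>: "0 < \<theta>" "\<theta> < 1"
  proof -
    have "(1/16::real) powr ?a < (1/16) powr (1/2)"
      using a powr_less_cancel_iff by (intro powr_less_mono') auto
    also have "\<dots> = 1/4"
      by (simp add: powr_half_sqrt real_sqrt_divide)
    finally show "\<theta> < 1" by (simp add: \<theta>_def)
  qed (simp add: \<theta>_def)
  obtain k1 :: nat where k1: "2 / c \<le> (2 ^ k1)\<^sup>2"
  proof -
    obtain k :: nat where "2 / c < 2 ^ k"
      using real_arch_pow[of 2 "2/c"] by auto
    moreover have "(2::real) ^ k \<le> (2 ^ k)\<^sup>2"
      by (simp add: power2_eq_square)
    ultimately have "2 / c \<le> (2 ^ k)\<^sup>2" by linarith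
    then show ?thesis by (rule that; simp)
  qed
  obtain n where n: "\<And>b. (\<And>k. 0 \<le> b k) \<Longrightarrow> (\<And>k. b k \<le> 4 ^ k) \<Longrightarrow>
      (\<And>k. k1 \<le> k \<Longrightarrow> b (Suc k) \<le> 16 * K0 * \<theta> ^ k * (1 + b k)) \<Longrightarrow>
      (\<Sum>k. ennreal (b (n + k))) \<le> ennreal (\<epsilon> / 16)"
    using geometric_recursion_tail[of "16 * K0" \<theta> "\<epsilon> / 16" k1] K0 \<theta> \<epsilon>
    by (metis zero_less_divide_iff zero_less_mult_iff zero_less_numeral)
  show ?thesis
  proof (intro exI[of _ "2 ^ n"] conjI allI impI)
    fix f :: "'a \<Rightarrow> real" assume f0: "\<forall>x. 0 \<le> f x" and f: "nikolskii C s 1 f"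
    have fm [measurable]: "f \<in> borel_measurable ?M" using f by (simp add: nikolskii_def L2_iff)
    define A where "A = (\<lambda>l. {x \<in> C. l < f x})"
    define m where "m = (\<lambda>l. measure lebesgue (A l))"
    have meas: "A k \<in> sets ?M" for k
      unfolding A_def using measurable_sets[of f ?M borel "{k<..}"] by (simp add: vimage_def Int_def conj_commute)
    then have lm: "A k \<in> lmeasurable" for k
      using meas[of k] Clm Cs by (intro fmeasurableI2[OF Clm]) (auto simp: sets_restrict_space_iff A_def)
    have em: "emeasure ?M (A k) = ennreal (m k)" for k
      using lm[of k] Cs by (simp add: m_def emeasure_restrict_space emeasure_eq_measure2 A_def)
    have m0: "0 \<le> m k" for k by (simp add: m_def)
    define b where "b = (\<lambda>k::nat. 16 ^ k * m (2 ^ k))"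
    have step: "m (2 * l) \<le> K0 / l\<^sup>2 * m l powr ?a" if "0 < l" "2 / c \<le> l\<^sup>2" for l
      using nikolskii_superlevel[OF Clm f c that] by (simp_all add: m_def A_def K0_def)
    have cheb: "m l \<le> 1 / l\<^sup>2" if "0 < l" for l
      using nikolskii_chebyshev[OF Clm f that] by (simp add: m_def A_def)
    have sum_b: "(\<Sum>k. ennreal (b (n + k))) \<le> ennreal (\<epsilon> / 16)"
    proof (rule n)
      show "0 \<le> b k" for k by (simp add: b_def m0)
      show "b k \<le> 4 ^ k" for k
      proof -
        have "b k \<le> 16 ^ k * (1 / (2 ^ k)\<^sup>2)"
          unfolding b_def by (intro mult_left_mono cheb) auto
        also have "\<dots> = 4 ^ k"
          by (simp add: power2_eq_square power_mult_distrib[symmetric] power_divide[symmetric])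
        finally show ?thesis .
      qed
      show "b (Suc k) \<le> 16 * K0 * \<theta> ^ k * (1 + b k)" if "k1 \<le> k" for k
      proof -
        have k: "2 / c \<le> (2 ^ k)\<^sup>2"
        proof -
          have "(2 ^ k1)\<^sup>2 \<le> ((2::real) ^ k)\<^sup>2"
            using that by (intro power_mono power_increasing) auto
          then show ?thesis using k1 by linarith
        qed
        have "b (Suc k) = 16 * 16 ^ k * m (2 * 2 ^ k)" by (simp add: b_def)
        also have "\<dots> \<le> 16 * 16 ^ k * (K0 / (2 ^ k)\<^sup>2 * m (2 ^ k) powr ?a)"
          by (intro mult_left_mono step k) auto
        also have "\<dots> = 16 * K0 * (4 ^ k * m (2 ^ k) powr ?a)"
          by (simp add: power2_eq_square power_mult_distrib[symmetric] power_divide[symmetric] field_simps)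
        also have "m (2 ^ k) = (1/16) ^ k * b k"
          by (simp add: b_def power_divide)
        also have "4 ^ k * ((1/16) ^ k * b k) powr ?a = \<theta> ^ k * b k powr ?a"
          by (simp add: powr_mult \<theta>_def power_mult_distrib powr_power powr_realpow[symmetric] powr_powr b_def m0 mult.commute)
        \<comment> \<open>Here the exponent must not exceed 1: the sublinear power is replaced by an
          affine expression, which gives the form of the recursion that the tail lemma
          accepts.\<close>
        also have "b k powr ?a \<le> 1 + b k"
        proof (cases "b k \<le> 1")
          case True
          then have "b k powr ?a \<le> 1"
            using a by (intro powr_le1) (auto simp: b_def m0)
          moreover have "0 \<le> b k" by (simp add: b_def m0)
          ultimately show ?thesis by linarith
        next
          case False
          then have "b k powr ?a \<le> b k powr 1"
            using a by (intro powr_mono) auto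
          then show ?thesis using False by simp
        qed
        finally show ?thesis
          using K0 \<theta> by (simp add: mult_left_mono mult.assoc)
      qed
    qed
    \<comment> \<open>On the dyadic layer where \<open>f x\<close> lies above
      \<open>2 ^ (n + k)\<close> and is at most \<open>2 ^ (n + Suc k)\<close>, the fourth power is
      at most \<open>16 * 16 ^ (n + k)\<close>, so a single summand already dominates. The layer is
      found as a least exponent.\<close>
    have pt: "ennreal (f x ^ 4) * indicator {2 ^ n<..} (f x) \<le> (\<Sum>k. ennreal (16 * 16 ^ (n + k)) * indicator (A (2 ^ (n + k))) x)"
      if x: "x \<in> C" for x
    proof (cases "2 ^ n < f x")
      case True
      have "\<exists>k. f x \<le> 2 ^ (n + Suc k)"
      proof -
        obtain k :: nat where "f x < 2 ^ k" using real_arch_pow[of 2 "f x"] by auto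
        moreover have "(2::real) ^ k \<le> 2 ^ (n + Suc k)" by (intro power_increasing) auto
        ultimately show ?thesis by (intro exI[of _ k]) linarith
      qed
      then have le: "f x \<le> 2 ^ (n + Suc (LEAST k. f x \<le> 2 ^ (n + Suc k)))"
        by (rule LeastI_ex)
      define k where "k = (LEAST k. f x \<le> 2 ^ (n + Suc k))"
      have le': "f x \<le> 2 ^ (n + Suc k)" using le by (simp only: k_def)
      have gt: "2 ^ (n + k) < f x"
      proof (cases k)
        case 0
        then show ?thesis using True by simp
      next
        case (Suc j)
        then have "\<not> f x \<le> 2 ^ (n + Suc j)"
          using not_less_Least[of j "\<lambda>k. f x \<le> 2 ^ (n + Suc k)"] by (simp add: k_def)
        then show ?thesis using Suc by simp
      qed
      have "f x ^ 4 \<le> (2 ^ (n + Suc k)) ^ 4"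
        using le' f0 by (intro power_mono) auto
      also have "\<dots> = 16 * 16 ^ (n + k)"
      proof -
        have "((2::real) ^ m) ^ 4 = 16 ^ m" for m
          using power_mult[of "2::real" m 4] power_mult[of "2::real" 4 m] by (simp add: mult.commute)
        then show ?thesis by simp
      qed
      finally have "ennreal (f x ^ 4) * indicator {2 ^ n<..} (f x) \<le> ennreal (16 * 16 ^ (n + k)) * indicator (A (2 ^ (n + k))) x"
        using True gt x by (simp add: A_def ennreal_leI)
      also have "\<dots> \<le> (\<Sum>k. ennreal (16 * 16 ^ (n + k)) * indicator (A (2 ^ (n + k))) x)"
      proof -
        have *: "h k \<le> suminf h" for h :: "nat \<Rightarrow> ennreal"
          using sum_le_suminf[OF summableI, of "{k}" h] by simp
        show ?thesis by (rule *)
      qed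
      finally show ?thesis .
    qed simp
    have "(\<integral>\<^sup>+x. ennreal (f x ^ 4) * indicator {2 ^ n<..} (f x) \<partial>?M)
        \<le> (\<integral>\<^sup>+x. (\<Sum>k. ennreal (16 * 16 ^ (n + k)) * indicator (A (2 ^ (n + k))) x) \<partial>?M)"
      using pt by (intro nn_integral_mono) auto
    also have "\<dots> = (\<Sum>k. \<integral>\<^sup>+x. ennreal (16 * 16 ^ (n + k)) * indicator (A (2 ^ (n + k))) x \<partial>?M)"
      using meas by (intro nn_integral_suminf) (auto intro!: borel_measurable_times_ennreal borel_measurable_indicator)
    also have "\<dots> = (\<Sum>k. 16 * ennreal (b (n + k)))"
    proof (rule suminf_cong)
      fix k
      have "(\<integral>\<^sup>+x. ennreal (16 * 16 ^ (n + k)) * indicator (A (2 ^ (n + k))) x \<partial>?M) = ennreal (16 * 16 ^ (n + k)) * ennreal (m (2 ^ (n + k)))"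
        using meas by (simp only: nn_integral_cmult_indicator em)
      also have "\<dots> = ennreal (16 * b (n + k))"
        by (subst ennreal_mult[symmetric]) (simp_all add: b_def m0 mult.assoc)
      also have "\<dots> = 16 * ennreal (b (n + k))"
        by (subst ennreal_mult) (simp_all add: b_def m0)
      finally show "(\<integral>\<^sup>+x. ennreal (16 * 16 ^ (n + k)) * indicator (A (2 ^ (n + k))) x \<partial>?M) = 16 * ennreal (b (n + k))" .
    qed
    also have "\<dots> = 16 * (\<Sum>k. ennreal (b (n + k)))"
      by simp
    also have "\<dots> \<le> 16 * ennreal (\<epsilon> / 16)"
      by (intro mult_left_mono sum_b) auto
    also have "\<dots> = ennreal \<epsilon>"
      using \<epsilon> ennreal_mult[of 16 "\<epsilon> / 16"] by simp
    finally show "(\<integral>\<^sup>+x. ennreal (f x ^ 4) * indicator {2 ^ n<..} (f x) \<partial>?M) \<le> ennreal \<epsilon>" .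
  qed simp
qed

text \<open>A finite positive factor can be inverted, so simple minorants of one integrand scale to
  simple minorants of the other. The argument never asks for measurability of \<open>F\<close>, so
  it applies to the iterated integrals in \<open>nikolskii\<close> without knowing that the inner
  integral is measurable in the outer variable.\<close>

lemma nn_integral_cmult_pos:
  fixes c :: real
  assumes c: "0 < c"
  shows "(\<integral>\<^sup>+x. ennreal c * F x \<partial>M) = ennreal c * (\<integral>\<^sup>+x. F x \<partial>M)"
proof -
  have le: "(\<integral>\<^sup>+x. ennreal c * F x \<partial>M) \<le> ennreal c * (\<integral>\<^sup>+x. F x \<partial>M)" if c: "0 < c" for c :: real and F
    unfolding nn_integral_def[of M "\<lambda>x. ennreal c * F x"]
  proof (rule SUP_least)
    fix g assume "g \<in> {g. simple_function M g \<and> g \<le> (\<lambda>x. ennreal c * F x)}"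
    then have g: "simple_function M g" "\<And>x. g x \<le> ennreal c * F x" by (auto simp: le_fun_def)
    have cc: "ennreal c * (ennreal (1 / c) * z) = z" "ennreal (1 / c) * (ennreal c * z) = z" for z
      using c by (simp_all add: mult.assoc[symmetric] ennreal_mult[symmetric])
    have "integral\<^sup>S M g = ennreal c * integral\<^sup>S M (\<lambda>x. ennreal (1 / c) * g x)"
      using simple_integral_mult[of M "\<lambda>x. ennreal (1 / c) * g x" "ennreal c"] g(1) by (simp add: cc simple_function_mult)
    also have "integral\<^sup>S M (\<lambda>x. ennreal (1 / c) * g x) = (\<integral>\<^sup>+x. ennreal (1 / c) * g x \<partial>M)"
      using g(1) by (simp add: nn_integral_eq_simple_integral simple_function_mult)
    also have "\<dots> \<le> (\<integral>\<^sup>+x. F x \<partial>M)"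
    proof (rule nn_integral_mono)
      fix x
      have "ennreal (1 / c) * g x \<le> ennreal (1 / c) * (ennreal c * F x)"
        by (intro mult_left_mono g) simp
      then show "ennreal (1 / c) * g x \<le> F x" by (simp only: cc)
    qed
    finally show "integral\<^sup>S M g \<le> ennreal c * (\<integral>\<^sup>+x. F x \<partial>M)"
      by (simp add: mult_left_mono)
  qed
  have "ennreal c * (\<integral>\<^sup>+x. F x \<partial>M) \<le> (\<integral>\<^sup>+x. ennreal c * F x \<partial>M)"
  proof -
    have cc: "ennreal c * (ennreal (1 / c) * z) = z" "ennreal (1 / c) * (ennreal c * z) = z" for z
      using c by (simp_all add: mult.assoc[symmetric] ennreal_mult[symmetric])
    have "(\<integral>\<^sup>+x. F x \<partial>M) \<le> ennreal (1 / c) * (\<integral>\<^sup>+x. ennreal c * F x \<partial>M)"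
      using le[of "1 / c" "\<lambda>x. ennreal c * F x"] c by (simp add: cc)
    then have "ennreal c * (\<integral>\<^sup>+x. F x \<partial>M) \<le> ennreal c * (ennreal (1 / c) * (\<integral>\<^sup>+x. ennreal c * F x \<partial>M))"
      by (rule mult_left_mono) simp
    then show ?thesis by (simp only: cc)
  qed
  with le[OF c] show ?thesis by (rule antisym)
qed

text \<open>The reverse triangle inequality reduces vector-valued functions to the normalised scalar
  case. \<open>N'\<close> is kept apart from \<open>N\<close> because the division asks for a
  positive number, while \<open>N\<close> may be 0.\<close>

lemma nikolskii_norm_scale:
  fixes f :: "'a::euclidean_space \<Rightarrow> 'b::euclidean_space"
  assumes f: "nikolskii C s N f" and N: "N \<le> N'" "0 < N'"
  shows "nikolskii C s 1 (\<lambda>x. norm (f x) / N')"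
  unfolding nikolskii_def
proof (intro conjI allI impI)
  have [measurable]: "f \<in> borel_measurable (lebesgue_on C)" and int: "integrable (lebesgue_on C) (\<lambda>x. (norm (f x))\<^sup>2)"
    using f by (auto simp: nikolskii_def L2_iff)
  have N0: "0 \<le> N" using f by (meson nikolskii_def nrm_L2_nonneg order_trans)
  show "(\<lambda>x. norm (f x) / N') \<in> elems (L2 C)"
    using int by (auto simp: L2_iff power_divide)
  have "nrm (L2 C) (\<lambda>x. norm (f x) / N') = nrm (L2 C) f / N'"
    using N by (simp add: nrm_L2 power_divide real_sqrt_divide)
  then show "nrm (L2 C) (\<lambda>x. norm (f x) / N') \<le> 1"
    using f N by (simp add: nikolskii_def)
  fix r :: real assume r: "0 < r \<and> r \<le> 1"
  have q: "0 < (1 / N')\<^sup>2" using N by simp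
  let ?p = "r powr (real DIM('a) + 2 * s)" and ?M = "lebesgue_on C"
  have "(\<integral>\<^sup>+x. \<integral>\<^sup>+y. ennreal ((norm (norm (f x) / N' - norm (f y) / N'))\<^sup>2) * indicator (ball x r) y \<partial>?M \<partial>?M)
    \<le> (\<integral>\<^sup>+x. \<integral>\<^sup>+y. ennreal ((1 / N')\<^sup>2) * (ennreal ((norm (f x - f y))\<^sup>2) * indicator (ball x r) y) \<partial>?M \<partial>?M)"
  proof (intro nn_integral_mono)
    fix x y
    have "(norm (norm (f x) / N' - norm (f y) / N'))\<^sup>2 = (1 / N')\<^sup>2 * \<bar>norm (f x) - norm (f y)\<bar>\<^sup>2"
      by (simp add: diff_divide_distrib[symmetric] power_divide)
    also have "\<dots> \<le> (1 / N')\<^sup>2 * (norm (f x - f y))\<^sup>2"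
      by (intro mult_left_mono power_mono norm_triangle_ineq3) auto
    finally show "ennreal ((norm (norm (f x) / N' - norm (f y) / N'))\<^sup>2) * indicator (ball x r) y
       \<le> ennreal ((1 / N')\<^sup>2) * (ennreal ((norm (f x - f y))\<^sup>2) * indicator (ball x r) y)"
      by (auto split: split_indicator simp: ennreal_mult[symmetric] intro!: ennreal_leI)
  qed
  also have "\<dots> = (\<integral>\<^sup>+x. ennreal ((1 / N')\<^sup>2) * (\<integral>\<^sup>+y. (ennreal ((norm (f x - f y))\<^sup>2) * indicator (ball x r) y) \<partial>?M) \<partial>?M)"
    by (simp only: nn_integral_cmult_pos[OF q])
  also have "\<dots> = ennreal ((1 / N')\<^sup>2) * (\<integral>\<^sup>+x. (\<integral>\<^sup>+y. (ennreal ((norm (f x - f y))\<^sup>2) * indicator (ball x r) y) \<partial>?M) \<partial>?M)"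
    by (simp only: nn_integral_cmult_pos[OF q])
  also have "\<dots> \<le> ennreal ((1 / N')\<^sup>2) * ennreal (N\<^sup>2 * ?p)"
    using f r by (intro mult_left_mono) (auto simp: nikolskii_def)
  also have "\<dots> \<le> ennreal (1\<^sup>2 * ?p)"
  proof -
    have "(1 / N')\<^sup>2 * (N\<^sup>2 * ?p) \<le> 1\<^sup>2 * ?p"
      unfolding mult.assoc[symmetric] power_mult_distrib[symmetric]
      using N N0 by (intro mult_right_mono power_mono) auto
    then show ?thesis by (simp add: ennreal_mult[symmetric] ennreal_leI)
  qed
  finally show "(\<integral>\<^sup>+x. \<integral>\<^sup>+y. ennreal ((norm (norm (f x) / N' - norm (f y) / N'))\<^sup>2) * indicator (ball x r) y \<partial>?M \<partial>?M)
    \<le> ennreal (1\<^sup>2 * ?p)" .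
qed

lemma nikolskii_L4_tail:
  fixes C :: "'a::euclidean_space set"
  assumes C: "open C" "convex C" "bounded C" "C \<noteq> {}"
    and a: "1/2 < 2 * s / DIM('a)" "2 * s / DIM('a) \<le> 1" and \<epsilon>: "0 < \<epsilon>"
  shows "\<exists>L>0. \<forall>(f::'a \<Rightarrow> 'b::euclidean_space) N N'. nikolskii C s N f \<longrightarrow> N \<le> N' \<longrightarrow> 0 < N' \<longrightarrow>
     (\<integral>\<^sup>+x. ennreal (norm (f x) ^ 4) * indicator {L * N'<..} (norm (f x)) \<partial>lebesgue_on C) \<le> ennreal (\<epsilon> * N' ^ 4)"
proof -
  obtain L where L: "0 < L" "\<forall>f::'a \<Rightarrow> real. (\<forall>x. 0 \<le> f x) \<longrightarrow> nikolskii C s 1 f \<longrightarrow>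
     (\<integral>\<^sup>+x. ennreal (f x ^ 4) * indicator {L<..} (f x) \<partial>lebesgue_on C) \<le> ennreal \<epsilon>"
    using nikolskii_L4_tail_scalar[OF C a \<epsilon>] by blast
  show ?thesis
  proof (intro exI[of _ L] conjI allI impI L(1))
    fix f :: "'a \<Rightarrow> 'b" and N N' assume f: "nikolskii C s N f" and N: "N \<le> N'" "0 < N'"
    let ?M = "lebesgue_on C" and ?g = "\<lambda>x. norm (f x) / N'"
    have "(\<integral>\<^sup>+x. ennreal (norm (f x) ^ 4) * indicator {L * N'<..} (norm (f x)) \<partial>?M)
      = (\<integral>\<^sup>+x. ennreal (N' ^ 4) * (ennreal (?g x ^ 4) * indicator {L<..} (?g x)) \<partial>?M)"
      using N by (intro nn_integral_cong)
        (auto simp: indicator_def ennreal_mult[symmetric] power_divide pos_less_divide_eq)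
    also have "\<dots> = ennreal (N' ^ 4) * (\<integral>\<^sup>+x. ennreal (?g x ^ 4) * indicator {L<..} (?g x) \<partial>?M)"
      using N by (intro nn_integral_cmult_pos) simp
    also have "\<dots> \<le> ennreal (N' ^ 4) * ennreal \<epsilon>"
      using N nikolskii_norm_scale[OF f N] by (intro mult_left_mono L(2)[rule_format]) auto
    also have "\<dots> = ennreal (\<epsilon> * N' ^ 4)"
      using N \<epsilon> by (simp add: ennreal_mult[symmetric] mult.commute)
    finally show "(\<integral>\<^sup>+x. ennreal (norm (f x) ^ 4) * indicator {L * N'<..} (norm (f x)) \<partial>?M) \<le> ennreal (\<epsilon> * N' ^ 4)" .
  qed
qed

text \<open>Above the height \<open>L * N\<close> the tail estimate with \<epsilon> = 1 applies,
  below it the function is bounded on a set of finite measure. For \<open>N = 0\<close> the function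
  vanishes almost everywhere.\<close>

lemma nikolskii_L4_bound:
  fixes C :: "'a::euclidean_space set"
  assumes C: "open C" "convex C" "bounded C" "C \<noteq> {}"
    and a: "1/2 < 2 * s / DIM('a)" "2 * s / DIM('a) \<le> 1"
  shows "\<exists>K>0. \<forall>(f::'a \<Rightarrow> 'b::euclidean_space) N. nikolskii C s N f \<longrightarrow>
     (\<integral>\<^sup>+x. ennreal (norm (f x) ^ 4) \<partial>lebesgue_on C) \<le> ennreal (K * N ^ 4)"
proof -
  obtain L where L: "0 < L" "\<forall>(f::'a \<Rightarrow> 'b) N N'. nikolskii C s N f \<longrightarrow> N \<le> N' \<longrightarrow> 0 < N' \<longrightarrow>
     (\<integral>\<^sup>+x. ennreal (norm (f x) ^ 4) * indicator {L * N'<..} (norm (f x)) \<partial>lebesgue_on C) \<le> ennreal (1 * N' ^ 4)"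
    using nikolskii_L4_tail[OF C a zero_less_one] by blast
  have Clm: "C \<in> lmeasurable" using C by (simp add: lmeasurable_open)
  define K where "K = 1 + L ^ 4 * measure lebesgue C"
  have K: "0 < K" using L(1) by (simp add: K_def add_pos_nonneg)
  show ?thesis
  proof (intro exI[of _ K] conjI allI impI K)
    fix f :: "'a \<Rightarrow> 'b" and N assume f: "nikolskii C s N f"
    let ?M = "lebesgue_on C"
    have fm [measurable]: "f \<in> borel_measurable ?M" using f by (simp add: nikolskii_def L2_iff)
    have N0: "0 \<le> N" using f by (meson nikolskii_def nrm_L2_nonneg order_trans)
    show "(\<integral>\<^sup>+x. ennreal (norm (f x) ^ 4) \<partial>?M) \<le> ennreal (K * N ^ 4)"
    proof (cases "N = 0")
      case True
      then have "nrm (L2 C) f = 0" using f by (simp add: nikolskii_def antisym)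
      then have "AE x in ?M. f x = 0" using f by (intro nrm_L2_eq_0D) (auto simp: nikolskii_def)
      then have "(\<integral>\<^sup>+x. ennreal (norm (f x) ^ 4) \<partial>?M) = (\<integral>\<^sup>+x. 0 \<partial>?M)"
        by (intro nn_integral_cong_AE) (auto elim!: eventually_mono)
      then show ?thesis by simp
    next
      case False
      then have N: "0 < N" using N0 by simp
      have pt: "ennreal (norm (f x) ^ 4) \<le> ennreal (norm (f x) ^ 4) * indicator {L * N<..} (norm (f x)) + ennreal ((L * N) ^ 4)" for x
        using N L(1) by (cases "L * N < norm (f x)") (auto intro!: ennreal_leI power_mono add_increasing2)
      have "(\<integral>\<^sup>+x. ennreal (norm (f x) ^ 4) \<partial>?M)
         \<le> (\<integral>\<^sup>+x. ennreal (norm (f x) ^ 4) * indicator {L * N<..} (norm (f x)) + ennreal ((L * N) ^ 4) \<partial>?M)"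
        using pt by (intro nn_integral_mono)
      also have "\<dots> = (\<integral>\<^sup>+x. ennreal (norm (f x) ^ 4) * indicator {L * N<..} (norm (f x)) \<partial>?M) + (\<integral>\<^sup>+x. ennreal ((L * N) ^ 4) \<partial>?M)"
        by (intro nn_integral_add) measurable
      also have "\<dots> \<le> ennreal (1 * N ^ 4) + ennreal ((L * N) ^ 4) * ennreal (measure lebesgue C)"
        using Clm by (intro add_mono L(2)[rule_format, OF f] N) (auto simp: emeasure_restrict_space fmeasurableD emeasure_eq_measure2)
      also have "\<dots> = ennreal (K * N ^ 4)"
        using N L(1) by (simp add: ennreal_mult[symmetric] ennreal_plus[symmetric] K_def algebra_simps power_mult_distrib del: ennreal_plus)
      finally show ?thesis .
    qed
  qed
qed

section \<open>Translations of functions with a weak gradient\<close>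

lemma integrable_lborel_translate:
  fixes k :: "'a::euclidean_space \<Rightarrow> 'b::euclidean_space"
  assumes "integrable lborel k"
  shows "integrable lborel (\<lambda>x. k (x + a))" "(LINT x|lborel. k (x + a)) = (LINT x|lborel. k x)"
proof -
  have [measurable]: "k \<in> borel_measurable borel"
    using assms borel_measurable_integrable by fastforce
  have "integrable (distr lborel borel ((+) a)) k"
    using assms by (simp add: lborel_distr_plus)
  then show "integrable lborel (\<lambda>x. k (x + a))"
    by (subst (asm) integrable_distr_eq) (simp_all add: add.commute)
  have "(LINT x|distr lborel borel ((+) a). k x) = (LINT x|lborel. k (a + x))"
    by (rule integral_distr) simp_all
  then show "(LINT x|lborel. k (x + a)) = (LINT x|lborel. k x)"
    by (simp add: lborel_distr_plus add.commute)
qed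

lemma nn_integral_lborel_translate:
  assumes [measurable]: "f \<in> borel_measurable borel"
  shows "(\<integral>\<^sup>+x. f (x + a) \<partial>lborel) = (\<integral>\<^sup>+x. f x \<partial>(lborel :: 'a::euclidean_space measure))"
proof -
  have "(\<integral>\<^sup>+x. f x \<partial>distr lborel borel ((+) a)) = (\<integral>\<^sup>+x. f (a + x) \<partial>lborel)"
    by (rule nn_integral_distr) simp_all
  then show ?thesis
    by (simp add: lborel_distr_plus add.commute)
qed

text \<open>This joint integrability justifies the exchange of the average over the segment with the
  integral in space. Each slice in \<tau> is a translate, so its L1 norm does not depend on
  \<tau>.\<close>

lemma integrable_lborel_segment:
  fixes k :: "'a::euclidean_space \<Rightarrow> 'b::euclidean_space"
  assumes k: "integrable lborel k"
  shows "integrable (lborel \<Otimes>\<^sub>M lborel) (\<lambda>(\<tau>::real, x). indicator {0..1} \<tau> *\<^sub>R k (x + \<tau> *\<^sub>R h))"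
proof -
  have [measurable]: "k \<in> borel_measurable borel"
    using k borel_measurable_integrable by fastforce
  show ?thesis
  proof (rule lborel_pair.Fubini_integrable)
    show "(\<lambda>(\<tau>::real, x). indicator {0..1} \<tau> *\<^sub>R k (x + \<tau> *\<^sub>R h)) \<in> borel_measurable (lborel \<Otimes>\<^sub>M lborel)"
      by measurable
    have eq: "(LINT x|lborel. norm (indicator {0..1} \<tau> *\<^sub>R k (x + \<tau> *\<^sub>R h))) = indicator {0..1} \<tau> * (LINT x|lborel. norm (k x))" for \<tau> :: real
      using integrable_lborel_translate(2)[OF integrable_norm[OF k], of "\<tau> *\<^sub>R h"] by simp
    show "integrable lborel (\<lambda>\<tau>. LINT x|lborel. norm (case (\<tau>, x) of (\<tau>::real, x) \<Rightarrow> indicator {0..1} \<tau> *\<^sub>R k (x + \<tau> *\<^sub>R h)))"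
      by (simp only: prod.case eq) (auto intro!: integrable_mult_left)
    show "AE \<tau> in lborel. integrable lborel (\<lambda>x. case (\<tau>, x) of (\<tau>::real, x) \<Rightarrow> indicator {0..1} \<tau> *\<^sub>R k (x + \<tau> *\<^sub>R h))"
      using integrable_lborel_translate(1)[OF k] by simp
  qed
qed

lemma test_function_translate:
  assumes t: "test_function (C \<inter> {x. x + h \<in> C}) \<phi>" and C: "convex C" and \<tau>: "0 \<le> \<tau>" "\<tau> \<le> (1::real)"
  shows "test_function C (\<lambda>x. \<phi> (x - \<tau> *\<^sub>R h))"
proof -
  obtain K where K: "compact K" "K \<subseteq> C \<inter> {x. x + h \<in> C}" "\<And>x. x \<notin> K \<Longrightarrow> \<phi> x = 0"
    using t unfolding test_function_def by auto
  have "Ck k (\<lambda>x. \<phi> (x - \<tau> *\<^sub>R h))" for k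
    using t unfolding test_function_def by (blast intro: Ck_translate)
  moreover have "compact ((+) (\<tau> *\<^sub>R h) ` K)"
    using K(1) by (rule compact_translation)
  moreover have "(+) (\<tau> *\<^sub>R h) ` K \<subseteq> C"
  proof
    fix z assume "z \<in> (+) (\<tau> *\<^sub>R h) ` K"
    then obtain x where x: "x \<in> K" "z = \<tau> *\<^sub>R h + x" by blast
    then have "x \<in> C" "x + h \<in> C" using K(2) by auto
    then have "(1 - \<tau>) *\<^sub>R x + \<tau> *\<^sub>R (x + h) \<in> C"
      using C \<tau> by (intro convexD) auto
    then show "z \<in> C" using x(2) by (simp add: algebra_simps)
  qed
  moreover have "\<phi> (x - \<tau> *\<^sub>R h) = 0" if "x \<notin> (+) (\<tau> *\<^sub>R h) ` K" for x
  proof (rule K(3))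
    show "x - \<tau> *\<^sub>R h \<notin> K"
    proof
      assume "x - \<tau> *\<^sub>R h \<in> K"
      then have "\<tau> *\<^sub>R h + (x - \<tau> *\<^sub>R h) \<in> (+) (\<tau> *\<^sub>R h) ` K" by (rule imageI)
      then show False using that by simp
    qed
  qed
  ultimately show ?thesis
    unfolding test_function_def by blast
qed

lemma partial_translate:
  assumes "test_function C \<phi>"
  shows "partial b (\<lambda>x. \<phi> (x - a)) x = partial b \<phi> (x - a)"
proof -
  have "((\<lambda>x. \<phi> (x - a)) has_derivative (\<lambda>h. partial h \<phi> (x - a))) (at x)"
    by (rule has_derivative_compose[of "\<lambda>x. x - a" "\<lambda>h. h" x UNIV \<phi>, OF _ test_function_has_derivative[OF assms]])
       (auto intro!: derivative_eq_intros)
  then show ?thesis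
    by (simp add: partial_def frechet_derivative_eqI)
qed

lemma partial_eq_sum_Basis:
  assumes "test_function C \<phi>"
  shows "partial h \<phi> x = (\<Sum>b\<in>Basis. (h \<bullet> b) * partial b \<phi> x)"
proof -
  have "linear (\<lambda>h. partial h \<phi> x)"
    using test_function_has_derivative[OF assms] has_derivative_linear by blast
  then show ?thesis
    using linear_sum[of "\<lambda>h. partial h \<phi> x" "\<lambda>b. (h \<bullet> b) *\<^sub>R b" Basis]
      linear_scale[of "\<lambda>h. partial h \<phi> x"]
    by (simp add: euclidean_representation)
qed

lemma continuous_on_partial:
  assumes "test_function C \<phi>"
  shows "continuous_on UNIV (partial h \<phi>)"
proof -
  have "partial h \<phi> = (\<lambda>x. \<Sum>b\<in>Basis. (h \<bullet> b) * partial b \<phi> x)"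
    using partial_eq_sum_Basis[OF assms] by blast
  moreover have "continuous_on UNIV (partial b \<phi>)" if "b \<in> Basis" for b
    using test_function_partial[OF assms that] by (rule test_function_imp_continuous)
  ultimately show ?thesis
    by (auto intro!: continuous_intros)
qed

lemma partial_bounded:
  assumes "test_function C \<phi>"
  obtains B where "\<And>x. \<bar>partial h \<phi> x\<bar> \<le> B"
proof -
  have "\<exists>B. \<forall>x. \<bar>partial b \<phi> x\<bar> \<le> B" if "b \<in> Basis" for b
    using test_function_bounded[OF test_function_partial[OF assms that]] by metis
  then obtain B where B: "\<And>b x. b \<in> Basis \<Longrightarrow> \<bar>partial b \<phi> x\<bar> \<le> B b" by metis
  have "\<bar>partial h \<phi> x\<bar> \<le> (\<Sum>b\<in>Basis. \<bar>h \<bullet> b\<bar> * B b)" for x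
  proof -
    have "\<bar>partial h \<phi> x\<bar> \<le> (\<Sum>b\<in>Basis. \<bar>(h \<bullet> b) * partial b \<phi> x\<bar>)"
      unfolding partial_eq_sum_Basis[OF assms, of h] by (rule sum_abs)
    also have "\<dots> \<le> (\<Sum>b\<in>Basis. \<bar>h \<bullet> b\<bar> * B b)"
      by (intro sum_mono) (simp add: abs_mult mult_left_mono B)
    finally show ?thesis .
  qed
  then show thesis by (rule that)
qed

lemma integral_lebesgue_on_eq_lborel:
  fixes f :: "'a::euclidean_space \<Rightarrow> 'b::euclidean_space"
  assumes D: "D \<in> sets lebesgue" and f: "f \<in> borel_measurable borel" and z: "\<And>x. x \<notin> D \<Longrightarrow> f x = 0"
  shows "(LINT x|lebesgue_on D. f x) = (LINT x|lborel. f x)"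
proof -
  have "(LINT x|lebesgue_on D. f x) = (LINT x|lebesgue. (if x \<in> D then f x else 0))"
    by (rule Lebesgue_Measure.integral_restrict_UNIV[OF D, symmetric])
  also have "(\<lambda>x. if x \<in> D then f x else 0) = f"
    using z by auto
  also have "(LINT x|lebesgue. f x) = (LINT x|lborel. f x)"
    using f by (simp add: integral_completion)
  finally show ?thesis .
qed

text \<open>Both sides are integrated against a test function \<open>\<phi>\<close>; averaging the weak derivative
  identity for the translates of \<open>\<phi>\<close> by \<open>\<tau> h\<close>, \<open>0 \<le> \<tau> \<le> 1\<close>, which are supported in \<open>C\<close> by convexity,
  and exchanging the integrals moves the translations over to \<open>W\<close> and \<open>G\<close>.\<close>

lemma weak_gradient_segment:
  fixes W :: "'a::euclidean_space \<Rightarrow> 'b::euclidean_space" and G :: "'a \<Rightarrow> 'a \<Rightarrow> 'b"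
  assumes C: "open C" "convex C" and W: "integrable lborel W"
    and G: "\<And>b. b \<in> Basis \<Longrightarrow> integrable lborel (G b)"
    and wp: "\<And>\<phi> b. test_function C \<phi> \<Longrightarrow> b \<in> Basis \<Longrightarrow>
       (LINT x|lborel. partial b \<phi> x *\<^sub>R W x) = - (LINT x|lborel. \<phi> x *\<^sub>R G b x)"
  shows "AE x in lborel. x \<in> C \<and> x + h \<in> C \<longrightarrow>
    W (x + h) - W x = (LINT \<tau>|lborel. indicator {0..1::real} \<tau> *\<^sub>R (\<Sum>b\<in>Basis. (h \<bullet> b) *\<^sub>R G b (x + \<tau> *\<^sub>R h)))"
proof -
  define Gh where "Gh = (\<lambda>x. \<Sum>b\<in>Basis. (h \<bullet> b) *\<^sub>R G b x)"
  define A where "A = (\<lambda>x. LINT \<tau>|lborel. indicator {0..1::real} \<tau> *\<^sub>R Gh (x + \<tau> *\<^sub>R h))"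
  define O' where "O' = C \<inter> {x. x + h \<in> C}"
  have Gh: "integrable lborel Gh"
    unfolding Gh_def using G by auto
  have [measurable]: "W \<in> borel_measurable borel" "Gh \<in> borel_measurable borel"
    using W Gh borel_measurable_integrable by fastforce+
  have "{x. x + h \<in> C} = (\<lambda>x. x + h) -` C" by auto
  then have "open {x. x + h \<in> C}"
    using C(1) by (auto intro!: continuous_open_vimage continuous_intros)
  then have O': "open O'" unfolding O'_def using C(1) by auto
  note seg = integrable_lborel_segment[OF Gh, of h]
  have A: "integrable lborel A"
    using lborel_pair.integrable_snd[OF seg] by (simp add: A_def)
  have [measurable]: "A \<in> borel_measurable borel"
    using A borel_measurable_integrable by fastforce
  define F where "F = (\<lambda>x. W (x + h) - W x - A x)"
  have F: "integrable lborel F"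
    unfolding F_def using A W integrable_lborel_translate(1)[OF W, of h] by simp
  have Fm [measurable]: "F \<in> borel_measurable borel"
    using F borel_measurable_integrable by fastforce
  have "AE x in lebesgue_on O'. F x = 0"
  proof (rule fundamental_lemma_calculus_of_variations[OF O'])
    show "locally_integrable O' F"
      unfolding locally_integrable_def set_integrable_def
    proof (intro allI impI)
      fix K assume "compact K \<and> K \<subseteq> O'"
      then have "K \<in> sets lebesgue" using lmeasurable_compact fmeasurableD by blast
      then show "integrable lebesgue (\<lambda>x. indicator K x *\<^sub>R F x)"
        using F by (intro integrable_mult_indicator) (simp_all add: integrable_completion)
    qed
    fix \<phi> assume t: "test_function O' \<phi>"
    have [measurable]: "\<phi> \<in> borel_measurable borel" by (rule test_function_measurable[OF t])
    have [measurable]: "partial h \<phi> \<in> borel_measurable borel"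
      using continuous_on_partial[OF t] by (rule borel_measurable_continuous_onI)
    obtain B where B: "\<And>x. \<bar>\<phi> x\<bar> \<le> B" "0 \<le> B" using test_function_bounded[OF t] by metis
    obtain B' where B': "\<And>x. \<bar>partial h \<phi> x\<bar> \<le> B'" using partial_bounded[OF t] by metis
    have mult: "integrable lborel (\<lambda>x. \<phi> (x + a) *\<^sub>R k x)" if k: "integrable lborel k" for k :: "'a \<Rightarrow> 'b" and a
    proof (rule Bochner_Integration.integrable_bound)
      show "integrable lborel (\<lambda>x. B * norm (k x))" using k by simp
      have [measurable]: "k \<in> borel_measurable borel" using k borel_measurable_integrable by fastforce
      show "(\<lambda>x. \<phi> (x + a) *\<^sub>R k x) \<in> borel_measurable lborel" by measurable
    qed (use B in \<open>auto simp: mult_right_mono\<close>)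
    have id: "(LINT x|lborel. partial h \<phi> (x - \<tau> *\<^sub>R h) *\<^sub>R W x) = - (LINT x|lborel. \<phi> (x - \<tau> *\<^sub>R h) *\<^sub>R Gh x)"
      if \<tau>: "0 \<le> \<tau>" "\<tau> \<le> 1" for \<tau>
    proof -
      let ?\<psi> = "\<lambda>x. \<phi> (x - \<tau> *\<^sub>R h)"
      have t': "test_function C ?\<psi>"
        using test_function_translate[OF _ C(2) \<tau>] t unfolding O'_def by blast
      have [measurable]: "?\<psi> \<in> borel_measurable borel" by (rule test_function_measurable[OF t'])
      have i1: "integrable lborel (\<lambda>x. partial b ?\<psi> x *\<^sub>R W x)" if b: "b \<in> Basis" for b
      proof -
        obtain B where B: "\<And>x. \<bar>partial b ?\<psi> x\<bar> \<le> B" using partial_bounded[OF t'] by metis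
        have [measurable]: "partial b ?\<psi> \<in> borel_measurable borel"
          using continuous_on_partial[OF t'] by (rule borel_measurable_continuous_onI)
        show ?thesis
        proof (rule Bochner_Integration.integrable_bound)
          show "integrable lborel (\<lambda>x. B * norm (W x))" using W by simp
          show "AE x in lborel. norm (partial b ?\<psi> x *\<^sub>R W x) \<le> norm (B * norm (W x))"
            using B order_trans[OF abs_ge_zero B] by (auto simp: mult_right_mono abs_mult)
        qed measurable
      qed
      have i2: "integrable lborel (\<lambda>x. ?\<psi> x *\<^sub>R G b x)" if b: "b \<in> Basis" for b
        using mult[OF G[OF b], of "- \<tau> *\<^sub>R h"] by simp
      have "(LINT x|lborel. partial h \<phi> (x - \<tau> *\<^sub>R h) *\<^sub>R W x) = (LINT x|lborel. (\<Sum>b\<in>Basis. (h \<bullet> b) *\<^sub>R (partial b ?\<psi> x *\<^sub>R W x)))"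
        by (simp add: partial_translate[OF t] partial_eq_sum_Basis[OF t, of h] scaleR_sum_left)
      also have "\<dots> = (\<Sum>b\<in>Basis. (h \<bullet> b) *\<^sub>R (LINT x|lborel. partial b ?\<psi> x *\<^sub>R W x))"
        by (subst Bochner_Integration.integral_sum) (auto simp del: scaleR_scaleR intro!: i1)
      also have "\<dots> = (\<Sum>b\<in>Basis. (h \<bullet> b) *\<^sub>R - (LINT x|lborel. ?\<psi> x *\<^sub>R G b x))"
        by (intro sum.cong refl arg_cong[where f = "\<lambda>z. (h \<bullet> _) *\<^sub>R z"] wp t')
      also have "\<dots> = - (\<Sum>b\<in>Basis. (h \<bullet> b) *\<^sub>R (LINT x|lborel. ?\<psi> x *\<^sub>R G b x))"
        by (simp add: sum_negf)
      also have "(\<Sum>b\<in>Basis. (h \<bullet> b) *\<^sub>R (LINT x|lborel. ?\<psi> x *\<^sub>R G b x)) = (LINT x|lborel. (\<Sum>b\<in>Basis. (h \<bullet> b) *\<^sub>R (?\<psi> x *\<^sub>R G b x)))"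
        by (subst Bochner_Integration.integral_sum) (auto simp del: scaleR_scaleR intro!: i2)
      also have "\<dots> = (LINT x|lborel. ?\<psi> x *\<^sub>R Gh x)"
        by (simp add: Gh_def scaleR_sum_right mult.commute)
      finally show ?thesis .
    qed
    \<comment> \<open>In this term the integral over \<open>\<tau>\<close> is evaluated first:
      \<open>partial h \<phi> (x - \<tau> *\<^sub>R h)\<close> is minus the derivative in
      \<open>\<tau>\<close> of \<open>\<phi> (x - \<tau> *\<^sub>R h)\<close>, so only the end
      points remain. A change of variables then moves the translation from \<open>\<phi>\<close> to
      \<open>W\<close>.\<close>
    have W1: "(LINT \<tau>|lborel. indicator {0..1::real} \<tau> *\<^sub>R (LINT x|lborel. partial h \<phi> (x - \<tau> *\<^sub>R h) *\<^sub>R W x))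
        = (LINT x|lborel. \<phi> x *\<^sub>R W x) - (LINT x|lborel. \<phi> x *\<^sub>R W (x + h))"
    proof -
      let ?k = "\<lambda>(\<tau>::real) x. indicator {0..1} \<tau> *\<^sub>R (partial h \<phi> (x - \<tau> *\<^sub>R h) *\<^sub>R W x)"
      have "integrable (lborel \<Otimes>\<^sub>M lborel) (case_prod ?k)"
      proof (rule Bochner_Integration.integrable_bound)
        show "integrable (lborel \<Otimes>\<^sub>M lborel) (\<lambda>z. B' * norm ((\<lambda>(\<tau>::real, x). indicator {0..1} \<tau> *\<^sub>R W (x + \<tau> *\<^sub>R 0)) z))"
          \<comment> \<open>Direction 0 turns the segment lemma into integrability of
            \<open>W\<close> over the product of \<open>{0..1}\<close> with the space.\<close>
          using integrable_lborel_segment[OF W, of 0] by (intro integrable_mult_right integrable_norm)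
        show "AE z in lborel \<Otimes>\<^sub>M lborel. norm (case_prod ?k z) \<le> norm (B' * norm ((\<lambda>(\<tau>::real, x). indicator {0..1} \<tau> *\<^sub>R W (x + \<tau> *\<^sub>R 0)) z))"
          using B' order_trans[OF abs_ge_zero B'] by (auto simp: indicator_def mult_right_mono abs_mult)
        show "case_prod ?k \<in> borel_measurable (lborel \<Otimes>\<^sub>M lborel)" by measurable
      qed
      then have "(LINT \<tau>|lborel. LINT x|lborel. ?k \<tau> x) = (LINT x|lborel. LINT \<tau>|lborel. ?k \<tau> x)"
        by (rule lborel_pair.Fubini_integral[symmetric])
      moreover have "(LINT \<tau>|lborel. ?k \<tau> x) = \<phi> x *\<^sub>R W x - \<phi> (x - h) *\<^sub>R W x" for x
      proof -
        have ftc: "(LINT \<tau>|lborel. indicator {0..1::real} \<tau> *\<^sub>R partial h \<phi> (x - \<tau> *\<^sub>R h)) = - \<phi> (x - 1 *\<^sub>R h) - - \<phi> (x - 0 *\<^sub>R h)"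
        proof (rule integral_FTC_atLeastAtMost)
          show "((\<lambda>\<tau>. - \<phi> (x - \<tau> *\<^sub>R h)) has_vector_derivative partial h \<phi> (x - \<tau> *\<^sub>R h)) (at \<tau> within {0..1})" for \<tau> :: real
          proof -
            have lin: "linear (\<lambda>h. partial h \<phi> y)" for y
              using test_function_has_derivative[OF t] has_derivative_linear by blast
            have "((\<lambda>\<tau>. \<phi> (x - \<tau> *\<^sub>R h)) has_derivative (\<lambda>d. partial (- d *\<^sub>R h) \<phi> (x - \<tau> *\<^sub>R h))) (at \<tau> within {0..1})"
              by (rule has_derivative_compose[of "\<lambda>\<tau>. x - \<tau> *\<^sub>R h" "\<lambda>d. - d *\<^sub>R h" \<tau> _ \<phi>, OF _ test_function_has_derivative[OF t]])
                 (auto intro!: derivative_eq_intros)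
            then have "((\<lambda>\<tau>. - \<phi> (x - \<tau> *\<^sub>R h)) has_derivative (\<lambda>d. - (partial (- d *\<^sub>R h) \<phi> (x - \<tau> *\<^sub>R h)))) (at \<tau> within {0..1})"
              by (rule has_derivative_minus)
            moreover have "- (partial (- d *\<^sub>R h) \<phi> y) = d *\<^sub>R partial h \<phi> y" for d y
              using linear_scale[OF lin, of "- d" h] by simp
            ultimately show ?thesis
              by (simp add: has_vector_derivative_def)
          qed
          show "continuous_on {0..1} (\<lambda>\<tau>. partial h \<phi> (x - \<tau> *\<^sub>R h))"
            by (intro continuous_on_compose2[OF continuous_on_partial[OF t, of h]] continuous_intros) auto
        qed simp
        have fac: "(LINT \<tau>|lborel. ?k \<tau> x) = (LINT \<tau>|lborel. indicator {0..1::real} \<tau> *\<^sub>R partial h \<phi> (x - \<tau> *\<^sub>R h)) *\<^sub>R W x"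
        proof -
          have "integrable lborel (\<lambda>\<tau>. indicator {0..1::real} \<tau> *\<^sub>R partial h \<phi> (x - \<tau> *\<^sub>R h))"
            by (intro borel_integrable_compact continuous_on_compose2[OF continuous_on_partial[OF t, of h]] continuous_intros) auto
          then show ?thesis
            by (subst integral_scaleR_left[symmetric]) simp_all
        qed
        show ?thesis
          unfolding fac ftc by (simp add: scaleR_diff_left)
      qed
      moreover have "(LINT x|lborel. \<phi> (x - h) *\<^sub>R W x) = (LINT x|lborel. \<phi> x *\<^sub>R W (x + h))"
        using integrable_lborel_translate(2)[of "\<lambda>x. \<phi> (x - h) *\<^sub>R W x" h] mult[OF W, of "- h"] by simp
      moreover have "(LINT x|lborel. \<phi> x *\<^sub>R W x - \<phi> (x - h) *\<^sub>R W x) = (LINT x|lborel. \<phi> x *\<^sub>R W x) - (LINT x|lborel. \<phi> (x - h) *\<^sub>R W x)"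
        using mult[OF W, of "- h"] mult[OF W, of 0] by (intro Bochner_Integration.integral_diff) simp_all
      ultimately show ?thesis by (simp del: scaleR_scaleR)
    qed
    \<comment> \<open>Here, for fixed \<open>\<tau>\<close>, the translation is moved from
      \<open>\<phi>\<close> to \<open>Gh\<close>, and the exchange of integrals produces the segment
      average \<open>A\<close>.\<close>
    have G1: "(LINT \<tau>|lborel. indicator {0..1::real} \<tau> *\<^sub>R (LINT x|lborel. \<phi> (x - \<tau> *\<^sub>R h) *\<^sub>R Gh x))
        = (LINT x|lborel. \<phi> x *\<^sub>R A x)"
    proof -
      let ?k = "\<lambda>(\<tau>::real) x. \<phi> x *\<^sub>R (indicator {0..1} \<tau> *\<^sub>R Gh (x + \<tau> *\<^sub>R h))"
      have "integrable (lborel \<Otimes>\<^sub>M lborel) (case_prod ?k)"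
      proof (rule Bochner_Integration.integrable_bound)
        show "integrable (lborel \<Otimes>\<^sub>M lborel) (\<lambda>z. B * norm ((\<lambda>(\<tau>::real, x). indicator {0..1} \<tau> *\<^sub>R Gh (x + \<tau> *\<^sub>R h)) z))"
          using seg by (intro integrable_mult_right integrable_norm)
        show "AE z in lborel \<Otimes>\<^sub>M lborel. norm (case_prod ?k z) \<le> norm (B * norm ((\<lambda>(\<tau>::real, x). indicator {0..1} \<tau> *\<^sub>R Gh (x + \<tau> *\<^sub>R h)) z))"
          using B by (auto simp: indicator_def mult_right_mono abs_mult)
        show "case_prod ?k \<in> borel_measurable (lborel \<Otimes>\<^sub>M lborel)" by measurable
      qed
      then have "(LINT \<tau>|lborel. LINT x|lborel. ?k \<tau> x) = (LINT x|lborel. LINT \<tau>|lborel. ?k \<tau> x)"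
        by (rule lborel_pair.Fubini_integral[symmetric])
      also have "\<dots> = (LINT x|lborel. \<phi> x *\<^sub>R A x)"
        by (simp add: A_def del: scaleR_scaleR)
      also have "(LINT \<tau>|lborel. LINT x|lborel. ?k \<tau> x) = (LINT \<tau>|lborel. indicator {0..1::real} \<tau> *\<^sub>R (LINT x|lborel. \<phi> (x - \<tau> *\<^sub>R h) *\<^sub>R Gh x))"
      proof (rule Bochner_Integration.integral_cong[OF refl])
        fix \<tau> :: real
        have "(LINT x|lborel. \<phi> (x - \<tau> *\<^sub>R h) *\<^sub>R Gh x) = (LINT x|lborel. \<phi> x *\<^sub>R Gh (x + \<tau> *\<^sub>R h))"
          using integrable_lborel_translate(2)[of "\<lambda>x. \<phi> (x - \<tau> *\<^sub>R h) *\<^sub>R Gh x" "\<tau> *\<^sub>R h"] mult[OF Gh, of "- \<tau> *\<^sub>R h"] by simp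
        then show "(LINT x|lborel. ?k \<tau> x) = indicator {0..1::real} \<tau> *\<^sub>R (LINT x|lborel. \<phi> (x - \<tau> *\<^sub>R h) *\<^sub>R Gh x)"
          by (simp add: scaleR_left_commute[of "\<phi> _"] del: scaleR_scaleR)
      qed
      finally show ?thesis .
    qed
    have "(LINT \<tau>|lborel. indicator {0..1::real} \<tau> *\<^sub>R (LINT x|lborel. partial h \<phi> (x - \<tau> *\<^sub>R h) *\<^sub>R W x))
      = (LINT \<tau>|lborel. - (indicator {0..1::real} \<tau> *\<^sub>R (LINT x|lborel. \<phi> (x - \<tau> *\<^sub>R h) *\<^sub>R Gh x)))"
      by (intro Bochner_Integration.integral_cong refl) (auto simp: indicator_def id)
    then have "(LINT x|lborel. \<phi> x *\<^sub>R W x) - (LINT x|lborel. \<phi> x *\<^sub>R W (x + h)) = - (LINT x|lborel. \<phi> x *\<^sub>R A x)"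
      by (simp add: W1 G1)
    moreover have "(LINT x|lborel. \<phi> x *\<^sub>R F x) =
       (LINT x|lborel. \<phi> x *\<^sub>R W (x + h)) - (LINT x|lborel. \<phi> x *\<^sub>R W x) - (LINT x|lborel. \<phi> x *\<^sub>R A x)"
      using mult[OF W, of 0] mult[OF A, of 0] mult[OF integrable_lborel_translate(1)[OF W, of h], of 0]
      by (simp add: F_def scaleR_diff_right)
    ultimately have "(LINT x|lborel. \<phi> x *\<^sub>R F x) = 0"
      by (simp add: algebra_simps)
    then show "(LINT x|lebesgue_on O'. \<phi> x *\<^sub>R F x) = 0"
      using O' test_function_zero_outside[OF t] by (subst integral_lebesgue_on_eq_lborel) (auto simp: borel_open)
  qed
  then have "AE x in lebesgue. x \<in> O' \<longrightarrow> F x = 0"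
    using O' by (simp add: AE_lebesgue_on_iff borel_open)
  then have "AE x in lborel. x \<in> O' \<longrightarrow> F x = 0"
    by (simp add: AE_completion_iff)
  then show ?thesis
    by eventually_elim (simp add: O'_def F_def A_def Gh_def)
qed

text \<open>Translations and exchanges of integrals are carried out on \<open>lborel\<close>, where
  a Lebesgue measurable function must first be replaced by a Borel one; the real-valued case is
  applied to the coordinates.\<close>

lemma borel_representative:
  fixes f :: "'a::euclidean_space \<Rightarrow> 'b::euclidean_space"
  assumes "f \<in> borel_measurable lebesgue"
  obtains g where "g \<in> borel_measurable borel" "AE x in lebesgue. f x = g x"
proof -
  have "\<exists>g\<in>borel_measurable borel. AE x in lborel. f x \<bullet> b = g x" for b
    using completion_ex_borel_measurable_real[of "\<lambda>x. f x \<bullet> b" lborel] assms by auto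
  then obtain g where g: "\<And>b. g b \<in> borel_measurable borel" "\<And>b. AE x in lborel. f x \<bullet> b = g b x" by metis
  show thesis
  proof
    show "(\<lambda>x. \<Sum>b\<in>Basis. g b x *\<^sub>R b) \<in> borel_measurable borel"
      using g(1) by measurable
    have "AE x in lebesgue. \<forall>b\<in>Basis. f x \<bullet> b = g b x"
      using g(2) by (intro AE_finite_allI AE_completion) auto
    then show "AE x in lebesgue. f x = (\<Sum>b\<in>Basis. g b x *\<^sub>R b)"
    proof eventually_elim
      case (elim x)
      then have "(\<Sum>b\<in>Basis. g b x *\<^sub>R b) = (\<Sum>b\<in>Basis. (f x \<bullet> b) *\<^sub>R b)" by simp
      then show ?case by (simp only: euclidean_representation)
    qed
  qed
qed

section \<open>Restriction to subdomains, and Nikolskii bounds from Slobodeckij and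
  \<open>H1\<close> regularity\<close>

lemma nn_integral_lebesgue_on:
  "C \<in> sets lebesgue \<Longrightarrow> (\<integral>\<^sup>+x. f x \<partial>lebesgue_on C) = (\<integral>\<^sup>+x. f x * indicator C x \<partial>lebesgue)"
  by (subst nn_integral_restrict_space) simp_all

lemma nn_integral_lebesgue_on_subset:
  assumes "C \<subseteq> D" "C \<in> sets lebesgue" "D \<in> sets lebesgue"
  shows "(\<integral>\<^sup>+x. f x \<partial>lebesgue_on C) \<le> (\<integral>\<^sup>+x. f x \<partial>lebesgue_on D)"
  using assms by (auto simp: nn_integral_lebesgue_on indicator_def intro!: nn_integral_mono)

lemma measurable_lebesgue_on_subset:
  "C \<subseteq> D \<Longrightarrow> f \<in> borel_measurable (lebesgue_on D) \<Longrightarrow> f \<in> borel_measurable (lebesgue_on C)"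
  using measurable_restrict_mono by blast

lemma L2_subset:
  fixes f :: "'a::euclidean_space \<Rightarrow> 'b::euclidean_space"
  assumes C: "C \<subseteq> D" "C \<in> sets lebesgue" "D \<in> sets lebesgue" and f: "f \<in> elems (L2 D)"
  shows "f \<in> elems (L2 C)" "nrm (L2 C) f \<le> nrm (L2 D) f"
proof -
  have fC [measurable]: "f \<in> borel_measurable (lebesgue_on C)"
    using f C(1) measurable_lebesgue_on_subset by (auto simp: L2_iff)
  have le: "(\<integral>\<^sup>+x. ennreal ((norm (f x))\<^sup>2) \<partial>lebesgue_on C) \<le> ennreal ((nrm (L2 D) f)\<^sup>2)"
    using nn_integral_lebesgue_on_subset[OF C, of "\<lambda>x. ennreal ((norm (f x))\<^sup>2)"] f
      nn_integral_eq_integral[of "lebesgue_on D" "\<lambda>x. (norm (f x))\<^sup>2"]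
    by (simp add: L2_iff nrm_L2_power2)
  show fL2: "f \<in> elems (L2 C)"
    unfolding L2_iff integrable_iff_bounded using le by (auto intro: le_less_trans)
  then have "ennreal ((nrm (L2 C) f)\<^sup>2) \<le> ennreal ((nrm (L2 D) f)\<^sup>2)"
    using le nn_integral_eq_integral[of "lebesgue_on C" "\<lambda>x. (norm (f x))\<^sup>2"]
    by (simp add: L2_iff nrm_L2_power2)
  then have "(nrm (L2 C) f)\<^sup>2 \<le> (nrm (L2 D) f)\<^sup>2"
    by (subst (asm) ennreal_le_iff) simp_all
  then show "nrm (L2 C) f \<le> nrm (L2 D) f"
    by (rule power2_le_imp_le) simp
qed

lemma L2_imp_integrable:
  fixes f :: "'a::euclidean_space \<Rightarrow> 'b::euclidean_space"
  assumes D: "D \<in> lmeasurable" and f: "f \<in> elems (L2 D)"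
  shows "integrable (lebesgue_on D) f"
proof (rule Bochner_Integration.integrable_bound)
  interpret finite_measure "lebesgue_on D" using D by (rule finite_measure_lebesgue_on)
  show "integrable (lebesgue_on D) (\<lambda>x. 1 + (norm (f x))\<^sup>2)"
    using f by (auto simp: L2_iff)
  have "a \<le> 1 + a\<^sup>2" for a :: real
    using zero_le_power2[of "a - 1 / 2"] by (simp add: power2_eq_square algebra_simps)
  then show "AE x in lebesgue_on D. norm (f x) \<le> norm (1 + (norm (f x))\<^sup>2)" by simp
qed (use f in \<open>auto simp: L2_iff\<close>)

lemma sigma_finite_lebesgue_on: "D \<in> lmeasurable \<Longrightarrow> sigma_finite_measure (lebesgue_on D)"
  using finite_measure_lebesgue_on finite_measure_def by blast

text \<open>For \<open>y\<close> in \<open>ball x r\<close> the Gagliardo denominator is at most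
  \<open>r powr (d + 2 * \<alpha>)\<close>, so inserting the kernel costs just this factor; as
  \<open>r \<le> 1\<close>, lowering the exponent to \<open>d + 2 * s\<close> only enlarges it. On
  the diagonal, where the quotient degenerates, the numerator is 0.\<close>

lemma Hs_nikolskii:
  fixes f :: "'a::euclidean_space \<Rightarrow> 'b::euclidean_space"
  assumes D: "D \<in> lmeasurable" and C: "C \<subseteq> D" "C \<in> sets lebesgue"
    and \<alpha>: "\<alpha> \<noteq> 1" "0 \<le> \<alpha>" "s \<le> \<alpha>" and f: "f \<in> elems (Hs D \<alpha>)"
  shows "nikolskii C s (nrm (Hs D \<alpha>) f) f"
proof -
  let ?M = "lebesgue_on D" and ?g = "gagliardo_integrand \<alpha> f" and ?N = "nrm (Hs D \<alpha>) f"
  interpret sigma_finite_measure ?M using D by (rule sigma_finite_lebesgue_on)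
  have Ds: "D \<in> sets lebesgue" using D by (rule fmeasurableD)
  have fL2: "f \<in> elems (L2 D)" and int: "integrable (?M \<Otimes>\<^sub>M ?M) ?g"
    using f \<alpha>(1) by (auto simp: Hs_def)
  have g0: "0 \<le> ?g z" for z by (auto simp: gagliardo_integrand_def split: prod.split)
  have N2: "?N\<^sup>2 = (nrm (L2 D) f)\<^sup>2 + (LINT z|(?M \<Otimes>\<^sub>M ?M). ?g z)"
    using \<alpha>(1) g0 by (simp add: Hs_def integral_nonneg_AE)
  have N0: "0 \<le> ?N" using \<alpha>(1) g0 by (simp add: Hs_def integral_nonneg_AE)
  have "nrm (L2 D) f \<le> ?N"
    by (rule power2_le_imp_le) (use N2 N0 g0 in \<open>auto intro!: integral_nonneg_AE\<close>)
  moreover have "(\<integral>\<^sup>+x. \<integral>\<^sup>+y. ennreal ((norm (f x - f y))\<^sup>2) * indicator (ball x r) y \<partial>lebesgue_on C \<partial>lebesgue_on C)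
      \<le> ennreal (?N\<^sup>2 * r powr (real DIM('a) + 2 * s))" if r: "0 < r" "r \<le> 1" for r
  proof -
    let ?q = "r powr (real DIM('a) + 2 * \<alpha>)"
    have "(\<integral>\<^sup>+x. \<integral>\<^sup>+y. ennreal ((norm (f x - f y))\<^sup>2) * indicator (ball x r) y \<partial>lebesgue_on C \<partial>lebesgue_on C)
      \<le> (\<integral>\<^sup>+x. \<integral>\<^sup>+y. ennreal ((norm (f x - f y))\<^sup>2) * indicator (ball x r) y \<partial>?M \<partial>lebesgue_on C)"
      by (intro nn_integral_mono nn_integral_lebesgue_on_subset C Ds)
    also have "\<dots> \<le> (\<integral>\<^sup>+x. \<integral>\<^sup>+y. ennreal ((norm (f x - f y))\<^sup>2) * indicator (ball x r) y \<partial>?M \<partial>?M)"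
      by (intro nn_integral_lebesgue_on_subset C Ds)
    also have "\<dots> \<le> (\<integral>\<^sup>+x. \<integral>\<^sup>+y. ennreal ?q * ennreal (?g (x, y)) \<partial>?M \<partial>?M)"
    proof (intro nn_integral_mono)
      fix x y
      show "ennreal ((norm (f x - f y))\<^sup>2) * indicator (ball x r) y \<le> ennreal ?q * ennreal (?g (x, y))"
      proof (cases "y \<in> ball x r \<and> x \<noteq> y")
        case True
        let ?t = "norm (x - y) powr (real DIM('a) + 2 * \<alpha>)"
        have t: "0 < ?t" "?t \<le> ?q"
          using True \<alpha>(2) by (auto simp: dist_norm intro!: powr_mono2)
        have "(norm (f x - f y))\<^sup>2 = ?t * ((norm (f x - f y))\<^sup>2 / ?t)"
          using t by simp
        also have "\<dots> \<le> ?q * ((norm (f x - f y))\<^sup>2 / ?t)"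
          using t by (intro mult_right_mono) auto
        finally show ?thesis
          using True by (simp add: ennreal_mult[symmetric] gagliardo_integrand_def ennreal_leI)
      qed auto
    qed
    also have "\<dots> = ennreal ?q * (\<integral>\<^sup>+x. \<integral>\<^sup>+y. ennreal (?g (x, y)) \<partial>?M \<partial>?M)"
      using r by (simp add: nn_integral_cmult_pos)
    also have "(\<integral>\<^sup>+x. \<integral>\<^sup>+y. ennreal (?g (x, y)) \<partial>?M \<partial>?M) = (\<integral>\<^sup>+z. ennreal (?g z) \<partial>(?M \<Otimes>\<^sub>M ?M))"
      using borel_measurable_integrable[OF int] by (intro nn_integral_fst) measurable
    also have "\<dots> = ennreal (LINT z|(?M \<Otimes>\<^sub>M ?M). ?g z)"
      using int g0 by (intro nn_integral_eq_integral) auto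
    also have "ennreal ?q * \<dots> \<le> ennreal ?q * ennreal (?N\<^sup>2)"
      by (intro mult_left_mono ennreal_leI) (auto simp: N2)
    also have "\<dots> \<le> ennreal (?N\<^sup>2 * r powr (real DIM('a) + 2 * s))"
      using \<alpha>(3) r powr_mono'[of "real DIM('a) + 2 * s" "real DIM('a) + 2 * \<alpha>" r]
      by (auto simp: ennreal_mult[symmetric] mult.commute intro!: ennreal_leI mult_left_mono)
    finally show ?thesis .
  qed
  ultimately show ?thesis
    using L2_subset[OF C Ds fL2] unfolding nikolskii_def by auto
qed

text \<open>Cauchy-Schwarz on an interval of length one. If the integrand is not integrable, the
  left side is 0 by the convention for the Bochner integral.\<close>

lemma norm_integral_segment_le:
  fixes k :: "real \<Rightarrow> 'b::euclidean_space"
  assumes [measurable]: "k \<in> borel_measurable borel"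
  shows "ennreal ((norm (LINT \<tau>|lborel. indicator {0..1} \<tau> *\<^sub>R k \<tau>))\<^sup>2) \<le> (\<integral>\<^sup>+\<tau>. indicator {0..1} \<tau> * ennreal ((norm (k \<tau>))\<^sup>2) \<partial>lborel)"
proof (cases "integrable lborel (\<lambda>\<tau>. indicator {0..1} \<tau> *\<^sub>R k \<tau>)")
  case True
  have "ennreal (norm (LINT \<tau>|lborel. indicator {0..1} \<tau> *\<^sub>R k \<tau>)) \<le> (\<integral>\<^sup>+\<tau>. ennreal (norm (indicator {0..1} \<tau> *\<^sub>R k \<tau>)) \<partial>lborel)"
    by (rule integral_norm_bound_ennreal[OF True])
  also have "\<dots> = (\<integral>\<^sup>+\<tau>. indicator {0..1} \<tau> * (indicator {0..1} \<tau> * ennreal (norm (k \<tau>))) \<partial>lborel)"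
    by (intro nn_integral_cong) (auto split: split_indicator)
  finally have "(ennreal (norm (LINT \<tau>|lborel. indicator {0..1} \<tau> *\<^sub>R k \<tau>)))\<^sup>2
      \<le> (\<integral>\<^sup>+\<tau>. indicator {0..1} \<tau> * (indicator {0..1} \<tau> * ennreal (norm (k \<tau>))) \<partial>lborel)\<^sup>2"
    by (intro power_mono) auto
  also have "\<dots> \<le> (\<integral>\<^sup>+\<tau>. (indicator {0..1} \<tau>)\<^sup>2 \<partial>(lborel::real measure)) * (\<integral>\<^sup>+\<tau>. (indicator {0..1} \<tau> * ennreal (norm (k \<tau>)))\<^sup>2 \<partial>lborel)"
    by (intro Cauchy_Schwarz_nn_integral) measurable
  also have "(\<integral>\<^sup>+\<tau>. (indicator {0..1} \<tau>)\<^sup>2 \<partial>(lborel::real measure)) = (\<integral>\<^sup>+\<tau>. indicator {0..1} \<tau> \<partial>(lborel::real measure))"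
    by (intro nn_integral_cong) (auto split: split_indicator)
  also have "\<dots> = 1" by simp
  also have "(\<integral>\<^sup>+\<tau>. (indicator {0..1} \<tau> * ennreal (norm (k \<tau>)))\<^sup>2 \<partial>lborel) = (\<integral>\<^sup>+\<tau>. indicator {0..1} \<tau> * ennreal ((norm (k \<tau>))\<^sup>2) \<partial>lborel)"
    by (intro nn_integral_cong) (auto split: split_indicator simp: ennreal_power)
  finally show ?thesis by (simp add: ennreal_power)
qed (simp add: not_integrable_integral_eq)

lemma norm_sum_Basis_le:
  fixes h :: "'a::euclidean_space" and g :: "'a \<Rightarrow> 'b::real_normed_vector"
  shows "(norm (\<Sum>b\<in>Basis. (h \<bullet> b) *\<^sub>R g b))\<^sup>2 \<le> (norm h)\<^sup>2 * (\<Sum>b\<in>Basis. (norm (g b))\<^sup>2)"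
proof -
  have "norm (\<Sum>b\<in>Basis. (h \<bullet> b) *\<^sub>R g b) \<le> (\<Sum>b\<in>Basis. \<bar>h \<bullet> b\<bar> * norm (g b))"
    by (rule order_trans[OF norm_sum]) simp
  then have "(norm (\<Sum>b\<in>Basis. (h \<bullet> b) *\<^sub>R g b))\<^sup>2 \<le> (\<Sum>b\<in>Basis. \<bar>h \<bullet> b\<bar> * norm (g b))\<^sup>2"
    by (rule power_mono) simp
  also have "\<dots> \<le> (\<Sum>b\<in>Basis. \<bar>h \<bullet> b\<bar>\<^sup>2) * (\<Sum>b\<in>Basis. (norm (g b))\<^sup>2)"
    by (rule Cauchy_Schwarz_ineq_sum)
  also have "(\<Sum>b\<in>Basis. \<bar>h \<bullet> b\<bar>\<^sup>2) = (norm h)\<^sup>2"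
    unfolding power2_norm_eq_inner by (subst euclidean_inner[of h h]) (simp add: power2_eq_square)
  finally show ?thesis .
qed

text \<open>With y = x + h and the integral over x taken first, each increment h contributes at most
  |h|^2 times the squared gradient norm on \<open>C\<close>. The bound |h| < r and the volume of the
  ball of increments give the power r^(d + 2).\<close>

lemma weak_gradient_oscillation:
  fixes W :: "'a::euclidean_space \<Rightarrow> 'b::euclidean_space" and G :: "'a \<Rightarrow> 'a \<Rightarrow> 'b"
  assumes C: "open C" "convex C" and W: "integrable lborel W"
    and G: "\<And>b. b \<in> Basis \<Longrightarrow> integrable lborel (G b)"
    and wp: "\<And>\<phi> b. test_function C \<phi> \<Longrightarrow> b \<in> Basis \<Longrightarrow>
       (LINT x|lborel. partial b \<phi> x *\<^sub>R W x) = - (LINT x|lborel. \<phi> x *\<^sub>R G b x)"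
    and r: "0 < r"
  shows "(\<integral>\<^sup>+x. indicator C x * (\<integral>\<^sup>+y. indicator C y * (ennreal ((norm (W x - W y))\<^sup>2) * indicator (ball x r) y) \<partial>lborel) \<partial>lborel)
    \<le> ennreal (unit_ball_vol DIM('a) * r ^ (DIM('a) + 2)) * (\<integral>\<^sup>+x. indicator C x * ennreal (\<Sum>b\<in>Basis. (norm (G b x))\<^sup>2) \<partial>lborel)"
proof -
  define S where "S = (\<lambda>x. indicator C x * ennreal (\<Sum>b\<in>Basis. (norm (G b x))\<^sup>2))"
  have [measurable]: "W \<in> borel_measurable borel" and Gm [measurable]: "\<And>b. b \<in> Basis \<Longrightarrow> G b \<in> borel_measurable borel"
    using W G borel_measurable_integrable by fastforce+
  have [measurable]: "C \<in> sets borel" "ball (0::'a) r \<in> sets borel" using C(1) by simp_all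
  have [measurable]: "S \<in> borel_measurable borel" unfolding S_def by measurable
  have gm [measurable]: "(\<lambda>x. \<Sum>b\<in>Basis. (h \<bullet> b) *\<^sub>R G b x) \<in> borel_measurable borel" for h by measurable
  have h: "(\<integral>\<^sup>+x. indicator C x * (indicator C (x + h) * ennreal ((norm (W x - W (x + h)))\<^sup>2)) \<partial>lborel)
     \<le> ennreal ((norm h)\<^sup>2) * (\<integral>\<^sup>+x. S x \<partial>lborel)" for h
  proof -
    let ?k = "\<lambda>x (\<tau>::real). (\<Sum>b\<in>Basis. (h \<bullet> b) *\<^sub>R G b (x + \<tau> *\<^sub>R h))"
    have "(\<integral>\<^sup>+x. indicator C x * (indicator C (x + h) * ennreal ((norm (W x - W (x + h)))\<^sup>2)) \<partial>lborel)
      \<le> (\<integral>\<^sup>+x. (\<integral>\<^sup>+\<tau>. indicator {0..1} \<tau> * (ennreal ((norm h)\<^sup>2) * S (x + \<tau> *\<^sub>R h)) \<partial>(lborel::real measure)) \<partial>lborel)"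
    proof (rule nn_integral_mono_AE)
      have "AE x in lborel. x \<in> C \<and> x + h \<in> C \<longrightarrow> W (x + h) - W x = (LINT \<tau>|lborel. indicator {0..1::real} \<tau> *\<^sub>R ?k x \<tau>)"
        by (rule weak_gradient_segment[OF C W G wp])
      then show "AE x in lborel. indicator C x * (indicator C (x + h) * ennreal ((norm (W x - W (x + h)))\<^sup>2))
        \<le> (\<integral>\<^sup>+\<tau>. indicator {0..1} \<tau> * (ennreal ((norm h)\<^sup>2) * S (x + \<tau> *\<^sub>R h)) \<partial>(lborel::real measure))"
      proof eventually_elim
        case (elim x)
        show ?case
        proof (cases "x \<in> C \<and> x + h \<in> C")
          case True
          then have e: "norm (W x - W (x + h)) = norm (LINT \<tau>|lborel. indicator {0..1::real} \<tau> *\<^sub>R ?k x \<tau>)"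
          proof -
            have "W (x + h) - W x = (LINT \<tau>|lborel. indicator {0..1::real} \<tau> *\<^sub>R ?k x \<tau>)"
              using elim True by (rule mp)
            then show ?thesis
              by (subst norm_minus_commute) (simp only:)
          qed
          have "ennreal ((norm (W x - W (x + h)))\<^sup>2) \<le> (\<integral>\<^sup>+\<tau>. indicator {0..1} \<tau> * ennreal ((norm (?k x \<tau>))\<^sup>2) \<partial>(lborel::real measure))"
            unfolding e by (rule norm_integral_segment_le) measurable
          also have "\<dots> \<le> (\<integral>\<^sup>+\<tau>. indicator {0..1} \<tau> * (ennreal ((norm h)\<^sup>2) * S (x + \<tau> *\<^sub>R h)) \<partial>(lborel::real measure))"
          proof (intro nn_integral_mono)
            fix \<tau> :: real
            show "indicator {0..1} \<tau> * ennreal ((norm (?k x \<tau>))\<^sup>2) \<le> indicator {0..1} \<tau> * (ennreal ((norm h)\<^sup>2) * S (x + \<tau> *\<^sub>R h))"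
            proof (cases "0 \<le> \<tau> \<and> \<tau> \<le> 1")
              case \<tau>: True
              \<comment> \<open>By convexity the whole segment lies in \<open>C\<close>, so the
                cut-off by \<open>C\<close> built into \<open>S\<close> loses nothing.\<close>
              have "(1 - \<tau>) *\<^sub>R x + \<tau> *\<^sub>R (x + h) \<in> C"
                using C(2) True \<tau> by (intro convexD) auto
              then have "x + \<tau> *\<^sub>R h \<in> C" by (simp add: algebra_simps)
              then show ?thesis
                using norm_sum_Basis_le[of h "\<lambda>b. G b (x + \<tau> *\<^sub>R h)"] \<tau>
                by (simp add: S_def ennreal_mult[symmetric] sum_nonneg ennreal_leI)
            qed (auto simp: indicator_def)
          qed
          finally show ?thesis using True by simp
        qed auto
      qed
    qed
    also have "\<dots> = (\<integral>\<^sup>+\<tau>. (\<integral>\<^sup>+x. indicator {0..1} \<tau> * (ennreal ((norm h)\<^sup>2) * S (x + \<tau> *\<^sub>R h)) \<partial>lborel) \<partial>(lborel::real measure))"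
      by (rule lborel_pair.Fubini') measurable
    also have "\<dots> = (\<integral>\<^sup>+\<tau>. indicator {0..1} \<tau> * (ennreal ((norm h)\<^sup>2) * (\<integral>\<^sup>+x. S x \<partial>lborel)) \<partial>(lborel::real measure))"
      by (intro nn_integral_cong) (simp add: nn_integral_cmult nn_integral_lborel_translate)
    also have "\<dots> = ennreal ((norm h)\<^sup>2) * (\<integral>\<^sup>+x. S x \<partial>lborel)"
      by (simp add: nn_integral_multc)
    finally show ?thesis .
  qed
  have "(\<integral>\<^sup>+x. indicator C x * (\<integral>\<^sup>+y. indicator C y * (ennreal ((norm (W x - W y))\<^sup>2) * indicator (ball x r) y) \<partial>lborel) \<partial>lborel)
    = (\<integral>\<^sup>+x. \<integral>\<^sup>+h. indicator C x * (indicator C (x + h) * (ennreal ((norm (W x - W (x + h)))\<^sup>2) * indicator (ball 0 r) h)) \<partial>lborel \<partial>lborel)"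
  proof (intro nn_integral_cong)
    fix x :: 'a
    have [measurable]: "ball x r \<in> sets borel" by simp
    have "(\<integral>\<^sup>+y. indicator C y * (ennreal ((norm (W x - W y))\<^sup>2) * indicator (ball x r) y) \<partial>lborel)
       = (\<integral>\<^sup>+h. indicator C (h + x) * (ennreal ((norm (W x - W (h + x)))\<^sup>2) * indicator (ball x r) (h + x)) \<partial>lborel)"
      by (rule nn_integral_lborel_translate[symmetric]) measurable
    also have "\<dots> = (\<integral>\<^sup>+h. (indicator C (x + h) * (ennreal ((norm (W x - W (x + h)))\<^sup>2) * indicator (ball 0 r) h)) \<partial>lborel)"
      by (intro nn_integral_cong) (auto simp: add.commute dist_norm split: split_indicator)
    finally show "indicator C x * (\<integral>\<^sup>+y. indicator C y * (ennreal ((norm (W x - W y))\<^sup>2) * indicator (ball x r) y) \<partial>lborel)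
       = (\<integral>\<^sup>+h. indicator C x * (indicator C (x + h) * (ennreal ((norm (W x - W (x + h)))\<^sup>2) * indicator (ball 0 r) h)) \<partial>lborel)"
      by (cases "x \<in> C") simp_all
  qed
  also have "\<dots> = (\<integral>\<^sup>+h. \<integral>\<^sup>+x. indicator C x * (indicator C (x + h) * (ennreal ((norm (W x - W (x + h)))\<^sup>2) * indicator (ball 0 r) h)) \<partial>lborel \<partial>lborel)"
    by (rule lborel_pair.Fubini') measurable
  also have "\<dots> \<le> (\<integral>\<^sup>+h. (ennreal (r\<^sup>2) * (\<integral>\<^sup>+x. S x \<partial>lborel)) * indicator (ball (0::'a) r) h \<partial>lborel)"
  proof (intro nn_integral_mono)
    fix h :: 'a
    show "(\<integral>\<^sup>+x. indicator C x * (indicator C (x + h) * (ennreal ((norm (W x - W (x + h)))\<^sup>2) * indicator (ball 0 r) h)) \<partial>lborel)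
      \<le> (ennreal (r\<^sup>2) * (\<integral>\<^sup>+x. S x \<partial>lborel)) * indicator (ball 0 r) h"
    proof (cases "h \<in> ball 0 r")
      case True
      then have "(norm h)\<^sup>2 \<le> r\<^sup>2" by (intro power_mono) auto
      then have "ennreal ((norm h)\<^sup>2) * (\<integral>\<^sup>+x. S x \<partial>lborel) \<le> ennreal (r\<^sup>2) * (\<integral>\<^sup>+x. S x \<partial>lborel)"
        by (intro mult_right_mono ennreal_leI) auto
      then show ?thesis using True h[of h] by (simp del: mem_ball)
    qed simp
  qed
  also have "\<dots> = ennreal (r\<^sup>2) * (\<integral>\<^sup>+x. S x \<partial>lborel) * emeasure lborel (ball (0::'a) r)"
    by (simp add: nn_integral_cmult_indicator)
  also have "\<dots> = ennreal (unit_ball_vol DIM('a) * r ^ (DIM('a) + 2)) * (\<integral>\<^sup>+x. S x \<partial>lborel)"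
    using r by (simp add: emeasure_ball ennreal_mult[symmetric] power_add mult_ac power2_eq_square)
  finally show ?thesis unfolding S_def .
qed

text \<open>The function and its gradient are extended by zero and replaced by Borel
  representatives. The extension need not have a weak gradient across the boundary, but the identity
  is tested with test functions of \<open>C\<close> only. Under the root, 1 accounts for the
  \<open>L2\<close> norm and the ball volume for the oscillation.\<close>

lemma H1_nikolskii:
  fixes w :: "'a::euclidean_space \<Rightarrow> 'b::euclidean_space"
  assumes D: "open D" "bounded D" and C: "C \<subseteq> D" "open C" "convex C"
    and s: "s \<le> 1" and w: "w \<in> elems (H1 D)"
  shows "nikolskii C s (sqrt (1 + unit_ball_vol DIM('a)) * nrm (H1 D) w) w"
proof -
  let ?V = "unit_ball_vol (real DIM('a))"
  have Dlm: "D \<in> lmeasurable" using D by (simp add: lmeasurable_open)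
  have Ds: "D \<in> sets lebesgue" using Dlm by (rule fmeasurableD)
  have Cs: "C \<in> sets lebesgue" using C by (simp add: borel_open)
  have V0: "0 \<le> ?V" by simp
  define ext where "ext = (\<lambda>(f::'a \<Rightarrow> 'b) x. if x \<in> D then f x else 0)"
  have rep: "\<exists>g. integrable lborel g \<and> (AE x in lebesgue. ext f x = g x)" if f: "f \<in> elems (L2 D)" for f
  proof -
    have i: "integrable lebesgue (ext f)"
      using L2_imp_integrable[OF Dlm f] unfolding ext_def by (simp add: Lebesgue_Measure.integrable_restrict_UNIV Ds)
    obtain g where g: "g \<in> borel_measurable borel" "AE x in lebesgue. ext f x = g x"
      using borel_representative[OF borel_measurable_integrable[OF i]] by blast
    have "integrable lebesgue g"
      using i g by (subst integrable_cong_AE[where g = "ext f"]) (auto elim!: eventually_mono intro: measurable_completion)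
    then show ?thesis using g by (auto simp: integrable_completion)
  qed
  obtain W where W: "integrable lborel W" "AE x in lebesgue. ext w x = W x"
    using rep[OF H1_imp_L2[OF w]] by blast
  have "\<forall>b\<in>Basis. \<exists>g. integrable lborel g \<and> (AE x in lebesgue. ext (wpartial D b w) x = g x)"
    using rep H1_wpartial_L2[OF D(1) w] by blast
  then obtain G where G: "\<And>b. b \<in> Basis \<Longrightarrow> integrable lborel (G b)" "\<And>b. b \<in> Basis \<Longrightarrow> AE x in lebesgue. ext (wpartial D b w) x = G b x"
    by metis
  have Wm [measurable]: "W \<in> borel_measurable borel" and Gm [measurable]: "\<And>b. b \<in> Basis \<Longrightarrow> G b \<in> borel_measurable borel"
    using W(1) G(1) borel_measurable_integrable by fastforce+
  have conv: "(LINT x|lebesgue_on D. \<psi> x *\<^sub>R f x) = (LINT x|lborel. \<psi> x *\<^sub>R g x)"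
    if \<psi>: "\<psi> \<in> borel_measurable borel" and fg: "AE x in lebesgue. ext f x = g x" and g: "integrable lborel g"
      and f: "f \<in> elems (L2 D)" for \<psi> f g
  proof -
    have [measurable]: "ext f \<in> borel_measurable lebesgue"
      using f Ds unfolding ext_def by (simp add: L2_iff borel_measurable_if)
    have [measurable]: "g \<in> borel_measurable lebesgue" "\<psi> \<in> borel_measurable lebesgue"
      using g \<psi> by (auto intro!: measurable_completion)
    have "(LINT x|lebesgue_on D. \<psi> x *\<^sub>R f x) = (LINT x|lebesgue. (if x \<in> D then \<psi> x *\<^sub>R f x else 0))"
      by (rule Lebesgue_Measure.integral_restrict_UNIV[OF Ds, symmetric])
    also have "\<dots> = (LINT x|lebesgue. \<psi> x *\<^sub>R ext f x)"
      by (intro Bochner_Integration.integral_cong) (auto simp: ext_def)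
    also have "\<dots> = (LINT x|lebesgue. \<psi> x *\<^sub>R g x)"
      by (intro integral_cong_AE) (use fg in \<open>auto elim!: eventually_mono\<close>)
    also have "\<dots> = (LINT x|lborel. \<psi> x *\<^sub>R g x)"
      using \<psi> g by (intro integral_completion) auto
    finally show ?thesis .
  qed
  have wp: "(LINT x|lborel. partial b \<phi> x *\<^sub>R W x) = - (LINT x|lborel. \<phi> x *\<^sub>R G b x)"
    if \<phi>: "test_function C \<phi>" and b: "b \<in> Basis" for \<phi> b
  proof -
    have t: "test_function D \<phi>" using test_function_mono[OF \<phi> C(1)] .
    have "(LINT x|lebesgue_on D. partial b \<phi> x *\<^sub>R w x) = - (LINT x|lebesgue_on D. \<phi> x *\<^sub>R wpartial D b w x)"
      using H1_weak_partial[OF w b] t by (simp add: weak_partial_def)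
    then show ?thesis
      using conv[OF test_function_measurable[OF test_function_partial[OF t b]] W(2,1) H1_imp_L2[OF w]]
        conv[OF test_function_measurable[OF t] G(2)[OF b] G(1)[OF b] H1_wpartial_L2[OF D(1) w b]]
      by simp
  qed
  have Wae: "AE x in lborel. x \<in> C \<longrightarrow> w x = W x"
    using W(2) unfolding AE_completion_iff by eventually_elim (use C(1) in \<open>auto simp: ext_def\<close>)
  have Gae: "AE x in lborel. \<forall>b\<in>Basis. x \<in> C \<longrightarrow> wpartial D b w x = G b x"
  proof (intro AE_finite_allI)
    fix b :: 'a assume "b \<in> Basis"
    from G(2)[OF this] show "AE x in lborel. x \<in> C \<longrightarrow> wpartial D b w x = G b x"
      unfolding AE_completion_iff by eventually_elim (use C(1) in \<open>auto simp: ext_def\<close>)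
  qed simp
  have cnv: "(\<integral>\<^sup>+x. F x \<partial>lebesgue_on C) = (\<integral>\<^sup>+x. indicator C x * F x \<partial>lborel)" for F
    by (simp add: nn_integral_lebesgue_on[OF Cs] nn_integral_completion mult.commute)
  have grad: "(\<integral>\<^sup>+x. indicator C x * ennreal (\<Sum>b\<in>Basis. (norm (G b x))\<^sup>2) \<partial>lborel) \<le> ennreal ((nrm (H1 D) w)\<^sup>2)"
  proof -
    have "(\<integral>\<^sup>+x. indicator C x * ennreal (\<Sum>b\<in>Basis. (norm (G b x))\<^sup>2) \<partial>lborel)
      = (\<integral>\<^sup>+x. indicator C x * ennreal (\<Sum>b\<in>Basis. (norm (wpartial D b w x))\<^sup>2) \<partial>lborel)"
      by (rule nn_integral_cong_AE) (use Gae in eventually_elim, auto split: split_indicator)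
    also have "\<dots> \<le> (\<integral>\<^sup>+x. ennreal (\<Sum>b\<in>Basis. (norm (wpartial D b w x))\<^sup>2) \<partial>lebesgue_on D)"
      using nn_integral_lebesgue_on_subset[OF C(1) Cs Ds] by (simp add: cnv[symmetric])
    also have "\<dots> = ennreal (LINT x|lebesgue_on D. (\<Sum>b\<in>Basis. (norm (wpartial D b w x))\<^sup>2))"
      using H1_wpartial_L2[OF D(1) w] by (intro nn_integral_eq_integral) (auto simp: L2_iff sum_nonneg)
    also have "\<dots> = ennreal (\<Sum>b\<in>Basis. (nrm (L2 D) (wpartial D b w))\<^sup>2)"
      using H1_wpartial_L2[OF D(1) w] by (subst Bochner_Integration.integral_sum) (auto simp: L2_iff nrm_L2_power2)
    also have "\<dots> \<le> ennreal ((nrm (H1 D) w)\<^sup>2)"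
      by (intro ennreal_leI) (simp add: nrm_H1_power2)
    finally show ?thesis .
  qed
  have "(\<integral>\<^sup>+x. \<integral>\<^sup>+y. ennreal ((norm (w x - w y))\<^sup>2) * indicator (ball x r) y \<partial>lebesgue_on C \<partial>lebesgue_on C)
      \<le> ennreal ((sqrt (1 + ?V) * nrm (H1 D) w)\<^sup>2 * r powr (real DIM('a) + 2 * s))" if r: "0 < r" "r \<le> 1" for r
  proof -
    have "(\<integral>\<^sup>+x. \<integral>\<^sup>+y. ennreal ((norm (w x - w y))\<^sup>2) * indicator (ball x r) y \<partial>lebesgue_on C \<partial>lebesgue_on C)
      = (\<integral>\<^sup>+x. indicator C x * (\<integral>\<^sup>+y. indicator C y * (ennreal ((norm (w x - w y))\<^sup>2) * indicator (ball x r) y) \<partial>lborel) \<partial>lborel)"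
      by (simp add: cnv)
    also have "\<dots> = (\<integral>\<^sup>+x. indicator C x * (\<integral>\<^sup>+y. indicator C y * (ennreal ((norm (W x - W y))\<^sup>2) * indicator (ball x r) y) \<partial>lborel) \<partial>lborel)"
      using Wae
    proof (intro nn_integral_cong_AE, eventually_elim)
      case (elim x)
      have "(\<integral>\<^sup>+y. indicator C y * (ennreal ((norm (w x - w y))\<^sup>2) * indicator (ball x r) y) \<partial>lborel) =
        (\<integral>\<^sup>+y. indicator C y * (ennreal ((norm (W x - W y))\<^sup>2) * indicator (ball x r) y) \<partial>lborel)" if x: "x \<in> C"
        using Wae by (intro nn_integral_cong_AE, eventually_elim) (use elim x in \<open>auto split: split_indicator\<close>)
      then show ?case by (auto split: split_indicator)
    qed
    also have "\<dots> \<le> ennreal (?V * r ^ (DIM('a) + 2)) * (\<integral>\<^sup>+x. indicator C x * ennreal (\<Sum>b\<in>Basis. (norm (G b x))\<^sup>2) \<partial>lborel)"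
      by (rule weak_gradient_oscillation[OF C(2,3) W(1) G(1) wp r(1)])
    also have "\<dots> \<le> ennreal (?V * r ^ (DIM('a) + 2)) * ennreal ((nrm (H1 D) w)\<^sup>2)"
      by (intro mult_left_mono grad) simp
    also have "\<dots> = ennreal (?V * r ^ (DIM('a) + 2) * (nrm (H1 D) w)\<^sup>2)"
      using r by (subst ennreal_mult) simp_all
    also have "\<dots> \<le> ennreal ((sqrt (1 + ?V) * nrm (H1 D) w)\<^sup>2 * r powr (real DIM('a) + 2 * s))"
    proof (rule ennreal_leI)
      have "r ^ (DIM('a) + 2) = r powr (real DIM('a) + 2)"
        using r by (simp add: powr_add powr_realpow power_add power2_eq_square)
      also have "\<dots> \<le> r powr (real DIM('a) + 2 * s)"
        using r s by (intro powr_mono') auto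
      finally have "?V * r ^ (DIM('a) + 2) \<le> (1 + ?V) * r powr (real DIM('a) + 2 * s)"
        using V0 r by (intro mult_mono) auto
      then have "?V * r ^ (DIM('a) + 2) * (nrm (H1 D) w)\<^sup>2 \<le> (1 + ?V) * r powr (real DIM('a) + 2 * s) * (nrm (H1 D) w)\<^sup>2"
        by (rule mult_right_mono) simp
      also have "\<dots> = (sqrt (1 + ?V) * nrm (H1 D) w)\<^sup>2 * r powr (real DIM('a) + 2 * s)"
        using V0 by (simp add: power_mult_distrib mult_ac)
      finally show "?V * r ^ (DIM('a) + 2) * (nrm (H1 D) w)\<^sup>2 \<le> (sqrt (1 + ?V) * nrm (H1 D) w)\<^sup>2 * r powr (real DIM('a) + 2 * s)" .
    qed
    finally show ?thesis .
  qed
  moreover have "nrm (L2 C) w \<le> sqrt (1 + ?V) * nrm (H1 D) w"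
  proof -
    have "nrm (L2 C) w \<le> 1 * nrm (H1 D) w"
      using L2_subset(2)[OF C(1) Cs Ds H1_imp_L2[OF w]] nrm_L2_le_H1[of D w] by linarith
    also have "\<dots> \<le> sqrt (1 + ?V) * nrm (H1 D) w"
      using V0 by (intro mult_right_mono) auto
    finally show ?thesis .
  qed
  ultimately show ?thesis
    using L2_subset(1)[OF C(1) Cs Ds H1_imp_L2[OF w]] unfolding nikolskii_def by auto
qed

section \<open>Polytopal domains as finite unions of convex sets\<close>

text \<open>\<open>n0\<close> and \<open>n1\<close> are the inner normals of the two bounding rays.
  In polar coordinates with angle \<open>t\<close> measured from the first ray, the two conditions
  read \<open>0 < sin t\<close> and \<open>0 < sin (\<beta> - t)\<close>, which for
  \<open>\<beta> \<le> pi\<close> confines \<open>t\<close> to the sector.\<close>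

lemma sector_eq_halfplanes_subset:
  fixes e1 e2 :: "'a::euclidean_space" and \<theta>0 \<beta> :: real
  assumes dim: "DIM('a) = 2" and e: "norm e1 = 1" "norm e2 = 1" "e1 \<bullet> e2 = 0"
    and \<beta>: "0 < \<beta>" "\<beta> \<le> pi"
  defines "n0 \<equiv> cos \<theta>0 *\<^sub>R e2 - sin \<theta>0 *\<^sub>R e1"
    and "n1 \<equiv> sin (\<theta>0 + \<beta>) *\<^sub>R e1 - cos (\<theta>0 + \<beta>) *\<^sub>R e2"
  assumes z: "0 < z \<bullet> n0" "0 < z \<bullet> n1"
  obtains \<rho> \<theta> where "z = \<rho> *\<^sub>R (cos \<theta> *\<^sub>R e1 + sin \<theta> *\<^sub>R e2)" "0 < \<rho>" "\<rho> = norm z" "\<theta>0 < \<theta>" "\<theta> < \<theta>0 + \<beta>"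
proof -
  define f1 where "f1 = cos \<theta>0 *\<^sub>R e1 + sin \<theta>0 *\<^sub>R e2"
  have e11: "e1 \<bullet> e1 = 1" "e2 \<bullet> e2 = 1" "e2 \<bullet> e1 = 0"
    using e by (simp_all add: norm_eq_1 inner_commute)
  have sc: "cos \<theta>0 * cos \<theta>0 + sin \<theta>0 * sin \<theta>0 = 1"
    using sin_cos_squared_add[of \<theta>0] by (simp add: power2_eq_square)
  have f: "f1 \<bullet> f1 = 1" "n0 \<bullet> n0 = 1" "f1 \<bullet> n0 = 0"
    using e11 e(3) sc by (simp_all add: f1_def n0_def inner_simps inner_commute algebra_simps)
  then have fn: "f1 \<noteq> n0" by auto
  have ind: "independent {f1, n0}"
    using f by (intro pairwise_orthogonal_independent) (auto simp: pairwise_def orthogonal_def inner_commute)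
  have "span {f1, n0} = UNIV"
    using ind fn dim independent_card_le_dim card_ge_dim_independent[of "{f1, n0}" UNIV]
    by (simp add: top.extremum_uniqueI)
  then have "z \<in> span {f1, n0}" by simp
  then obtain p where "z - p *\<^sub>R f1 \<in> span {n0}" by (auto simp: span_insert)
  then obtain q where "z - p *\<^sub>R f1 = q *\<^sub>R n0" by (auto simp: span_singleton)
  then have zpq: "z = p *\<^sub>R f1 + q *\<^sub>R n0" by (simp add: algebra_simps)
  have zz: "z \<bullet> z = p\<^sup>2 + q\<^sup>2"
    unfolding zpq using f by (simp add: inner_simps inner_commute power2_eq_square)
  have zn0: "z \<bullet> n0 = q"
    unfolding zpq using f by (simp add: inner_simps)
  define \<rho> where "\<rho> = norm z"
  have \<rho>2: "\<rho>\<^sup>2 = p\<^sup>2 + q\<^sup>2" by (simp add: \<rho>_def power2_norm_eq_inner zz)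
  have "z \<noteq> 0" using z by auto
  then have \<rho>: "0 < \<rho>" by (simp add: \<rho>_def)
  have "(p / \<rho>)\<^sup>2 + (q / \<rho>)\<^sup>2 = 1"
    using \<rho> by (simp add: power_divide add_divide_distrib[symmetric] \<rho>2[symmetric])
  then obtain t where t: "0 \<le> t" "t < 2 * pi" "p / \<rho> = cos t" "q / \<rho> = sin t"
    using sincos_total_2pi by metis
  have pq: "p = \<rho> * cos t" "q = \<rho> * sin t"
    using t \<rho> by (simp_all add: field_simps)
  have "0 < sin t"
    using z(1) \<rho> unfolding zn0 pq(2) by (simp add: zero_less_mult_iff)
  have t_pi: "0 < t" "t < pi"
  proof -
    show "t < pi"
      using sin_lt_zero[of t] sin_pi t \<open>0 < sin t\<close> by (cases t pi rule: linorder_cases) auto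
    show "0 < t" using t(1) \<open>0 < sin t\<close> by (cases "t = 0") auto
  qed
  have z_eq: "z = \<rho> *\<^sub>R (cos (\<theta>0 + t) *\<^sub>R e1 + sin (\<theta>0 + t) *\<^sub>R e2)"
    unfolding zpq pq f1_def n0_def by (simp add: cos_add sin_add algebra_simps)
  have "z \<bullet> n1 = \<rho> * (cos (\<theta>0 + t) * sin (\<theta>0 + \<beta>) - sin (\<theta>0 + t) * cos (\<theta>0 + \<beta>))"
    by (subst z_eq) (use e11 e(3) in \<open>simp add: n1_def inner_simps algebra_simps\<close>)
  also have "\<dots> = \<rho> * sin (\<beta> - t)"
    using sin_diff[of "\<theta>0 + \<beta>" "\<theta>0 + t"] by (simp add: mult.commute)
  finally have "0 < sin (\<beta> - t)"
    using z(2) \<rho> by (simp add: zero_less_mult_iff)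
  then have "t < \<beta>"
  proof -
    have "\<not> \<beta> \<le> t"
    proof
      assume "\<beta> \<le> t"
      then have "0 \<le> sin (t - \<beta>)"
        using t_pi \<beta> by (intro sin_ge_zero) auto
      then show False
        using \<open>0 < sin (\<beta> - t)\<close> sin_minus[of "t - \<beta>"] by simp
    qed
    then show ?thesis by simp
  qed
  then show thesis
    using that[OF z_eq \<rho>] t_pi by (simp add: \<rho>_def)
qed

text \<open>A sector with opening \<open>\<omega> < 2 * pi\<close> is the union of its first and its last subsector with
  opening \<open>min \<omega> pi\<close>, which are intersections of the disc with two half-planes.\<close>

lemma interior_angle_convex_cover:
  fixes D :: "'a::euclidean_space set"
  assumes dim: "DIM('a) = 2" and ang: "interior_angle D x \<omega>"
  obtains r P Q where "0 < r" "D \<inter> ball x r = P \<union> Q" "open P" "open Q" "convex P" "convex Q" "bounded P" "bounded Q"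
proof -
  obtain r e1 e2 where \<omega>: "0 < \<omega>" "\<omega> < 2 * pi" and r: "0 < r" and e: "norm e1 = 1" "norm e2 = 1" "e1 \<bullet> e2 = 0"
    and D: "D \<inter> ball x r = {x + \<rho> *\<^sub>R (cos \<theta> *\<^sub>R e1 + sin \<theta> *\<^sub>R e2) | \<rho> \<theta>. 0 < \<rho> \<and> \<rho> < r \<and> 0 < \<theta> \<and> \<theta> < \<omega>}"
    using ang unfolding interior_angle_def by blast
  define \<beta> where "\<beta> = min \<omega> pi"
  have \<beta>: "0 < \<beta>" "\<beta> \<le> pi" "\<beta> \<le> \<omega>" using \<omega> by (auto simp: \<beta>_def)
  define N0 where "N0 = (\<lambda>\<theta>0. cos \<theta>0 *\<^sub>R e2 - sin \<theta>0 *\<^sub>R e1)"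
  define N1 where "N1 = (\<lambda>\<theta>0. sin (\<theta>0 + \<beta>) *\<^sub>R e1 - cos (\<theta>0 + \<beta>) *\<^sub>R e2)"
  define P where "P = (\<lambda>\<theta>0. ball x r \<inter> {y. N0 \<theta>0 \<bullet> x < N0 \<theta>0 \<bullet> y} \<inter> {y. N1 \<theta>0 \<bullet> x < N1 \<theta>0 \<bullet> y})"
  have opn: "open (P t)" for t
    unfolding P_def by (intro open_Int open_ball open_halfspace_gt)
  have cvx: "convex (P t)" for t
    unfolding P_def by (intro convex_Int convex_ball convex_halfspace_gt)
  have bdd: "bounded (P t)" for t
    by (rule bounded_subset[OF bounded_ball[of x r]]) (auto simp: P_def)
  have e11: "e1 \<bullet> e1 = 1" "e2 \<bullet> e2 = 1" "e2 \<bullet> e1 = 0"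
    using e by (simp_all add: norm_eq_1 inner_commute)
  have sub: "P t \<subseteq> D \<inter> ball x r" if t: "0 \<le> t" "t + \<beta> \<le> \<omega>" for t
  proof
    fix y assume y: "y \<in> P t"
    then have "0 < (y - x) \<bullet> N0 t" "0 < (y - x) \<bullet> N1 t"
      by (simp_all add: P_def inner_diff_left inner_commute[of "N0 t"] inner_commute[of "N1 t"])
    then obtain \<rho> \<theta> where "y - x = \<rho> *\<^sub>R (cos \<theta> *\<^sub>R e1 + sin \<theta> *\<^sub>R e2)" "0 < \<rho>" "\<rho> = norm (y - x)" "t < \<theta>" "\<theta> < t + \<beta>"
      using sector_eq_halfplanes_subset[OF dim e \<beta>(1,2), of "y - x" t] unfolding N0_def N1_def by metis
    moreover have "norm (y - x) < r"
      using y by (simp add: P_def dist_norm norm_minus_commute)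
    ultimately show "y \<in> D \<inter> ball x r"
      unfolding D using t by (intro CollectI exI[of _ \<rho>] exI[of _ \<theta>]) (auto simp: algebra_simps)
  qed
  have nrm: "norm (cos \<theta> *\<^sub>R e1 + sin \<theta> *\<^sub>R e2) = 1" for \<theta>
    unfolding norm_eq_1 using e11 e(3) sin_cos_squared_add2[of \<theta>]
    by (simp add: inner_simps power2_eq_square)
  have mem: "x + \<rho> *\<^sub>R (cos \<theta> *\<^sub>R e1 + sin \<theta> *\<^sub>R e2) \<in> P t"
    if "0 < \<rho>" "\<rho> < r" "t < \<theta>" "\<theta> < t + \<beta>" for \<rho> \<theta> t
  proof -
    have i0: "N0 t \<bullet> (cos \<theta> *\<^sub>R e1 + sin \<theta> *\<^sub>R e2) = sin (\<theta> - t)"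
      using e11 e(3) by (simp add: N0_def inner_simps sin_diff algebra_simps)
    have i1: "N1 t \<bullet> (cos \<theta> *\<^sub>R e1 + sin \<theta> *\<^sub>R e2) = sin (t + \<beta> - \<theta>)"
      using e11 e(3) sin_diff[of "t + \<beta>" \<theta>] by (simp add: N1_def inner_simps algebra_simps)
    have "0 < sin (\<theta> - t)" "0 < sin (t + \<beta> - \<theta>)"
      using that \<beta> by (auto intro!: sin_gt_zero)
    moreover define e where "e = cos \<theta> *\<^sub>R e1 + sin \<theta> *\<^sub>R e2"
    ultimately show ?thesis
      using that nrm[of \<theta>] i0 i1 unfolding e_def[symmetric] by (simp add: P_def dist_norm inner_add_right)
  qed
  have "D \<inter> ball x r = P 0 \<union> P (\<omega> - \<beta>)"
  proof
    show "P 0 \<union> P (\<omega> - \<beta>) \<subseteq> D \<inter> ball x r"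
      using sub[of 0] sub[of "\<omega> - \<beta>"] \<beta> by simp
    show "D \<inter> ball x r \<subseteq> P 0 \<union> P (\<omega> - \<beta>)"
    proof
      fix y assume "y \<in> D \<inter> ball x r"
      then obtain \<rho> \<theta> where y: "y = x + \<rho> *\<^sub>R (cos \<theta> *\<^sub>R e1 + sin \<theta> *\<^sub>R e2)" "0 < \<rho>" "\<rho> < r" "0 < \<theta>" "\<theta> < \<omega>"
        unfolding D by blast
      show "y \<in> P 0 \<union> P (\<omega> - \<beta>)"
      proof (cases "\<theta> < \<beta>")
        case True
        then show ?thesis using mem[of \<rho> 0 \<theta>] y by simp
      next
        case False
        then have "\<omega> - \<beta> < \<theta>"
          using \<omega> y by (auto simp: \<beta>_def min_def split: if_splits)
        then show ?thesis using mem[of \<rho> "\<omega> - \<beta>" \<theta>] y by simp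
      qed
    qed
  qed
  then show thesis
    using that[OF r] opn cvx bdd by blast
qed

text \<open>Only the polygonal case needs an argument: every point of the closure has a
  neighbourhood that meets \<open>D\<close> in at most two convex open sets, a ball at points of
  \<open>D\<close> and two sectors at frontier points, and compactness of the closure selects
  finitely many.\<close>

lemma polytopal_domain_convex_cover:
  fixes D :: "'a::euclidean_space set"
  assumes "polytopal_domain D"
  obtains \<C> where "finite \<C>" "\<Union>\<C> = D" "\<And>C. C \<in> \<C> \<Longrightarrow> open C \<and> convex C \<and> bounded C \<and> C \<noteq> {}"
proof -
  consider (conv) "open D" "convex D" "bounded D" "D \<noteq> {}" | (poly) "DIM('a) = 2" "polygon D"
  proof -
    have "open (interior P) \<and> convex (interior P) \<and> bounded (interior P)" if "polytope P" for P :: "'a set"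
      using that by (simp add: polytope_imp_convex polytope_imp_bounded convex_interior bounded_interior)
    then show thesis
      using assms that open_box convex_box(2) bounded_box unfolding polytopal_domain_def by blast
  qed
  then show thesis
  proof cases
    case conv
    then show thesis using that[of "{D}"] by auto
  next
    case poly
    then have D: "open D" "bounded D" by (auto simp: polygon_def)
    have "\<exists>U \<F>. open U \<and> x \<in> U \<and> finite \<F> \<and> D \<inter> U = \<Union>\<F> \<and> (\<forall>C\<in>\<F>. open C \<and> convex C \<and> bounded C)"
      if x: "x \<in> closure D" for x
    proof (cases "x \<in> D")
      case True
      then obtain r where r: "0 < r" "ball x r \<subseteq> D" using D(1) open_contains_ball by blast
      then have "D \<inter> ball x r = \<Union>{ball x r}" by auto
      then show ?thesis
        using r by (intro exI[of _ "ball x r"] exI[of _ "{ball x r}"]) auto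
    next
      case False
      then have "x \<in> frontier D" using x D(1) by (simp add: frontier_def interior_open)
      then obtain \<omega> where "interior_angle D x \<omega>" using poly(2) by (auto simp: polygon_def)
      then obtain r P Q where r: "0 < r" "D \<inter> ball x r = P \<union> Q" "open P" "open Q" "convex P" "convex Q" "bounded P" "bounded Q"
        using interior_angle_convex_cover[OF poly(1)] by metis
      then show ?thesis
        by (intro exI[of _ "ball x r"] exI[of _ "{P, Q}"]) auto
    qed
    then obtain U \<F> where U: "\<And>x. x \<in> closure D \<Longrightarrow> open (U x) \<and> x \<in> U x \<and> finite (\<F> x) \<and> D \<inter> U x = \<Union>(\<F> x) \<and>
        (\<forall>C\<in>\<F> x. open C \<and> convex C \<and> bounded C)" by metis
    have "compact (closure D)" using D(2) by simp
    then obtain X where X: "X \<subseteq> closure D" "finite X" "closure D \<subseteq> (\<Union>x\<in>X. U x)"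
      using U by (elim compactE_image[of _ "closure D" U]) auto
    \<comment> \<open>Empty pieces are discarded because the lower bound for the measure of balls is
      stated for non-empty sets.\<close>
    define \<C> where "\<C> = (\<Union>x\<in>X. \<F> x) - {{}}"
    show thesis
    proof (rule that)
      show "finite \<C>" unfolding \<C>_def using X U by blast
      have un: "\<Union>(\<F> x) = D \<inter> U x" if "x \<in> X" for x using U X(1) that by blast
      have "\<Union>\<C> = (\<Union>x\<in>X. \<Union>(\<F> x))" unfolding \<C>_def by blast
      also have "\<dots> = (\<Union>x\<in>X. D \<inter> U x)" using un by simp
      also have "\<dots> = D" using X(3) closure_subset[of D] by blast
      finally show "\<Union>\<C> = D" .
      show "open C \<and> convex C \<and> bounded C \<and> C \<noteq> {}" if "C \<in> \<C>" for C
        using that U X(1) unfolding \<C>_def by blast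
    qed
  qed
qed

lemma admissible_range:
  assumes "polytopal_domain D" "admissible D \<alpha>"
  shows "1/2 < \<alpha>" "\<alpha> \<le> 1"
proof -
  have "\<alpha> \<le> 1" if "\<alpha> < pi / \<omega>" "reentrant_corner D x \<omega>" for x \<omega>
  proof -
    have "pi < \<omega>" using that by (simp add: reentrant_corner_def)
    moreover from this have "0 < \<omega>" using pi_gt_zero by linarith
    ultimately have "pi / \<omega> \<le> 1" by simp
    then show ?thesis using that by linarith
  qed
  then show "1/2 < \<alpha>" "\<alpha> \<le> 1"
    using assms(2) by (auto simp: admissible_def split: if_splits)
qed

lemma polytopal_not_convex_DIM:
  fixes D :: "'a::euclidean_space set"
  assumes "polytopal_domain D" "\<not> convex D"
  shows "DIM('a) = 2"
  using assms polytope_imp_convex convex_interior convex_box(2) unfolding polytopal_domain_def by blast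

text \<open>In the non-convex case the room between 1/2 and \<open>pi / \<omega>\<close> comes from
  \<open>\<omega> < 2 * pi\<close>.\<close>

lemma admissible_exists:
  fixes D :: "'a::euclidean_space set"
  assumes "polytopal_domain D"
  obtains \<alpha> where "admissible D \<alpha>"
proof (cases "convex D")
  case True
  then show thesis using that[of 1] by (simp add: admissible_def)
next
  case False
  then obtain x \<omega> where x: "reentrant_corner D x \<omega>"
    using assms polytopal_not_convex_DIM[OF assms] unfolding polytopal_domain_def by auto
  then have "pi < \<omega>" "\<omega> < 2 * pi"
    by (auto simp: reentrant_corner_def interior_angle_def)
  then have "1/2 < pi / \<omega>"
    using pi_gt_zero by (simp add: less_divide_eq)
  then obtain \<alpha> where "1/2 < \<alpha>" "\<alpha> < pi / \<omega>" using dense by blast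
  then show thesis using that[of \<alpha>] x False by (auto simp: admissible_def)
qed

section \<open>Bounds for products on polytopal domains\<close>

text \<open>Integrability to the fourth power is phrased through the squared norm, so that the
  Cauchy-Schwarz inequality of \<open>L2\<close> applies directly. Accordingly \<open>L4sq\<close>
  is the square of the L4 norm.\<close>

definition in_L4 :: "'a::euclidean_space set \<Rightarrow> ('a \<Rightarrow> 'b::euclidean_space) \<Rightarrow> bool" where
  "in_L4 D f \<longleftrightarrow> f \<in> borel_measurable (lebesgue_on D) \<and> (\<lambda>x. (norm (f x))\<^sup>2) \<in> elems (L2 D)"

definition L4sq :: "'a::euclidean_space set \<Rightarrow> ('a \<Rightarrow> 'b::euclidean_space) \<Rightarrow> real" where
  "L4sq D f = nrm (L2 D) (\<lambda>x. (norm (f x))\<^sup>2)"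

lemma L4sq_nonneg [simp]: "0 \<le> L4sq D f"
  by (simp add: L4sq_def)

lemma in_L4I:
  assumes f [measurable]: "f \<in> borel_measurable (lebesgue_on D)"
    and le: "(\<integral>\<^sup>+x. ennreal (norm (f x) ^ 4) \<partial>lebesgue_on D) \<le> ennreal B" and B: "0 \<le> B"
  shows "in_L4 D f" "L4sq D f \<le> sqrt B"
proof -
  have "integrable (lebesgue_on D) (\<lambda>x. norm (f x) ^ 4)"
    unfolding integrable_iff_bounded using le by (auto intro: le_less_trans)
  then show L4: "in_L4 D f"
    by (auto simp: in_L4_def L2_iff)
  have "ennreal (LINT x|lebesgue_on D. norm (f x) ^ 4) \<le> ennreal B"
    using le nn_integral_eq_integral[of "lebesgue_on D" "\<lambda>x. norm (f x) ^ 4"] L4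
    by (simp add: in_L4_def L2_iff)
  then show "L4sq D f \<le> sqrt B"
    using B by (simp add: L4sq_def nrm_L2 ennreal_le_iff)
qed

lemma in_L4_mult:
  assumes f: "in_L4 D f" and g: "in_L4 D g"
  shows "(\<lambda>x. norm (f x) * norm (g x)) \<in> elems (L2 D)"
    and "(nrm (L2 D) (\<lambda>x. norm (f x) * norm (g x)))\<^sup>2 \<le> L4sq D f * L4sq D g"
proof -
  have [measurable]: "f \<in> borel_measurable (lebesgue_on D)" "g \<in> borel_measurable (lebesgue_on D)"
    using f g by (auto simp: in_L4_def)
  note fg = f[unfolded in_L4_def, THEN conjunct2] g[unfolded in_L4_def, THEN conjunct2]
  show "(\<lambda>x. norm (f x) * norm (g x)) \<in> elems (L2 D)"
    using L2_integrable_norm_mult[OF fg] by (simp add: L2_iff power_mult_distrib)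
  show "(nrm (L2 D) (\<lambda>x. norm (f x) * norm (g x)))\<^sup>2 \<le> L4sq D f * L4sq D g"
    using L2_Cauchy_Schwarz[OF fg] by (simp add: nrm_L2_power2 L4sq_def power_mult_distrib)
qed

lemma nn_integral_lebesgue_on_cover:
  assumes \<C>: "finite \<C>" "\<Union>\<C> = D" "\<And>C. C \<in> \<C> \<Longrightarrow> C \<in> sets lebesgue"
    and g [measurable]: "g \<in> borel_measurable (lebesgue_on D)"
  shows "(\<integral>\<^sup>+x. g x \<partial>lebesgue_on D) \<le> (\<Sum>C\<in>\<C>. \<integral>\<^sup>+x. g x \<partial>lebesgue_on C)"
proof -
  have D: "D \<in> sets lebesgue" using \<C> by (metis sets.finite_Union subsetI)
  have "(\<integral>\<^sup>+x. g x \<partial>lebesgue_on D) \<le> (\<integral>\<^sup>+x. (\<Sum>C\<in>\<C>. g x * indicator C x) \<partial>lebesgue_on D)"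
  proof (rule nn_integral_mono)
    fix x assume "x \<in> space (lebesgue_on D)"
    then obtain C where C: "C \<in> \<C>" "x \<in> C" using \<C>(2) by auto
    have "g x = (\<Sum>C\<in>{C}. g x * indicator C x)" using C by simp
    also have "\<dots> \<le> (\<Sum>C\<in>\<C>. g x * indicator C x)"
      using C \<C>(1) by (intro sum_mono2) auto
    finally show "g x \<le> (\<Sum>C\<in>\<C>. g x * indicator C x)" .
  qed
  also have "\<dots> = (\<Sum>C\<in>\<C>. \<integral>\<^sup>+x. g x * indicator C x \<partial>lebesgue_on D)"
  proof (rule nn_integral_sum)
    fix C assume "C \<in> \<C>"
    then have "C \<in> sets (lebesgue_on D)" using \<C> D by (auto simp: sets_restrict_space_iff)
    then show "(\<lambda>x. g x * indicator C x) \<in> borel_measurable (lebesgue_on D)" by measurable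
  qed
  also have "\<dots> = (\<Sum>C\<in>\<C>. \<integral>\<^sup>+x. g x \<partial>lebesgue_on C)"
  proof (rule sum.cong[OF refl])
    fix C assume C: "C \<in> \<C>"
    then have "C \<subseteq> D" using \<C>(2) by auto
    then show "(\<integral>\<^sup>+x. g x * indicator C x \<partial>lebesgue_on D) = (\<integral>\<^sup>+x. g x \<partial>lebesgue_on C)"
      using C \<C>(3) D by (auto simp: nn_integral_lebesgue_on indicator_def intro!: nn_integral_cong)
  qed
  finally show ?thesis .
qed

section \<open>L4 bounds and product bounds for a fixed domain and exponent\<close>

locale polytopal =
  fixes D :: "'a::euclidean_space set" and \<alpha> :: real
  assumes dim: "DIM('a) \<in> {1, 2, 3}" and poly: "polytopal_domain D" and adm: "admissible D \<alpha>"
begin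

text \<open>The order at which the Nikolskii bounds are used. The recursion wants
  \<open>2 * s / d\<close> above 1/2 and at most 1: in one dimension \<alpha> = 1 is too large and
  is lowered to 1/2, in two dimensions \<alpha> > 1/2 is enough, in three \<alpha> = 1 gives
  2/3.\<close>

definition smoothness :: real where "smoothness = (if DIM('a) = 1 then 1/2 else \<alpha>)"

lemma \<alpha>_range: "1/2 < \<alpha>" "\<alpha> \<le> 1"
  using admissible_range[OF poly adm] by auto

lemma \<alpha>_eq_1: "DIM('a) \<noteq> 2 \<Longrightarrow> \<alpha> = 1"
  using polytopal_not_convex_DIM[OF poly] adm by (auto simp: admissible_def split: if_splits)

lemma smoothness: "1/2 < 2 * smoothness / DIM('a)" "2 * smoothness / DIM('a) \<le> 1" "smoothness \<le> \<alpha>" "smoothness \<le> 1"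
  using dim \<alpha>_eq_1 \<alpha>_range by (auto simp: smoothness_def)

text \<open>One cover is fixed once and for all, so that the constants taken from it do not vary
  with the functions to be estimated.\<close>

definition pieces :: "'a set set" where
  "pieces = (SOME \<C>. finite \<C> \<and> \<Union>\<C> = D \<and> (\<forall>C\<in>\<C>. open C \<and> convex C \<and> bounded C \<and> C \<noteq> {}))"

lemma pieces:
  "finite pieces" "\<Union>pieces = D"
  "\<And>C. C \<in> pieces \<Longrightarrow> open C" "\<And>C. C \<in> pieces \<Longrightarrow> convex C" "\<And>C. C \<in> pieces \<Longrightarrow> bounded C" "\<And>C. C \<in> pieces \<Longrightarrow> C \<noteq> {}"
  "\<And>C. C \<in> pieces \<Longrightarrow> C \<subseteq> D" "\<And>C. C \<in> pieces \<Longrightarrow> C \<in> sets lebesgue"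
proof -
  have "\<exists>\<C>. finite \<C> \<and> \<Union>\<C> = D \<and> (\<forall>C\<in>\<C>. open C \<and> convex C \<and> bounded C \<and> C \<noteq> {})"
    using polytopal_domain_convex_cover[OF poly] by metis
  then have *: "finite pieces \<and> \<Union>pieces = D \<and> (\<forall>C\<in>pieces. open C \<and> convex C \<and> bounded C \<and> C \<noteq> {})"
    unfolding pieces_def by (rule someI_ex)
  then show "finite pieces" "\<Union>pieces = D"
    "\<And>C. C \<in> pieces \<Longrightarrow> open C" "\<And>C. C \<in> pieces \<Longrightarrow> convex C" "\<And>C. C \<in> pieces \<Longrightarrow> bounded C" "\<And>C. C \<in> pieces \<Longrightarrow> C \<noteq> {}"
    by blast+
  show "C \<subseteq> D" if "C \<in> pieces" for C using * that by blast
  show "C \<in> sets lebesgue" if "C \<in> pieces" for C using * that by (simp add: borel_open)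
qed

lemma D_open: "open D" and D_bounded: "bounded D" and D_lmeasurable: "D \<in> lmeasurable" and D_sets: "D \<in> sets lebesgue"
proof -
  show "open D" using pieces(2,3) open_Union by metis
  then show "D \<in> sets lebesgue" by (simp add: borel_open)
  show "bounded D" using pieces(1,2,5) bounded_Union by metis
  then show "D \<in> lmeasurable" using \<open>open D\<close> by (simp add: lmeasurable_open)
qed

lemma nikolskii_pieces_L4:
  "\<exists>K>0. \<forall>(f::'a \<Rightarrow> 'b::euclidean_space) N. f \<in> borel_measurable (lebesgue_on D) \<longrightarrow> (\<forall>C\<in>pieces. nikolskii C smoothness N f) \<longrightarrow> 0 \<le> N \<longrightarrow>
     (\<integral>\<^sup>+x. ennreal (norm (f x) ^ 4) \<partial>lebesgue_on D) \<le> ennreal (K * N ^ 4)"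
proof -
  have "\<forall>C\<in>pieces. \<exists>K>0. \<forall>(f::'a \<Rightarrow> 'b) N. nikolskii C smoothness N f \<longrightarrow>
     (\<integral>\<^sup>+x. ennreal (norm (f x) ^ 4) \<partial>lebesgue_on C) \<le> ennreal (K * N ^ 4)"
    by (intro ballI nikolskii_L4_bound pieces smoothness)
  from bchoice[OF this] obtain K where K: "\<forall>C\<in>pieces. 0 < K C \<and> (\<forall>(f::'a \<Rightarrow> 'b) N. nikolskii C smoothness N f \<longrightarrow>
     (\<integral>\<^sup>+x. ennreal (norm (f x) ^ 4) \<partial>lebesgue_on C) \<le> ennreal (K C * N ^ 4))" by blast
  have sK: "0 \<le> (\<Sum>C\<in>pieces. K C)" using K by (intro sum_nonneg) (auto simp: less_imp_le)
  show ?thesis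
  proof (intro exI[of _ "1 + (\<Sum>C\<in>pieces. K C)"] conjI allI impI)
    show "0 < 1 + (\<Sum>C\<in>pieces. K C)" using sK by linarith
    fix f :: "'a \<Rightarrow> 'b" and N :: real
    assume f [measurable]: "f \<in> borel_measurable (lebesgue_on D)" and n: "\<forall>C\<in>pieces. nikolskii C smoothness N f" and N: "0 \<le> N"
    have "(\<integral>\<^sup>+x. ennreal (norm (f x) ^ 4) \<partial>lebesgue_on D) \<le> (\<Sum>C\<in>pieces. \<integral>\<^sup>+x. ennreal (norm (f x) ^ 4) \<partial>lebesgue_on C)"
      by (intro nn_integral_lebesgue_on_cover pieces) measurable
    also have "\<dots> \<le> (\<Sum>C\<in>pieces. ennreal (K C * N ^ 4))"
      using K n by (intro sum_mono) blast
    also have "\<dots> = ennreal ((\<Sum>C\<in>pieces. K C) * N ^ 4)"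
      using K N by (subst sum_ennreal) (auto simp: sum_distrib_right less_imp_le)
    also have "\<dots> \<le> ennreal ((1 + (\<Sum>C\<in>pieces. K C)) * N ^ 4)"
      using N by (intro ennreal_leI mult_right_mono) auto
    finally show "(\<integral>\<^sup>+x. ennreal (norm (f x) ^ 4) \<partial>lebesgue_on D) \<le> ennreal ((1 + (\<Sum>C\<in>pieces. K C)) * N ^ 4)" .
  qed
qed

text \<open>The tolerance is shared out among the pieces, and the common height dominates the
  heights of all of them; raising the height only shrinks a tail.\<close>

lemma nikolskii_pieces_L4_tail:
  assumes "0 < \<epsilon>" "0 < N"
  shows "\<exists>L>0. \<forall>(f::'a \<Rightarrow> 'b::euclidean_space). f \<in> borel_measurable (lebesgue_on D) \<longrightarrow> (\<forall>C\<in>pieces. nikolskii C smoothness N f) \<longrightarrow>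
     (\<integral>\<^sup>+x. ennreal (norm (f x) ^ 4) * indicator {L<..} (norm (f x)) \<partial>lebesgue_on D) \<le> ennreal \<epsilon>"
proof -
  define \<epsilon>' where "\<epsilon>' = \<epsilon> / ((1 + real (card pieces)) * N ^ 4)"
  have \<epsilon>': "0 < \<epsilon>'" using assms by (simp add: \<epsilon>'_def add_pos_nonneg)
  have "\<forall>C\<in>pieces. \<exists>L>0. \<forall>(f::'a \<Rightarrow> 'b) N N'. nikolskii C smoothness N f \<longrightarrow> N \<le> N' \<longrightarrow> 0 < N' \<longrightarrow>
     (\<integral>\<^sup>+x. ennreal (norm (f x) ^ 4) * indicator {L * N'<..} (norm (f x)) \<partial>lebesgue_on C) \<le> ennreal (\<epsilon>' * N' ^ 4)"
    by (intro ballI nikolskii_L4_tail pieces smoothness \<epsilon>')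
  from bchoice[OF this] obtain L where L: "\<forall>C\<in>pieces. 0 < L C \<and> (\<forall>(f::'a \<Rightarrow> 'b) N N'. nikolskii C smoothness N f \<longrightarrow> N \<le> N' \<longrightarrow> 0 < N' \<longrightarrow>
     (\<integral>\<^sup>+x. ennreal (norm (f x) ^ 4) * indicator {L C * N'<..} (norm (f x)) \<partial>lebesgue_on C) \<le> ennreal (\<epsilon>' * N' ^ 4))" by blast
  define LL where "LL = (1 + (\<Sum>C\<in>pieces. L C)) * N"
  have sL: "0 \<le> (\<Sum>C\<in>pieces. L C)" using L by (intro sum_nonneg) (auto simp: less_imp_le)
  have LL: "L C * N \<le> LL" if "C \<in> pieces" for C
  proof -
    have "L C \<le> (\<Sum>C\<in>pieces. L C)" using L that by (intro member_le_sum pieces(1)) (auto simp: less_imp_le)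
    then show ?thesis unfolding LL_def using assms by (intro mult_right_mono) auto
  qed
  show ?thesis
  proof (intro exI[of _ LL] conjI allI impI)
    show "0 < LL" unfolding LL_def using sL assms by (intro mult_pos_pos) auto
    fix f :: "'a \<Rightarrow> 'b"
    assume f [measurable]: "f \<in> borel_measurable (lebesgue_on D)" and n: "\<forall>C\<in>pieces. nikolskii C smoothness N f"
    have "(\<integral>\<^sup>+x. ennreal (norm (f x) ^ 4) * indicator {LL<..} (norm (f x)) \<partial>lebesgue_on D)
       \<le> (\<Sum>C\<in>pieces. \<integral>\<^sup>+x. ennreal (norm (f x) ^ 4) * indicator {LL<..} (norm (f x)) \<partial>lebesgue_on C)"
      by (intro nn_integral_lebesgue_on_cover pieces) measurable
    also have "\<dots> \<le> (\<Sum>C\<in>pieces. ennreal (\<epsilon>' * N ^ 4))"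
    proof (rule sum_mono)
      fix C assume C: "C \<in> pieces"
      have "(\<integral>\<^sup>+x. ennreal (norm (f x) ^ 4) * indicator {LL<..} (norm (f x)) \<partial>lebesgue_on C)
         \<le> (\<integral>\<^sup>+x. ennreal (norm (f x) ^ 4) * indicator {L C * N<..} (norm (f x)) \<partial>lebesgue_on C)"
        using LL[OF C] by (intro nn_integral_mono) (auto split: split_indicator)
      also have "\<dots> \<le> ennreal (\<epsilon>' * N ^ 4)" using L C n assms by blast
      finally show "(\<integral>\<^sup>+x. ennreal (norm (f x) ^ 4) * indicator {LL<..} (norm (f x)) \<partial>lebesgue_on C) \<le> ennreal (\<epsilon>' * N ^ 4)" .
    qed
    also have "\<dots> = ennreal (real (card pieces) * (\<epsilon>' * N ^ 4))"
      using \<epsilon>' assms by (subst sum_ennreal) auto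
    also have "\<dots> \<le> ennreal \<epsilon>"
    proof (rule ennreal_leI)
      have "real (card pieces) * (\<epsilon>' * N ^ 4) = \<epsilon> * (real (card pieces) / (1 + real (card pieces)))"
        using assms by (simp add: \<epsilon>'_def)
      also have "\<dots> \<le> \<epsilon> * 1"
        using assms by (intro mult_left_mono) auto
      finally show "real (card pieces) * (\<epsilon>' * N ^ 4) \<le> \<epsilon>" by simp
    qed
    finally show "(\<integral>\<^sup>+x. ennreal (norm (f x) ^ 4) * indicator {LL<..} (norm (f x)) \<partial>lebesgue_on D) \<le> ennreal \<epsilon>" .
  qed
qed

text \<open>The factor of \<open>H1_nikolskii\<close>. Being at least 1, it also serves the
  fractional spaces, whose Nikolskii bound comes without a factor.\<close>

definition V where "V = sqrt (1 + unit_ball_vol (real DIM('a)))"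

lemma V_ge_1: "1 \<le> V"
  by (simp add: V_def)

lemma H1_nikolskii_pieces:
  "w \<in> elems (H1 D) \<Longrightarrow> C \<in> pieces \<Longrightarrow> nikolskii C smoothness (V * nrm (H1 D) w) w"
  unfolding V_def by (intro H1_nikolskii D_open D_bounded pieces smoothness)

lemma Hs_imp_L2:
  "f \<in> elems (Hs D \<alpha>) \<Longrightarrow> f \<in> elems (L2 D)" "f \<in> elems (Hs D \<alpha>) \<Longrightarrow> nrm (L2 D) f \<le> nrm (Hs D \<alpha>) f"
proof -
  show "f \<in> elems (L2 D)" if "f \<in> elems (Hs D \<alpha>)"
    using that H1_imp_L2 by (auto simp: Hs_def split: if_splits)
  show "nrm (L2 D) f \<le> nrm (Hs D \<alpha>) f" if "f \<in> elems (Hs D \<alpha>)"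
  proof (cases "\<alpha> = 1")
    case True
    then show ?thesis using nrm_L2_le_H1[of D f] by (simp add: Hs_def)
  next
    case False
    have g0: "0 \<le> gagliardo_integrand \<alpha> f z" for z by (auto simp: gagliardo_integrand_def split: prod.split)
    have "0 \<le> (LINT z|(lebesgue_on D \<Otimes>\<^sub>M lebesgue_on D). gagliardo_integrand \<alpha> f z)"
      by (rule Bochner_Integration.integral_nonneg) (rule g0)
    then show ?thesis
      using False by (auto simp: Hs_def intro!: real_le_rsqrt)
  qed
qed

lemma Hs_nonneg: "0 \<le> nrm (Hs D \<alpha>) f"
proof (cases "\<alpha> = 1")
  case False
  have g0: "0 \<le> gagliardo_integrand \<alpha> f z" for z by (auto simp: gagliardo_integrand_def split: prod.split)
  have "0 \<le> (LINT z|(lebesgue_on D \<Otimes>\<^sub>M lebesgue_on D). gagliardo_integrand \<alpha> f z)"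
    by (rule Bochner_Integration.integral_nonneg) (rule g0)
  then show ?thesis using False by (auto simp: Hs_def)
qed (simp add: Hs_def)

lemma nikolskii_mono:
  assumes f: "nikolskii C s N f" and N: "N \<le> N'"
  shows "nikolskii C s N' (f :: 'a \<Rightarrow> 'b::euclidean_space)"
proof -
  have N0: "0 \<le> N" using f by (meson nikolskii_def nrm_L2_nonneg order_trans)
  show ?thesis
    unfolding nikolskii_def
  proof (intro conjI allI impI)
    show "f \<in> elems (L2 C)" "nrm (L2 C) f \<le> N'" using f N by (auto simp: nikolskii_def)
    fix r :: real assume r: "0 < r \<and> r \<le> 1"
    have "N\<^sup>2 * r powr (real DIM('a) + 2 * s) \<le> N'\<^sup>2 * r powr (real DIM('a) + 2 * s)"
      using N N0 by (intro mult_right_mono power_mono) auto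
    then show "(\<integral>\<^sup>+x. \<integral>\<^sup>+y. ennreal ((norm (f x - f y))\<^sup>2) * indicator (ball x r) y \<partial>lebesgue_on C \<partial>lebesgue_on C)
         \<le> ennreal (N'\<^sup>2 * r powr (real DIM('a) + 2 * s))"
      using f r unfolding nikolskii_def by (meson ennreal_leI order_trans)
  qed
qed

lemma Hs_nikolskii_pieces:
  assumes f: "f \<in> elems (Hs D \<alpha>)" and C: "C \<in> pieces"
  shows "nikolskii C smoothness (V * nrm (Hs D \<alpha>) f) f"
proof (cases "\<alpha> = 1")
  case True
  then show ?thesis using f H1_nikolskii_pieces[OF _ C] by (simp add: Hs_def)
next
  case False
  have "nikolskii C smoothness (nrm (Hs D \<alpha>) f) f"
    using \<alpha>_range by (intro Hs_nikolskii D_lmeasurable pieces C False smoothness f) auto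
  then show ?thesis
    by (rule nikolskii_mono) (use V_ge_1 Hs_nonneg[of f] mult_right_mono[of 1 V "nrm (Hs D \<alpha>) f"] in simp)
qed

lemma in_L4_bounds:
  "\<exists>K>0. (\<forall>w::'a \<Rightarrow> 'b::euclidean_space. w \<in> elems (H1 D) \<longrightarrow> in_L4 D w \<and> L4sq D w \<le> K * (nrm (H1 D) w)\<^sup>2) \<and>
     (\<forall>f::'a \<Rightarrow> 'b. f \<in> elems (Hs D \<alpha>) \<longrightarrow> in_L4 D f \<and> L4sq D f \<le> K * (nrm (Hs D \<alpha>) f)\<^sup>2)"
proof -
  obtain K where K: "0 < K" "\<forall>(f::'a \<Rightarrow> 'b) N. f \<in> borel_measurable (lebesgue_on D) \<longrightarrow> (\<forall>C\<in>pieces. nikolskii C smoothness N f) \<longrightarrow> 0 \<le> N \<longrightarrow>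
     (\<integral>\<^sup>+x. ennreal (norm (f x) ^ 4) \<partial>lebesgue_on D) \<le> ennreal (K * N ^ 4)"
    using nikolskii_pieces_L4 by blast
  have V0: "0 \<le> V" using V_ge_1 by linarith
  have *: "in_L4 D f \<and> L4sq D f \<le> (sqrt K * V\<^sup>2) * N\<^sup>2"
    if "f \<in> elems (L2 D)" "\<forall>C\<in>pieces. nikolskii C smoothness (V * N) f" "0 \<le> N" for f :: "'a \<Rightarrow> 'b" and N
  proof -
    have m: "f \<in> borel_measurable (lebesgue_on D)" using that(1) by (simp add: L2_iff)
    have le: "(\<integral>\<^sup>+x. ennreal (norm (f x) ^ 4) \<partial>lebesgue_on D) \<le> ennreal (K * (V * N) ^ 4)"
      using K(2) m that V0 by (meson mult_nonneg_nonneg)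
    have "sqrt (K * (V * N) ^ 4) = sqrt K * sqrt (((V * N)\<^sup>2)\<^sup>2)"
      by (simp add: real_sqrt_mult)
    also have "\<dots> = (sqrt K * V\<^sup>2) * N\<^sup>2"
      by (simp only: real_sqrt_abs) (simp add: power_mult_distrib)
    finally show ?thesis
      using in_L4I[OF m le] K(1) that V0 by simp
  qed
  show ?thesis
    using K(1) V_ge_1 by (intro exI[of _ "sqrt K * V\<^sup>2"] conjI allI impI *)
      (auto intro: H1_nikolskii_pieces Hs_nikolskii_pieces H1_imp_L2 Hs_imp_L2 Hs_nonneg mult_pos_pos)
qed

text \<open>With \<open>h\<close> the part of \<open>f\<close> above the height \<open>L\<close>,
  the L4 bounds for \<open>w\<close> and \<open>h\<close> yield the first term, and the bound of the
  rest of \<open>f\<close> by \<open>L\<close> yields the second, so \<open>B = L\<^sup>2\<close>.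
  The height is chosen from \<open>\<delta>\<close> and \<open>M\<close> before \<open>f\<close> and
  \<open>w\<close>.\<close>

lemma product_bound:
  assumes \<delta>: "0 < \<delta>"
  shows "\<exists>B\<ge>0. \<forall>(f::'a \<Rightarrow> 'b::euclidean_space) (w::'a \<Rightarrow> 'b). f \<in> elems (Hs D \<alpha>) \<longrightarrow> nrm (Hs D \<alpha>) f \<le> M \<longrightarrow> w \<in> elems (H1 D) \<longrightarrow>
     (nrm (L2 D) (\<lambda>x. norm (w x) * norm (f x)))\<^sup>2 \<le> \<delta> * (nrm (H1 D) w)\<^sup>2 + B * (nrm (L2 D) w)\<^sup>2"
proof -
  obtain K where K: "0 < K" "\<forall>w::'a \<Rightarrow> 'b. w \<in> elems (H1 D) \<longrightarrow> in_L4 D w \<and> L4sq D w \<le> K * (nrm (H1 D) w)\<^sup>2"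
     "\<forall>f::'a \<Rightarrow> 'b. f \<in> elems (Hs D \<alpha>) \<longrightarrow> in_L4 D f \<and> L4sq D f \<le> K * (nrm (Hs D \<alpha>) f)\<^sup>2"
    using in_L4_bounds by blast
  \<comment> \<open>The absolute value and the added 1 make this bound positive for every real
    \<open>M\<close>, as the tail lemma requires.\<close>
  define N where "N = V * (\<bar>M\<bar> + 1)"
  have N: "0 < N" using V_ge_1 by (simp add: N_def)
  \<comment> \<open>\<open>L4sq\<close> of the cut function is at most the square root of
    \<open>\<epsilon>\<close>, and the division by \<open>K\<close> cancels the constant in the
    bound for \<open>w\<close>.\<close>
  define \<epsilon> where "\<epsilon> = (\<delta> / K)\<^sup>2"
  have \<epsilon>: "0 < \<epsilon>" using \<delta> K(1) by (simp add: \<epsilon>_def)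
  obtain L where L: "0 < L" "\<forall>(f::'a \<Rightarrow> 'b). f \<in> borel_measurable (lebesgue_on D) \<longrightarrow> (\<forall>C\<in>pieces. nikolskii C smoothness N f) \<longrightarrow>
     (\<integral>\<^sup>+x. ennreal (norm (f x) ^ 4) * indicator {L<..} (norm (f x)) \<partial>lebesgue_on D) \<le> ennreal \<epsilon>"
    using nikolskii_pieces_L4_tail[OF \<epsilon> N] by blast
  show ?thesis
  proof (intro exI[of _ "L\<^sup>2"] conjI allI impI)
    fix f w :: "'a \<Rightarrow> 'b"
    assume f: "f \<in> elems (Hs D \<alpha>)" "nrm (Hs D \<alpha>) f \<le> M" and w: "w \<in> elems (H1 D)"
    have [measurable]: "f \<in> borel_measurable (lebesgue_on D)" "w \<in> borel_measurable (lebesgue_on D)"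
      using Hs_imp_L2(1)[OF f(1)] H1_imp_L2[OF w] by (auto simp: L2_iff)
    have nk: "\<forall>C\<in>pieces. nikolskii C smoothness N f"
    proof
      fix C assume "C \<in> pieces"
      have "V * nrm (Hs D \<alpha>) f \<le> N"
        unfolding N_def using f(2) V_ge_1 by (intro mult_left_mono) auto
      then show "nikolskii C smoothness N f"
        using nikolskii_mono Hs_nikolskii_pieces[OF f(1) \<open>C \<in> pieces\<close>] by blast
    qed
    define h where "h = (\<lambda>x. indicator {L<..} (norm (f x)) *\<^sub>R f x)"
    have hm [measurable]: "h \<in> borel_measurable (lebesgue_on D)" unfolding h_def by measurable
    have "(\<integral>\<^sup>+x. ennreal (norm (h x) ^ 4) \<partial>lebesgue_on D) = (\<integral>\<^sup>+x. ennreal (norm (f x) ^ 4) * indicator {L<..} (norm (f x)) \<partial>lebesgue_on D)"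
      by (intro nn_integral_cong) (auto simp: h_def split: split_indicator)
    also have "\<dots> \<le> ennreal \<epsilon>" using L(2) nk by simp
    finally have h: "in_L4 D h" "L4sq D h \<le> \<delta> / K"
      using in_L4I[OF hm, of \<epsilon>] \<epsilon> \<delta> K(1) by (auto simp: \<epsilon>_def)
    have w4: "in_L4 D w" "L4sq D w \<le> K * (nrm (H1 D) w)\<^sup>2" using K(2) w by auto
    have f4: "in_L4 D f" using K(3) f(1) by auto
    note wf = in_L4_mult(1)[OF w4(1) f4] and wh = in_L4_mult[OF w4(1) h(1)]
    have iw: "integrable (lebesgue_on D) (\<lambda>x. (norm (w x))\<^sup>2)" using H1_imp_L2[OF w] by (simp add: L2_iff)
    have "(nrm (L2 D) (\<lambda>x. norm (w x) * norm (f x)))\<^sup>2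
       \<le> (LINT x|lebesgue_on D. (norm (norm (w x) * norm (h x)))\<^sup>2 + L\<^sup>2 * (norm (w x))\<^sup>2)"
      unfolding nrm_L2_power2
    proof (rule integral_mono)
      show "integrable (lebesgue_on D) (\<lambda>x. (norm (norm (w x) * norm (f x)))\<^sup>2)" using wf by (simp add: L2_iff)
      show "integrable (lebesgue_on D) (\<lambda>x. (norm (norm (w x) * norm (h x)))\<^sup>2 + L\<^sup>2 * (norm (w x))\<^sup>2)"
        using wh(1) iw by (simp add: L2_iff)
      fix x
      show "(norm (norm (w x) * norm (f x)))\<^sup>2 \<le> (norm (norm (w x) * norm (h x)))\<^sup>2 + L\<^sup>2 * (norm (w x))\<^sup>2"
      proof (cases "L < norm (f x)")
        case True
        then show ?thesis by (simp add: h_def)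
      next
        case False
        then have "(norm (w x))\<^sup>2 * (norm (f x))\<^sup>2 \<le> (norm (w x))\<^sup>2 * L\<^sup>2"
          by (intro mult_left_mono power_mono) auto
        then show ?thesis by (simp add: power_mult_distrib mult.commute add_increasing)
      qed
    qed
    also have "\<dots> = (nrm (L2 D) (\<lambda>x. norm (w x) * norm (h x)))\<^sup>2 + L\<^sup>2 * (nrm (L2 D) w)\<^sup>2"
      using wh(1) iw by (simp add: L2_iff nrm_L2_power2)
    also have "\<dots> \<le> (K * (nrm (H1 D) w)\<^sup>2) * (\<delta> / K) + L\<^sup>2 * (nrm (L2 D) w)\<^sup>2"
      using wh(2) w4(2) h(2) K(1) \<delta> by (intro add_right_mono) (rule order_trans[OF wh(2)], intro mult_mono, auto)
    finally show "(nrm (L2 D) (\<lambda>x. norm (w x) * norm (f x)))\<^sup>2 \<le> \<delta> * (nrm (H1 D) w)\<^sup>2 + L\<^sup>2 * (nrm (L2 D) w)\<^sup>2"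
      using K(1) by (simp add: mult.commute)
  qed simp
qed

end

section \<open>The form associated with the LLBE\<close>

lemma norm_cross3_le: "norm (cross3 x y) \<le> norm x * norm y"
proof (rule power2_le_imp_le)
  show "(norm (cross3 x y))\<^sup>2 \<le> (norm x * norm y)\<^sup>2"
    using norm_cross_dot[of x y] zero_le_power2[of "x \<bullet> y"] by linarith
qed simp

lemma cross3_diff_split: "cross3 a p - cross3 c q = cross3 (a - c) p + cross3 c (p - q)"
  by (simp add: cross3_simps)

lemma borel_measurable_cross3 [measurable]:
  assumes "f \<in> borel_measurable M" "g \<in> borel_measurable M"
  shows "(\<lambda>x. cross3 (f x) (g x)) \<in> borel_measurable M"
  by (rule borel_measurable_continuous_Pair[OF assms, of cross3])
     (intro continuous_on_cross continuous_intros)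

lemma L2_dominated:
  fixes f :: "'a::euclidean_space \<Rightarrow> 'b::euclidean_space" and g :: "'a \<Rightarrow> 'c::euclidean_space"
  assumes g: "g \<in> elems (L2 D)" and f [measurable]: "f \<in> borel_measurable (lebesgue_on D)"
    and le: "\<And>x. norm (f x) \<le> norm (g x)"
  shows "f \<in> elems (L2 D)" "nrm (L2 D) f \<le> nrm (L2 D) g"
proof -
  have sq: "(norm (f x))\<^sup>2 \<le> (norm (g x))\<^sup>2" for x using le by (rule power_mono) simp
  have "integrable (lebesgue_on D) (\<lambda>x. (norm (f x))\<^sup>2)"
    by (rule Bochner_Integration.integrable_bound[of _ "\<lambda>x. (norm (g x))\<^sup>2"]) (use g sq in \<open>auto simp: L2_iff\<close>)
  then show fL: "f \<in> elems (L2 D)" by (simp add: L2_iff f)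
  then have "(nrm (L2 D) f)\<^sup>2 \<le> (nrm (L2 D) g)\<^sup>2"
    using g sq unfolding nrm_L2_power2 by (intro integral_mono) (auto simp: L2_iff)
  then show "nrm (L2 D) f \<le> nrm (L2 D) g" by (rule power2_le_imp_le) simp
qed

lemma L2_inner_cong_AE:
  fixes f g h :: "'a::euclidean_space \<Rightarrow> 'b::euclidean_space"
  assumes D: "D \<in> sets lebesgue" and f: "f \<in> borel_measurable (lebesgue_on D)" and g: "g \<in> borel_measurable (lebesgue_on D)"
    and ae: "AE x in lebesgue_on D. g x = h x"
  shows "L2_inner D f g = L2_inner D f h"
proof -
  have [measurable]: "f \<in> borel_measurable (lebesgue_on D)" "g \<in> borel_measurable (lebesgue_on D)" "h \<in> borel_measurable (lebesgue_on D)"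
    using f g AE_lebesgue_on_measurable[OF D g ae] by auto
  show ?thesis
    unfolding L2_inner_def by (rule integral_cong_AE) (use ae in \<open>auto elim!: eventually_mono\<close>)
qed

lemma L2_inner_diff_right:
  fixes f g h :: "'a::euclidean_space \<Rightarrow> 'b::euclidean_space"
  assumes "f \<in> elems (L2 D)" "g \<in> elems (L2 D)" "h \<in> elems (L2 D)"
  shows "L2_inner D f (\<lambda>x. g x - h x) = L2_inner D f g - L2_inner D f h"
  using L2_inner_diff_left[OF assms(2,3,1)] by (simp add: L2_inner_commute)

text \<open>The chosen derivatives are additive only almost everywhere, which the integral does not
  notice.\<close>

lemma L2_inner_wpartial_diff:
  assumes D: "open D" and h: "h \<in> elems (L2 D)" and p: "p \<in> elems (H1 D)" and q: "q \<in> elems (H1 D)" and b: "b \<in> Basis"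
  shows "L2_inner D h (wpartial D b (\<lambda>x. p x - q x)) = L2_inner D h (wpartial D b p) - L2_inner D h (wpartial D b q)"
proof -
  have "L2_inner D h (wpartial D b (\<lambda>x. p x - q x)) = L2_inner D h (\<lambda>x. wpartial D b p x - wpartial D b q x)"
    using D h H1_wpartial_L2[OF D H1_diff[OF D p q] b] wpartial_diff_AE[OF D p q b]
    by (intro L2_inner_cong_AE) (auto simp: L2_iff borel_open)
  then show ?thesis
    by (simp add: L2_inner_diff_right[OF h H1_wpartial_L2[OF D p b] H1_wpartial_L2[OF D q b]])
qed

lemma nrm_L2_wpartial_diff:
  assumes D: "open D" and p: "p \<in> elems (H1 D)" and q: "q \<in> elems (H1 D)" and b: "b \<in> Basis"
  shows "nrm (L2 D) (\<lambda>x. wpartial D b p x - wpartial D b q x) \<le> nrm (H1 D) (\<lambda>x. p x - q x)"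
proof -
  have "nrm (L2 D) (wpartial D b (\<lambda>x. p x - q x)) = nrm (L2 D) (\<lambda>x. wpartial D b p x - wpartial D b q x)"
    using D H1_wpartial_L2[OF D H1_diff[OF D p q] b] wpartial_diff_AE[OF D p q b]
    by (intro nrm_L2_cong_AE) (auto simp: L2_iff borel_open)
  then show ?thesis using nrm_L2_wpartial_le_H1[OF b, of D "\<lambda>x. p x - q x"] by simp
qed

section \<open>The reaction term\<close>

definition saturation :: "real \<Rightarrow> real^3 \<Rightarrow> real^3" where
  "saturation \<mu> a = (1 + \<mu> * (norm a)\<^sup>2) *\<^sub>R a"

lemma borel_measurable_saturation [measurable]:
  "f \<in> borel_measurable M \<Longrightarrow> (\<lambda>x. saturation \<mu> (f x)) \<in> borel_measurable M"
  unfolding saturation_def by measurable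

lemma norm_saturation_le: "0 \<le> \<mu> \<Longrightarrow> norm (saturation \<mu> a) \<le> norm a + \<mu> * ((norm a)\<^sup>2 * norm a)"
  by (simp add: saturation_def distrib_right mult.assoc)

text \<open>The map is the gradient of a convex function. The computation estimates the mixed term
  by Cauchy-Schwarz and is left, for the two norms \<open>x\<close> and \<open>y\<close>, with
  \<open>x ^ 4 + y ^ 4 - (x\<^sup>2 + y\<^sup>2) * x * y = (x - y)\<^sup>2 * (x\<^sup>2 + x * y +
  y\<^sup>2)\<close>.\<close>

lemma saturation_monotone:
  assumes "0 \<le> \<mu>"
  shows "0 \<le> (saturation \<mu> a - saturation \<mu> c) \<bullet> (a - c)"
proof -
  have "(saturation \<mu> a - saturation \<mu> c) \<bullet> (a - c) =
    (a - c) \<bullet> (a - c) + \<mu> * ((norm a)\<^sup>2 * (a \<bullet> a) + (norm c)\<^sup>2 * (c \<bullet> c) - ((norm a)\<^sup>2 + (norm c)\<^sup>2) * (a \<bullet> c))"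
    by (simp add: saturation_def inner_diff_left inner_diff_right inner_add_left inner_add_right inner_commute algebra_simps)
  moreover have "((norm a)\<^sup>2 + (norm c)\<^sup>2) * (a \<bullet> c) \<le> ((norm a)\<^sup>2 + (norm c)\<^sup>2) * (norm a * norm c)"
    by (intro mult_left_mono norm_cauchy_schwarz) auto
  moreover have "0 \<le> (norm a - norm c)\<^sup>2 * ((norm a)\<^sup>2 + norm a * norm c + (norm c)\<^sup>2)"
    by (intro mult_nonneg_nonneg add_nonneg_nonneg) auto
  then have "((norm a)\<^sup>2 + (norm c)\<^sup>2) * (norm a * norm c) \<le> (norm a)\<^sup>2 * (norm a)\<^sup>2 + (norm c)\<^sup>2 * (norm c)\<^sup>2"
    by (simp add: power2_eq_square algebra_simps)
  ultimately show ?thesis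
    using assms by (simp add: power2_norm_eq_inner[symmetric])
qed

text \<open>This serves the continuity along sequences converging in \<open>H1\<close>, hence the
  bound by the limit \<open>c\<close> and the increment \<open>g\<close> alone. The constant 5 is
  crude: \<open>3 * x\<^sup>2 + 3 * x * y + y\<^sup>2\<close> is bounded by means of
  \<open>2 * x * y \<le> x\<^sup>2 + y\<^sup>2\<close>.\<close>

lemma saturation_diff_le:
  assumes "0 \<le> \<mu>"
  shows "norm (saturation \<mu> (c + g) - saturation \<mu> c) \<le> norm g + 5 * \<mu> * (((norm c)\<^sup>2 + (norm g)\<^sup>2) * norm g)"
proof -
  define x y where "x = norm c" and "y = norm g"
  have xy: "0 \<le> x" "0 \<le> y" by (auto simp: x_def y_def)
  have z: "norm (c + g) \<le> x + y" unfolding x_def y_def by (rule norm_triangle_ineq)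
  have n2: "(norm (c + g))\<^sup>2 \<le> (x + y)\<^sup>2" using z by (rule power_mono) simp
  have d: "\<bar>(norm (c + g))\<^sup>2 - x\<^sup>2\<bar> \<le> y * (2 * x + y)"
  proof -
    have "(norm (c + g))\<^sup>2 - x\<^sup>2 = (norm (c + g) - x) * (norm (c + g) + x)"
      by (simp add: power2_eq_square algebra_simps)
    then have "\<bar>(norm (c + g))\<^sup>2 - x\<^sup>2\<bar> = \<bar>norm (c + g) - x\<bar> * (norm (c + g) + x)"
      using xy by (simp add: abs_mult)
    also have "\<dots> \<le> y * (2 * x + y)"
      using z xy norm_triangle_ineq3[of "c + g" c] by (intro mult_mono) (auto simp: x_def y_def)
    finally show ?thesis .
  qed
  have "saturation \<mu> (c + g) - saturation \<mu> c = g + \<mu> *\<^sub>R ((norm (c + g))\<^sup>2 *\<^sub>R g + ((norm (c + g))\<^sup>2 - x\<^sup>2) *\<^sub>R c)"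
    by (simp add: saturation_def x_def algebra_simps)
  then have "norm (saturation \<mu> (c + g) - saturation \<mu> c) \<le> y + \<mu> * norm ((norm (c + g))\<^sup>2 *\<^sub>R g + ((norm (c + g))\<^sup>2 - x\<^sup>2) *\<^sub>R c)"
    using assms norm_triangle_ineq[of g "\<mu> *\<^sub>R ((norm (c + g))\<^sup>2 *\<^sub>R g + ((norm (c + g))\<^sup>2 - x\<^sup>2) *\<^sub>R c)"] by (simp add: y_def)
  also have "\<dots> \<le> y + \<mu> * (5 * ((x\<^sup>2 + y\<^sup>2) * y))"
  proof (intro add_left_mono mult_left_mono assms)
    have "norm ((norm (c + g))\<^sup>2 *\<^sub>R g + ((norm (c + g))\<^sup>2 - x\<^sup>2) *\<^sub>R c) \<le> (norm (c + g))\<^sup>2 * y + \<bar>(norm (c + g))\<^sup>2 - x\<^sup>2\<bar> * x"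
      by (rule order_trans[OF norm_triangle_ineq]) (simp add: x_def y_def)
    also have "\<dots> \<le> (x + y)\<^sup>2 * y + (y * (2 * x + y)) * x"
      using n2 d xy by (intro add_mono mult_right_mono)
    also have "\<dots> \<le> 5 * ((x\<^sup>2 + y\<^sup>2) * y)"
    proof -
      have "(x + y)\<^sup>2 * y + (y * (2 * x + y)) * x = (3 * x\<^sup>2 + 3 * (x * y) + y\<^sup>2) * y"
        by (simp add: power2_eq_square algebra_simps)
      also have "\<dots> \<le> (5 * (x\<^sup>2 + y\<^sup>2)) * y"
      proof (intro mult_right_mono xy)
        have "x\<^sup>2 + y\<^sup>2 \<ge> 2 * (x * y)" using sum_squares_bound[of x y] by simp
        moreover have "0 \<le> x * y" using xy by simp
        moreover have gen: "3 * X + 3 * p + Y \<le> 5 * (X + Y)" if "2 * p \<le> X + Y" "0 \<le> p" "0 \<le> X" "0 \<le> Y" for p X Y :: real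
          using that by (simp add: algebra_simps)
        ultimately show "3 * x\<^sup>2 + 3 * (x * y) + y\<^sup>2 \<le> 5 * (x\<^sup>2 + y\<^sup>2)"
          by (intro gen) auto
      qed
      finally show ?thesis by (simp only: mult.assoc)
    qed
    finally show "norm ((norm (c + g))\<^sup>2 *\<^sub>R g + ((norm (c + g))\<^sup>2 - x\<^sup>2) *\<^sub>R c) \<le> 5 * ((x\<^sup>2 + y\<^sup>2) * y)" .
  qed
  finally show ?thesis by (simp add: x_def y_def)
qed

text \<open>The spatial part of the weak formulation with \<phi> as test function. It is linear in
  \<phi> but not in \<open>f\<close>.\<close>

definition llb_form :: "'a::euclidean_space set \<Rightarrow> real \<Rightarrow> real \<Rightarrow> real \<Rightarrow> real \<Rightarrow> ('a \<Rightarrow> real^3) \<Rightarrow> ('a \<Rightarrow> real^3) \<Rightarrow> real" where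
  "llb_form D \<kappa>1 \<kappa>2 \<mu> \<gamma> f \<phi> =
     \<kappa>1 * grad_inner D f \<phi> + \<gamma> * cross_grad_inner D f f \<phi> + \<kappa>2 * L2_inner D (\<lambda>x. saturation \<mu> (f x)) \<phi>"

lemma in_L4_triple:
  fixes f g h k :: "'a::euclidean_space \<Rightarrow> real^3"
  assumes f: "in_L4 D f" and g: "in_L4 D g" and h: "in_L4 D h"
  shows "integrable (lebesgue_on D) (\<lambda>x. (norm (f x))\<^sup>2 * (norm (g x) * norm (h x)))"
    and "(LINT x|lebesgue_on D. (norm (f x))\<^sup>2 * (norm (g x) * norm (h x))) \<le> L4sq D f * sqrt (L4sq D g * L4sq D h)"
proof -
  have f2: "(\<lambda>x. (norm (f x))\<^sup>2) \<in> elems (L2 D)" using f by (simp add: in_L4_def)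
  note gh = in_L4_mult[OF g h]
  show "integrable (lebesgue_on D) (\<lambda>x. (norm (f x))\<^sup>2 * (norm (g x) * norm (h x)))"
    using L2_integrable_norm_mult[OF f2 gh(1)] by simp
  have "(LINT x|lebesgue_on D. (norm (f x))\<^sup>2 * (norm (g x) * norm (h x))) \<le> L4sq D f * nrm (L2 D) (\<lambda>x. norm (g x) * norm (h x))"
    using L2_Cauchy_Schwarz[OF f2 gh(1)] by (simp add: L4sq_def)
  also have "\<dots> \<le> L4sq D f * sqrt (L4sq D g * L4sq D h)"
    by (intro mult_left_mono real_le_rsqrt gh(2)) simp
  finally show "(LINT x|lebesgue_on D. (norm (f x))\<^sup>2 * (norm (g x) * norm (h x))) \<le> L4sq D f * sqrt (L4sq D g * L4sq D h)" .
qed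

lemma cross3_L2:
  assumes f: "in_L4 D f" and g: "in_L4 D g"
  shows "(\<lambda>x. cross3 (f x) (g x)) \<in> elems (L2 D)" "nrm (L2 D) (\<lambda>x. cross3 (f x) (g x)) \<le> sqrt (L4sq D f * L4sq D g)"
proof -
  have [measurable]: "f \<in> borel_measurable (lebesgue_on D)" "g \<in> borel_measurable (lebesgue_on D)"
    using f g by (auto simp: in_L4_def)
  note fg = in_L4_mult[OF f g]
  have m: "(\<lambda>x. cross3 (f x) (g x)) \<in> borel_measurable (lebesgue_on D)" by measurable
  have le: "norm (cross3 (f x) (g x)) \<le> norm (norm (f x) * norm (g x))" for x using norm_cross3_le by simp
  show "(\<lambda>x. cross3 (f x) (g x)) \<in> elems (L2 D)" by (rule L2_dominated(1)[OF fg(1) m le])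
  have "nrm (L2 D) (\<lambda>x. cross3 (f x) (g x)) \<le> nrm (L2 D) (\<lambda>x. norm (f x) * norm (g x))"
    by (rule L2_dominated(2)[OF fg(1) m le])
  also have "\<dots> \<le> sqrt (L4sq D f * L4sq D g)" by (rule real_le_rsqrt) (rule fg(2))
  finally show "nrm (L2 D) (\<lambda>x. cross3 (f x) (g x)) \<le> sqrt (L4sq D f * L4sq D g)" .
qed

text \<open>The cubic term is not placed in \<open>L2\<close>, which would ask for sixth powers. It
  is paired with the test function as |f|^2 times |f| |p|, two factors that lie in \<open>L2\<close>
  by the L4 bounds.\<close>

lemma saturation_integrable:
  assumes \<mu>: "0 \<le> \<mu>" and f: "in_L4 D f" "f \<in> elems (L2 D)" and p: "in_L4 D p" "p \<in> elems (L2 D)"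
  shows "integrable (lebesgue_on D) (\<lambda>x. saturation \<mu> (f x) \<bullet> p x)"
    and "\<bar>L2_inner D (\<lambda>x. saturation \<mu> (f x)) p\<bar> \<le> nrm (L2 D) f * nrm (L2 D) p + \<mu> * (L4sq D f * sqrt (L4sq D f * L4sq D p))"
proof -
  have [measurable]: "f \<in> borel_measurable (lebesgue_on D)" "p \<in> borel_measurable (lebesgue_on D)"
    using f p by (auto simp: in_L4_def)
  let ?B = "\<lambda>x. norm (f x) * norm (p x) + \<mu> * ((norm (f x))\<^sup>2 * (norm (f x) * norm (p x)))"
  note t = in_L4_triple[OF f(1) f(1) p(1)] and m = L2_integrable_norm_mult[OF f(2) p(2)]
  have B: "integrable (lebesgue_on D) ?B" using t(1) m by simp
  have le: "\<bar>saturation \<mu> (f x) \<bullet> p x\<bar> \<le> ?B x" for x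
  proof -
    have "\<bar>saturation \<mu> (f x) \<bullet> p x\<bar> \<le> norm (saturation \<mu> (f x)) * norm (p x)" by (rule Cauchy_Schwarz_ineq2)
    also have "\<dots> \<le> (norm (f x) + \<mu> * ((norm (f x))\<^sup>2 * norm (f x))) * norm (p x)"
      by (intro mult_right_mono norm_saturation_le \<mu>) simp
    finally show ?thesis by (simp add: algebra_simps)
  qed
  show int: "integrable (lebesgue_on D) (\<lambda>x. saturation \<mu> (f x) \<bullet> p x)"
  proof (rule Bochner_Integration.integrable_bound[OF B])
    show "AE x in lebesgue_on D. norm (saturation \<mu> (f x) \<bullet> p x) \<le> norm (?B x)"
      using le by (intro AE_I2) (smt (verit) real_norm_def)
  qed measurable
  have "\<bar>L2_inner D (\<lambda>x. saturation \<mu> (f x)) p\<bar> \<le> (LINT x|lebesgue_on D. norm (saturation \<mu> (f x) \<bullet> p x))"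
    unfolding L2_inner_def using integral_norm_bound[of "lebesgue_on D" "\<lambda>x. saturation \<mu> (f x) \<bullet> p x"] by simp
  also have "\<dots> \<le> (LINT x|lebesgue_on D. ?B x)"
    using int B le by (intro integral_mono) auto
  also have "\<dots> = (LINT x|lebesgue_on D. norm (f x) * norm (p x)) + \<mu> * (LINT x|lebesgue_on D. (norm (f x))\<^sup>2 * (norm (f x) * norm (p x)))"
    using t(1) m by simp
  also have "\<dots> \<le> nrm (L2 D) f * nrm (L2 D) p + \<mu> * (L4sq D f * sqrt (L4sq D f * L4sq D p))"
    by (intro add_mono mult_left_mono \<mu> t(2) L2_Cauchy_Schwarz f p)
  finally show "\<bar>L2_inner D (\<lambda>x. saturation \<mu> (f x)) p\<bar> \<le> nrm (L2 D) f * nrm (L2 D) p + \<mu> * (L4sq D f * sqrt (L4sq D f * L4sq D p))" .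
qed

section \<open>Bounds and one-sided monotonicity of the form\<close>

context polytopal
begin

lemma H1plus_D:
  assumes f: "f \<in> elems (H1plus D \<alpha>)"
  shows "f \<in> elems (H1 D)" "b \<in> Basis \<Longrightarrow> wpartial D b f \<in> elems (Hs D \<alpha>)"
    "b \<in> Basis \<Longrightarrow> nrm (Hs D \<alpha>) (wpartial D b f) \<le> nrm (H1plus D \<alpha>) f" "nrm (H1 D) f \<le> nrm (H1plus D \<alpha>) f"
proof -
  show f1: "f \<in> elems (H1 D)" and w: "b \<in> Basis \<Longrightarrow> wpartial D b f \<in> elems (Hs D \<alpha>)" for b
    using f by (auto simp: H1plus_def)
  have sq: "(nrm (H1plus D \<alpha>) f)\<^sup>2 = (nrm (L2 D) f)\<^sup>2 + (\<Sum>b\<in>Basis. (nrm (Hs D \<alpha>) (wpartial D b f))\<^sup>2)"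
    by (simp add: H1plus_def sum_nonneg)
  have n: "0 \<le> nrm (H1plus D \<alpha>) f" by (simp add: H1plus_def sum_nonneg)
  show "nrm (Hs D \<alpha>) (wpartial D b f) \<le> nrm (H1plus D \<alpha>) f" if "b \<in> Basis"
    by (rule power2_le_imp_le[OF _ n]) (use that in \<open>auto simp: sq intro!: add_increasing member_le_sum\<close>)
  show "nrm (H1 D) f \<le> nrm (H1plus D \<alpha>) f"
    by (rule power2_le_imp_le[OF _ n])
       (auto simp: sq nrm_H1_power2 intro!: sum_mono power_mono Hs_imp_L2(2) w)
qed

lemma nrm_H1plus_nonneg: "0 \<le> nrm (H1plus D \<alpha>) f"
  by (simp add: H1plus_def sum_nonneg)

text \<open>A fixed choice of the constant in \<open>in_L4_bounds\<close>, common to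
  \<open>H1\<close> and \<open>Hs\<close>, so that later statements can name it.\<close>

definition K4 :: real where
  "K4 = (SOME K. 0 < K \<and> (\<forall>w::'a \<Rightarrow> real^3. w \<in> elems (H1 D) \<longrightarrow> in_L4 D w \<and> L4sq D w \<le> K * (nrm (H1 D) w)\<^sup>2) \<and>
     (\<forall>f::'a \<Rightarrow> real^3. f \<in> elems (Hs D \<alpha>) \<longrightarrow> in_L4 D f \<and> L4sq D f \<le> K * (nrm (Hs D \<alpha>) f)\<^sup>2))"

lemma K4: "0 < K4"
  and H1_L4: "w \<in> elems (H1 D) \<Longrightarrow> in_L4 D w" "w \<in> elems (H1 D) \<Longrightarrow> L4sq D w \<le> K4 * (nrm (H1 D) w)\<^sup>2"
  and Hs_L4: "f \<in> elems (Hs D \<alpha>) \<Longrightarrow> in_L4 D f" "f \<in> elems (Hs D \<alpha>) \<Longrightarrow> L4sq D f \<le> K4 * (nrm (Hs D \<alpha>) f)\<^sup>2"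
  for w f :: "'a \<Rightarrow> real^3"
proof -
  have "\<exists>K. 0 < K \<and> (\<forall>w::'a \<Rightarrow> real^3. w \<in> elems (H1 D) \<longrightarrow> in_L4 D w \<and> L4sq D w \<le> K * (nrm (H1 D) w)\<^sup>2) \<and>
     (\<forall>f::'a \<Rightarrow> real^3. f \<in> elems (Hs D \<alpha>) \<longrightarrow> in_L4 D f \<and> L4sq D f \<le> K * (nrm (Hs D \<alpha>) f)\<^sup>2)"
    using in_L4_bounds by blast
  from someI_ex[OF this, folded K4_def]
  show "0 < K4" "w \<in> elems (H1 D) \<Longrightarrow> in_L4 D w" "w \<in> elems (H1 D) \<Longrightarrow> L4sq D w \<le> K4 * (nrm (H1 D) w)\<^sup>2"
    "f \<in> elems (Hs D \<alpha>) \<Longrightarrow> in_L4 D f" "f \<in> elems (Hs D \<alpha>) \<Longrightarrow> L4sq D f \<le> K4 * (nrm (Hs D \<alpha>) f)\<^sup>2"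
    for w f :: "'a \<Rightarrow> real^3" by blast+
qed

lemma sqrt_L4sq_le:
  assumes "L4sq D f \<le> K4 * x\<^sup>2" "L4sq D g \<le> K4 * y\<^sup>2" "0 \<le> x" "0 \<le> y"
  shows "sqrt (L4sq D f * L4sq D g) \<le> K4 * (x * y)"
proof -
  have "L4sq D f * L4sq D g \<le> (K4 * x\<^sup>2) * (K4 * y\<^sup>2)"
    using assms K4 by (intro mult_mono) auto
  also have "\<dots> = (K4 * (x * y))\<^sup>2" by (simp add: power_mult_distrib power2_eq_square)
  finally show ?thesis
    using K4 assms by (intro real_le_lsqrt) auto
qed

text \<open>The norm of \<open>H1plus\<close>, for which a weak solution offers only square
  integrability in time, enters linearly; everything else is controlled by \<open>H1\<close>. The
  bound serves twice: for continuity in the test function and, with coefficients 0 and 1, for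
  integrability in time of the single terms.\<close>

lemma llb_form_bound:
  assumes \<mu>: "0 \<le> \<mu>"
  shows "\<exists>K\<ge>0. \<forall>f p. f \<in> elems (H1plus D \<alpha>) \<longrightarrow> p \<in> elems (H1 D) \<longrightarrow>
    \<bar>llb_form D \<kappa>1 \<kappa>2 \<mu> \<gamma> f p\<bar> \<le> K * (nrm (H1 D) f + nrm (H1 D) f * nrm (H1plus D \<alpha>) f + nrm (H1 D) f ^ 3) * nrm (H1 D) p"
proof -
  let ?d = "real DIM('a)"
  define K where "K = \<bar>\<kappa>1\<bar> * ?d + \<bar>\<gamma>\<bar> * (?d * K4) + \<bar>\<kappa>2\<bar> * (1 + \<mu> * K4\<^sup>2)"
  have K0: "0 \<le> K" using K4 \<mu> by (simp add: K_def)
  have "\<bar>llb_form D \<kappa>1 \<kappa>2 \<mu> \<gamma> f p\<bar> \<le> K * (nrm (H1 D) f + nrm (H1 D) f * nrm (H1plus D \<alpha>) f + nrm (H1 D) f ^ 3) * nrm (H1 D) p"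
    if f: "f \<in> elems (H1plus D \<alpha>)" and p: "p \<in> elems (H1 D)" for f p
  proof -
    define x y z where "x = nrm (H1 D) f" and "y = nrm (H1plus D \<alpha>) f" and "z = nrm (H1 D) p"
    have xyz: "0 \<le> x" "0 \<le> y" "0 \<le> z" by (auto simp: x_def y_def z_def nrm_H1plus_nonneg)
    note f1 = H1plus_D(1)[OF f]
    have g: "\<bar>grad_inner D f p\<bar> \<le> ?d * (x * z)"
    proof -
      have "\<bar>grad_inner D f p\<bar> \<le> (\<Sum>b\<in>(Basis::'a set). \<bar>L2_inner D (wpartial D b f) (wpartial D b p)\<bar>)"
        unfolding grad_inner_def by (rule sum_abs)
      also have "\<dots> \<le> (\<Sum>b\<in>(Basis::'a set). x * z)"
      proof (rule sum_mono)
        fix b :: 'a assume b: "b \<in> Basis"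
        have "\<bar>L2_inner D (wpartial D b f) (wpartial D b p)\<bar> \<le> nrm (L2 D) (wpartial D b f) * nrm (L2 D) (wpartial D b p)"
          by (intro L2_inner_bound H1_wpartial_L2 D_open f1 p b)
        also have "\<dots> \<le> x * z"
          unfolding x_def z_def by (intro mult_mono nrm_L2_wpartial_le_H1 b) auto
        finally show "\<bar>L2_inner D (wpartial D b f) (wpartial D b p)\<bar> \<le> x * z" .
      qed
      finally show ?thesis by simp
    qed
    have c: "\<bar>cross_grad_inner D f f p\<bar> \<le> ?d * (K4 * (x * y) * z)"
    proof -
      have "\<bar>cross_grad_inner D f f p\<bar> \<le> (\<Sum>b\<in>(Basis::'a set). \<bar>L2_inner D (\<lambda>x. cross3 (f x) (wpartial D b f x)) (wpartial D b p)\<bar>)"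
        unfolding cross_grad_inner_def by (rule sum_abs)
      also have "\<dots> \<le> (\<Sum>b\<in>(Basis::'a set). K4 * (x * y) * z)"
      proof (rule sum_mono)
        fix b :: 'a assume b: "b \<in> Basis"
        note fL = H1_L4[OF f1] and wL = Hs_L4[OF H1plus_D(2)[OF f b]]
        have "L4sq D (wpartial D b f) \<le> K4 * y\<^sup>2"
          using wL(2) H1plus_D(3)[OF f b] K4 Hs_nonneg
          by (smt (verit) mult_left_mono power_mono y_def)
        then have "sqrt (L4sq D f * L4sq D (wpartial D b f)) \<le> K4 * (x * y)"
          using fL(2) xyz by (intro sqrt_L4sq_le) (auto simp: x_def)
        then have "nrm (L2 D) (\<lambda>x. cross3 (f x) (wpartial D b f x)) \<le> K4 * (x * y)"
          using cross3_L2(2)[OF fL(1) wL(1)] by linarith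
        then have "nrm (L2 D) (\<lambda>x. cross3 (f x) (wpartial D b f x)) * nrm (L2 D) (wpartial D b p) \<le> (K4 * (x * y)) * z"
          unfolding z_def using K4 xyz by (intro mult_mono nrm_L2_wpartial_le_H1 b) auto
        then show "\<bar>L2_inner D (\<lambda>x. cross3 (f x) (wpartial D b f x)) (wpartial D b p)\<bar> \<le> K4 * (x * y) * z"
          using L2_inner_bound[OF cross3_L2(1)[OF fL(1) wL(1)] H1_wpartial_L2[OF D_open p b]] by linarith
      qed
      finally show ?thesis by simp
    qed
    have s: "\<bar>L2_inner D (\<lambda>x. saturation \<mu> (f x)) p\<bar> \<le> x * z + \<mu> * (K4 * x\<^sup>2 * (K4 * (x * z)))"
    proof -
      have "\<bar>L2_inner D (\<lambda>x. saturation \<mu> (f x)) p\<bar> \<le> nrm (L2 D) f * nrm (L2 D) p + \<mu> * (L4sq D f * sqrt (L4sq D f * L4sq D p))"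
        by (intro saturation_integrable \<mu> H1_L4 H1_imp_L2 f1 p)
      also have "\<dots> \<le> x * z + \<mu> * (K4 * x\<^sup>2 * (K4 * (x * z)))"
        using xyz K4 H1_L4(2)[OF f1] H1_L4(2)[OF p] unfolding x_def z_def
        by (intro add_mono mult_mono mult_left_mono \<mu> nrm_L2_le_H1 sqrt_L4sq_le) auto
      finally show ?thesis .
    qed
    have "\<bar>llb_form D \<kappa>1 \<kappa>2 \<mu> \<gamma> f p\<bar> \<le> \<bar>\<kappa>1\<bar> * \<bar>grad_inner D f p\<bar> + \<bar>\<gamma>\<bar> * \<bar>cross_grad_inner D f f p\<bar> + \<bar>\<kappa>2\<bar> * \<bar>L2_inner D (\<lambda>x. saturation \<mu> (f x)) p\<bar>"
      unfolding llb_form_def abs_mult[symmetric] by linarith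
    also have "\<dots> \<le> \<bar>\<kappa>1\<bar> * (?d * (x * z)) + \<bar>\<gamma>\<bar> * (?d * (K4 * (x * y) * z)) + \<bar>\<kappa>2\<bar> * (x * z + \<mu> * (K4 * x\<^sup>2 * (K4 * (x * z))))"
      by (intro add_mono mult_left_mono g c s) auto
    also have "\<dots> = (\<bar>\<kappa>1\<bar> * ?d + \<bar>\<kappa>2\<bar>) * (x * z) + (\<bar>\<gamma>\<bar> * (?d * K4)) * ((x * y) * z) + (\<bar>\<kappa>2\<bar> * (\<mu> * K4\<^sup>2)) * (x ^ 3 * z)"
      by (simp add: algebra_simps power2_eq_square power3_eq_cube)
    also have "\<dots> \<le> K * (x * z) + K * ((x * y) * z) + K * (x ^ 3 * z)"
      using xyz K4 \<mu> by (intro add_mono mult_right_mono) (auto simp: K_def algebra_simps)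
    finally show ?thesis by (simp add: x_def y_def z_def algebra_simps)
  qed
  then show ?thesis using K0 by blast
qed

lemma llb_form_diff_right:
  assumes \<mu>: "0 \<le> \<mu>" and f: "f \<in> elems (H1plus D \<alpha>)" and p: "p \<in> elems (H1 D)" and q: "q \<in> elems (H1 D)"
  shows "llb_form D \<kappa>1 \<kappa>2 \<mu> \<gamma> f (\<lambda>x. p x - q x) = llb_form D \<kappa>1 \<kappa>2 \<mu> \<gamma> f p - llb_form D \<kappa>1 \<kappa>2 \<mu> \<gamma> f q"
proof -
  note f1 = H1plus_D(1)[OF f]
  have 1: "grad_inner D f (\<lambda>x. p x - q x) = grad_inner D f p - grad_inner D f q"
    using H1_wpartial_L2[OF D_open f1]
    by (simp add: grad_inner_def L2_inner_wpartial_diff[OF D_open _ p q] sum_subtractf)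
  have 2: "cross_grad_inner D f f (\<lambda>x. p x - q x) = cross_grad_inner D f f p - cross_grad_inner D f f q"
    using cross3_L2(1)[OF H1_L4(1)[OF f1] Hs_L4(1)[OF H1plus_D(2)[OF f]]]
    by (simp add: cross_grad_inner_def L2_inner_wpartial_diff[OF D_open _ p q] sum_subtractf)
  have 3: "L2_inner D (\<lambda>x. saturation \<mu> (f x)) (\<lambda>x. p x - q x) = L2_inner D (\<lambda>x. saturation \<mu> (f x)) p - L2_inner D (\<lambda>x. saturation \<mu> (f x)) q"
    using saturation_integrable(1)[OF \<mu> H1_L4(1)[OF f1] H1_imp_L2[OF f1] H1_L4(1) H1_imp_L2] p q
    by (simp add: L2_inner_def inner_diff_right)
  show ?thesis
    unfolding llb_form_def 1 2 3 by (simp add: algebra_simps)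
qed

text \<open>In the difference of the cross product terms, \<open>u \<times> \<nabla>u - v \<times> \<nabla>v = w \<times> \<nabla>u + v \<times> \<nabla>w\<close> for
  \<open>w = u - v\<close>, and the last term is orthogonal to \<open>\<nabla>w\<close>.\<close>

lemma llb_form_monotone:
  assumes \<kappa>1: "0 < \<kappa>1" and \<kappa>2: "0 \<le> \<kappa>2" and \<mu>: "0 \<le> \<mu>"
  shows "\<exists>B\<ge>0. \<forall>f g. f \<in> elems (H1plus D \<alpha>) \<longrightarrow> nrm (H1plus D \<alpha>) f \<le> M \<longrightarrow> g \<in> elems (H1plus D \<alpha>) \<longrightarrow>
    - B * (nrm (L2 D) (\<lambda>x. f x - g x))\<^sup>2 \<le>
      llb_form D \<kappa>1 \<kappa>2 \<mu> \<gamma> f (\<lambda>x. f x - g x) - llb_form D \<kappa>1 \<kappa>2 \<mu> \<gamma> g (\<lambda>x. f x - g x)"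
proof -
  let ?d = "real DIM('a)"
  have d: "0 < ?d" by simp
  define \<gamma>' where "\<gamma>' = \<bar>\<gamma>\<bar> + 1"
  have \<gamma>': "0 < \<gamma>'" "\<bar>\<gamma>\<bar> \<le> \<gamma>'" by (auto simp: \<gamma>'_def)
  \<comment> \<open>The weight of Young's inequality: multiplied by \<gamma>', the share
    \<open>\<eta> * E\<close> is exactly the coercive term \<open>\<kappa>1 * E\<close>. The divisor
    is \<gamma>' because \<gamma> may be 0.\<close>
  define \<eta> where "\<eta> = \<kappa>1 / \<gamma>'"
  have \<eta>: "0 < \<eta>" using \<kappa>1 \<gamma>' by (simp add: \<eta>_def)
  \<comment> \<open>Half of \<open>\<eta>\<close> is spent on Young's inequality itself and the
    other half on the gradient part of the product bound, summed over the directions: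
    \<open>d * \<delta> / (2 * \<eta>) = \<eta> / 2\<close>.\<close>
  define \<delta> where "\<delta> = \<eta>\<^sup>2 / ?d"
  have \<delta>: "0 < \<delta>" using \<eta> d by (simp add: \<delta>_def)
  obtain B where B: "0 \<le> B" "\<forall>(f::'a \<Rightarrow> real^3) (w::'a \<Rightarrow> real^3). f \<in> elems (Hs D \<alpha>) \<longrightarrow> nrm (Hs D \<alpha>) f \<le> M \<longrightarrow> w \<in> elems (H1 D) \<longrightarrow>
     (nrm (L2 D) (\<lambda>x. norm (w x) * norm (f x)))\<^sup>2 \<le> \<delta> * (nrm (H1 D) w)\<^sup>2 + B * (nrm (L2 D) w)\<^sup>2"
    using product_bound[OF \<delta>, of M] by blast
  define B' where "B' = \<gamma>' * (?d * ((\<delta> + B) / (2 * \<eta>)))"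
  have B': "0 \<le> B'" using \<gamma>' \<delta> B \<eta> by (simp add: B'_def)
  have "- B' * (nrm (L2 D) (\<lambda>x. f x - g x))\<^sup>2 \<le>
      llb_form D \<kappa>1 \<kappa>2 \<mu> \<gamma> f (\<lambda>x. f x - g x) - llb_form D \<kappa>1 \<kappa>2 \<mu> \<gamma> g (\<lambda>x. f x - g x)"
    if f: "f \<in> elems (H1plus D \<alpha>)" and fM: "nrm (H1plus D \<alpha>) f \<le> M" and g: "g \<in> elems (H1plus D \<alpha>)" for f g
  proof -
    define w where "w = (\<lambda>x. f x - g x)"
    note f1 = H1plus_D(1)[OF f] and g1 = H1plus_D(1)[OF g]
    have w: "w \<in> elems (H1 D)" unfolding w_def by (rule H1_diff[OF D_open f1 g1])
    define E where "E = (\<Sum>b\<in>(Basis::'a set). (nrm (L2 D) (wpartial D b w))\<^sup>2)"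
    define n where "n = (nrm (L2 D) w)\<^sup>2"
    have wE: "(nrm (H1 D) w)\<^sup>2 = n + E" by (simp add: nrm_H1_power2 E_def n_def)
    have wp: "AE x in lebesgue_on D. wpartial D b w x = wpartial D b f x - wpartial D b g x" if "b \<in> Basis" for b
      unfolding w_def by (rule wpartial_diff_AE[OF D_open f1 g1 that])
    have gr: "grad_inner D f w - grad_inner D g w = E"
    proof -
      have "L2_inner D (wpartial D b f) (wpartial D b w) - L2_inner D (wpartial D b g) (wpartial D b w) = (nrm (L2 D) (wpartial D b w))\<^sup>2" if b: "b \<in> Basis" for b
        using L2_inner_wpartial_diff[OF D_open H1_wpartial_L2[OF D_open w b] f1 g1 b]
        by (simp add: L2_inner_self[symmetric] w_def[symmetric] L2_inner_commute)
      then show ?thesis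
        by (simp add: grad_inner_def E_def sum_subtractf[symmetric])
    qed
    have cr: "\<bar>cross_grad_inner D f f w - cross_grad_inner D g g w\<bar> \<le> \<eta> * E + ?d * ((\<delta> + B) / (2 * \<eta>)) * n"
    proof -
      have tm: "\<bar>L2_inner D (\<lambda>x. cross3 (f x) (wpartial D b f x)) (wpartial D b w) - L2_inner D (\<lambda>x. cross3 (g x) (wpartial D b g x)) (wpartial D b w)\<bar>
         \<le> (\<delta> * (n + E) + B * n) / (2 * \<eta>) + \<eta> / 2 * (nrm (L2 D) (wpartial D b w))\<^sup>2" if b: "b \<in> Basis" for b
      proof -
        note cf = cross3_L2(1)[OF H1_L4(1)[OF f1] Hs_L4(1)[OF H1plus_D(2)[OF f b]]]
          and cg = cross3_L2(1)[OF H1_L4(1)[OF g1] Hs_L4(1)[OF H1plus_D(2)[OF g b]]]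
          and pw = H1_wpartial_L2[OF D_open w b]
          and cw = cross3_L2(1)[OF H1_L4(1)[OF w] Hs_L4(1)[OF H1plus_D(2)[OF f b]]]
        have "L2_inner D (\<lambda>x. cross3 (f x) (wpartial D b f x)) (wpartial D b w) - L2_inner D (\<lambda>x. cross3 (g x) (wpartial D b g x)) (wpartial D b w)
          = (LINT x|lebesgue_on D. (cross3 (f x) (wpartial D b f x) - cross3 (g x) (wpartial D b g x)) \<bullet> wpartial D b w x)"
          using L2_integrable_inner[OF cf pw] L2_integrable_inner[OF cg pw] by (simp add: L2_inner_def inner_diff_left)
        also have "\<dots> = (LINT x|lebesgue_on D. cross3 (w x) (wpartial D b f x) \<bullet> wpartial D b w x)"
        proof (rule integral_cong_AE)
          have [measurable]: "f \<in> borel_measurable (lebesgue_on D)" "g \<in> borel_measurable (lebesgue_on D)" "w \<in> borel_measurable (lebesgue_on D)"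
              "wpartial D b f \<in> borel_measurable (lebesgue_on D)" "wpartial D b g \<in> borel_measurable (lebesgue_on D)" "wpartial D b w \<in> borel_measurable (lebesgue_on D)"
            using H1_wpartial_L2[OF D_open _ b] H1_imp_L2 f1 g1 w by (auto simp: L2_iff)
          show "(\<lambda>x. (cross3 (f x) (wpartial D b f x) - cross3 (g x) (wpartial D b g x)) \<bullet> wpartial D b w x) \<in> borel_measurable (lebesgue_on D)"
            "(\<lambda>x. cross3 (w x) (wpartial D b f x) \<bullet> wpartial D b w x) \<in> borel_measurable (lebesgue_on D)"
            by measurable
          show "AE x in lebesgue_on D. (cross3 (f x) (wpartial D b f x) - cross3 (g x) (wpartial D b g x)) \<bullet> wpartial D b w x = cross3 (w x) (wpartial D b f x) \<bullet> wpartial D b w x"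
            using wp[OF b]
          proof eventually_elim
            case (elim x)
            have "cross3 (f x) (wpartial D b f x) - cross3 (g x) (wpartial D b g x) = cross3 (w x) (wpartial D b f x) + cross3 (g x) (wpartial D b w x)"
              by (simp only: elim) (simp add: w_def cross3_diff_split)
            then show ?case by (simp add: inner_add_left dot_cross_self)
          qed
        qed
        also have "\<bar>\<dots>\<bar> \<le> nrm (L2 D) (\<lambda>x. cross3 (w x) (wpartial D b f x)) * nrm (L2 D) (wpartial D b w)"
          using L2_inner_bound[OF cw pw] by (simp add: L2_inner_def)
        also have "\<dots> \<le> nrm (L2 D) (\<lambda>x. norm (w x) * norm (wpartial D b f x)) * nrm (L2 D) (wpartial D b w)"
          using norm_cross3_le cw
          by (intro mult_right_mono L2_dominated(2) in_L4_mult(1) H1_L4(1) w Hs_L4(1) H1plus_D(2) f b) (auto simp: L2_iff)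
        also have "\<dots> \<le> (nrm (L2 D) (\<lambda>x. norm (w x) * norm (wpartial D b f x)))\<^sup>2 / (2 * \<eta>) + \<eta> / 2 * (nrm (L2 D) (wpartial D b w))\<^sup>2"
        proof -
          have "p * q \<le> p\<^sup>2 / (2 * \<eta>) + \<eta> / 2 * q\<^sup>2" for p q
          proof -
            have "0 \<le> (p - \<eta> * q)\<^sup>2 / (2 * \<eta>)" using \<eta> by simp
            also have "\<dots> = p\<^sup>2 / (2 * \<eta>) + \<eta> / 2 * q\<^sup>2 - p * q"
              using \<eta> by (simp add: power2_eq_square field_simps)
            finally show ?thesis by simp
          qed
          then show ?thesis .
        qed
        also have "\<dots> \<le> (\<delta> * (n + E) + B * n) / (2 * \<eta>) + \<eta> / 2 * (nrm (L2 D) (wpartial D b w))\<^sup>2"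
        proof -
          have "nrm (Hs D \<alpha>) (wpartial D b f) \<le> M" using H1plus_D(3)[OF f b] fM by linarith
          then have "(nrm (L2 D) (\<lambda>x. norm (w x) * norm (wpartial D b f x)))\<^sup>2 \<le> \<delta> * (n + E) + B * n"
            using B(2)[rule_format, OF H1plus_D(2)[OF f b] _ w] by (simp only: wE n_def[symmetric])
          then show ?thesis
            using \<eta> by (intro add_right_mono divide_right_mono) auto
        qed
        finally show ?thesis .
      qed
      have "\<bar>cross_grad_inner D f f w - cross_grad_inner D g g w\<bar> \<le> (\<Sum>b\<in>(Basis::'a set). (\<delta> * (n + E) + B * n) / (2 * \<eta>) + \<eta> / 2 * (nrm (L2 D) (wpartial D b w))\<^sup>2)"
        unfolding cross_grad_inner_def sum_subtractf[symmetric]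
        by (rule order_trans[OF sum_abs sum_mono]) (rule tm)
      also have "\<dots> = ?d * ((\<delta> * (n + E) + B * n) / (2 * \<eta>)) + \<eta> / 2 * E"
        by (simp add: sum.distrib E_def sum_distrib_left)
      also have "\<dots> = ?d * ((\<delta> + B) / (2 * \<eta>)) * n + (?d * \<delta> / (2 * \<eta>) + \<eta> / 2) * E"
        using \<eta> by (simp add: field_simps)
      also have "?d * \<delta> / (2 * \<eta>) + \<eta> / 2 = \<eta>"
        using \<eta> by (simp add: \<delta>_def power2_eq_square)
      finally show ?thesis by simp
    qed
    have sa: "0 \<le> L2_inner D (\<lambda>x. saturation \<mu> (f x)) w - L2_inner D (\<lambda>x. saturation \<mu> (g x)) w"
    proof -
      note i = saturation_integrable(1)[OF \<mu> H1_L4(1)[OF f1] H1_imp_L2[OF f1] H1_L4(1)[OF w] H1_imp_L2[OF w]]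
        saturation_integrable(1)[OF \<mu> H1_L4(1)[OF g1] H1_imp_L2[OF g1] H1_L4(1)[OF w] H1_imp_L2[OF w]]
      have "L2_inner D (\<lambda>x. saturation \<mu> (f x)) w - L2_inner D (\<lambda>x. saturation \<mu> (g x)) w = (LINT x|lebesgue_on D. (saturation \<mu> (f x) - saturation \<mu> (g x)) \<bullet> w x)"
        using i by (simp add: L2_inner_def inner_diff_left)
      also have "\<dots> \<ge> 0"
        by (intro Bochner_Integration.integral_nonneg) (simp add: w_def saturation_monotone[OF \<mu>])
      finally show ?thesis .
    qed
    have "llb_form D \<kappa>1 \<kappa>2 \<mu> \<gamma> f w - llb_form D \<kappa>1 \<kappa>2 \<mu> \<gamma> g w =
      \<kappa>1 * E + \<gamma> * (cross_grad_inner D f f w - cross_grad_inner D g g w) + \<kappa>2 * (L2_inner D (\<lambda>x. saturation \<mu> (f x)) w - L2_inner D (\<lambda>x. saturation \<mu> (g x)) w)"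
      unfolding gr[symmetric] llb_form_def by (simp add: algebra_simps)
    moreover have "\<bar>\<gamma> * (cross_grad_inner D f f w - cross_grad_inner D g g w)\<bar> \<le> \<gamma>' * (\<eta> * E + ?d * ((\<delta> + B) / (2 * \<eta>)) * n)"
      unfolding abs_mult using \<gamma>' by (intro mult_mono cr) auto
    moreover have "\<gamma>' * (\<eta> * E + ?d * ((\<delta> + B) / (2 * \<eta>)) * n) = \<kappa>1 * E + B' * n"
      using \<gamma>' by (simp add: \<eta>_def B'_def algebra_simps)
    moreover have "0 \<le> \<kappa>2 * (L2_inner D (\<lambda>x. saturation \<mu> (f x)) w - L2_inner D (\<lambda>x. saturation \<mu> (g x)) w)"
      using \<kappa>2 sa by simp
    ultimately have "- B' * n \<le> llb_form D \<kappa>1 \<kappa>2 \<mu> \<gamma> f w - llb_form D \<kappa>1 \<kappa>2 \<mu> \<gamma> g w"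
      by linarith
    then show ?thesis by (simp add: n_def w_def)
  qed
  then show ?thesis using B' by blast
qed

end

section \<open>Measurability and integrability in time\<close>

lemma AE_limit_measurable:
  fixes f :: "nat \<Rightarrow> 'a::euclidean_space \<Rightarrow> real"
  assumes S: "S \<in> sets lebesgue" and f: "\<And>n. f n \<in> borel_measurable (lebesgue_on S)"
    and lim: "AE t in lebesgue_on S. (\<lambda>n. f n t) \<longlonglongrightarrow> g t"
  shows "g \<in> borel_measurable (lebesgue_on S)"
proof (rule AE_lebesgue_on_measurable[OF S])
  show "(\<lambda>t. lim (\<lambda>n. f n t)) \<in> borel_measurable (lebesgue_on S)"
    using f by (rule borel_measurable_lim_metric)
  show "AE t in lebesgue_on S. lim (\<lambda>n. f n t) = g t"
    using lim by eventually_elim (rule limI)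
qed

text \<open>The composition of a simple function with any \<open>F\<close> is simple, so continuity
  of \<open>F\<close> along convergent sequences of the space suffices, and the nonlinear terms of
  the form are covered as well.\<close>

lemma strongly_measurable_functional:
  fixes F :: "('a \<Rightarrow> 'b::real_normed_vector) \<Rightarrow> real"
  assumes sm: "strongly_measurable T X u"
    and cont: "\<And>f g. (\<And>n. f n \<in> elems X) \<Longrightarrow> g \<in> elems X \<Longrightarrow> (\<lambda>n. nrm X (\<lambda>x. f n x - g x)) \<longlonglongrightarrow> 0 \<Longrightarrow>
      (\<lambda>n. F (f n)) \<longlonglongrightarrow> F g"
  shows "(\<lambda>t. F (u t)) \<in> borel_measurable (lebesgue_on {0<..<T})"
proof -
  obtain s where s: "\<And>n. simple_in T X (s n)" and lim: "AE t in lebesgue_on {0<..<T}. (\<lambda>n. nrm X (\<lambda>x. s n t x - u t x)) \<longlonglongrightarrow> 0"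
    and mem: "AE t in lebesgue_on {0<..<T}. u t \<in> elems X"
    using sm unfolding strongly_measurable_def by blast
  show ?thesis
  proof (rule AE_limit_measurable)
    show "(\<lambda>t. F (s n t)) \<in> borel_measurable (lebesgue_on {0<..<T})" for n
      using simple_function_compose[of _ "s n" F] s[of n]
      by (auto simp: simple_in_def comp_def intro!: borel_measurable_simple_function)
    show "AE t in lebesgue_on {0<..<T}. (\<lambda>n. F (s n t)) \<longlonglongrightarrow> F (u t)"
      using lim mem AE_space
    proof eventually_elim
      case (elim t)
      then show ?case
        using s by (intro cont) (auto simp: simple_in_def)
    qed
  qed simp
qed

lemma Lq_infinity_bounded:
  assumes "u \<in> Lq \<infinity> T X"
  obtains m where "0 \<le> m" "AE t in lebesgue_on {0<..<T}. nrm X (u t) \<le> m"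
proof -
  let ?e = "esssup (lebesgue_on {0<..<T}) (\<lambda>t. ereal (nrm X (u t)))"
  have "?e < \<infinity>" using assms by (simp add: Lq_def Lq_norm_def)
  then have "\<exists>m\<ge>0. ?e \<le> ereal m"
    by (cases ?e) (auto, metis abs_ge_self abs_ge_zero)
  then obtain m where m: "0 \<le> m" "?e \<le> ereal m" by blast
  have "AE t in lebesgue_on {0<..<T}. nrm X (u t) \<le> m"
    using esssup_AE[of "\<lambda>t. ereal (nrm X (u t))" "lebesgue_on {0<..<T}"]
  proof eventually_elim
    case (elim t)
    then have "ereal (nrm X (u t)) \<le> ereal m" using m(2) by (rule order_trans)
    then show ?case by simp
  qed
  then show thesis using that m(1) by blast
qed

lemma Lq_mem_AE: "u \<in> Lq q T X \<Longrightarrow> AE t in lebesgue_on {0<..<T}. u t \<in> elems X"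
  by (simp add: Lq_def strongly_measurable_def)

section \<open>Continuity of the terms of the form on \<open>H1\<close>, and their integrability in
  time\<close>

context polytopal
begin

lemma H1_tendsto_wpartial:
  assumes f: "\<And>n. f n \<in> elems (H1 D)" and g: "g \<in> elems (H1 D)" and h: "h \<in> elems (L2 D)" and b: "b \<in> Basis"
    and lim: "(\<lambda>n. nrm (H1 D) (\<lambda>x. f n x - g x)) \<longlonglongrightarrow> 0"
  shows "(\<lambda>n. L2_inner D (wpartial D b (f n)) h) \<longlonglongrightarrow> L2_inner D (wpartial D b g) h"
proof -
  have "(\<lambda>n. L2_inner D (wpartial D b (f n)) h - L2_inner D (wpartial D b g) h) \<longlonglongrightarrow> 0"
  proof (rule Lim_null_comparison)
    show "\<forall>\<^sub>F n in sequentially. norm (L2_inner D (wpartial D b (f n)) h - L2_inner D (wpartial D b g) h) \<le> nrm (H1 D) (\<lambda>x. f n x - g x) * nrm (L2 D) h"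
    proof (intro always_eventually allI)
      fix n
      have "L2_inner D (wpartial D b (f n)) h - L2_inner D (wpartial D b g) h = L2_inner D (\<lambda>x. wpartial D b (f n) x - wpartial D b g x) h"
        by (intro L2_inner_diff_left[symmetric] H1_wpartial_L2 D_open f g b h)
      then have "norm (L2_inner D (wpartial D b (f n)) h - L2_inner D (wpartial D b g) h)
         \<le> nrm (L2 D) (\<lambda>x. wpartial D b (f n) x - wpartial D b g x) * nrm (L2 D) h"
        using L2_inner_bound[OF L2_diff[OF H1_wpartial_L2[OF D_open f b] H1_wpartial_L2[OF D_open g b]] h] by simp
      also have "\<dots> \<le> nrm (H1 D) (\<lambda>x. f n x - g x) * nrm (L2 D) h"
        by (intro mult_right_mono nrm_L2_wpartial_diff D_open f g b) simp
      finally show "norm (L2_inner D (wpartial D b (f n)) h - L2_inner D (wpartial D b g) h) \<le> nrm (H1 D) (\<lambda>x. f n x - g x) * nrm (L2 D) h" .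
    qed
    show "(\<lambda>n. nrm (H1 D) (\<lambda>x. f n x - g x) * nrm (L2 D) h) \<longlonglongrightarrow> 0"
      by (rule tendsto_mult_left_zero[OF lim])
  qed
  then show ?thesis by (simp add: LIM_zero_iff)
qed

text \<open>Convergence in \<open>H1\<close> makes both factors of the cross product converge in
  \<open>L2\<close>, hence the product in L1, and this can be paired with bounded functions
  \<open>h\<close> only.\<close>

lemma H1_tendsto_cross:
  fixes f :: "nat \<Rightarrow> 'a \<Rightarrow> real^3"
  assumes f: "\<And>n. f n \<in> elems (H1 D)" and g: "g \<in> elems (H1 D)" and b: "b \<in> Basis"
    and h: "h \<in> borel_measurable (lebesgue_on D)" "\<And>x. norm (h x) \<le> k"
    and lim: "(\<lambda>n. nrm (H1 D) (\<lambda>x. f n x - g x)) \<longlonglongrightarrow> 0"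
  shows "(\<lambda>n. L2_inner D (\<lambda>x. cross3 (f n x) (wpartial D b (f n) x)) h) \<longlonglongrightarrow> L2_inner D (\<lambda>x. cross3 (g x) (wpartial D b g x)) h"
proof -
  have k: "0 \<le> k" using h(2) norm_ge_zero order_trans by blast
  have [measurable]: "h \<in> borel_measurable (lebesgue_on D)" by (rule h)
  have cb: "integrable (lebesgue_on D) (\<lambda>x. cross3 (p x) (q x) \<bullet> h x) \<and>
      \<bar>L2_inner D (\<lambda>x. cross3 (p x) (q x)) h\<bar> \<le> k * (nrm (L2 D) p * nrm (L2 D) q)"
    if p: "p \<in> elems (L2 D)" and q: "q \<in> elems (L2 D)" for p q
  proof -
    have [measurable]: "p \<in> borel_measurable (lebesgue_on D)" "q \<in> borel_measurable (lebesgue_on D)"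
      using p q by (auto simp: L2_iff)
    note m = L2_integrable_norm_mult[OF p q]
    have le: "\<bar>cross3 (p x) (q x) \<bullet> h x\<bar> \<le> k * (norm (p x) * norm (q x))" for x
    proof -
      have "\<bar>cross3 (p x) (q x) \<bullet> h x\<bar> \<le> norm (cross3 (p x) (q x)) * norm (h x)" by (rule Cauchy_Schwarz_ineq2)
      also have "\<dots> \<le> (norm (p x) * norm (q x)) * k"
        by (intro mult_mono norm_cross3_le h) auto
      finally show ?thesis by (simp add: mult.commute)
    qed
    have int: "integrable (lebesgue_on D) (\<lambda>x. cross3 (p x) (q x) \<bullet> h x)"
    proof (rule Bochner_Integration.integrable_bound)
      show "integrable (lebesgue_on D) (\<lambda>x. k * (norm (p x) * norm (q x)))" using m by simp
      show "AE x in lebesgue_on D. norm (cross3 (p x) (q x) \<bullet> h x) \<le> norm (k * (norm (p x) * norm (q x)))"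
        using le k by simp
    qed measurable
    have "\<bar>L2_inner D (\<lambda>x. cross3 (p x) (q x)) h\<bar> \<le> (LINT x|lebesgue_on D. norm (cross3 (p x) (q x) \<bullet> h x))"
      unfolding L2_inner_def using integral_norm_bound[of "lebesgue_on D" "\<lambda>x. cross3 (p x) (q x) \<bullet> h x"] by simp
    also have "\<dots> \<le> (LINT x|lebesgue_on D. k * (norm (p x) * norm (q x)))"
      using int m le by (intro integral_mono) auto
    also have "\<dots> \<le> k * (nrm (L2 D) p * nrm (L2 D) q)"
      using k L2_Cauchy_Schwarz[OF p q] by (simp add: mult_left_mono)
    finally show ?thesis using int by blast
  qed
  let ?a = "\<lambda>n. nrm (H1 D) (\<lambda>x. f n x - g x)"
  let ?G = "nrm (H1 D) g"
  note gp = H1_wpartial_L2[OF D_open g b] and gL = H1_imp_L2[OF g]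
  have "(\<lambda>n. L2_inner D (\<lambda>x. cross3 (f n x) (wpartial D b (f n) x)) h - L2_inner D (\<lambda>x. cross3 (g x) (wpartial D b g x)) h) \<longlonglongrightarrow> 0"
  proof (rule Lim_null_comparison)
    show "\<forall>\<^sub>F n in sequentially. norm (L2_inner D (\<lambda>x. cross3 (f n x) (wpartial D b (f n) x)) h - L2_inner D (\<lambda>x. cross3 (g x) (wpartial D b g x)) h)
       \<le> k * (?a n * (?a n + ?G)) + k * (?G * ?a n)"
    proof (intro always_eventually allI)
      fix n
      note fp = H1_wpartial_L2[OF D_open f[of n] b] and fL = H1_imp_L2[OF f[of n]]
      note dL = L2_diff[OF fL gL] and dp = L2_diff[OF fp gp]
      have da: "nrm (L2 D) (\<lambda>x. f n x - g x) \<le> ?a n" by (rule nrm_L2_le_H1)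
      have pa: "nrm (L2 D) (\<lambda>x. wpartial D b (f n) x - wpartial D b g x) \<le> ?a n"
        by (intro nrm_L2_wpartial_diff D_open f g b)
      have Ga: "nrm (L2 D) g \<le> ?G" by (rule nrm_L2_le_H1)
      have "nrm (L2 D) (wpartial D b (f n)) \<le> nrm (L2 D) (\<lambda>x. wpartial D b (f n) x - wpartial D b g x) + nrm (L2 D) (wpartial D b g)"
        using nrm_L2_triangle[OF dp gp] by simp
      then have fa: "nrm (L2 D) (wpartial D b (f n)) \<le> ?a n + ?G"
        using pa nrm_L2_wpartial_le_H1[OF b, of D g] by linarith
      have "L2_inner D (\<lambda>x. cross3 (f n x) (wpartial D b (f n) x)) h - L2_inner D (\<lambda>x. cross3 (g x) (wpartial D b g x)) h
        = (LINT x|lebesgue_on D. cross3 (f n x) (wpartial D b (f n) x) \<bullet> h x - cross3 (g x) (wpartial D b g x) \<bullet> h x)"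
        using cb[OF fL fp] cb[OF gL gp] by (simp add: L2_inner_def)
      also have "\<dots> = (LINT x|lebesgue_on D. cross3 (f n x - g x) (wpartial D b (f n) x) \<bullet> h x + cross3 (g x) (wpartial D b (f n) x - wpartial D b g x) \<bullet> h x)"
        by (simp only: inner_diff_left[symmetric] cross3_diff_split inner_add_left)
      also have "\<dots> = L2_inner D (\<lambda>x. cross3 (f n x - g x) (wpartial D b (f n) x)) h + L2_inner D (\<lambda>x. cross3 (g x) (wpartial D b (f n) x - wpartial D b g x)) h"
        using cb[OF dL fp] cb[OF gL dp] by (simp add: L2_inner_def)
      finally have "norm (L2_inner D (\<lambda>x. cross3 (f n x) (wpartial D b (f n) x)) h - L2_inner D (\<lambda>x. cross3 (g x) (wpartial D b g x)) h)
        \<le> k * (nrm (L2 D) (\<lambda>x. f n x - g x) * nrm (L2 D) (wpartial D b (f n))) + k * (nrm (L2 D) g * nrm (L2 D) (\<lambda>x. wpartial D b (f n) x - wpartial D b g x))"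
        using cb[OF dL fp, THEN conjunct2] cb[OF gL dp, THEN conjunct2] unfolding real_norm_def by linarith
      also have "\<dots> \<le> k * (?a n * (?a n + ?G)) + k * (?G * ?a n)"
        by (intro add_mono mult_left_mono mult_mono da fa pa Ga k) auto
      finally show "norm (L2_inner D (\<lambda>x. cross3 (f n x) (wpartial D b (f n) x)) h - L2_inner D (\<lambda>x. cross3 (g x) (wpartial D b g x)) h)
        \<le> k * (?a n * (?a n + ?G)) + k * (?G * ?a n)" .
    qed
    have "(\<lambda>n. k * (?a n * (?a n + ?G)) + k * (?G * ?a n)) \<longlonglongrightarrow> k * (0 * (0 + ?G)) + k * (?G * 0)"
      by (intro tendsto_intros lim)
    then show "(\<lambda>n. k * (?a n * (?a n + ?G)) + k * (?G * ?a n)) \<longlonglongrightarrow> 0" by simp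
  qed
  then show ?thesis by (simp add: LIM_zero_iff)
qed

text \<open>The L4 bounds dominate the difference of the cubic terms by products in which the norm
  of \<open>f n - g\<close> occurs as a factor.\<close>

lemma H1_tendsto_saturation:
  fixes f :: "nat \<Rightarrow> 'a \<Rightarrow> real^3"
  assumes \<mu>: "0 \<le> \<mu>" and f: "\<And>n. f n \<in> elems (H1 D)" and g: "g \<in> elems (H1 D)" and p: "p \<in> elems (H1 D)"
    and lim: "(\<lambda>n. nrm (H1 D) (\<lambda>x. f n x - g x)) \<longlonglongrightarrow> 0"
  shows "(\<lambda>n. L2_inner D (\<lambda>x. saturation \<mu> (f n x)) p) \<longlonglongrightarrow> L2_inner D (\<lambda>x. saturation \<mu> (g x)) p"
proof -
  let ?a = "\<lambda>n. nrm (H1 D) (\<lambda>x. f n x - g x)"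
  let ?G = "nrm (H1 D) g" and ?P = "nrm (H1 D) p"
  have int: "integrable (lebesgue_on D) (\<lambda>x. saturation \<mu> (q x) \<bullet> p x)" if "q \<in> elems (H1 D)" for q
    by (intro saturation_integrable \<mu> H1_L4 H1_imp_L2 that p)
  have "(\<lambda>n. L2_inner D (\<lambda>x. saturation \<mu> (f n x)) p - L2_inner D (\<lambda>x. saturation \<mu> (g x)) p) \<longlonglongrightarrow> 0"
  proof (rule Lim_null_comparison)
    show "\<forall>\<^sub>F n in sequentially. norm (L2_inner D (\<lambda>x. saturation \<mu> (f n x)) p - L2_inner D (\<lambda>x. saturation \<mu> (g x)) p)
       \<le> ?a n * ?P + 5 * \<mu> * (K4 * ?G\<^sup>2 * (K4 * (?a n * ?P)) + K4 * (?a n)\<^sup>2 * (K4 * (?a n * ?P)))"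
    proof (intro always_eventually allI)
      fix n
      define w where "w = (\<lambda>x. f n x - g x)"
      have w: "w \<in> elems (H1 D)" unfolding w_def by (rule H1_diff[OF D_open f g])
      note L4 = H1_L4(1)[OF g] H1_L4(1)[OF w] H1_L4(1)[OF p]
      note t1 = in_L4_triple[OF L4(1,2,3)] and t2 = in_L4_triple[OF L4(2,2,3)]
        and m = L2_integrable_norm_mult[OF H1_imp_L2[OF w] H1_imp_L2[OF p]]
      let ?B = "\<lambda>x. norm (w x) * norm (p x) + 5 * \<mu> * ((norm (g x))\<^sup>2 * (norm (w x) * norm (p x)) + (norm (w x))\<^sup>2 * (norm (w x) * norm (p x)))"
      have le: "norm (saturation \<mu> (f n x) \<bullet> p x - saturation \<mu> (g x) \<bullet> p x) \<le> ?B x" for x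
      proof -
        have "norm (saturation \<mu> (f n x) \<bullet> p x - saturation \<mu> (g x) \<bullet> p x) \<le> norm (saturation \<mu> (f n x) - saturation \<mu> (g x)) * norm (p x)"
          using Cauchy_Schwarz_ineq2[of "saturation \<mu> (f n x) - saturation \<mu> (g x)" "p x"] by (simp add: inner_diff_left)
        also have "\<dots> \<le> (norm (w x) + 5 * \<mu> * (((norm (g x))\<^sup>2 + (norm (w x))\<^sup>2) * norm (w x))) * norm (p x)"
          using saturation_diff_le[OF \<mu>, of "g x" "w x"] by (intro mult_right_mono) (auto simp: w_def)
        finally show ?thesis by (simp add: algebra_simps)
      qed
      have "norm (L2_inner D (\<lambda>x. saturation \<mu> (f n x)) p - L2_inner D (\<lambda>x. saturation \<mu> (g x)) p)
         = norm (LINT x|lebesgue_on D. saturation \<mu> (f n x) \<bullet> p x - saturation \<mu> (g x) \<bullet> p x)"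
        using int[OF f[of n]] int[OF g] by (simp add: L2_inner_def)
      also have "\<dots> \<le> (LINT x|lebesgue_on D. norm (saturation \<mu> (f n x) \<bullet> p x - saturation \<mu> (g x) \<bullet> p x))"
        by (rule integral_norm_bound)
      also have "\<dots> \<le> (LINT x|lebesgue_on D. ?B x)"
        using int[OF f[of n]] int[OF g] t1(1) t2(1) m le by (intro integral_mono) auto
      also have "\<dots> = (LINT x|lebesgue_on D. norm (w x) * norm (p x)) + 5 * \<mu> * ((LINT x|lebesgue_on D. (norm (g x))\<^sup>2 * (norm (w x) * norm (p x)))
          + (LINT x|lebesgue_on D. (norm (w x))\<^sup>2 * (norm (w x) * norm (p x))))"
        using t1(1) t2(1) m by simp
      also have "\<dots> \<le> nrm (L2 D) w * nrm (L2 D) p + 5 * \<mu> * (L4sq D g * sqrt (L4sq D w * L4sq D p) + L4sq D w * sqrt (L4sq D w * L4sq D p))"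
        using \<mu> by (intro add_mono mult_left_mono t1(2) t2(2) L2_Cauchy_Schwarz H1_imp_L2 w p) auto
      also have "\<dots> \<le> ?a n * ?P + 5 * \<mu> * (K4 * ?G\<^sup>2 * (K4 * (?a n * ?P)) + K4 * (?a n)\<^sup>2 * (K4 * (?a n * ?P)))"
        using \<mu> K4 H1_L4(2)[OF g] H1_L4(2)[OF w] H1_L4(2)[OF p] unfolding w_def[symmetric]
        by (intro add_mono mult_mono nrm_L2_le_H1 sqrt_L4sq_le) auto
      finally show "norm (L2_inner D (\<lambda>x. saturation \<mu> (f n x)) p - L2_inner D (\<lambda>x. saturation \<mu> (g x)) p)
         \<le> ?a n * ?P + 5 * \<mu> * (K4 * ?G\<^sup>2 * (K4 * (?a n * ?P)) + K4 * (?a n)\<^sup>2 * (K4 * (?a n * ?P)))" .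
    qed
    have "(\<lambda>n. ?a n * ?P + 5 * \<mu> * (K4 * ?G\<^sup>2 * (K4 * (?a n * ?P)) + K4 * (?a n)\<^sup>2 * (K4 * (?a n * ?P))))
       \<longlonglongrightarrow> 0 * ?P + 5 * \<mu> * (K4 * ?G\<^sup>2 * (K4 * (0 * ?P)) + K4 * 0\<^sup>2 * (K4 * (0 * ?P)))"
      by (intro tendsto_intros lim)
    then show "(\<lambda>n. ?a n * ?P + 5 * \<mu> * (K4 * ?G\<^sup>2 * (K4 * (?a n * ?P)) + K4 * (?a n)\<^sup>2 * (K4 * (?a n * ?P)))) \<longlonglongrightarrow> 0" by simp
  qed
  then show ?thesis by (simp add: LIM_zero_iff)
qed

text \<open>The cross product term is continuous on \<open>H1\<close> only after truncating the gradient of the test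
  function; the truncation is removed by dominated convergence.\<close>

lemma cross_grad_inner_measurable:
  assumes u: "strongly_measurable T (H1 D) u" "AE t in lebesgue_on {0<..<T}. u t \<in> elems (H1plus D \<alpha>)"
    and p: "p \<in> elems (H1 D)"
  shows "(\<lambda>t. cross_grad_inner D (u t) (u t) p) \<in> borel_measurable (lebesgue_on {0<..<T})"
  unfolding cross_grad_inner_def
proof (rule borel_measurable_sum)
  fix b :: 'a assume b: "b \<in> Basis"
  let ?h = "wpartial D b p"
  define h where "h = (\<lambda>k::nat. \<lambda>x. if norm (?h x) \<le> real k then ?h x else 0)"
  have [measurable]: "?h \<in> borel_measurable (lebesgue_on D)" using H1_wpartial_L2[OF D_open p b] by (simp add: L2_iff)
  have hm [measurable]: "h k \<in> borel_measurable (lebesgue_on D)" for k unfolding h_def by measurable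
  show "(\<lambda>t. L2_inner D (\<lambda>x. cross3 (u t x) (wpartial D b (u t) x)) ?h) \<in> borel_measurable (lebesgue_on {0<..<T})"
  proof (rule AE_limit_measurable)
    show "(\<lambda>t. L2_inner D (\<lambda>x. cross3 (u t x) (wpartial D b (u t) x)) (h k)) \<in> borel_measurable (lebesgue_on {0<..<T})" for k
      by (rule strongly_measurable_functional[OF u(1), where F = "\<lambda>f. L2_inner D (\<lambda>x. cross3 (f x) (wpartial D b f x)) (h k)"])
         (rule H1_tendsto_cross[where k = "real k"], auto simp: b hm, simp add: h_def)
    show "AE t in lebesgue_on {0<..<T}. (\<lambda>k. L2_inner D (\<lambda>x. cross3 (u t x) (wpartial D b (u t) x)) (h k)) \<longlonglongrightarrow> L2_inner D (\<lambda>x. cross3 (u t x) (wpartial D b (u t) x)) ?h"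
      using u(2)
    proof eventually_elim
      case (elim t)
      let ?c = "\<lambda>x. cross3 (u t x) (wpartial D b (u t) x)"
      \<comment> \<open>At times when the solution lies in \<open>H1plus\<close> the cross product
        is square integrable by the L4 bounds, which provides an integrable majorant.\<close>
      have c: "?c \<in> elems (L2 D)"
        by (intro cross3_L2 H1_L4 Hs_L4 H1plus_D elim b)
      then have [measurable]: "?c \<in> borel_measurable (lebesgue_on D)" by (simp add: L2_iff)
      show ?case
        unfolding L2_inner_def
      proof (rule integral_dominated_convergence)
        show "integrable (lebesgue_on D) (\<lambda>x. norm (?c x) * norm (?h x))"
          by (intro L2_integrable_norm_mult c H1_wpartial_L2 D_open p b)
        show "AE x in lebesgue_on D. (\<lambda>k. ?c x \<bullet> h k x) \<longlonglongrightarrow> ?c x \<bullet> ?h x"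
        proof (intro AE_I2 tendsto_inner tendsto_const)
          fix x
          obtain N :: nat where "norm (?h x) \<le> real N" using real_arch_simple by blast
          then have "\<forall>\<^sub>F k in sequentially. h k x = ?h x"
            unfolding h_def eventually_sequentially by (intro exI[of _ N]) auto
          then show "(\<lambda>k. h k x) \<longlonglongrightarrow> ?h x" by (rule tendsto_eventually)
        qed
        show "AE x in lebesgue_on D. norm (?c x \<bullet> h k x) \<le> norm (?c x) * norm (?h x)" for k
        proof (intro AE_I2)
          fix x
          have "norm (?c x \<bullet> h k x) \<le> norm (?c x) * norm (h k x)" by (simp add: Cauchy_Schwarz_ineq2)
          also have "\<dots> \<le> norm (?c x) * norm (?h x)" by (intro mult_left_mono) (auto simp: h_def)
          finally show "norm (?c x \<bullet> h k x) \<le> norm (?c x) * norm (?h x)" .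
        qed
      qed measurable
    qed
  qed simp
qed

lemma llb_terms_integrable:
  assumes \<mu>: "0 \<le> \<mu>" and u: "u \<in> Lq \<infinity> T (H1 D)" "u \<in> Lq 2 T (H1plus D \<alpha>)" and p: "p \<in> elems (H1 D)"
  shows "integrable (lebesgue_on {0<..<T}) (\<lambda>t. grad_inner D (u t) p)"
    and "integrable (lebesgue_on {0<..<T}) (\<lambda>t. cross_grad_inner D (u t) (u t) p)"
    and "integrable (lebesgue_on {0<..<T}) (\<lambda>t. L2_inner D (\<lambda>x. saturation \<mu> (u t x)) p)"
proof -
  let ?M = "lebesgue_on {0<..<T}"
  interpret fm: finite_measure ?M by (rule finite_measure_lebesgue_on) simp
  obtain m where m: "0 \<le> m" "AE t in ?M. nrm (H1 D) (u t) \<le> m" using Lq_infinity_bounded[OF u(1)] by blast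
  have mem: "AE t in ?M. u t \<in> elems (H1plus D \<alpha>)" by (rule Lq_mem_AE[OF u(2)])
  have sm: "strongly_measurable T (H1 D) u" using u(1) by (simp add: Lq_def)
  have sq: "integrable ?M (\<lambda>t. (nrm (H1plus D \<alpha>) (u t))\<^sup>2)"
  proof -
    have "real_of_ereal 2 = 2" by (metis numeral_eq_ereal real_of_ereal.simps(1))
    then have "integrable ?M (\<lambda>t. nrm (H1plus D \<alpha>) (u t) powr 2)" using u(2) by (simp add: Lq_def)
    then show ?thesis by (simp add: powr_numeral nrm_H1plus_nonneg)
  qed
  have bnd: "integrable ?M F" if F: "F \<in> borel_measurable ?M"
    and le: "\<And>f. f \<in> elems (H1plus D \<alpha>) \<Longrightarrow> \<bar>E f\<bar> \<le> K * (nrm (H1 D) f + nrm (H1 D) f * nrm (H1plus D \<alpha>) f + nrm (H1 D) f ^ 3) * nrm (H1 D) p"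
    and K: "0 \<le> K" and FE: "F = (\<lambda>t. E (u t))" for F E K
  proof (rule Bochner_Integration.integrable_bound)
    let ?B = "\<lambda>t. (K * nrm (H1 D) p) * (m + m * (1 + (nrm (H1plus D \<alpha>) (u t))\<^sup>2) + m ^ 3)"
    show "integrable ?M ?B" using sq by simp
    show "AE t in ?M. norm (F t) \<le> norm (?B t)"
      using mem m(2)
    proof eventually_elim
      case (elim t)
      let ?V = "nrm (H1plus D \<alpha>) (u t)" and ?n = "nrm (H1 D) (u t)"
      \<comment> \<open>The single power of the \<open>H1plus\<close> norm is traded for its square,
        which is integrable in time.\<close>
      have V: "?V \<le> 1 + ?V\<^sup>2" using zero_le_power2[of "?V - 1 / 2"] by (simp add: power2_eq_square algebra_simps)
      have "\<bar>F t\<bar> \<le> K * (?n + ?n * ?V + ?n ^ 3) * nrm (H1 D) p" using le[OF elim(1)] by (simp add: FE)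
      also have "\<dots> \<le> K * (m + m * (1 + ?V\<^sup>2) + m ^ 3) * nrm (H1 D) p"
        using elim(2) m(1) V nrm_H1plus_nonneg[of "u t"]
        by (intro mult_right_mono mult_left_mono K add_mono mult_mono power_mono) auto
      also have "\<dots> = ?B t" by (simp add: mult_ac)
      finally show ?case using K m(1) by simp
    qed
  qed (rule F)
  have grad: "(\<lambda>t. grad_inner D (u t) p) \<in> borel_measurable ?M"
    unfolding grad_inner_def
  proof (rule borel_measurable_sum)
    fix b :: 'a assume b: "b \<in> Basis"
    show "(\<lambda>t. L2_inner D (wpartial D b (u t)) (wpartial D b p)) \<in> borel_measurable ?M"
      by (rule strongly_measurable_functional[OF sm, where F = "\<lambda>f. L2_inner D (wpartial D b f) (wpartial D b p)"])
         (intro H1_tendsto_wpartial H1_wpartial_L2 D_open p b)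
  qed
  have sat: "(\<lambda>t. L2_inner D (\<lambda>x. saturation \<mu> (u t x)) p) \<in> borel_measurable ?M"
    by (rule strongly_measurable_functional[OF sm, where F = "\<lambda>f. L2_inner D (\<lambda>x. saturation \<mu> (f x)) p"])
       (intro H1_tendsto_saturation \<mu> p)
  \<comment> \<open>Coefficients 1 and 0 isolate in turn the gradient term, the cross product term
    and the reaction term.\<close>
  note b1 = llb_form_bound[OF \<mu>, of 1 0 0, unfolded llb_form_def]
    and b2 = llb_form_bound[OF \<mu>, of 0 0 1, unfolded llb_form_def]
    and b3 = llb_form_bound[OF \<mu>, of 0 1 0, unfolded llb_form_def]
  show "integrable ?M (\<lambda>t. grad_inner D (u t) p)"
    using b1 p by (elim exE conjE) (rule bnd[OF grad _ _ refl], auto)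
  show "integrable ?M (\<lambda>t. cross_grad_inner D (u t) (u t) p)"
    using b2 p by (elim exE conjE) (rule bnd[OF cross_grad_inner_measurable[OF sm mem p] _ _ refl], auto)
  show "integrable ?M (\<lambda>t. L2_inner D (\<lambda>x. saturation \<mu> (u t x)) p)"
    using b3 p by (elim exE conjE) (rule bnd[OF sat _ _ refl], auto)
qed

lemma H1_tendsto_llb_form:
  assumes \<mu>: "0 \<le> \<mu>" and f: "f \<in> elems (H1plus D \<alpha>)" and p: "\<And>n. p n \<in> elems (H1 D)" and q: "q \<in> elems (H1 D)"
    and lim: "(\<lambda>n. nrm (H1 D) (\<lambda>x. p n x - q x)) \<longlonglongrightarrow> 0"
  shows "(\<lambda>n. llb_form D \<kappa>1 \<kappa>2 \<mu> \<gamma> f (p n)) \<longlonglongrightarrow> llb_form D \<kappa>1 \<kappa>2 \<mu> \<gamma> f q"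
proof -
  obtain K where K: "\<forall>f p. f \<in> elems (H1plus D \<alpha>) \<longrightarrow> p \<in> elems (H1 D) \<longrightarrow>
    \<bar>llb_form D \<kappa>1 \<kappa>2 \<mu> \<gamma> f p\<bar> \<le> K * (nrm (H1 D) f + nrm (H1 D) f * nrm (H1plus D \<alpha>) f + nrm (H1 D) f ^ 3) * nrm (H1 D) p"
    using llb_form_bound[OF \<mu>] by blast
  have "(\<lambda>n. llb_form D \<kappa>1 \<kappa>2 \<mu> \<gamma> f (p n) - llb_form D \<kappa>1 \<kappa>2 \<mu> \<gamma> f q) \<longlonglongrightarrow> 0"
  proof (rule Lim_null_comparison)
    let ?c = "K * (nrm (H1 D) f + nrm (H1 D) f * nrm (H1plus D \<alpha>) f + nrm (H1 D) f ^ 3)"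
    show "\<forall>\<^sub>F n in sequentially. norm (llb_form D \<kappa>1 \<kappa>2 \<mu> \<gamma> f (p n) - llb_form D \<kappa>1 \<kappa>2 \<mu> \<gamma> f q) \<le> ?c * nrm (H1 D) (\<lambda>x. p n x - q x)"
      using K[rule_format, OF f H1_diff[OF D_open p q]]
      by (intro always_eventually allI) (simp add: llb_form_diff_right[OF \<mu> f p q])
    show "(\<lambda>n. ?c * nrm (H1 D) (\<lambda>x. p n x - q x)) \<longlonglongrightarrow> 0"
      by (rule tendsto_mult_right_zero[OF lim])
  qed
  then show ?thesis by (simp add: LIM_zero_iff)
qed

end

section \<open>Weak time derivatives\<close>

lemma L2_sum:
  fixes f :: "'i \<Rightarrow> 'a::euclidean_space \<Rightarrow> 'b::euclidean_space"
  assumes "\<And>i. i \<in> I \<Longrightarrow> f i \<in> elems (L2 D)"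
  shows "(\<lambda>x. \<Sum>i\<in>I. f i x) \<in> elems (L2 D)"
  using assms by (induction I rule: infinite_finite_induct) (auto simp: L2_zero L2_add)

lemma L2_inner_sum_left:
  fixes f :: "'i \<Rightarrow> 'a::euclidean_space \<Rightarrow> 'b::euclidean_space"
  assumes "\<And>i. i \<in> I \<Longrightarrow> f i \<in> elems (L2 D)" and h: "h \<in> elems (L2 D)"
  shows "L2_inner D (\<lambda>x. \<Sum>i\<in>I. f i x) h = (\<Sum>i\<in>I. L2_inner D (f i) h)"
  using assms(1)
proof (induction I rule: infinite_finite_induct)
  case (insert i I)
  then show ?case
    using L2_inner_add_left[OF _ _ h, of "f i" "\<lambda>x. \<Sum>i\<in>I. f i x"] L2_sum[of I f D] by simp
qed (auto simp: L2_inner_def)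

lemma L2_tendsto_inner:
  fixes g h :: "'a::euclidean_space \<Rightarrow> 'b::euclidean_space"
  assumes f: "\<And>n. f n \<in> elems (L2 D)" and g: "g \<in> elems (L2 D)" and h: "h \<in> elems (L2 D)"
    and lim: "(\<lambda>n. nrm (L2 D) (\<lambda>x. f n x - g x)) \<longlonglongrightarrow> 0"
  shows "(\<lambda>n. L2_inner D (f n) h) \<longlonglongrightarrow> L2_inner D g h"
proof -
  have "(\<lambda>n. L2_inner D (f n) h - L2_inner D g h) \<longlonglongrightarrow> 0"
  proof (rule Lim_null_comparison)
    show "\<forall>\<^sub>F n in sequentially. norm (L2_inner D (f n) h - L2_inner D g h) \<le> nrm (L2 D) (\<lambda>x. f n x - g x) * nrm (L2 D) h"
      using L2_inner_bound[OF L2_diff[OF f g] h] by (intro always_eventually allI) (simp add: L2_inner_diff_left[OF f g h])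
    show "(\<lambda>n. nrm (L2 D) (\<lambda>x. f n x - g x) * nrm (L2 D) h) \<longlonglongrightarrow> 0"
      by (rule tendsto_mult_left_zero[OF lim])
  qed
  then show ?thesis by (simp add: LIM_zero_iff)
qed

section \<open>Pairing Bochner integrals with fixed square integrable functions\<close>

lemma simple_integral_inner:
  fixes s :: "real \<Rightarrow> 'a::euclidean_space \<Rightarrow> 'b::euclidean_space"
  assumes s: "simple_in T (L2 D) s" and h: "h \<in> elems (L2 D)"
  shows "integrable (lebesgue_on {0<..<T}) (\<lambda>t. L2_inner D (s t) h)"
    and "L2_inner D (simple_integral T s) h = (LINT t|lebesgue_on {0<..<T}. L2_inner D (s t) h)"
    and "simple_integral T s \<in> elems (L2 D)"
proof -
  let ?M = "lebesgue_on {0<..<T}" and ?Y = "s ` {0<..<T}"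
  interpret fm: finite_measure ?M by (rule finite_measure_lebesgue_on) simp
  have sf: "simple_function ?M s" and mem: "\<And>t. t \<in> {0<..<T} \<Longrightarrow> s t \<in> elems (L2 D)"
    using s by (auto simp: simple_in_def)
  have fin: "finite ?Y" using sf by (simp add: simple_function_def)
  have Y: "y \<in> elems (L2 D)" if "y \<in> ?Y" for y using that mem by auto
  define A where "A = (\<lambda>y. {t \<in> {0<..<T}. s t = y})"
  have Am: "A y \<in> sets ?M" for y
  proof (cases "y \<in> ?Y")
    case True
    then have "s -` {y} \<inter> space ?M \<in> sets ?M" using sf by (auto simp: simple_function_def)
    moreover have "s -` {y} \<inter> space ?M = A y" by (auto simp: A_def)
    ultimately show ?thesis by simp
  next
    case False
    then have "A y = {}" by (auto simp: A_def)
    then show ?thesis by simp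
  qed
  have si: "simple_integral T s = (\<lambda>x. \<Sum>y\<in>?Y. measure lebesgue (A y) *\<^sub>R y x)"
    unfolding simple_integral_def A_def ..
  have int: "integrable ?M (\<lambda>t. indicator (A y) t * c)" for y and c :: real
    using Am[of y] by (intro integrable_mult_left integrable_real_indicator) (simp_all add: less_top[symmetric])
  have rep: "L2_inner D (s t) h = (\<Sum>y\<in>?Y. indicator (A y) t * L2_inner D y h)" if t: "t \<in> {0<..<T}" for t
  proof -
    have "(\<Sum>y\<in>?Y. indicator (A y) t * L2_inner D y h) = (\<Sum>y\<in>{s t}. indicator (A y) t * L2_inner D y h)"
      using t fin by (intro sum.mono_neutral_right) (auto simp: A_def)
    moreover have "t \<in> A (s t)" using t by (simp add: A_def)
    then have "(\<Sum>y\<in>{s t}. indicator (A y) t * L2_inner D y h) = L2_inner D (s t) h" by simp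
    ultimately show ?thesis by (simp only:)
  qed
  have "integrable ?M (\<lambda>t. \<Sum>y\<in>?Y. indicator (A y) t * L2_inner D y h)"
    by (intro Bochner_Integration.integrable_sum int)
  then show "integrable ?M (\<lambda>t. L2_inner D (s t) h)"
    by (rule Bochner_Integration.integrable_cong[THEN iffD1, rotated -1]) (auto simp: rep)
  have "(LINT t|?M. L2_inner D (s t) h) = (LINT t|?M. (\<Sum>y\<in>?Y. indicator (A y) t * L2_inner D y h))"
    by (intro Bochner_Integration.integral_cong) (auto simp: rep)
  also have "\<dots> = (\<Sum>y\<in>?Y. (LINT t|?M. indicator (A y) t * L2_inner D y h))"
    by (intro Bochner_Integration.integral_sum int)
  also have "\<dots> = (\<Sum>y\<in>?Y. measure lebesgue (A y) * L2_inner D y h)"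
  proof (intro sum.cong refl)
    fix y
    have "measure ?M (A y) = measure lebesgue (A y)"
      by (rule measure_restrict_space) (auto simp: A_def)
    then show "(LINT t|?M. indicator (A y) t * L2_inner D y h) = measure lebesgue (A y) * L2_inner D y h"
      using Am[of y] sets.sets_into_space[OF Am[of y]] by (simp add: Int_absorb2)
  qed
  also have "\<dots> = L2_inner D (simple_integral T s) h"
    unfolding si using L2_inner_sum_left[of ?Y "\<lambda>y x. measure lebesgue (A y) *\<^sub>R y x" D h] Y h
    by (simp add: L2_scaleR L2_inner_scaleR_left)
  finally show "L2_inner D (simple_integral T s) h = (LINT t|?M. L2_inner D (s t) h)" ..
  show "simple_integral T s \<in> elems (L2 D)"
    unfolding simple_integral_def by (intro L2_sum L2_scaleR Y)
qed

lemma strongly_measurable_L2_inner: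
  fixes h :: "'a::euclidean_space \<Rightarrow> 'b::euclidean_space"
  assumes "strongly_measurable T (L2 D) u" and h: "h \<in> elems (L2 D)"
  shows "(\<lambda>t. L2_inner D (u t) h) \<in> borel_measurable (lebesgue_on {0<..<T})"
  by (rule strongly_measurable_functional[OF assms(1), where F = "\<lambda>f. L2_inner D f h"]) (rule L2_tendsto_inner[OF _ _ h])

lemma strongly_measurable_nrm_L2_diff:
  fixes u :: "real \<Rightarrow> 'a::euclidean_space \<Rightarrow> 'b::euclidean_space"
  assumes sm: "strongly_measurable T (L2 D) u" and s: "simple_in T (L2 D) s"
  shows "(\<lambda>t. nrm (L2 D) (\<lambda>x. u t x - s t x)) \<in> borel_measurable (lebesgue_on {0<..<T})"
proof -
  obtain s' where s': "\<And>n. simple_in T (L2 D) (s' n)" and lim: "AE t in lebesgue_on {0<..<T}. (\<lambda>n. nrm (L2 D) (\<lambda>x. s' n t x - u t x)) \<longlonglongrightarrow> 0"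
    and mem: "AE t in lebesgue_on {0<..<T}. u t \<in> elems (L2 D)"
    using sm unfolding strongly_measurable_def by blast
  show ?thesis
  proof (rule AE_limit_measurable)
    show "(\<lambda>t. nrm (L2 D) (\<lambda>x. s' n t x - s t x)) \<in> borel_measurable (lebesgue_on {0<..<T})" for n
    proof -
      have "simple_function (lebesgue_on {0<..<T}) (\<lambda>t. (\<lambda>(p, q). nrm (L2 D) (\<lambda>x. p x - q x)) (s' n t, s t))"
        using s'[of n] s unfolding simple_in_def
        by (intro simple_function_compose1[where g = "\<lambda>(p, q). nrm (L2 D) (\<lambda>x. p x - q x)"] simple_function_Pair) auto
      then show ?thesis using borel_measurable_simple_function by fastforce
    qed
    show "AE t in lebesgue_on {0<..<T}. (\<lambda>n. nrm (L2 D) (\<lambda>x. s' n t x - s t x)) \<longlonglongrightarrow> nrm (L2 D) (\<lambda>x. u t x - s t x)"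
      using lim mem AE_space
    proof eventually_elim
      case (elim t)
      then have S': "s' n t \<in> elems (L2 D)" for n using s' by (auto simp: simple_in_def)
      have S: "s t \<in> elems (L2 D)" using s elim by (auto simp: simple_in_def)
      have "(\<lambda>n. nrm (L2 D) (\<lambda>x. s' n t x - s t x) - nrm (L2 D) (\<lambda>x. u t x - s t x)) \<longlonglongrightarrow> 0"
      proof (rule Lim_null_comparison[OF _ elim(1)], intro always_eventually allI)
        fix n
        show "norm (nrm (L2 D) (\<lambda>x. s' n t x - s t x) - nrm (L2 D) (\<lambda>x. u t x - s t x)) \<le> nrm (L2 D) (\<lambda>x. s' n t x - u t x)"
          using nrm_L2_diff_triangle[OF S' S elim(2), of n] nrm_L2_diff_triangle[OF elim(2) S S'[of n]]
            nrm_L2_minus_commute[of D "u t" "s' n t"] by (simp add: abs_le_iff)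
      qed
      then show ?case by (simp add: LIM_zero_iff)
    qed
  qed simp
qed

text \<open>The integral is available only as a limit of integrals of simple functions. Pairing with
  \<open>h\<close> commutes with the integral of a simple function and is continuous in both limits,
  so a vector-valued identity becomes a scalar one for each \<open>h\<close>.\<close>

lemma has_X_integral_inner:
  fixes u :: "real \<Rightarrow> 'a::euclidean_space \<Rightarrow> 'b::euclidean_space"
  assumes u: "has_X_integral T (L2 D) u I" and h: "h \<in> elems (L2 D)"
  shows "(LINT t|lebesgue_on {0<..<T}. L2_inner D (u t) h) = L2_inner D I h"
proof -
  let ?M = "lebesgue_on {0<..<T}"
  obtain s where sm: "strongly_measurable T (L2 D) u" and I: "I \<in> elems (L2 D)" and s: "\<And>n. simple_in T (L2 D) (s n)"
    and l1: "(\<lambda>n. \<integral>\<^sup>+t. ennreal (nrm (L2 D) (\<lambda>x. u t x - s n t x)) \<partial>?M) \<longlonglongrightarrow> 0"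
    and l2: "(\<lambda>n. nrm (L2 D) (\<lambda>x. simple_integral T (s n) x - I x)) \<longlonglongrightarrow> 0"
    using u unfolding has_X_integral_def by blast
  have mem: "AE t in ?M. u t \<in> elems (L2 D)" using sm by (simp add: strongly_measurable_def)
  have um [measurable]: "(\<lambda>t. L2_inner D (u t) h) \<in> borel_measurable ?M" by (rule strongly_measurable_L2_inner[OF sm h])
  have im [measurable]: "(\<lambda>t. L2_inner D (s n t) h) \<in> borel_measurable ?M" for n using simple_integral_inner(1)[OF s h] by auto
  have dist: "(\<integral>\<^sup>+t. ennreal (norm (L2_inner D (s n t) h - L2_inner D (u t) h)) \<partial>?M)
      \<le> (\<integral>\<^sup>+t. ennreal (nrm (L2 D) (\<lambda>x. u t x - s n t x)) \<partial>?M) * ennreal (nrm (L2 D) h)" for n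
  proof -
    have "(\<integral>\<^sup>+t. ennreal (norm (L2_inner D (s n t) h - L2_inner D (u t) h)) \<partial>?M)
      \<le> (\<integral>\<^sup>+t. ennreal (nrm (L2 D) (\<lambda>x. u t x - s n t x)) * ennreal (nrm (L2 D) h) \<partial>?M)"
    proof (rule nn_integral_mono_AE)
      show "AE t in ?M. ennreal (norm (L2_inner D (s n t) h - L2_inner D (u t) h)) \<le> ennreal (nrm (L2 D) (\<lambda>x. u t x - s n t x)) * ennreal (nrm (L2 D) h)"
        using mem AE_space
      proof eventually_elim
        case (elim t)
        then have S: "s n t \<in> elems (L2 D)" using s[of n] by (auto simp: simple_in_def)
        have "\<bar>L2_inner D (s n t) h - L2_inner D (u t) h\<bar> \<le> nrm (L2 D) (\<lambda>x. u t x - s n t x) * nrm (L2 D) h"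
          using L2_inner_bound[OF L2_diff[OF S elim(1)] h] nrm_L2_minus_commute[of D "s n t" "u t"]
          by (simp add: L2_inner_diff_left[OF S elim(1) h])
        then show ?case by (simp add: ennreal_mult[symmetric] ennreal_leI)
      qed
    qed
    also have "\<dots> = (\<integral>\<^sup>+t. ennreal (nrm (L2 D) (\<lambda>x. u t x - s n t x)) \<partial>?M) * ennreal (nrm (L2 D) h)"
      using strongly_measurable_nrm_L2_diff[OF sm s] by (intro nn_integral_multc) measurable
    finally show ?thesis .
  qed
  have z: "(\<lambda>n. (\<integral>\<^sup>+t. ennreal (nrm (L2 D) (\<lambda>x. u t x - s n t x)) \<partial>?M) * ennreal (nrm (L2 D) h)) \<longlonglongrightarrow> 0"
    using tendsto_mult_ennreal[OF l1 tendsto_const, of "ennreal (nrm (L2 D) h)"] by simp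
  have lim0: "(\<lambda>n. \<integral>\<^sup>+t. ennreal (norm (L2_inner D (s n t) h - L2_inner D (u t) h)) \<partial>?M) \<longlonglongrightarrow> 0"
    by (rule tendsto_sandwich[OF always_eventually always_eventually tendsto_const z]) (simp, intro allI dist)
  \<comment> \<open>One simple function at finite L1 distance already gives integrability of the
    limit.\<close>
  have ui: "integrable ?M (\<lambda>t. L2_inner D (u t) h)"
  proof -
    have "\<forall>\<^sub>F n in sequentially. (\<integral>\<^sup>+t. ennreal (norm (L2_inner D (s n t) h - L2_inner D (u t) h)) \<partial>?M) < 1"
      using lim0 by (rule order_tendstoD) simp
    then obtain n where "(\<integral>\<^sup>+t. ennreal (norm (L2_inner D (s n t) h - L2_inner D (u t) h)) \<partial>?M) < 1"
      by (auto simp: eventually_sequentially)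
    then have "integrable ?M (\<lambda>t. L2_inner D (s n t) h - L2_inner D (u t) h)"
      by (intro integrableI_bounded) (auto intro: less_trans[OF _ ennreal_one_less_top])
    from Bochner_Integration.integrable_diff[OF simple_integral_inner(1)[OF s h] this]
    show ?thesis
      by (rule Bochner_Integration.integrable_cong[THEN iffD1, rotated -1]) auto
  qed
  have "(\<lambda>n. LINT t|?M. L2_inner D (s n t) h) \<longlonglongrightarrow> (LINT t|?M. L2_inner D (u t) h)"
    by (rule tendsto_L1_int[OF simple_integral_inner(1)[OF s h] ui lim0])
  moreover have "(\<lambda>n. LINT t|?M. L2_inner D (s n t) h) \<longlonglongrightarrow> L2_inner D I h"
    using L2_tendsto_inner[OF simple_integral_inner(3)[OF s h] I h l2] by (simp add: simple_integral_inner(2)[OF s h])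
  ultimately show ?thesis by (rule LIMSEQ_unique)
qed

section \<open>Mollified indicators of time intervals\<close>

definition hat :: "real \<Rightarrow> real" where
  "hat x = flat_exp 0 x * flat_exp 0 (1 - x) / (LINT y|lborel. flat_exp 0 y * flat_exp 0 (1 - y))"

text \<open>This is a normalised mollifier supported in \<open>{0..1}\<close>, so its scaled
  translates sit to the right of their base point. The normalising integral is positive because the
  unnormalised product is positive on all of \<open>{0<..<1}\<close>.\<close>

lemma hat:
  "0 \<le> hat x" "x \<notin> {0..1} \<Longrightarrow> hat x = 0" "continuous_on UNIV hat" "integrable lborel hat" "(LINT y|lborel. hat y) = 1"
  "Ck k (\<lambda>r. hat (c * (r - a)))"
proof -
  let ?p = "\<lambda>x. flat_exp 0 x * flat_exp 0 (1 - x)"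
  have cf: "continuous_on UNIV (flat_exp 0)"
    using flat_exp_has_derivative DERIV_isCont continuous_at_imp_continuous_on by blast
  have cp: "continuous_on UNIV ?p"
    by (intro continuous_intros continuous_on_compose2[OF cf]) auto
  have p0: "0 \<le> ?p x" for x by (simp add: flat_exp_def)
  have z: "?p x = 0" if "x \<notin> {0..1}" for x using that by (auto simp: flat_exp_def)
  have "integrable lborel (\<lambda>x. indicator {0..1} x *\<^sub>R ?p x)"
    by (intro borel_integrable_compact continuous_on_subset[OF cp]) auto
  moreover have "indicator {0..1} x *\<^sub>R ?p x = ?p x" for x using z[of x] by (auto split: split_indicator)
  ultimately have ip: "integrable lborel ?p" by (simp only:)
  have "(LINT y|lborel. ?p y) \<noteq> 0"
  proof
    assume "(LINT y|lborel. ?p y) = 0"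
    then have "AE y in lborel. ?p y = 0"
      using integral_nonneg_eq_0_iff_AE[OF ip] p0 by simp
    then have "AE y in lborel. y \<notin> {0<..<1::real}"
      by eventually_elim (auto simp: flat_exp_def)
    then have "emeasure lborel {0<..<1::real} = 0"
      by (subst (asm) AE_iff_measurable[of "{0<..<1}"]) auto
    then show False by simp
  qed
  moreover have "0 \<le> (LINT y|lborel. ?p y)" by (intro Bochner_Integration.integral_nonneg p0)
  ultimately have P: "0 < (LINT y|lborel. ?p y)" by linarith
  show "0 \<le> hat x" unfolding hat_def using P p0 by simp
  show "x \<notin> {0..1} \<Longrightarrow> hat x = 0" unfolding hat_def using z by simp
  show "continuous_on UNIV hat" unfolding hat_def using P by (intro continuous_intros cp) auto
  show "integrable lborel hat" unfolding hat_def using ip by simp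
  show "(LINT y|lborel. hat y) = 1" unfolding hat_def using P by simp
  have "Ck k (\<lambda>r::real. flat_exp 0 (c * (r \<bullet> 1) + (- c * a)) * flat_exp 0 (- c * (r \<bullet> 1) + (1 + c * a)) * (1 / (LINT y|lborel. ?p y)))"
    by (intro Ck_mult Ck_flat_exp Ck_const)
  then show "Ck k (\<lambda>r. hat (c * (r - a)))"
    by (simp add: hat_def algebra_simps inner_real_def)
qed

definition step :: "real \<Rightarrow> real" where "step x = (LINT y|lborel. indicator {0..x} y * hat y)"

text \<open>Integrating the mollifier gives a smooth transition from 0 to 1. Splitting the integral
  at an intermediate point reduces the derivative to the fundamental theorem for the continuous
  function \<open>hat\<close>.\<close>

lemma step:
  "(step has_real_derivative hat x) (at x)" "x \<le> 0 \<Longrightarrow> step x = 0" "1 \<le> x \<Longrightarrow> step x = 1" "0 \<le> step x" "step x \<le> 1"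
proof -
  have [measurable]: "hat \<in> borel_measurable borel" using hat(3) by (rule borel_measurable_continuous_onI)
  have int: "integrable lborel (\<lambda>y. indicator A y * hat y)" if "A \<in> sets borel" for A
    using integrable_mult_indicator[of A lborel hat] hat(4) that by simp
  show z: "step x = 0" if "x \<le> 0" for x
  proof -
    have "AE y in lborel. indicator {0..x} y * hat y = 0"
      using AE_lborel_singleton[of 0] by eventually_elim (use that in \<open>auto split: split_indicator\<close>)
    then show ?thesis
      unfolding step_def by (subst integral_eq_zero_AE) auto
  qed
  show "step x = 1" if "1 \<le> x"
  proof -
    have e: "indicator {0..x} y * hat y = hat y" for y using that hat(2)[of y] by (auto split: split_indicator)
    show ?thesis by (simp only: step_def e hat(5))
  qed
  show "0 \<le> step x" unfolding step_def by (intro Bochner_Integration.integral_nonneg) (simp add: hat(1))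
  have "step x \<le> (LINT y|lborel. hat y)"
    unfolding step_def using int[of "{0..x}"] hat(1,4) by (intro integral_mono) (auto split: split_indicator)
  then show "step x \<le> 1" by (simp add: hat(5))
  have diff: "(LINT y|lborel. indicator {a..b} y * hat y) = step b - step a" if "a \<le> b" for a b
  proof -
    have e: "AE y in lborel. indicator {0..b} y * hat y - indicator {0..a} y * hat y = indicator {a..b} y * hat y"
      using AE_lborel_singleton[of a] AE_lborel_singleton[of 0]
      by eventually_elim (use that hat(2) in \<open>auto split: split_indicator\<close>)
    have "step b - step a = (LINT y|lborel. indicator {0..b} y * hat y - indicator {0..a} y * hat y)"
      by (simp add: step_def int)
    also have "\<dots> = (LINT y|lborel. indicator {a..b} y * hat y)"
      by (rule integral_cong_AE) (use e in auto)
    finally show ?thesis ..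
  qed
  have hk: "integral {a..b} hat = step b - step a" if "a \<le> b" for a b
  proof -
    have "(LINT y|lborel. indicator {a..b} y *\<^sub>R hat y) = integral {a..b} hat"
      using set_borel_integral_eq_integral(2)[of "{a..b}" hat] int[of "{a..b}"]
      by (simp add: set_lebesgue_integral_def set_integrable_def)
    then show ?thesis using diff[OF that] by simp
  qed
  have "((\<lambda>u. integral {x - 1..u} hat) has_real_derivative hat x) (at x within {x - 1..x + 1})"
    using integral_has_real_derivative[of "x - 1" "x + 1" hat x] continuous_on_subset[OF hat(3)] by simp
  then have "((\<lambda>u. integral {x - 1..u} hat) has_real_derivative hat x) (at x)"
    by (simp add: at_within_Icc_at)
  then have "((\<lambda>u. step u - step (x - 1)) has_real_derivative hat x) (at x)"
    by (rule has_field_derivative_transform_within_open[of _ _ _ "{x - 1<..}"]) (auto simp: hk)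
  then have "((\<lambda>u. (step u - step (x - 1)) + step (x - 1)) has_real_derivative hat x + 0) (at x)"
    by (intro DERIV_add) auto
  then show "(step has_real_derivative hat x) (at x)" by simp
qed

text \<open>After the substitution \<open>r = s + y / (n + 1)\<close> the mollifier no longer
  depends on \<open>n\<close>, and dominated convergence applies.\<close>

lemma hat_integral_tendsto:
  assumes F: "F \<in> borel_measurable borel" "\<And>r. \<bar>F r\<bar> \<le> B" and c: "isCont F (s::real)"
  shows "(\<lambda>n. LINT r|lborel. real (Suc n) * hat (real (Suc n) * (r - s)) * F r) \<longlonglongrightarrow> F s"
proof -
  have [measurable]: "F \<in> borel_measurable borel" "hat \<in> borel_measurable borel"
    using F hat(3) by (auto intro: borel_measurable_continuous_onI)
  have sub: "(LINT r|lborel. real (Suc n) * hat (real (Suc n) * (r - s)) * F r) = (LINT y|lborel. hat y * F (s + 1 / real (Suc n) * y))" for n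
  proof -
    have "(LINT r|lborel. real (Suc n) * hat (real (Suc n) * (r - s)) * F r) =
       \<bar>1 / real (Suc n)\<bar> *\<^sub>R (LINT y|lborel. real (Suc n) * hat (real (Suc n) * ((s + 1 / real (Suc n) * y) - s)) * F (s + 1 / real (Suc n) * y))"
      by (rule lborel_integral_real_affine) simp
    also have "\<dots> = (LINT y|lborel. \<bar>1 / real (Suc n)\<bar> *\<^sub>R (real (Suc n) * hat (real (Suc n) * ((s + 1 / real (Suc n) * y) - s)) * F (s + 1 / real (Suc n) * y)))"
      by (rule integral_scaleR_right[symmetric])
    also have "\<dots> = (LINT y|lborel. hat y * F (s + 1 / real (Suc n) * y))"
      by (intro Bochner_Integration.integral_cong refl) (simp del: of_nat_Suc)
    finally show ?thesis .
  qed
  have "(\<lambda>n. LINT y|lborel. hat y * F (s + 1 / real (Suc n) * y)) \<longlonglongrightarrow> (LINT y|lborel. hat y * F s)"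
  proof (rule integral_dominated_convergence[where w = "\<lambda>y. B * hat y"])
    show "AE y in lborel. (\<lambda>n. hat y * F (s + 1 / real (Suc n) * y)) \<longlonglongrightarrow> hat y * F s"
    proof (intro AE_I2 tendsto_mult tendsto_const)
      fix y
      have "(\<lambda>n. s + 1 / real (Suc n) * y) \<longlonglongrightarrow> s + 0 * y"
        by (intro tendsto_intros LIMSEQ_Suc[OF lim_1_over_n])
      then show "(\<lambda>n. F (s + 1 / real (Suc n) * y)) \<longlonglongrightarrow> F s"
        using isCont_tendsto_compose[OF c] by simp
    qed
    show "AE y in lborel. norm (hat y * F (s + 1 / real (Suc n) * y)) \<le> B * hat y" for n
    proof (intro AE_I2)
      fix y
      have "hat y * \<bar>F (s + 1 / real (Suc n) * y)\<bar> \<le> hat y * B"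
        by (intro mult_left_mono F(2) hat(1))
      then show "norm (hat y * F (s + 1 / real (Suc n) * y)) \<le> B * hat y"
        by (simp add: abs_mult hat(1) mult.commute[of B] del: of_nat_Suc)
    qed
  qed (use hat(4) in simp_all)
  then show ?thesis unfolding sub using hat(5) by simp
qed

text \<open>The test function is a smoothed indicator of the interval, a step at \<open>s\<close>
  minus a step at \<open>t\<close>. Its derivative is a mollifier at \<open>s\<close> minus one at
  \<open>t\<close> and recovers the values of the continuous \<open>f\<close> there, while the test
  function itself tends to the indicator.\<close>

lemma weak_time_derivative_FTC:
  fixes f q :: "real \<Rightarrow> real"
  assumes f: "continuous_on {0..T} f" and q: "integrable (lebesgue_on {0<..<T}) q"
    and weak: "\<And>\<psi>. test_function {0<..<T} \<psi> \<Longrightarrow>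
      (LINT r|lebesgue_on {0<..<T}. deriv \<psi> r * f r) = - (LINT r|lebesgue_on {0<..<T}. \<psi> r * q r)"
    and st: "0 < s" "s < t" "t < T"
  shows "f t - f s = (LINT r|lebesgue_on {s<..<t}. q r)"
proof -
  let ?M = "lebesgue_on {0<..<T}"
  \<comment> \<open>Extension by zero gives a bounded Borel function on the line, as the
    mollification lemma requires; it stays continuous at the interior times \<open>s\<close> and
    \<open>t\<close>.\<close>
  define F where "F = (\<lambda>r. if r \<in> {0..T} then f r else 0)"
  have Fm [measurable]: "F \<in> borel_measurable borel"
    unfolding F_def by (rule borel_measurable_continuous_on_if) (use f in auto)
  have "compact (f ` {0..T})" using f by (intro compact_continuous_image) auto
  then obtain B0 where "\<And>r. r \<in> {0..T} \<Longrightarrow> \<bar>f r\<bar> \<le> B0"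
    using compact_imp_bounded bounded_real by (metis image_eqI)
  then have B: "\<bar>F r\<bar> \<le> max B0 0" for r
    unfolding F_def by (cases "r \<in> {0..T}") (auto intro: max.coboundedI1)
  have cF: "isCont F a" if "0 < a" "a < T" for a
  proof -
    have "isCont f a" using f that by (simp add: continuous_on_interior)
    moreover have "\<forall>\<^sub>F r in nhds a. F r = f r"
      using that by (auto simp: F_def eventually_nhds intro!: exI[of _ "{0<..<T}"])
    ultimately show ?thesis using isCont_cong by blast
  qed
  have [measurable]: "hat \<in> borel_measurable borel" using hat(3) by (rule borel_measurable_continuous_onI)
  define \<psi> where "\<psi> = (\<lambda>n r. step (real (Suc n) * (r - s)) - step (real (Suc n) * (r - t)))"
  define \<psi>' where "\<psi>' = (\<lambda>n r. real (Suc n) * hat (real (Suc n) * (r - s)) - real (Suc n) * hat (real (Suc n) * (r - t)))"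
  have d: "(\<psi> n has_real_derivative \<psi>' n r) (at r)" for n r
  proof -
    have "((\<lambda>r. step (real (Suc n) * (r - a))) has_real_derivative hat (real (Suc n) * (r - a)) * real (Suc n)) (at r)" for a
      by (rule DERIV_chain2[OF step(1)]) (auto intro!: derivative_eq_intros)
    from DERIV_diff[OF this[of s] this[of t]] show ?thesis
      by (simp add: \<psi>_def \<psi>'_def mult.commute)
  qed
  \<comment> \<open>The mollifier lies to the right of its base point, so \<open>\<psi> n\<close> is
    supported in \<open>{s..t + 1 / (n + 1)}\<close> and only the right end has to be kept below
    \<open>T\<close>.\<close>
  obtain N :: nat where N: "1 / real (Suc N) < T - t" using st nat_approx_posE[of "T - t"] by auto
  have test: "test_function {0<..<T} (\<psi> n)" if n: "N \<le> n" for n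
  proof -
    let ?K = "{s..t + 1 / real (Suc n)}"
    have "1 / real (Suc n) \<le> 1 / real (Suc N)" using n by (simp add: field_simps)
    then have K: "?K \<subseteq> {0<..<T}" using N st by auto
    have out: "\<psi> n r = 0" if r: "r \<notin> ?K" for r
    proof (cases "r < s")
      case True
      then show ?thesis using st by (simp add: \<psi>_def step(2) mult_nonneg_nonpos)
    next
      case False
      then have "1 / real (Suc n) \<le> r - t" using r by auto
      then have 1: "1 \<le> real (Suc n) * (r - t)" by (simp add: divide_le_eq mult.commute del: of_nat_Suc)
      have "real (Suc n) * (r - t) \<le> real (Suc n) * (r - s)" using st by (intro mult_left_mono) auto
      with 1 have 2: "1 \<le> real (Suc n) * (r - s)" by (rule order_trans)
      show ?thesis by (simp only: \<psi>_def step(3)[OF 1] step(3)[OF 2])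
    qed
    have Suc: "Ck (Suc k) (\<psi> n)" for k
    proof (rule Ck_SucI)
      show "(\<psi> n has_derivative (\<lambda>h. \<psi>' n r * h)) (at r)" for r
        using d[of n r] by (simp add: has_field_derivative_def)
      have "Ck k (\<lambda>r. (real (Suc n) * hat (real (Suc n) * (r - s)) + (- real (Suc n)) * hat (real (Suc n) * (r - t))) * b)" for b
        by (intro Ck_mult[OF Ck_add[OF Ck_mult[OF Ck_const hat(6)] Ck_mult[OF Ck_const hat(6)]] Ck_const])
      then show "Ck k (\<lambda>r. \<psi>' n r * b)" for b
        by (simp only: \<psi>'_def diff_conv_add_uminus mult_minus_left)
    qed
    then have "Ck k (\<psi> n)" for k using Ck_Suc_imp by blast
    then show ?thesis unfolding test_function_def using K out by (intro conjI allI exI[of _ ?K]) auto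
  qed
  have qm [measurable]: "q \<in> borel_measurable ?M" using q by simp
  have "(\<lambda>n. - (LINT r|?M. \<psi> n r * q r)) \<longlonglongrightarrow> F s - F t"
  proof -
    have eq: "- (LINT r|?M. \<psi> n r * q r) = (LINT r|lborel. real (Suc n) * hat (real (Suc n) * (r - s)) * F r) - (LINT r|lborel. real (Suc n) * hat (real (Suc n) * (r - t)) * F r)"
      if n: "N \<le> n" for n
    proof -
      have t: "test_function {0<..<T} (\<psi> n)" by (rule test[OF n])
      have z: "\<psi>' n r = 0" if "r \<notin> {0<..<T}" for r
      proof -
        have "partial 1 (\<psi> n) r = 0"
          using test_function_zero_outside[OF test_function_partial[OF t, of 1] that] by simp
        moreover have "partial 1 (\<psi> n) r = \<psi>' n r"
          using d[of n r] by (simp add: partial_def frechet_derivative_eqI has_field_derivative_def)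
        ultimately show ?thesis by simp
      qed
      have "- (LINT r|?M. \<psi> n r * q r) = (LINT r|?M. \<psi>' n r * f r)"
        using weak[OF t] by (simp add: DERIV_imp_deriv[OF d])
      also have "\<dots> = (LINT r|?M. \<psi>' n r * F r)"
        by (intro Bochner_Integration.integral_cong) (auto simp: F_def)
      also have "\<dots> = (LINT r|lborel. \<psi>' n r * F r)"
      proof (rule integral_lebesgue_on_eq_lborel)
        show "(\<lambda>r. \<psi>' n r * F r) \<in> borel_measurable borel" unfolding \<psi>'_def by measurable
        show "\<And>r. r \<notin> {0<..<T} \<Longrightarrow> \<psi>' n r * F r = 0" by (simp add: z)
      qed simp
      also have "\<dots> = (LINT r|lborel. real (Suc n) * hat (real (Suc n) * (r - s)) * F r - real (Suc n) * hat (real (Suc n) * (r - t)) * F r)"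
        by (simp add: \<psi>'_def left_diff_distrib)
      also have "\<dots> = (LINT r|lborel. real (Suc n) * hat (real (Suc n) * (r - s)) * F r) - (LINT r|lborel. real (Suc n) * hat (real (Suc n) * (r - t)) * F r)"
      proof (rule Bochner_Integration.integral_diff)
        have "integrable lborel (\<lambda>r. real (Suc n) * hat (real (Suc n) * (r - a)) * F r)" for a
        proof (rule Bochner_Integration.integrable_bound)
          have "integrable lborel (\<lambda>r. hat (- real (Suc n) * a + real (Suc n) * r))"
            using lborel_integrable_real_affine[OF hat(4), of "real (Suc n)" "- real (Suc n) * a"] by simp
          then have "integrable lborel (\<lambda>r. hat (real (Suc n) * (r - a)))"
            by (simp add: algebra_simps)
          then show "integrable lborel (\<lambda>r. (real (Suc n) * max B0 0) * hat (real (Suc n) * (r - a)))"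
            by (rule integrable_mult_right)
          have "norm (real (Suc n) * hat (real (Suc n) * (r - a)) * F r) \<le> norm ((real (Suc n) * max B0 0) * hat (real (Suc n) * (r - a)))" for r
            using B[of r] hat(1)[of "real (Suc n) * (r - a)"] mult_left_mono[OF B[of r], of "real (Suc n) * hat (real (Suc n) * (r - a))"]
            by (simp add: abs_mult mult_ac del: of_nat_Suc)
          then show "AE r in lborel. norm (real (Suc n) * hat (real (Suc n) * (r - a)) * F r) \<le> norm ((real (Suc n) * max B0 0) * hat (real (Suc n) * (r - a)))"
            by (rule AE_I2)
        qed measurable
        then show "integrable lborel (\<lambda>r. real (Suc n) * hat (real (Suc n) * (r - s)) * F r)" "integrable lborel (\<lambda>r. real (Suc n) * hat (real (Suc n) * (r - t)) * F r)"
          by blast+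
      qed
      finally show ?thesis .
    qed
    have "(\<lambda>n. (LINT r|lborel. real (Suc n) * hat (real (Suc n) * (r - s)) * F r) - (LINT r|lborel. real (Suc n) * hat (real (Suc n) * (r - t)) * F r)) \<longlonglongrightarrow> F s - F t"
      using st by (intro tendsto_diff hat_integral_tendsto[OF Fm B] cF) auto
    then show ?thesis
      by (rule Lim_transform_eventually) (use eq in \<open>auto simp: eventually_sequentially intro!: exI[of _ N]\<close>)
  qed
  moreover have "(\<lambda>n. - (LINT r|?M. \<psi> n r * q r)) \<longlonglongrightarrow> - (LINT r|?M. indicator {s<..t} r * q r)"
  proof (intro tendsto_minus integral_dominated_convergence[where w = "\<lambda>r. norm (q r)"])
    have "\<psi> n \<in> borel_measurable borel" for n
      using d[of n] by (intro borel_measurable_continuous_onI continuous_at_imp_continuous_on) (blast intro: DERIV_isCont)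
    then have "\<psi> n \<in> borel_measurable ?M" for n
      by (intro measurable_restrict_space1 measurable_completion) simp
    then show "(\<lambda>r. \<psi> n r * q r) \<in> borel_measurable ?M" for n by measurable
    have "{s<..t} \<in> sets ?M" using st by (auto simp: sets_restrict_space_iff)
    then show "(\<lambda>r. indicator {s<..t} r * q r) \<in> borel_measurable ?M" by measurable
    show "integrable ?M (\<lambda>r. norm (q r))" using q by simp
    show "AE r in ?M. norm (\<psi> n r * q r) \<le> norm (q r)" for n
    proof (intro AE_I2)
      fix r
      have "\<bar>\<psi> n r\<bar> \<le> 1"
        using step(4,5)[of "real (Suc n) * (r - s)"] step(4,5)[of "real (Suc n) * (r - t)"]
        by (simp add: \<psi>_def abs_le_iff del: of_nat_Suc)
      then show "norm (\<psi> n r * q r) \<le> norm (q r)" by (simp add: abs_mult mult_left_le_one_le)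
    qed
    show "AE r in ?M. (\<lambda>n. \<psi> n r * q r) \<longlonglongrightarrow> indicator {s<..t} r * q r"
    proof (intro AE_I2 tendsto_mult tendsto_const)
      fix r
      \<comment> \<open>At \<open>r = a\<close> the step is still 0, so the limit is the indicator
        of the open half-line, and the difference of two such indicators is that of
        \<open>{s<..t}\<close>. The single time \<open>t\<close> is dropped afterwards as a null
        set.\<close>
      have one: "\<forall>\<^sub>F n in sequentially. step (real (Suc n) * (r - a)) = indicator {a<..} r" for a
      proof (cases "a < r")
        case True
        then obtain m :: nat where m: "1 / real (Suc m) < r - a" using nat_approx_posE[of "r - a"] by auto
        have "1 \<le> real (Suc n) * (r - a)" if "m \<le> n" for n
        proof -
          have "1 \<le> real (Suc m) * (r - a)" using m by (simp add: divide_less_eq mult.commute del: of_nat_Suc)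
          also have "\<dots> \<le> real (Suc n) * (r - a)" using that True by (intro mult_right_mono) auto
          finally show ?thesis .
        qed
        then show ?thesis using True by (auto simp: eventually_sequentially step(3) simp del: of_nat_Suc intro!: exI[of _ m])
      next
        case False
        then show ?thesis by (intro always_eventually allI) (simp add: step(2) mult_nonneg_nonpos)
      qed
      have "\<forall>\<^sub>F n in sequentially. \<psi> n r = indicator {s<..t} r"
        using one[of s] one[of t] by eventually_elim (use st in \<open>auto simp: \<psi>_def split: split_indicator\<close>)
      then show "(\<lambda>n. \<psi> n r) \<longlonglongrightarrow> indicator {s<..t} r" by (rule tendsto_eventually)
    qed
  qed
  ultimately have "F s - F t = - (LINT r|?M. indicator {s<..t} r * q r)" by (rule LIMSEQ_unique)
  moreover have "(LINT r|?M. indicator {s<..t} r * q r) = (LINT r|lebesgue_on {s<..<t}. q r)"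
  proof -
    have "(LINT r|?M. indicator {s<..t} r * q r) = (LINT r|lebesgue. (if r \<in> {0<..<T} then indicator {s<..t} r * q r else 0))"
      by (rule Lebesgue_Measure.integral_restrict_UNIV[symmetric]) simp
    also have "\<dots> = (LINT r|lebesgue. (if r \<in> {s<..<t} then q r else 0))"
    proof (rule integral_cong_AE)
      have "(\<lambda>r. if r \<in> {0<..<T} then q r else 0) \<in> borel_measurable lebesgue" using qm by (subst borel_measurable_if) simp_all
      then have m: "(\<lambda>r. indicator A r * (if r \<in> {0<..<T} then q r else 0)) \<in> borel_measurable lebesgue" if "A \<in> sets borel" for A
        using that by (intro borel_measurable_times borel_measurable_indicator) auto
      have "(\<lambda>r. indicator {s<..t} r * (if r \<in> {0<..<T} then q r else 0)) = (\<lambda>r. if r \<in> {0<..<T} then indicator {s<..t} r * q r else 0)" by auto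
      then show "(\<lambda>r. if r \<in> {0<..<T} then indicator {s<..t} r * q r else 0) \<in> borel_measurable lebesgue" using m[of "{s<..t}"] by simp
      have "(\<lambda>r. indicator {s<..<t} r * (if r \<in> {0<..<T} then q r else 0)) = (\<lambda>r. if r \<in> {s<..<t} then q r else 0)"
        using st by (auto split: split_indicator)
      then show "(\<lambda>r. if r \<in> {s<..<t} then q r else 0) \<in> borel_measurable lebesgue" using m[of "{s<..<t}"] by simp
      have "AE r in lebesgue. r \<noteq> t" using AE_lborel_singleton[of t] by (rule AE_completion)
      then show "AE r in lebesgue. (if r \<in> {0<..<T} then indicator {s<..t} r * q r else 0) = (if r \<in> {s<..<t} then q r else 0)"
        by eventually_elim (use st in \<open>auto split: split_indicator\<close>)
    qed
    also have "\<dots> = (LINT r|lebesgue_on {s<..<t}. q r)"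
      by (rule Lebesgue_Measure.integral_restrict_UNIV) simp
    finally show ?thesis .
  qed
  ultimately show ?thesis using st by (simp add: F_def)
qed

text \<open>The time derivative enters the energy estimate only through pairings with fixed
  functions; for these the scalar fundamental theorem holds between any two interior times, with
  continuity in time fixing the point values.\<close>

lemma W1q_infinity_derivative:
  fixes u :: "real \<Rightarrow> 'a::euclidean_space \<Rightarrow> 'b::euclidean_space"
  assumes u: "u \<in> W1q \<infinity> T (L2 D)" and c: "continuous_in_time T (L2 D) u"
  obtains g m where "0 \<le> m" "AE t in lebesgue_on {0<..<T}. g t \<in> elems (L2 D) \<and> nrm (L2 D) (g t) \<le> m"
    "\<And>h. h \<in> elems (L2 D) \<Longrightarrow> integrable (lebesgue_on {0<..<T}) (\<lambda>t. L2_inner D (g t) h)"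
    "\<And>h s t. h \<in> elems (L2 D) \<Longrightarrow> 0 < s \<Longrightarrow> s < t \<Longrightarrow> t < T \<Longrightarrow>
       L2_inner D (u t) h - L2_inner D (u s) h = (LINT r|lebesgue_on {s<..<t}. L2_inner D (g r) h)"
proof -
  let ?M = "lebesgue_on {0<..<T}"
  interpret fm: finite_measure ?M by (rule finite_measure_lebesgue_on) simp
  obtain g where g: "g \<in> Lq \<infinity> T (L2 D)" and w: "weak_time_deriv T (L2 D) u g"
    using u by (auto simp: W1q_def)
  obtain m where m: "0 \<le> m" "AE t in ?M. nrm (L2 D) (g t) \<le> m" using Lq_infinity_bounded[OF g] by blast
  have sm: "strongly_measurable T (L2 D) g" using g by (simp add: Lq_def)
  have mem: "AE t in ?M. g t \<in> elems (L2 D) \<and> nrm (L2 D) (g t) \<le> m"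
    using m(2) Lq_mem_AE[OF g] by eventually_elim simp
  have int: "integrable ?M (\<lambda>t. L2_inner D (g t) h)" if h: "h \<in> elems (L2 D)" for h
  proof (rule Bochner_Integration.integrable_bound)
    show "integrable ?M (\<lambda>t. m * nrm (L2 D) h)" by simp
    show "AE t in ?M. norm (L2_inner D (g t) h) \<le> norm (m * nrm (L2 D) h)"
      using mem
    proof eventually_elim
      case (elim t)
      then have "\<bar>L2_inner D (g t) h\<bar> \<le> nrm (L2 D) (g t) * nrm (L2 D) h" by (intro L2_inner_bound h) auto
      also have "\<dots> \<le> m * nrm (L2 D) h" using elim by (intro mult_right_mono) auto
      finally show ?case using m(1) by simp
    qed
  qed (rule strongly_measurable_L2_inner[OF sm h])
  have ftc: "L2_inner D (u t) h - L2_inner D (u s) h = (LINT r|lebesgue_on {s<..<t}. L2_inner D (g r) h)"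
    if h: "h \<in> elems (L2 D)" and st: "0 < s" "s < t" "t < T" for h s t
  proof (rule weak_time_derivative_FTC[where f = "\<lambda>r. L2_inner D (u r) h", OF _ int[OF h] _ st])
    have uL: "u r \<in> elems (L2 D)" if "r \<in> {0..T}" for r using c that by (simp add: continuous_in_time_def)
    show "continuous_on {0..T} (\<lambda>r. L2_inner D (u r) h)"
      unfolding continuous_on_def
    proof (intro ballI)
      fix a assume a: "a \<in> {0..T}"
      have "((\<lambda>r. L2_inner D (u r) h - L2_inner D (u a) h) \<longlongrightarrow> 0) (at a within {0..T})"
      proof (rule Lim_null_comparison)
        show "\<forall>\<^sub>F r in at a within {0..T}. norm (L2_inner D (u r) h - L2_inner D (u a) h) \<le> nrm (L2 D) (\<lambda>x. u r x - u a x) * nrm (L2 D) h"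
          unfolding eventually_at_filter
          using L2_inner_bound[OF L2_diff[OF uL uL[OF a]] h] L2_inner_diff_left[OF uL uL[OF a] h]
          by (intro always_eventually allI impI) simp
        show "((\<lambda>r. nrm (L2 D) (\<lambda>x. u r x - u a x) * nrm (L2 D) h) \<longlongrightarrow> 0) (at a within {0..T})"
          using c a by (intro tendsto_mult_left_zero) (simp add: continuous_in_time_def)
      qed
      then show "((\<lambda>r. L2_inner D (u r) h) \<longlongrightarrow> L2_inner D (u a) h) (at a within {0..T})"
        by (simp add: LIM_zero_iff)
    qed
    fix \<psi> assume "test_function {0<..<T} \<psi>"
    then obtain I where I: "has_X_integral T (L2 D) (\<lambda>t x. deriv \<psi> t *\<^sub>R u t x) I" "has_X_integral T (L2 D) (\<lambda>t x. \<psi> t *\<^sub>R g t x) (\<lambda>x. - I x)"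
      using w by (auto simp: weak_time_deriv_def)
    show "(LINT r|?M. deriv \<psi> r * L2_inner D (u r) h) = - (LINT r|?M. \<psi> r * L2_inner D (g r) h)"
      using has_X_integral_inner[OF I(1) h] has_X_integral_inner[OF I(2) h]
      by (simp add: L2_inner_scaleR_left L2_inner_uminus_left)
  qed
  show thesis by (rule that[OF m(1) mem int ftc])
qed

section \<open>The energy estimate\<close>

lemma integral_lebesgue_on_interval_diff:
  fixes q :: "real \<Rightarrow> real"
  assumes q: "integrable (lebesgue_on {0<..<T}) q" and st: "0 < s" "s < t" "t < T"
  shows "(LINT r|lebesgue_on {0<..<t}. q r) - (LINT r|lebesgue_on {0<..<s}. q r) = (LINT r|lebesgue_on {s<..<t}. q r)"
    and "0 \<le> a \<Longrightarrow> b \<le> T \<Longrightarrow> integrable (lebesgue_on {a<..<b}) q"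
proof -
  define Q where "Q = (\<lambda>r. if r \<in> {0<..<T} then q r else 0)"
  have Q: "integrable lebesgue Q"
    using q unfolding Q_def by (subst Lebesgue_Measure.integrable_restrict_UNIV) simp_all
  have Qi: "integrable lebesgue (\<lambda>r. indicator {a<..<b} r * Q r)" for a b
    using integrable_mult_indicator[of "{a<..<b}" lebesgue Q] Q by simp
  have Qe: "indicator {a<..<b} r * Q r = (if r \<in> {a<..<b} then q r else 0)" if "0 \<le> a" "b \<le> T" for a b r
    using that by (auto simp: Q_def)
  show "integrable (lebesgue_on {a<..<b}) q" if "0 \<le> a" "b \<le> T"
  proof -
    have "integrable lebesgue (\<lambda>r. if r \<in> {a<..<b} then q r else 0)"
      using Qi[of a b] unfolding Qe[OF that] .
    then show ?thesis by (subst (asm) Lebesgue_Measure.integrable_restrict_UNIV) simp_all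
  qed
  have L: "(LINT r|lebesgue_on {a<..<b}. q r) = (LINT r|lebesgue. indicator {a<..<b} r * Q r)" if "0 \<le> a" "b \<le> T" for a b
    unfolding Qe[OF that] by (rule Lebesgue_Measure.integral_restrict_UNIV[symmetric]) simp
  have "(LINT r|lebesgue_on {0<..<t}. q r) - (LINT r|lebesgue_on {0<..<s}. q r) = (LINT r|lebesgue. indicator {0<..<t} r * Q r - indicator {0<..<s} r * Q r)"
    using st by (simp add: L Qi)
  also have "\<dots> = (LINT r|lebesgue. indicator {s<..<t} r * Q r)"
  proof (rule integral_cong_AE)
    have "AE r in lebesgue. r \<noteq> s" using AE_lborel_singleton[of s] by (rule AE_completion)
    then show "AE r in lebesgue. indicator {0<..<t} r * Q r - indicator {0<..<s} r * Q r = indicator {s<..<t} r * Q r"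
      by eventually_elim (use st in \<open>auto split: split_indicator\<close>)
  qed (use borel_measurable_integrable[OF Qi] in \<open>auto intro!: borel_measurable_diff\<close>)
  also have "\<dots> = (LINT r|lebesgue_on {s<..<t}. q r)"
    using st by (simp add: L)
  finally show "(LINT r|lebesgue_on {0<..<t}. q r) - (LINT r|lebesgue_on {0<..<s}. q r) = (LINT r|lebesgue_on {s<..<t}. q r)" .
qed

text \<open>The integrals are known for end points strictly inside the interval, so the box
  criterion is applied on \<open>{1 / (n + 1)<..<T - 1 / (n + 1)}\<close> for each \<open>n\<close>,
  and the countably many null sets are united.\<close>

lemma AE_zero_if_interval_integrals_zero:
  fixes q :: "real \<Rightarrow> real"
  assumes q: "integrable (lebesgue_on {0<..<T}) q"
    and z: "\<And>s t. 0 < s \<Longrightarrow> s < t \<Longrightarrow> t < T \<Longrightarrow> (LINT r|lebesgue_on {s<..<t}. q r) = 0"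
  shows "AE r in lebesgue_on {0<..<T}. q r = 0"
proof -
  define Q where "Q = (\<lambda>r. if r \<in> {0<..<T} then q r else 0)"
  have Q: "integrable lebesgue Q"
    using q unfolding Q_def by (subst Lebesgue_Measure.integrable_restrict_UNIV) simp_all
  have "AE r in lebesgue. r \<in> {1 / real (Suc n)<..<T - 1 / real (Suc n)} \<longrightarrow> q r = 0" for n
  proof -
    let ?d = "1 / real (Suc n)"
    let ?F = "\<lambda>r. indicator {?d<..<T - ?d} r *\<^sub>R Q r"
    have d: "0 < ?d" by simp
    have "(LINT r|lebesgue. indicator (box a b) r *\<^sub>R ?F r) = 0" for a b
    proof -
      have "indicator (box a b) r *\<^sub>R ?F r = (if r \<in> {max a ?d<..<min b (T - ?d)} then q r else 0)" for r
      proof (cases "r \<in> {?d<..<T - ?d}")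
        case True
        then have "0 < r \<and> r < T" using d unfolding greaterThanLessThan_iff by linarith
        then show ?thesis using True by (auto simp: Q_def indicator_def box_real simp del: of_nat_Suc)
      next
        case False
        then show ?thesis by (auto simp: indicator_def simp del: of_nat_Suc)
      qed
      then have "(LINT r|lebesgue. indicator (box a b) r *\<^sub>R ?F r) = (LINT r|lebesgue. (if r \<in> {max a ?d<..<min b (T - ?d)} then q r else 0))"
        by (simp only:)
      also have "\<dots> = (LINT r|lebesgue_on {max a ?d<..<min b (T - ?d)}. q r)"
        by (rule Lebesgue_Measure.integral_restrict_UNIV) simp
      also have "\<dots> = 0"
      proof (cases "max a ?d < min b (T - ?d)")
        case True
        have "0 < max a ?d" using d by (rule less_le_trans) simp
        moreover have "min b (T - ?d) < T" using d by (intro le_less_trans[OF min.cobounded2]) simp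
        ultimately show ?thesis using z True by blast
      next
        case False
        then have "min b (T - ?d) \<le> max a ?d" by (rule leI)
        then have "{max a ?d<..<min b (T - ?d)} = {}" by (rule greaterThanLessThan_empty)
        then show ?thesis by (simp only: integral_lebesgue_on_empty)
      qed
      finally show ?thesis .
    qed
    then have "AE r in lebesgue. ?F r = 0"
      using Q by (intro AE_zero_if_box_integrals_zero integrable_mult_indicator) auto
    then show ?thesis
    proof eventually_elim
      case (elim r)
      show ?case
      proof
        assume r: "r \<in> {?d<..<T - ?d}"
        then have "r \<in> {0<..<T}" using d unfolding greaterThanLessThan_iff by linarith
        then show "q r = 0" using elim r by (simp add: Q_def del: of_nat_Suc)
      qed
    qed
  qed
  then have "AE r in lebesgue. \<forall>n. r \<in> {1 / real (Suc n)<..<T - 1 / real (Suc n)} \<longrightarrow> q r = 0"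
    by (subst AE_all_countable) blast
  then have "AE r in lebesgue. r \<in> {0<..<T} \<longrightarrow> q r = 0"
  proof eventually_elim
    case (elim r)
    show ?case
    proof
      assume "r \<in> {0<..<T}"
      then have "0 < min r (T - r)" by simp
      then obtain n where n: "1 / real (Suc n) < min r (T - r)" using nat_approx_posE by blast
      then have "1 / real (Suc n) < r" "1 / real (Suc n) < T - r" by auto
      then have "r \<in> {1 / real (Suc n)<..<T - 1 / real (Suc n)}"
        unfolding greaterThanLessThan_iff by linarith
      then show "q r = 0" using elim by blast
    qed
  qed
  then show ?thesis by (simp add: AE_lebesgue_on_iff)
qed

text \<open>Over \<open>n + 1\<close> equal parts the squared lengths add up to
  \<open>(t - s)\<^sup>2 / (n + 1)\<close>, so the telescoped increment is at most an arbitrarily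
  small number. Continuity extends the comparison to the end points 0 and \<open>T\<close>.\<close>

lemma antitone_if_square_increments:
  fixes F :: "real \<Rightarrow> real"
  assumes c: "continuous_on {0..T} F" and sq: "\<And>s t. 0 < s \<Longrightarrow> s < t \<Longrightarrow> t < T \<Longrightarrow> F t - F s \<le> C * (t - s)\<^sup>2"
    and t: "t \<in> {0..T}"
  shows "F t \<le> F 0"
proof -
  have mono: "F t \<le> F s" if st: "0 < s" "s < t" "t < T" for s t
  proof -
    have bound: "F t - F s \<le> C * (t - s)\<^sup>2 * (1 / real (Suc n))" for n
    proof -
      let ?N = "real (Suc n)"
      define \<delta> where "\<delta> = (t - s) / ?N"
      have \<delta>: "0 < \<delta>" "?N * \<delta> = t - s" using st by (simp_all add: \<delta>_def del: of_nat_Suc)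
      define a where "a = (\<lambda>i. s + real i * \<delta>)"
      have a: "a 0 = s" "a (Suc n) = t" using \<delta> by (simp_all add: a_def del: of_nat_Suc)
      have "F t - F s = (\<Sum>i<Suc n. F (a (Suc i)) - F (a i))"
        using sum_lessThan_telescope[of "\<lambda>i. F (a i)" "Suc n"] a by simp
      also have "\<dots> \<le> (\<Sum>i<Suc n. C * \<delta>\<^sup>2)"
      proof (rule sum_mono)
        fix i assume i: "i \<in> {..<Suc n}"
        have "a (Suc i) \<le> t"
        proof -
          have "real (Suc i) * \<delta> \<le> ?N * \<delta>" using i \<delta>(1) by (intro mult_right_mono) auto
          then show ?thesis using \<delta>(2) by (simp add: a_def del: of_nat_Suc)
        qed
        moreover have "s \<le> a i" using \<delta>(1) by (simp add: a_def)
        moreover have "a (Suc i) - a i = \<delta>" by (simp add: a_def algebra_simps)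
        ultimately show "F (a (Suc i)) - F (a i) \<le> C * \<delta>\<^sup>2"
          using sq[of "a i" "a (Suc i)"] st \<delta>(1) by simp
      qed
      also have "\<dots> = ?N * (C * \<delta>\<^sup>2)" by simp
      also have "\<dots> = C * ((?N * \<delta>) * \<delta>)" by (simp add: power2_eq_square)
      also have "\<dots> = C * (t - s)\<^sup>2 * (1 / ?N)"
        unfolding \<delta>(2) by (simp add: \<delta>_def power2_eq_square del: of_nat_Suc)
      finally show ?thesis .
    qed
    have "(\<lambda>n. C * (t - s)\<^sup>2 * (1 / real (Suc n))) \<longlonglongrightarrow> C * (t - s)\<^sup>2 * 0"
      by (intro tendsto_intros LIMSEQ_Suc[OF lim_1_over_n])
    then have "F t - F s \<le> C * (t - s)\<^sup>2 * 0"
      by (rule LIMSEQ_le_const) (use bound in blast)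
    then show ?thesis by simp
  qed
  show ?thesis
  proof (cases "0 < t")
    case True
    then have T: "0 < T" using t by simp
    have inner: "F t \<le> F 0" if t: "0 < t" "t < T" for t
    proof (rule tendsto_lowerbound)
      show "(F \<longlongrightarrow> F 0) (at 0 within {0..T})" using c T by (simp add: continuous_on_def)
      show "\<forall>\<^sub>F s in at 0 within {0..T}. F t \<le> F s"
        unfolding eventually_at using t mono[OF _ _ t(2)] by (intro exI[of _ t]) (auto simp: dist_real_def)
      show "at 0 within {0..T} \<noteq> bot" using T by (simp add: trivial_limit_within islimpt_Icc)
    qed
    show ?thesis
    proof (cases "t < T")
      case True
      then show ?thesis using inner \<open>0 < t\<close> by blast
    next
      case False
      then have tT: "t = T" using t by simp
      show ?thesis
        unfolding tT
      proof (rule tendsto_upperbound)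
        show "(F \<longlongrightarrow> F T) (at T within {0..T})" using c T by (simp add: continuous_on_def)
        show "\<forall>\<^sub>F s in at T within {0..T}. F s \<le> F 0"
          unfolding eventually_at using T inner by (intro exI[of _ T]) (auto simp: dist_real_def)
        show "at T within {0..T} \<noteq> bot" using T by (simp add: trivial_limit_within islimpt_Icc)
      qed
    qed
  next
    case False
    then show ?thesis using t by (simp add: antisym_conv)
  qed
qed

section \<open>From the weak formulation to the comparison of two solutions\<close>

context polytopal
begin

text \<open>The weak formulation is subtracted at two times. Integrability of the three terms is
  what allows them to be merged under one integral, since a non-integrable function has integral 0
  by convention and additivity would fail.\<close>

lemma weak_solution_increment:
  assumes \<mu>: "0 \<le> \<mu>" and u: "weak_solution D \<kappa>1 \<kappa>2 \<mu> \<gamma> T u0 u" and p: "p \<in> elems (H1 D)"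
    and st: "0 < s" "s < t" "t < T"
  shows "L2_inner D (u t) p - L2_inner D (u s) p = - (LINT r|lebesgue_on {s<..<t}. llb_form D \<kappa>1 \<kappa>2 \<mu> \<gamma> (u r) p)"
    and "integrable (lebesgue_on {0<..<T}) (\<lambda>r. llb_form D \<kappa>1 \<kappa>2 \<mu> \<gamma> (u r) p)"
proof -
  have u1: "u \<in> Lq \<infinity> T (H1 D)" "u \<in> Lq 2 T (H1plus D \<alpha>)"
    using u adm by (auto simp: weak_solution_def)
  note int = llb_terms_integrable[OF \<mu> u1 p]
  show fi: "integrable (lebesgue_on {0<..<T}) (\<lambda>r. llb_form D \<kappa>1 \<kappa>2 \<mu> \<gamma> (u r) p)"
    unfolding llb_form_def using int by simp
  have eq: "L2_inner D (u \<tau>) p + (LINT r|lebesgue_on {0<..<\<tau>}. llb_form D \<kappa>1 \<kappa>2 \<mu> \<gamma> (u r) p) = L2_inner D u0 p"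
    if \<tau>: "0 < \<tau>" "\<tau> < T" for \<tau>
  proof -
    have i: "integrable (lebesgue_on {0<..<\<tau>}) q" if "integrable (lebesgue_on {0<..<T}) q" for q :: "real \<Rightarrow> real"
      using integral_lebesgue_on_interval_diff(2)[OF that st, of 0 \<tau>] \<tau> by simp
    have "(LINT r|lebesgue_on {0<..<\<tau>}. llb_form D \<kappa>1 \<kappa>2 \<mu> \<gamma> (u r) p) =
       \<kappa>1 * (LINT s|lebesgue_on {0<..<\<tau>}. grad_inner D (u s) p)
        + \<gamma> * (LINT s|lebesgue_on {0<..<\<tau>}. cross_grad_inner D (u s) (u s) p)
        + \<kappa>2 * (LINT s|lebesgue_on {0<..<\<tau>}. L2_inner D (\<lambda>x. saturation \<mu> (u s x)) p)"
      unfolding llb_form_def using i[OF int(1)] i[OF int(2)] i[OF int(3)] by simp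
    moreover have "L2_inner D (u \<tau>) p
        + \<kappa>1 * (LINT s|lebesgue_on {0<..<\<tau>}. grad_inner D (u s) p)
        + \<gamma> * (LINT s|lebesgue_on {0<..<\<tau>}. cross_grad_inner D (u s) (u s) p)
        + \<kappa>2 * (LINT s|lebesgue_on {0<..<\<tau>}. L2_inner D (\<lambda>x. saturation \<mu> (u s x)) p) = L2_inner D u0 p"
      using u p \<tau> unfolding weak_solution_def saturation_def by auto
    ultimately show ?thesis by simp
  qed
  show "L2_inner D (u t) p - L2_inner D (u s) p = - (LINT r|lebesgue_on {s<..<t}. llb_form D \<kappa>1 \<kappa>2 \<mu> \<gamma> (u r) p)"
    using eq[of t] eq[of s] st integral_lebesgue_on_interval_diff(1)[OF fi st] by simp
qed

text \<open>The weak formulation holds for fixed test functions; approximating \<open>z\<close> by simple functions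
  reduces time dependent test functions to countably many fixed ones.\<close>

lemma llb_form_eq_time_derivative:
  assumes \<mu>: "0 \<le> \<mu>" and u: "weak_solution D \<kappa>1 \<kappa>2 \<mu> \<gamma> T u0 u"
    and g: "AE t in lebesgue_on {0<..<T}. g t \<in> elems (L2 D)"
      "\<And>h. h \<in> elems (L2 D) \<Longrightarrow> integrable (lebesgue_on {0<..<T}) (\<lambda>t. L2_inner D (g t) h)"
      "\<And>h s t. h \<in> elems (L2 D) \<Longrightarrow> 0 < s \<Longrightarrow> s < t \<Longrightarrow> t < T \<Longrightarrow>
         L2_inner D (u t) h - L2_inner D (u s) h = (LINT r|lebesgue_on {s<..<t}. L2_inner D (g r) h)"
    and z: "strongly_measurable T (H1 D) z"
  shows "AE r in lebesgue_on {0<..<T}. llb_form D \<kappa>1 \<kappa>2 \<mu> \<gamma> (u r) (z r) = - L2_inner D (g r) (z r)"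
proof -
  let ?M = "lebesgue_on {0<..<T}"
  obtain s where s: "\<And>n. simple_in T (H1 D) (s n)" and lim: "AE t in ?M. (\<lambda>n. nrm (H1 D) (\<lambda>x. s n t x - z t x)) \<longlonglongrightarrow> 0"
    and zm: "AE t in ?M. z t \<in> elems (H1 D)"
    using z unfolding strongly_measurable_def by blast
  define \<Phi> where "\<Phi> = (\<Union>n. s n ` {0<..<T})"
  have "finite (s n ` {0<..<T})" for n using s[of n] by (simp add: simple_in_def simple_function_def)
  then have cnt: "countable \<Phi>" unfolding \<Phi>_def by (intro countable_UN) (auto intro: countable_finite)
  have \<Phi>: "p \<in> elems (H1 D)" if "p \<in> \<Phi>" for p
    using that s unfolding \<Phi>_def simple_in_def by blast
  have "AE r in ?M. \<forall>p\<in>\<Phi>. llb_form D \<kappa>1 \<kappa>2 \<mu> \<gamma> (u r) p + L2_inner D (g r) p = 0"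
    unfolding AE_ball_countable[OF cnt]
  proof
    fix p assume "p \<in> \<Phi>"
    then have p: "p \<in> elems (H1 D)" by (rule \<Phi>)
    note pL = H1_imp_L2[OF p]
    show "AE r in ?M. llb_form D \<kappa>1 \<kappa>2 \<mu> \<gamma> (u r) p + L2_inner D (g r) p = 0"
    \<comment> \<open>\<open>T\<close> may be non-positive here, and then the time interval is
      empty. Otherwise some pair of interior times gives access to
      \<open>weak_solution_increment\<close>.\<close>
    proof (cases "\<exists>s t. 0 < s \<and> s < t \<and> t < T")
      case False
      then have "{0<..<T} = {}"
        by (metis dense greaterThanLessThan_empty_iff linorder_not_le)
      then show ?thesis by (simp only: AE_lebesgue_on_iff sets.empty_sets) simp
    next
      case True
      then have fi: "integrable ?M (\<lambda>r. llb_form D \<kappa>1 \<kappa>2 \<mu> \<gamma> (u r) p)"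
        using weak_solution_increment(2)[OF \<mu> u p] by blast
      show ?thesis
      proof (rule AE_zero_if_interval_integrals_zero)
        show "integrable ?M (\<lambda>r. llb_form D \<kappa>1 \<kappa>2 \<mu> \<gamma> (u r) p + L2_inner D (g r) p)"
          using fi g(2)[OF pL] by simp
        fix a b :: real assume ab: "0 < a" "a < b" "b < T"
        have "integrable (lebesgue_on {a<..<b}) (\<lambda>r. llb_form D \<kappa>1 \<kappa>2 \<mu> \<gamma> (u r) p)" "integrable (lebesgue_on {a<..<b}) (\<lambda>r. L2_inner D (g r) p)"
          using integral_lebesgue_on_interval_diff(2)[OF fi ab, of a b] integral_lebesgue_on_interval_diff(2)[OF g(2)[OF pL] ab, of a b] ab by auto
        then show "(LINT r|lebesgue_on {a<..<b}. llb_form D \<kappa>1 \<kappa>2 \<mu> \<gamma> (u r) p + L2_inner D (g r) p) = 0"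
          using weak_solution_increment(1)[OF \<mu> u p ab] g(3)[OF pL ab] by simp
      qed
    qed
  qed
  moreover have "AE t in ?M. u t \<in> elems (H1plus D \<alpha>)"
    using u adm by (intro Lq_mem_AE[of u 2]) (auto simp: weak_solution_def)
  ultimately show ?thesis
    using lim zm g(1) AE_space
  proof eventually_elim
    case (elim r)
    have S: "s n r \<in> \<Phi>" for n
      using elim(6) unfolding \<Phi>_def by (intro UN_I[of n] imageI) auto
    note SH = \<Phi>[OF S]
    have "(\<lambda>n. llb_form D \<kappa>1 \<kappa>2 \<mu> \<gamma> (u r) (s n r)) \<longlonglongrightarrow> llb_form D \<kappa>1 \<kappa>2 \<mu> \<gamma> (u r) (z r)"
      by (rule H1_tendsto_llb_form[OF \<mu> elim(2) SH elim(4,3)])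
    moreover have "(\<lambda>n. L2_inner D (s n r) (g r)) \<longlonglongrightarrow> L2_inner D (z r) (g r)"
    proof (rule L2_tendsto_inner[OF H1_imp_L2[OF SH] H1_imp_L2[OF elim(4)] elim(5)])
      show "(\<lambda>n. nrm (L2 D) (\<lambda>x. s n r x - z r x)) \<longlonglongrightarrow> 0"
        by (rule tendsto_sandwich[OF always_eventually always_eventually tendsto_const elim(3)]) (auto intro: nrm_L2_le_H1)
    qed
    then have "(\<lambda>n. - L2_inner D (g r) (s n r)) \<longlonglongrightarrow> - L2_inner D (g r) (z r)"
      by (intro tendsto_minus) (simp add: L2_inner_commute)
    moreover have "llb_form D \<kappa>1 \<kappa>2 \<mu> \<gamma> (u r) (s n r) = - L2_inner D (g r) (s n r)" for n
      using elim(1) S[of n] by (simp add: eq_neg_iff_add_eq_0)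
    ultimately show ?case
      by (simp add: LIMSEQ_unique)
  qed
qed

text \<open>Formally, \<open>L2_inner D (G r) (w r)\<close> is half the derivative of the squared
  norm \<open>\<theta>\<close>, and the form bounds it by \<open>B * \<theta> r\<close> for almost
  every \<open>r\<close>. As \<open>\<theta>\<close> is not differentiated, the bound is transported
  to the end points of short intervals at the cost of the Lipschitz constant of \<open>w\<close> in
  time.\<close>

lemma energy_estimate:
  assumes \<mu>: "0 \<le> \<mu>" and T: "0 < T"
    and B: "0 \<le> B" "\<forall>f g. f \<in> elems (H1plus D \<alpha>) \<longrightarrow> nrm (H1plus D \<alpha>) f \<le> M \<longrightarrow> g \<in> elems (H1plus D \<alpha>) \<longrightarrow>
      - B * (nrm (L2 D) (\<lambda>x. f x - g x))\<^sup>2 \<le>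
        llb_form D \<kappa>1 \<kappa>2 \<mu> \<gamma> f (\<lambda>x. f x - g x) - llb_form D \<kappa>1 \<kappa>2 \<mu> \<gamma> g (\<lambda>x. f x - g x)"
    and u: "strong_solution D \<kappa>1 \<kappa>2 \<mu> \<gamma> T u0 u" and v: "strong_solution D \<kappa>1 \<kappa>2 \<mu> \<gamma> T v0 v"
    and uM: "AE t in lebesgue_on {0<..<T}. nrm (H1plus D \<alpha>) (u t) \<le> M"
    and t: "t \<in> {0..T}"
  shows "nrm (L2 D) (\<lambda>x. u t x - v t x) \<le> exp (B * T) * nrm (L2 D) (\<lambda>x. u0 x - v0 x)"
    and "continuous_on {0..T} (\<lambda>t. nrm (L2 D) (\<lambda>x. u t x - v t x))"
proof -
  let ?M = "lebesgue_on {0<..<T}"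
  have uw: "weak_solution D \<kappa>1 \<kappa>2 \<mu> \<gamma> T u0 u" "u \<in> W1q \<infinity> T (L2 D)"
    and vw: "weak_solution D \<kappa>1 \<kappa>2 \<mu> \<gamma> T v0 v" "v \<in> W1q \<infinity> T (L2 D)"
    using u v by (auto simp: strong_solution_def)
  have uc: "continuous_in_time T (L2 D) u" and vc: "continuous_in_time T (L2 D) v"
    using uw vw by (auto simp: weak_solution_def)
  have uH: "strongly_measurable T (H1 D) u" and vH: "strongly_measurable T (H1 D) v"
    using uw vw by (auto simp: weak_solution_def Lq_def)
  have uL: "u r \<in> elems (L2 D)" and vL: "v r \<in> elems (L2 D)" if "r \<in> {0..T}" for r
    using uc vc that by (auto simp: continuous_in_time_def)
  define w where "w = (\<lambda>r x. u r x - v r x)"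
  have wL: "w r \<in> elems (L2 D)" if "r \<in> {0..T}" for r
    unfolding w_def using uL[OF that] vL[OF that] by (rule L2_diff)
  let ?n = "nrm (L2 D)"
  have wc: "continuous_on {0..T} (\<lambda>r. ?n (w r))"
    unfolding continuous_on_def
  proof
    fix a assume a: "a \<in> {0..T}"
    have "((\<lambda>r. ?n (w r) - ?n (w a)) \<longlongrightarrow> 0) (at a within {0..T})"
    proof (rule Lim_null_comparison)
      have "norm (?n (w r) - ?n (w a)) \<le> ?n (\<lambda>x. u r x - u a x) + ?n (\<lambda>x. v r x - v a x)" if r: "r \<in> {0..T}" for r
      proof -
        have tri: "?n p \<le> ?n (\<lambda>x. p x - q x) + ?n q" if "p \<in> elems (L2 D)" "q \<in> elems (L2 D)" for p q :: "'a \<Rightarrow> real^3"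
          using nrm_L2_triangle[OF L2_diff[OF that] that(2)] by simp
        have "?n (\<lambda>x. w r x - w a x) \<le> ?n (\<lambda>x. u r x - u a x) + ?n (\<lambda>x. v r x - v a x)"
        proof -
          have "(\<lambda>x. w r x - w a x) = (\<lambda>x. (u r x - u a x) + - (v r x - v a x))" by (auto simp: w_def)
          moreover have "?n (\<lambda>x. - (v r x - v a x)) = ?n (\<lambda>x. v r x - v a x)"
            by (simp add: nrm_L2 norm_minus_commute)
          ultimately show ?thesis
            using nrm_L2_triangle[OF L2_diff[OF uL[OF r] uL[OF a]] L2_uminus[OF L2_diff[OF vL[OF r] vL[OF a]]]] by simp
        qed
        then show ?thesis
          using tri[OF wL[OF r] wL[OF a]] tri[OF wL[OF a] wL[OF r]] nrm_L2_minus_commute[of D "w r" "w a"] by simp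
      qed
      then show "\<forall>\<^sub>F r in at a within {0..T}. norm (?n (w r) - ?n (w a)) \<le> ?n (\<lambda>x. u r x - u a x) + ?n (\<lambda>x. v r x - v a x)"
        by (simp add: eventually_at_filter)
      show "((\<lambda>r. ?n (\<lambda>x. u r x - u a x) + ?n (\<lambda>x. v r x - v a x)) \<longlongrightarrow> 0) (at a within {0..T})"
        using uc vc a by (intro tendsto_add_zero) (auto simp: continuous_in_time_def)
    qed
    then show "((\<lambda>r. ?n (w r)) \<longlongrightarrow> ?n (w a)) (at a within {0..T})" by (simp add: LIM_zero_iff)
  qed
  then show "continuous_on {0..T} (\<lambda>t. nrm (L2 D) (\<lambda>x. u t x - v t x))" by (simp add: w_def)
  have "compact ((\<lambda>r. ?n (w r)) ` {0..T})" using wc by (intro compact_continuous_image) auto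
  then obtain R where R: "\<And>r. r \<in> {0..T} \<Longrightarrow> \<bar>?n (w r)\<bar> \<le> R"
    using compact_imp_bounded bounded_real by (metis image_eqI)
  have R0: "0 \<le> R" using R[of 0] T by (meson abs_ge_zero atLeastAtMost_iff less_eq_real_def order_trans)
  obtain gu mu where gu: "0 \<le> mu" "AE t in ?M. gu t \<in> elems (L2 D) \<and> ?n (gu t) \<le> mu"
    "\<And>h. h \<in> elems (L2 D) \<Longrightarrow> integrable ?M (\<lambda>t. L2_inner D (gu t) h)"
    "\<And>h s t. h \<in> elems (L2 D) \<Longrightarrow> 0 < s \<Longrightarrow> s < t \<Longrightarrow> t < T \<Longrightarrow>
       L2_inner D (u t) h - L2_inner D (u s) h = (LINT r|lebesgue_on {s<..<t}. L2_inner D (gu r) h)"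
    by (rule W1q_infinity_derivative[OF uw(2) uc]) blast
  obtain gv mv where gv: "0 \<le> mv" "AE t in ?M. gv t \<in> elems (L2 D) \<and> ?n (gv t) \<le> mv"
    "\<And>h. h \<in> elems (L2 D) \<Longrightarrow> integrable ?M (\<lambda>t. L2_inner D (gv t) h)"
    "\<And>h s t. h \<in> elems (L2 D) \<Longrightarrow> 0 < s \<Longrightarrow> s < t \<Longrightarrow> t < T \<Longrightarrow>
       L2_inner D (v t) h - L2_inner D (v s) h = (LINT r|lebesgue_on {s<..<t}. L2_inner D (gv r) h)"
    by (rule W1q_infinity_derivative[OF vw(2) vc]) blast
  define m where "m = mu + mv"
  have m0: "0 \<le> m" using gu(1) gv(1) by (simp add: m_def)
  define G where "G = (\<lambda>r x. gu r x - gv r x)"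
  have G: "AE t in ?M. G t \<in> elems (L2 D) \<and> ?n (G t) \<le> m"
    using gu(2) gv(2)
  proof eventually_elim
    case (elim r)
    have "?n (\<lambda>x. gu r x + - gv r x) \<le> ?n (gu r) + ?n (\<lambda>x. - gv r x)"
      by (intro nrm_L2_triangle L2_uminus) (use elim in auto)
    moreover have "?n (\<lambda>x. - gv r x) = ?n (gv r)" by (simp add: nrm_L2)
    ultimately show ?case using elim by (auto simp: G_def m_def intro: L2_diff)
  qed
  have Gi: "integrable ?M (\<lambda>r. L2_inner D (G r) h)"
    and inc: "\<And>s t. 0 < s \<Longrightarrow> s < t \<Longrightarrow> t < T \<Longrightarrow> L2_inner D (\<lambda>x. w t x - w s x) h = (LINT r|lebesgue_on {s<..<t}. L2_inner D (G r) h)"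
    if h: "h \<in> elems (L2 D)" for h
  proof -
    have ae: "AE r in ?M. L2_inner D (gu r) h - L2_inner D (gv r) h = L2_inner D (G r) h"
      using gu(2) gv(2) by eventually_elim (simp add: G_def L2_inner_diff_left[OF _ _ h])
    have i: "integrable ?M (\<lambda>r. L2_inner D (gu r) h - L2_inner D (gv r) h)"
      using gu(3)[OF h] gv(3)[OF h] by simp
    have Gm: "(\<lambda>r. L2_inner D (G r) h) \<in> borel_measurable ?M"
      by (rule AE_lebesgue_on_measurable[OF _ borel_measurable_integrable[OF i] ae]) simp
    show Gi: "integrable ?M (\<lambda>r. L2_inner D (G r) h)"
      using i ae Gm by (subst integrable_cong_AE[symmetric]) auto
    fix s t assume st: "0 < s" "s < t" "t < T"
    then have r: "s \<in> {0..T}" "t \<in> {0..T}" by auto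
    have "L2_inner D (\<lambda>x. w t x - w s x) h = (L2_inner D (u t) h - L2_inner D (v t) h) - (L2_inner D (u s) h - L2_inner D (v s) h)"
      by (simp add: L2_inner_diff_left[OF wL[OF r(2)] wL[OF r(1)] h]) (simp add: w_def L2_inner_diff_left[OF uL[OF r(1)] vL[OF r(1)] h] L2_inner_diff_left[OF uL[OF r(2)] vL[OF r(2)] h])
    also have "\<dots> = (LINT r|lebesgue_on {s<..<t}. L2_inner D (gu r) h) - (LINT r|lebesgue_on {s<..<t}. L2_inner D (gv r) h)"
      using gu(4)[OF h st] gv(4)[OF h st] by simp
    also have "\<dots> = (LINT r|lebesgue_on {s<..<t}. L2_inner D (gu r) h - L2_inner D (gv r) h)"
      using integral_lebesgue_on_interval_diff(2)[OF gu(3)[OF h] st, of s t] integral_lebesgue_on_interval_diff(2)[OF gv(3)[OF h] st, of s t] st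
      by simp
    also have "\<dots> = (LINT r|lebesgue_on {s<..<t}. L2_inner D (G r) h)"
    proof (rule integral_cong_AE)
      show "(\<lambda>r. L2_inner D (gu r) h - L2_inner D (gv r) h) \<in> borel_measurable (lebesgue_on {s<..<t})"
        "(\<lambda>r. L2_inner D (G r) h) \<in> borel_measurable (lebesgue_on {s<..<t})"
        using integral_lebesgue_on_interval_diff(2)[OF i st, of s t] integral_lebesgue_on_interval_diff(2)[OF Gi st, of s t] st by auto
      show "AE r in lebesgue_on {s<..<t}. L2_inner D (gu r) h - L2_inner D (gv r) h = L2_inner D (G r) h"
        using ae st by (auto simp: AE_lebesgue_on_iff elim!: eventually_mono)
    qed
    finally show "L2_inner D (\<lambda>x. w t x - w s x) h = (LINT r|lebesgue_on {s<..<t}. L2_inner D (G r) h)" .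
  qed
  have fm: "measure (lebesgue_on {s<..<t}) {s<..<t} = t - s" if "s < t" for s t :: real
    using that by (simp add: measure_restrict_space)
  have intc: "(LINT r|lebesgue_on {s<..<t}. q r) \<le> c * (t - s)"
    if st: "0 < s" "s < t" "t < T" and q: "integrable ?M q" and le: "AE r in ?M. r \<in> {s<..<t} \<longrightarrow> q r \<le> c" for s t c and q :: "real \<Rightarrow> real"
  proof -
    interpret finite_measure "lebesgue_on {s<..<t}" by (rule finite_measure_lebesgue_on) simp
    have "(LINT r|lebesgue_on {s<..<t}. q r) \<le> (LINT r|lebesgue_on {s<..<t}. c)"
    proof (rule integral_mono_AE)
      show "integrable (lebesgue_on {s<..<t}) q" using integral_lebesgue_on_interval_diff(2)[OF q st, of s t] st by simp
      show "AE r in lebesgue_on {s<..<t}. q r \<le> c"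
        using le st by (auto simp: AE_lebesgue_on_iff elim!: eventually_mono)
    qed simp
    also have "\<dots> = c * (t - s)" using fm[OF st(2)] by (simp add: mult.commute)
    finally show ?thesis .
  qed
  \<comment> \<open>The increment is tested with itself, which gives its squared norm on the left,
    and one factor of the norm cancels.\<close>
  have lip: "?n (\<lambda>x. w t x - w s x) \<le> m * (t - s)" if st: "0 < s" "s < t" "t < T" for s t
  proof -
    let ?h = "\<lambda>x. w t x - w s x"
    have h: "?h \<in> elems (L2 D)" using st by (intro L2_diff wL) auto
    have "(?n ?h)\<^sup>2 = (LINT r|lebesgue_on {s<..<t}. L2_inner D (G r) ?h)"
      using inc[OF h st] by (simp add: L2_inner_self)
    also have "\<dots> \<le> (m * ?n ?h) * (t - s)"
    proof (rule intc[OF st Gi[OF h]])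
      show "AE r in ?M. r \<in> {s<..<t} \<longrightarrow> L2_inner D (G r) ?h \<le> m * ?n ?h"
        using G
      proof eventually_elim
        case (elim r)
        then have "\<bar>L2_inner D (G r) ?h\<bar> \<le> ?n (G r) * ?n ?h" by (intro L2_inner_bound h) auto
        also have "\<dots> \<le> m * ?n ?h" using elim by (intro mult_right_mono) auto
        finally show ?case by linarith
      qed
    qed
    finally have le: "?n ?h * ?n ?h \<le> ?n ?h * (m * (t - s))" by (simp add: power2_eq_square mult_ac)
    show ?thesis
    proof (cases "?n ?h = 0")
      case True
      then show ?thesis using m0 st by simp
    next
      case False
      then have "0 < ?n ?h" using nrm_L2_nonneg[of D ?h] by linarith
      then show ?thesis using le by (simp only: mult_le_cancel_left_pos)
    qed
  qed
  define \<theta> where "\<theta> = (\<lambda>r. (?n (w r))\<^sup>2)"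
  have \<theta>0: "0 \<le> \<theta> r" for r by (simp add: \<theta>_def)
  have Gw: "AE r in ?M. L2_inner D (G r) (w r) \<le> B * \<theta> r"
  proof -
    have gu': "AE t in ?M. gu t \<in> elems (L2 D)" using gu(2) by eventually_elim simp
    have gv': "AE t in ?M. gv t \<in> elems (L2 D)" using gv(2) by eventually_elim simp
    \<comment> \<open>Each equation is tested with \<open>u\<close> and with \<open>v\<close>
      separately, both strongly measurable in \<open>H1\<close> as members of the solution space;
      linearity in the test function then yields the equations tested with \<open>w\<close>.\<close>
    have e: "AE r in ?M. llb_form D \<kappa>1 \<kappa>2 \<mu> \<gamma> (u r) (z r) = - L2_inner D (gu r) (z r)"
      if z: "strongly_measurable T (H1 D) z" for z
      by (rule llb_form_eq_time_derivative[OF \<mu> uw(1) gu' _ _ z]; (rule gu(3) gu(4); assumption))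
    have e': "AE r in ?M. llb_form D \<kappa>1 \<kappa>2 \<mu> \<gamma> (v r) (z r) = - L2_inner D (gv r) (z r)"
      if z: "strongly_measurable T (H1 D) z" for z
      by (rule llb_form_eq_time_derivative[OF \<mu> vw(1) gv' _ _ z]; (rule gv(3) gv(4); assumption))
    have up: "AE t in ?M. u t \<in> elems (H1plus D \<alpha>)" and vp: "AE t in ?M. v t \<in> elems (H1plus D \<alpha>)"
      using uw(1) vw(1) adm by (auto simp: weak_solution_def intro!: Lq_mem_AE[of _ 2])
    show ?thesis
      using e[OF uH] e[OF vH] e'[OF uH] e'[OF vH] gu' gv' up vp uM
    proof eventually_elim
      case (elim r)
      note uh = H1plus_D(1)[OF elim(7)] and vh = H1plus_D(1)[OF elim(8)]
      note ul = H1_imp_L2[OF uh] and vl = H1_imp_L2[OF vh]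
      have wl: "w r \<in> elems (L2 D)" unfolding w_def by (rule L2_diff[OF ul vl])
      have 1: "llb_form D \<kappa>1 \<kappa>2 \<mu> \<gamma> (u r) (w r) = - L2_inner D (gu r) (w r)"
        unfolding w_def llb_form_diff_right[OF \<mu> elim(7) uh vh] elim(1,2) L2_inner_diff_right[OF elim(5) ul vl] by simp
      have 2: "llb_form D \<kappa>1 \<kappa>2 \<mu> \<gamma> (v r) (w r) = - L2_inner D (gv r) (w r)"
        unfolding w_def llb_form_diff_right[OF \<mu> elim(8) uh vh] elim(3,4) L2_inner_diff_right[OF elim(6) ul vl] by simp
      have "- B * \<theta> r \<le> llb_form D \<kappa>1 \<kappa>2 \<mu> \<gamma> (u r) (w r) - llb_form D \<kappa>1 \<kappa>2 \<mu> \<gamma> (v r) (w r)"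
        using B(2)[rule_format, OF elim(7,9,8)] by (simp only: \<theta>_def w_def)
      then show ?case
        unfolding 1 2 G_def L2_inner_diff_left[OF elim(5,6) wl] by simp
    qed
  qed
  \<comment> \<open>The term \<open>4 * B * R * m\<close> comes from replacing
    \<open>\<theta> r\<close> by \<open>\<theta> s\<close>, where \<open>R\<close> bounds the norm
    of \<open>w\<close> and \<open>m\<close> is its Lipschitz constant; \<open>m\<^sup>2\<close>
    comes from replacing \<open>w t + w s\<close> by twice \<open>w r\<close>.\<close>
  define C where "C = 4 * B * R * m + m\<^sup>2"
  have step: "\<theta> t - \<theta> s \<le> (2 * B * \<theta> s + C * (t - s)) * (t - s)" if st: "0 < s" "s < t" "t < T" for s t
  proof -
    have r: "s \<in> {0..T}" "t \<in> {0..T}" using st by auto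
    let ?h = "\<lambda>x. w t x + w s x"
    have h: "?h \<in> elems (L2 D)" by (intro L2_add wL r)
    \<comment> \<open>The difference of squares is the increment paired with the sum
      \<open>w t + w s\<close>, which is fixed with respect to the integration time, so the integral
      formula for the increment applies.\<close>
    have "\<theta> t - \<theta> s = L2_inner D (\<lambda>x. w t x - w s x) ?h"
    proof -
      have "L2_inner D (\<lambda>x. w t x - w s x) ?h = L2_inner D ?h (w t) - L2_inner D ?h (w s)"
        unfolding L2_inner_diff_left[OF wL[OF r(2)] wL[OF r(1)] h] L2_inner_commute[of D _ ?h] ..
      also have "\<dots> = \<theta> t - \<theta> s"
        unfolding L2_inner_add_left[OF wL[OF r(2)] wL[OF r(1)] wL[OF r(1)]] L2_inner_add_left[OF wL[OF r(2)] wL[OF r(1)] wL[OF r(2)]]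
        by (simp add: L2_inner_self \<theta>_def L2_inner_commute[of D "w s" "w t"])
      finally show ?thesis ..
    qed
    also have "\<dots> = (LINT r|lebesgue_on {s<..<t}. L2_inner D (G r) ?h)" by (rule inc[OF h st])
    also have "\<dots> \<le> (2 * B * \<theta> s + C * (t - s)) * (t - s)"
    proof (rule intc[OF st Gi[OF h]])
      show "AE r in ?M. r \<in> {s<..<t} \<longrightarrow> L2_inner D (G r) ?h \<le> 2 * B * \<theta> s + C * (t - s)"
        using Gw G
      proof eventually_elim
        case (elim r)
        show ?case
        proof
          assume rs: "r \<in> {s<..<t}"
          then have rT: "r \<in> {0..T}" "0 < r" "r < T" "s < r" "r < t" using st by auto
          have d1: "(\<lambda>x. w t x - w r x) \<in> elems (L2 D)" and d2: "(\<lambda>x. w r x - w s x) \<in> elems (L2 D)"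
            by (intro L2_diff wL rT r)+
          have GL: "G r \<in> elems (L2 D)" "?n (G r) \<le> m" using elim(2) by auto
          have b: "\<bar>L2_inner D (G r) p\<bar> \<le> m * c" if "p \<in> elems (L2 D)" "?n p \<le> c" for p c
          proof -
            have "\<bar>L2_inner D (G r) p\<bar> \<le> ?n (G r) * ?n p" by (rule L2_inner_bound[OF GL(1) that(1)])
            also have "\<dots> \<le> m * c" using GL(2) that(2) m0 by (intro mult_mono) auto
            finally show ?thesis .
          qed
          \<comment> \<open>The sum is split as
            \<open>w t + w s = 2 * w r + (w t - w r) - (w r - w s)\<close>. The first part meets the
            energy inequality at time \<open>r\<close>, the other two are small by the Lipschitz
            bound.\<close>
          have "L2_inner D (G r) ?h = 2 * L2_inner D (G r) (w r) + L2_inner D (G r) (\<lambda>x. w t x - w r x) - L2_inner D (G r) (\<lambda>x. w r x - w s x)"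
            using L2_inner_diff_right[OF GL(1) wL[OF r(2)] wL[OF rT(1)]] L2_inner_diff_right[OF GL(1) wL[OF rT(1)] wL[OF r(1)]]
              L2_inner_add_left[OF wL[OF r(2)] wL[OF r(1)] GL(1)] by (simp add: L2_inner_commute)
          also have "\<dots> \<le> 2 * (B * \<theta> r) + m * (m * (t - r)) + m * (m * (r - s))"
            using elim(1) b[OF d1 lip[OF rT(2,5) st(3)]] b[OF d2 lip[OF st(1) rT(4,3)]] by linarith
          also have "\<dots> = 2 * B * \<theta> r + m\<^sup>2 * (t - s)" by (simp add: power2_eq_square algebra_simps)
          also have "\<dots> \<le> 2 * B * (\<theta> s + 2 * R * m * (t - s)) + m\<^sup>2 * (t - s)"
          proof (intro add_right_mono mult_left_mono)
            have "?n (w r) \<le> ?n (\<lambda>x. w r x - w s x) + ?n (w s)"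
              using nrm_L2_triangle[OF d2 wL[OF r(1)]] by simp
            then have d: "?n (w r) - ?n (w s) \<le> m * (t - s)"
              using lip[OF st(1) rT(4,3)] mult_left_mono[OF _ m0, of "r - s" "t - s"] rT by linarith
            have "\<theta> r - \<theta> s = (?n (w r) - ?n (w s)) * (?n (w r) + ?n (w s))"
              by (simp add: \<theta>_def power2_eq_square algebra_simps)
            also have "\<dots> \<le> (m * (t - s)) * (?n (w r) + ?n (w s))"
              by (intro mult_right_mono d) simp
            also have "\<dots> \<le> (m * (t - s)) * (R + R)"
              using R[OF rT(1)] R[OF r(1)] m0 st by (intro mult_left_mono add_mono) auto
            finally show "\<theta> r \<le> \<theta> s + 2 * R * m * (t - s)" by (simp add: algebra_simps)
          qed (use B in auto)
          also have "\<dots> = 2 * B * \<theta> s + C * (t - s)" by (simp add: C_def algebra_simps)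
          finally show "L2_inner D (G r) ?h \<le> 2 * B * \<theta> s + C * (t - s)" .
        qed
      qed
    qed
    finally show ?thesis .
  qed
  have C0: "0 \<le> C" using B(1) R0 m0 by (simp add: C_def)
  \<comment> \<open>The exponential is the integrating factor: by \<open>1 + x \<le> exp x\<close>
    it swallows the part of the increment that is linear in \<open>t - s\<close>, so that only the
    quadratic part remains.\<close>
  define F where "F = (\<lambda>r. exp (- (2 * B) * r) * \<theta> r)"
  have "F t \<le> F 0"
  proof (rule antitone_if_square_increments[where C = C, OF _ _ t])
    show "continuous_on {0..T} F"
      unfolding F_def \<theta>_def by (intro continuous_intros wc)
    fix s t assume st: "0 < s" "s < t" "t < T"
    have E: "exp (- (2 * B) * s) = exp (- (2 * B) * t) * exp (2 * B * (t - s))"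
      by (simp add: exp_add[symmetric] algebra_simps)
    have "\<theta> t \<le> (1 + 2 * B * (t - s)) * \<theta> s + C * (t - s)\<^sup>2"
      using step[OF st] by (simp add: power2_eq_square algebra_simps)
    also have "\<dots> \<le> exp (2 * B * (t - s)) * \<theta> s + C * (t - s)\<^sup>2"
      by (intro add_right_mono mult_right_mono exp_ge_add_one_self \<theta>0)
    finally have "F t \<le> exp (- (2 * B) * t) * (exp (2 * B * (t - s)) * \<theta> s + C * (t - s)\<^sup>2)"
      unfolding F_def by (intro mult_left_mono) auto
    also have "\<dots> = F s + exp (- (2 * B) * t) * (C * (t - s)\<^sup>2)"
      by (simp only: F_def E distrib_left mult.assoc)
    also have "\<dots> \<le> F s + 1 * (C * (t - s)\<^sup>2)"
      using B(1) st C0 by (intro add_left_mono mult_right_mono) auto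
    finally show "F t - F s \<le> C * (t - s)\<^sup>2" by simp
  qed
  then have "exp (2 * B * t) * (exp (- (2 * B) * t) * \<theta> t) \<le> exp (2 * B * t) * \<theta> 0"
    unfolding F_def by (intro mult_left_mono) auto
  then have "\<theta> t \<le> exp (2 * B * t) * \<theta> 0"
    by (simp add: mult.assoc[symmetric] exp_add[symmetric])
  also have "\<dots> \<le> exp (2 * B * T) * \<theta> 0"
    using t B(1) by (intro mult_right_mono \<theta>0) (auto intro: mult_left_mono)
  also have "exp (2 * B * T) = (exp (B * T))\<^sup>2"
    by (simp add: exp_double[symmetric] mult.assoc)
  finally have "(?n (w t))\<^sup>2 \<le> (exp (B * T) * ?n (w 0))\<^sup>2"
    by (simp add: \<theta>_def power_mult_distrib)
  then have le: "?n (w t) \<le> exp (B * T) * ?n (w 0)"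
    by (rule power2_le_imp_le) simp
  have "?n (w 0) = ?n (\<lambda>x. u0 x - v0 x)"
  proof (rule nrm_L2_cong_AE[OF D_sets])
    show "w 0 \<in> borel_measurable (lebesgue_on D)" using wL[of 0] T by (simp add: L2_iff)
    have "AE x in lebesgue_on D. u 0 x = u0 x" "AE x in lebesgue_on D. v 0 x = v0 x"
      using uw(1) vw(1) by (auto simp: weak_solution_def)
    then show "AE x in lebesgue_on D. w 0 x = u0 x - v0 x" by eventually_elim (simp add: w_def)
  qed
  then show "nrm (L2 D) (\<lambda>x. u t x - v t x) \<le> exp (B * T) * nrm (L2 D) (\<lambda>x. u0 x - v0 x)"
    using le by (simp add: w_def)
qed

end

text \<open>The constant is \<open>exp (B * Tstar)\<close>, where \<open>B\<close> is fixed by the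
  domain, the coefficients, \<alpha> and \<open>M\<close> before any solution is considered. For
  uniqueness, \<open>M\<close> is read off from the essential bound of the given solution, and the
  estimate with equal initial data holds at every time because solutions are continuous
  representatives.\<close>

theorem theorem3p7:
  fixes D :: "(real^'n) set" and \<kappa>1 \<kappa>2 \<mu> \<gamma> T Tstar :: real
  assumes "CARD('n) \<in> {1, 2, 3}" and "polytopal_domain D"
    and "0 < \<kappa>1" and "0 < \<kappa>2" and "0 < \<mu>"
    and "0 < T"
    and "CARD('n) \<in> {1, 2} \<longrightarrow> Tstar = T"
    and "CARD('n) = 3 \<longrightarrow> 0 < Tstar \<and> Tstar \<le> T"
  shows "(\<forall>\<alpha> M. admissible D \<alpha> \<longrightarrow>
           (\<exists>C. \<forall>u0 v0 u v.
              u0 \<in> elems (H1Delta D) \<and> v0 \<in> elems (H1Delta D) \<and>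
              strong_solution D \<kappa>1 \<kappa>2 \<mu> \<gamma> Tstar u0 u \<and> has_regularity D Tstar u \<and>
              strong_solution D \<kappa>1 \<kappa>2 \<mu> \<gamma> Tstar v0 v \<and> has_regularity D Tstar v \<and>
              regularity_bound D Tstar \<alpha> M u \<and> regularity_bound D Tstar \<alpha> M v \<longrightarrow>
              Lq_norm \<infinity> Tstar (L2 D) (\<lambda>t x. u t x - v t x)
                \<le> ereal (C * nrm (L2 D) (\<lambda>x. u0 x - v0 x)))) \<and>
         (\<forall>u0 u v.
            u0 \<in> elems (H1Delta D) \<and>
            strong_solution D \<kappa>1 \<kappa>2 \<mu> \<gamma> Tstar u0 u \<and> has_regularity D Tstar u \<and>
            strong_solution D \<kappa>1 \<kappa>2 \<mu> \<gamma> Tstar u0 v \<longrightarrow>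
            (\<forall>t\<in>{0..Tstar}. AE x in lebesgue_on D. u t x = v t x))"
proof -
  have T: "0 < Tstar" using assms(1,6-8) by auto
  have pol: "polytopal D \<alpha>" if "admissible D \<alpha>" for \<alpha>
    using assms(1,2) that by unfold_locales auto
  have \<mu>: "0 \<le> \<mu>" and \<kappa>2: "0 \<le> \<kappa>2" using assms by auto
  show ?thesis
  proof (intro conjI allI impI)
    fix \<alpha> M assume \<alpha>: "admissible D \<alpha>"
    interpret polytopal D \<alpha> by (rule pol[OF \<alpha>])
    obtain B where B: "0 \<le> B" "\<forall>f g. f \<in> elems (H1plus D \<alpha>) \<longrightarrow> nrm (H1plus D \<alpha>) f \<le> M \<longrightarrow> g \<in> elems (H1plus D \<alpha>) \<longrightarrow>
      - B * (nrm (L2 D) (\<lambda>x. f x - g x))\<^sup>2 \<le>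
        llb_form D \<kappa>1 \<kappa>2 \<mu> \<gamma> f (\<lambda>x. f x - g x) - llb_form D \<kappa>1 \<kappa>2 \<mu> \<gamma> g (\<lambda>x. f x - g x)"
      using llb_form_monotone[OF assms(3) \<kappa>2 \<mu>, of M \<gamma>] by blast
    show "\<exists>C. \<forall>u0 v0 u v.
              u0 \<in> elems (H1Delta D) \<and> v0 \<in> elems (H1Delta D) \<and>
              strong_solution D \<kappa>1 \<kappa>2 \<mu> \<gamma> Tstar u0 u \<and> has_regularity D Tstar u \<and>
              strong_solution D \<kappa>1 \<kappa>2 \<mu> \<gamma> Tstar v0 v \<and> has_regularity D Tstar v \<and>
              regularity_bound D Tstar \<alpha> M u \<and> regularity_bound D Tstar \<alpha> M v \<longrightarrow>
              Lq_norm \<infinity> Tstar (L2 D) (\<lambda>t x. u t x - v t x)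
                \<le> ereal (C * nrm (L2 D) (\<lambda>x. u0 x - v0 x))"
    proof (intro exI[of _ "exp (B * Tstar)"] allI impI, elim conjE)
      fix u0 v0 u v
      assume u: "strong_solution D \<kappa>1 \<kappa>2 \<mu> \<gamma> Tstar u0 u" and v: "strong_solution D \<kappa>1 \<kappa>2 \<mu> \<gamma> Tstar v0 v"
        and ub: "regularity_bound D Tstar \<alpha> M u"
      have "esssup (lebesgue_on {0<..<Tstar}) (\<lambda>t. ereal (nrm (H1plus D \<alpha>) (u t))) \<le> ereal M"
        using ub by (simp add: regularity_bound_def Lq_norm_def)
      then have uM: "AE t in lebesgue_on {0<..<Tstar}. nrm (H1plus D \<alpha>) (u t) \<le> M"
        using esssup_AE[of "\<lambda>t. ereal (nrm (H1plus D \<alpha>) (u t))" "lebesgue_on {0<..<Tstar}"]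
        by (auto elim!: eventually_mono dest: order_trans)
      note est = energy_estimate[OF \<mu> T B u v uM]
      have "continuous_on {0<..<Tstar} (\<lambda>t. nrm (L2 D) (\<lambda>x. u t x - v t x))"
        using est(2)[of 0] T by (rule_tac continuous_on_subset) auto
      \<comment> \<open>The essential supremum is bounded by an almost everywhere bound only for
        measurable functions; continuity in time supplies the measurability.\<close>
      then have "(\<lambda>t. ereal (nrm (L2 D) (\<lambda>x. u t x - v t x))) \<in> borel_measurable (lebesgue_on {0<..<Tstar})"
        by (intro borel_measurable_ereal continuous_imp_measurable_on_sets_lebesgue) auto
      then show "Lq_norm \<infinity> Tstar (L2 D) (\<lambda>t x. u t x - v t x) \<le> ereal (exp (B * Tstar) * nrm (L2 D) (\<lambda>x. u0 x - v0 x))"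
        unfolding Lq_norm_def using est(1) by (auto simp: AE_lebesgue_on_iff intro!: esssup_I)
    qed
  next
    fix u0 u v
    assume *: "u0 \<in> elems (H1Delta D) \<and> strong_solution D \<kappa>1 \<kappa>2 \<mu> \<gamma> Tstar u0 u \<and> has_regularity D Tstar u \<and>
            strong_solution D \<kappa>1 \<kappa>2 \<mu> \<gamma> Tstar u0 v"
    obtain \<alpha> where \<alpha>: "admissible D \<alpha>" using admissible_exists[OF assms(2)] by blast
    interpret polytopal D \<alpha> by (rule pol[OF \<alpha>])
    have "u \<in> Lq \<infinity> Tstar (H1plus D \<alpha>)" using * \<alpha> by (simp add: has_regularity_def)
    then obtain M where M: "AE t in lebesgue_on {0<..<Tstar}. nrm (H1plus D \<alpha>) (u t) \<le> M"
      using Lq_infinity_bounded by blast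
    obtain B where B: "0 \<le> B" "\<forall>f g. f \<in> elems (H1plus D \<alpha>) \<longrightarrow> nrm (H1plus D \<alpha>) f \<le> M \<longrightarrow> g \<in> elems (H1plus D \<alpha>) \<longrightarrow>
      - B * (nrm (L2 D) (\<lambda>x. f x - g x))\<^sup>2 \<le>
        llb_form D \<kappa>1 \<kappa>2 \<mu> \<gamma> f (\<lambda>x. f x - g x) - llb_form D \<kappa>1 \<kappa>2 \<mu> \<gamma> g (\<lambda>x. f x - g x)"
      using llb_form_monotone[OF assms(3) \<kappa>2 \<mu>, of M \<gamma>] by blast
    show "\<forall>t\<in>{0..Tstar}. AE x in lebesgue_on D. u t x = v t x"
    proof
      fix t assume t: "t \<in> {0..Tstar}"
      have uL: "u t \<in> elems (L2 D)" "v t \<in> elems (L2 D)"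
        using * t by (auto simp: strong_solution_def weak_solution_def continuous_in_time_def)
      have "nrm (L2 D) (\<lambda>x. u t x - v t x) \<le> exp (B * Tstar) * nrm (L2 D) (\<lambda>x. u0 x - u0 x)"
        using * by (intro energy_estimate[OF \<mu> T B _ _ M t]) auto
      then have "nrm (L2 D) (\<lambda>x. u t x - v t x) = 0"
        by (intro antisym) (simp_all add: nrm_L2)
      then have "AE x in lebesgue_on D. u t x - v t x = 0"
        by (rule nrm_L2_eq_0D[OF L2_diff[OF uL]])
      then show "AE x in lebesgue_on D. u t x = v t x" by simp
    qed
  qed
qed

end
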